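(* Let $T>0$, $\lambda>0$, $u_0\in H^2(\mathbb{T}^2)$, and let $u$ be the solution on $[0,T)$ (in the sense of the context) of the Kuramoto-Sivashinsky equation $$\partial_t u+(u\cdot\nabla)u+\lambda\Delta u+\Delta^2u=0\ \text{ in }\mathbb{T}^2\times[0,T],\qquad u(0)=u_0 .$$ If $\nabla\cdot u\in L^2\big(0,T;\dot B^{0}_{2,2}(\mathbb{T}^2)\big)$, then the equation admits a global strong solution, i.e. $u\in L^\infty([0,T];H^2(\mathbb{T}^2))\cap L^2([0,T];H^4(\mathbb{T}^2))$.
   Context: $\mathbb{T}^2=\mathbb{R}^2/(2\pi\mathbb{Z}^2)$; $u:\mathbb{T}^2\times[0,T]\to\mathbb{R}^2$ is not assumed divergence free. Strong solution on $[0,T')$: $u\in L^\infty([0,T');H^2(\mathbb{T}^2))\cap L^2([0,T');H^4(\mathbb{T}^2))$ such that for every smooth $\psi$ on $\mathbb{T}^2$, $\langle\partial_tu,\psi\rangle+(u\cdot\nabla u,\psi)+(\Delta u,\Delta\psi)=\lambda(\nabla u,\nabla\psi)$, with $u(0)=u_0$. By "solution on $[0,T)$" we mean a function that is a strong solution on $[0,T')$ for every $0<T'<T$. Homogeneous toroidal Besov spaces (here $d=2$): let $\mathcal{D}_0(\mathbb{T}^d)$ be the smooth $2\pi$-periodic functions with zero integral and $\mathcal{D}_0'(\mathbb{T}^d)$ its dual. Fix $\phi\in C^\infty(\mathbb{R}^d)$ with $0\le\phi\le1$, $\operatorname{supp}\phi\subset\{1/2<|\xi|<2\}$, $\sum_{j\in\mathbb{Z}}\phi(2^{-j}\xi)=1$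 for $\xi\ne0$, and set $\varphi_j(x)=\sum_{m\in\mathbb{Z}^d}\phi(2^{-j}m)e^{im\cdot x}$. For $s\in\mathbb{R}$, $1\le p,q\le\infty$, $\dot B^s_{p,q}(\mathbb{T}^d)$ is the set of $f\in\mathcal{D}_0'(\mathbb{T}^d)$ with $\|f\|_{\dot B^s_{p,q}}=\big\|\big(2^{sj}\|\varphi_j*f\|_{L^p(\mathbb{T}^d)}\big)_{j\in\mathbb{Z}}\big\|_{\ell^q(\mathbb{Z})}<\infty$. *)

theory Defs
  imports "HOL-Analysis.Analysis" "HOL-Probability.Essential_Supremum"
begin

text \<open>
  A function on the torus of side \<open>2\<pi>\<close> is represented by a \<open>2\<pi>\<close>-periodic function on \<open>real ^ 'n\<close>;
  integrals over the torus are integrals over one period cell.  Elements of Lebesgue, Sobolev and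
  Bochner spaces are represented by functions, not by equivalence classes, so everything below is
  insensitive to modifications on null sets.
\<close>

section \<open>Periodic and smooth functions\<close>

definition periodic :: "(real ^ 'n \<Rightarrow> 'b) \<Rightarrow> bool" where
  "periodic f \<longleftrightarrow> (\<forall>x i. f (x + (2 * pi) *\<^sub>R axis i 1) = f x)"

definition torus :: "(real ^ 'n) measure" where
  "torus = lebesgue_on (cbox 0 (\<chi> i. 2 * pi))"

definition iter_deriv ::
    "'a::real_normed_vector list \<Rightarrow> ('a \<Rightarrow> 'b::real_normed_vector) \<Rightarrow> 'a \<Rightarrow> 'b" where
  "iter_deriv vs f = foldr (\<lambda>v g x. frechet_derivative g (at x) v) vs f"

definition smooth :: "('a::real_normed_vector \<Rightarrow> 'b::real_normed_vector) \<Rightarrow> bool" where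
  "smooth f \<longleftrightarrow> (\<forall>vs x. iter_deriv vs f differentiable (at x))"

text \<open>\<open>pderivs [i\<^sub>1, \<dots>, i\<^sub>k] f\<close> is the classical derivative \<open>\<partial>\<^bsub>i\<^sub>1\<^esub> \<dots> \<partial>\<^bsub>i\<^sub>k\<^esub> f\<close>.\<close>

definition pderivs :: "'n::finite list \<Rightarrow> (real ^ 'n \<Rightarrow> 'b::real_normed_vector) \<Rightarrow> real ^ 'n \<Rightarrow> 'b" where
  "pderivs is f = iter_deriv (map (\<lambda>i. axis i 1) is) f"

section \<open>Lebesgue, Sobolev and Bochner spaces\<close>

definition enn_powr :: "ennreal \<Rightarrow> real \<Rightarrow> ennreal" where
  "enn_powr x r = (if x = \<infinity> then \<infinity> else ennreal (enn2real x powr r))"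

text \<open>For \<open>1 \<le> p \<le> \<infinity>\<close>.  With \<open>count_space UNIV\<close> as the measure this is the \<open>\<ell>\<^sup>p\<close> norm.\<close>

definition Lnorm :: "ennreal \<Rightarrow> 'a measure \<Rightarrow> ('a \<Rightarrow> ennreal) \<Rightarrow> ennreal" where
  "Lnorm p M f = (if p = \<infinity> then esssup M f
     else enn_powr (\<integral>\<^sup>+ x. enn_powr (f x) (enn2real p) \<partial>M) (1 / enn2real p))"

definition torus_norm :: "ennreal \<Rightarrow> (real ^ 'n \<Rightarrow> 'b::real_normed_vector) \<Rightarrow> ennreal" where
  "torus_norm p f = Lnorm p torus (\<lambda>x. ennreal (norm (f x)))"

definition torus_L :: "ennreal \<Rightarrow> (real ^ 'n \<Rightarrow> 'b::real_normed_vector) set" where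
  "torus_L p = {f. periodic f \<and> f \<in> borel_measurable torus \<and> torus_norm p f < \<infinity>}"

definition torus_inner :: "(real ^ 'n \<Rightarrow> 'b::euclidean_space) \<Rightarrow> (real ^ 'n \<Rightarrow> 'b) \<Rightarrow> real" where
  "torus_inner f g = (\<integral>x. f x \<bullet> g x \<partial>torus)"

definition is_weak_deriv ::
    "'n::finite list \<Rightarrow> (real ^ 'n \<Rightarrow> 'b::euclidean_space) \<Rightarrow> (real ^ 'n \<Rightarrow> 'b) \<Rightarrow> bool" where
  "is_weak_deriv is f g \<longleftrightarrow> f \<in> torus_L 1 \<and> g \<in> torus_L 1 \<and>
     (\<forall>\<psi> :: real ^ 'n \<Rightarrow> real. smooth \<psi> \<and> periodic \<psi> \<longrightarrow>
        (\<integral>x. pderivs is \<psi> x *\<^sub>R f x \<partial>torus) = (-1) ^ length is *\<^sub>R (\<integral>x. \<psi> x *\<^sub>R g x \<partial>torus))"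

text \<open>Unique up to a null set whenever it exists; unspecified otherwise.\<close>

definition weak_deriv ::
    "'n::finite list \<Rightarrow> (real ^ 'n \<Rightarrow> 'b::euclidean_space) \<Rightarrow> real ^ 'n \<Rightarrow> 'b" where
  "weak_deriv is f = (SOME g. is_weak_deriv is f g)"

definition sobolev :: "nat \<Rightarrow> (real ^ 'n \<Rightarrow> 'b::euclidean_space) set" where
  "sobolev k = {f. f \<in> torus_L 2 \<and>
     (\<forall>is. length is \<le> k \<longrightarrow> (\<exists>g. is_weak_deriv is f g \<and> g \<in> torus_L 2))}"

text \<open>
  Summing over index lists rather than multi-indices gives
  \<open>(\<Sum>j\<le>k. \<parallel>\<nabla>\<^sup>j f\<parallel>\<^sup>2)\<^sup>1\<^sup>/\<^sup>2\<close> with the Euclidean norm of the full derivative tensor \<open>\<nabla>\<^sup>j f\<close>.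
\<close>

definition sobolev_norm :: "nat \<Rightarrow> (real ^ 'n \<Rightarrow> 'b::euclidean_space) \<Rightarrow> ennreal" where
  "sobolev_norm k f =
     enn_powr (\<Sum>is | length is \<le> k. (torus_norm 2 (weak_deriv is f))\<^sup>2) (1 / 2)"

text \<open>
  The Bochner space \<open>L\<^sup>p(M; X)\<close>, where \<open>X\<close> is a space of functions with (semi)norm \<open>N\<close>: strong
  measurability, i.e. almost everywhere approximability by \<open>X\<close>-valued simple functions, together
  with finiteness of the norm.
\<close>

definition bochner ::
    "ennreal \<Rightarrow> 't measure \<Rightarrow> ('a \<Rightarrow> 'b::real_vector) set \<Rightarrow> (('a \<Rightarrow> 'b) \<Rightarrow> ennreal) \<Rightarrow> ('t \<Rightarrow> 'a \<Rightarrow> 'b) set" where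
  "bochner p M X N = {u.
     (AE t in M. u t \<in> X) \<and>
     (\<exists>s :: nat \<Rightarrow> 't \<Rightarrow> 'a \<Rightarrow> 'b.
        (\<forall>n. simple_function M (s n) \<and> s n ` space M \<subseteq> X) \<and>
        (AE t in M. (\<lambda>n. N (\<lambda>x. s n t x - u t x)) \<longlonglongrightarrow> 0)) \<and>
     Lnorm p M (\<lambda>t. N (u t)) < \<infinity>}"

abbreviation bochner_sobolev ::
    "ennreal \<Rightarrow> real set \<Rightarrow> nat \<Rightarrow> (real \<Rightarrow> real ^ 'n \<Rightarrow> 'b::euclidean_space) set" where
  "bochner_sobolev p I k \<equiv> bochner p (lebesgue_on I) (sobolev k) (sobolev_norm k)"

section \<open>Homogeneous toroidal Besov spaces\<close>

definition D0 :: "(real ^ 'n \<Rightarrow> complex) set" where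
  "D0 = {\<psi>. smooth \<psi> \<and> periodic \<psi> \<and> (\<integral>x. \<psi> x \<partial>torus) = 0}"

text \<open>
  The dual of \<open>D0\<close> with its Frechet topology, which is generated by the suprema of derivatives.
  Functionals are extended by 0 outside \<open>D0\<close>.
\<close>

definition D0_dual :: "((real ^ 'n \<Rightarrow> complex) \<Rightarrow> complex) set" where
  "D0_dual = {F.
     (\<forall>\<psi>\<in>D0. \<forall>\<theta>\<in>D0. F (\<lambda>x. \<psi> x + \<theta> x) = F \<psi> + F \<theta>) \<and>
     (\<forall>\<psi>\<in>D0. \<forall>c. F (\<lambda>x. c * \<psi> x) = c * F \<psi>) \<and>
     (\<exists>k C. \<forall>\<psi>\<in>D0. \<forall>B. (\<forall>is x. length is \<le> k \<longrightarrow> norm (pderivs is \<psi> x) \<le> B) \<longrightarrow> norm (F \<psi>) \<le> C * B) \<and>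
     (\<forall>\<psi>. \<psi> \<notin> D0 \<longrightarrow> F \<psi> = 0)}"

definition distribution :: "(real ^ 'n \<Rightarrow> real) \<Rightarrow> (real ^ 'n \<Rightarrow> complex) \<Rightarrow> complex" where
  "distribution f \<psi> = (if \<psi> \<in> D0 then \<integral>x. f x *\<^sub>R \<psi> x \<partial>torus else 0)"

definition littlewood_paley :: "(real ^ 'n \<Rightarrow> real) \<Rightarrow> bool" where
  "littlewood_paley \<phi> \<longleftrightarrow> smooth \<phi> \<and> (\<forall>\<xi>. 0 \<le> \<phi> \<xi> \<and> \<phi> \<xi> \<le> 1) \<and>
     closure {\<xi>. \<phi> \<xi> \<noteq> 0} \<subseteq> {\<xi>. 1 / 2 < norm \<xi> \<and> norm \<xi> < 2} \<and>
     (\<forall>\<xi>. \<xi> \<noteq> 0 \<longrightarrow> ((\<lambda>j::int. \<phi> (2 powi (- j) *\<^sub>R \<xi>)) has_sum 1) UNIV)"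

text \<open>The sum over the integer lattice has only finitely many nonzero terms.\<close>

definition lp_kernel :: "(real ^ 'n \<Rightarrow> real) \<Rightarrow> int \<Rightarrow> real ^ 'n \<Rightarrow> complex" where
  "lp_kernel \<phi> j x = (\<Sum>\<^sub>\<infinity>m :: int ^ 'n.
     let \<xi> = (\<chi> i. real_of_int (m $ i)) in
       complex_of_real (\<phi> (2 powi (- j) *\<^sub>R \<xi>)) * exp (\<i> * complex_of_real (\<xi> \<bullet> x)))"

definition lp_block ::
    "(real ^ 'n \<Rightarrow> real) \<Rightarrow> int \<Rightarrow> ((real ^ 'n \<Rightarrow> complex) \<Rightarrow> complex) \<Rightarrow> real ^ 'n \<Rightarrow> complex" where
  "lp_block \<phi> j F x = F (\<lambda>y. lp_kernel \<phi> j (x - y))"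

definition besov_norm ::
    "(real ^ 'n \<Rightarrow> real) \<Rightarrow> real \<Rightarrow> ennreal \<Rightarrow> ennreal \<Rightarrow> ((real ^ 'n \<Rightarrow> complex) \<Rightarrow> complex) \<Rightarrow> ennreal" where
  "besov_norm \<phi> s p q F = Lnorm q (count_space UNIV)
     (\<lambda>j::int. ennreal (2 powr (s * real_of_int j)) * torus_norm p (lp_block \<phi> j F))"

definition besov ::
    "(real ^ 'n \<Rightarrow> real) \<Rightarrow> real \<Rightarrow> ennreal \<Rightarrow> ennreal \<Rightarrow> ((real ^ 'n \<Rightarrow> complex) \<Rightarrow> complex) set" where
  "besov \<phi> s p q = {F \<in> D0_dual. besov_norm \<phi> s p q F < \<infinity>}"

section \<open>Strong solutions of the Kuramoto--Sivashinsky equation\<close>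

definition weak_laplacian :: "(real ^ 'n \<Rightarrow> 'b::euclidean_space) \<Rightarrow> real ^ 'n \<Rightarrow> 'b" where
  "weak_laplacian f x = (\<Sum>i\<in>UNIV. weak_deriv [i, i] f x)"

definition laplacian :: "(real ^ 'n \<Rightarrow> 'b::euclidean_space) \<Rightarrow> real ^ 'n \<Rightarrow> 'b" where
  "laplacian f x = (\<Sum>i\<in>UNIV. pderivs [i, i] f x)"

definition weak_divergence :: "(real ^ 'n \<Rightarrow> real ^ 'n) \<Rightarrow> real ^ 'n \<Rightarrow> real" where
  "weak_divergence f x = (\<Sum>i\<in>UNIV. weak_deriv [i] f x $ i)"

definition advection :: "(real ^ 'n \<Rightarrow> real ^ 'n) \<Rightarrow> real ^ 'n \<Rightarrow> real ^ 'n" where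
  "advection f x = (\<Sum>i\<in>UNIV. f x $ i *\<^sub>R weak_deriv [i] f x)"

text \<open>\<open>g\<close> is the derivative of \<open>f\<close> in the sense of distributions on the open interval \<open>(a, b)\<close>.\<close>

definition has_weak_time_deriv :: "real \<Rightarrow> real \<Rightarrow> (real \<Rightarrow> real) \<Rightarrow> (real \<Rightarrow> real) \<Rightarrow> bool" where
  "has_weak_time_deriv a b f g \<longleftrightarrow>
     (\<forall>c d. a < c \<and> d < b \<longrightarrow> integrable (lebesgue_on {c..d}) f \<and> integrable (lebesgue_on {c..d}) g) \<and>
     (\<forall>\<eta> :: real \<Rightarrow> real. smooth \<eta> \<and> closure {t. \<eta> t \<noteq> 0} \<subseteq> {a<..<b} \<longrightarrow>
        (\<integral>t. f t * deriv \<eta> t \<partial>lebesgue_on {a<..<b}) = - (\<integral>t. g t * \<eta> t \<partial>lebesgue_on {a<..<b}))"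

text \<open>
  Since \<open>u\<close> is determined only up to a null set of times, \<open>u(0) = u\<^sub>0\<close> refers to the representative of
  \<open>u\<close> that is continuous in time with values in \<open>L\<^sup>2\<close>.
\<close>

definition initial_value ::
    "real \<Rightarrow> (real \<Rightarrow> real ^ 'n \<Rightarrow> 'b::euclidean_space) \<Rightarrow> (real ^ 'n \<Rightarrow> 'b) \<Rightarrow> bool" where
  "initial_value T u u\<^sub>0 \<longleftrightarrow> (\<exists>v.
     (\<forall>t\<in>{0..<T}. v t \<in> torus_L 2 \<and>
        ((\<lambda>r. torus_norm 2 (\<lambda>x. v r x - v t x)) \<longlongrightarrow> 0) (at t within {0..<T})) \<and>
     (AE t in lebesgue_on {0..<T}. AE x in torus. v t x = u t x) \<and>
     (AE x in torus. v 0 x = u\<^sub>0 x))"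

text \<open>\<open>dtu t\<close> stands for the pairing of \<open>\<partial>\<^sub>t u\<close> at time \<open>t\<close> with \<open>\<psi>\<close>.\<close>

definition strong_solution ::
    "real \<Rightarrow> real \<Rightarrow> (real ^ 'n \<Rightarrow> real ^ 'n) \<Rightarrow> (real \<Rightarrow> real ^ 'n \<Rightarrow> real ^ 'n) \<Rightarrow> bool" where
  "strong_solution T lam u\<^sub>0 u \<longleftrightarrow>
     u \<in> bochner_sobolev \<infinity> {0..<T} 2 \<and>
     u \<in> bochner_sobolev 2 {0..<T} 4 \<and>
     (\<forall>\<psi>. smooth \<psi> \<and> periodic \<psi> \<longrightarrow>
        (\<exists>dtu. has_weak_time_deriv 0 T (\<lambda>t. torus_inner (u t) \<psi>) dtu \<and>
           (AE t in lebesgue_on {0<..<T}.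
              dtu t + torus_inner (advection (u t)) \<psi>
                + torus_inner (weak_laplacian (u t)) (laplacian \<psi>)
              = lam * (\<Sum>i\<in>UNIV. torus_inner (weak_deriv [i] (u t)) (pderivs [i] \<psi>))))) \<and>
     initial_value T u u\<^sub>0"

definition solution_on ::
    "real \<Rightarrow> real \<Rightarrow> (real ^ 'n \<Rightarrow> real ^ 'n) \<Rightarrow> (real \<Rightarrow> real ^ 'n \<Rightarrow> real ^ 'n) \<Rightarrow> bool" where
  "solution_on T lam u\<^sub>0 u \<longleftrightarrow> (\<forall>T'. 0 < T' \<and> T' < T \<longrightarrow> strong_solution T' lam u\<^sub>0 u)"

end

theory Submission
  imports Defs
begin

text \<open>
  Test the equation with \<open>u\<close>: integration by parts turns the nonlinear term into
  \<open>- 1/2 \<integral> (div u) \<bar>u\<bar>\<^sup>2\<close>, which is at most a constant times \<open>\<parallel>div u\<parallel> \<parallel>u\<parallel> \<parallel>u\<parallel>\<^bsub>H\<^sup>2\<^esub>\<close> because in two dimensions \<open>H\<^sup>2\<close>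
  embeds into \<open>L\<^sup>\<infinity>\<close>. Part of it is absorbed by the dissipation \<open>\<parallel>\<Delta>u\<parallel>\<^sup>2\<close>, and the rest is controlled by
  Gronwall's lemma, since the Besov norm of order zero bounds \<open>\<parallel>div u\<parallel>\<close> in \<open>L\<^sup>2(0, T)\<close>. Hence \<open>u\<close> is
  bounded in \<open>L\<^sup>2\<close> and square integrable in time with values in \<open>H\<^sup>2\<close>; testing with \<open>\<Delta>\<^sup>2 u\<close> then
  gives \<open>H\<^sup>2\<close> and \<open>H\<^sup>4\<close> bounds up to time \<open>T\<close>. All estimates are made for the coefficients with respect to
  the Hartley basis \<open>cos (k \<cdot> x) + sin (k \<cdot> x)\<close>, which is orthogonal and real, so that a weak solution is
  the same as a system of scalar integral equations for its modes.
\<close>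

text \<open>A strong solution is only tested with fixed smooth functions of space, so neither
  \<open>u\<close> nor its bilaplacian is admissible. Only constant multiples of single Hartley
  functions are tested. The square of each mode is expanded by a Fubini argument, and the energy
  inequalities come from adding finitely many modes and letting their number grow. The delicate
  point of the second estimate is that the squared L2 norm of (u . grad) u is only bounded by (E +
  D)^2, where E and D are, up to constants, the squared L2 norms of u and of its Laplacian. One
  factor is treated as a coefficient: the first estimate bounds the time integral of D, so the
  inequality becomes linear with an integrable coefficient. Both Gronwall arguments run on a final
  interval [r, T) where the coefficient has integral at most 1/2; earlier times are covered by the
  bounds that come with the given solution. The homogeneous Besov norm does not see frequency 0,
  which is harmless because a divergence has mean zero. In time nothing is uniform up to T at the
  outset, so measurability, the weak equation and the initial value are glued from
  subintervals.\<close>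

lemma smooth_coinduct:
  assumes "f \<in> C"
    and diff: "\<And>g x. g \<in> C \<Longrightarrow> g differentiable (at x)"
    and step: "\<And>g v. g \<in> C \<Longrightarrow> (\<lambda>x. frechet_derivative g (at x) v) \<in> C"
  shows "smooth f"
proof -
  have "iter_deriv vs f \<in> C" for vs
    by (induction vs) (auto simp: iter_deriv_def assms(1) intro: step)
  then show ?thesis
    using diff by (auto simp: smooth_def)
qed

section \<open>Hartley functions and trigonometric polynomials\<close>

definition lat :: "int ^ 'n \<Rightarrow> real ^ 'n" where
  "lat k = (\<chi> i. real_of_int (k $ i))"

text \<open>Differentiation turns \<open>cas k\<close> into a multiple of \<open>cas (- k)\<close>.
  This is the origin of the reflected frequencies in every formula of odd order below.\<close>

definition cas :: "int ^ 'n \<Rightarrow> real ^ 'n \<Rightarrow> real" where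
  "cas k x = cos (lat k \<bullet> x) + sin (lat k \<bullet> x)"

definition trig_poly :: "(real ^ 'n \<Rightarrow> 'b::real_normed_vector) \<Rightarrow> bool" where
  "trig_poly f \<longleftrightarrow> (\<exists>A c. finite A \<and> f = (\<lambda>x. \<Sum>k\<in>A. cas k x *\<^sub>R c k))"

lemma lat_simps [simp]:
  "lat 0 = 0" "lat (- k) = - lat k" "lat (k + l) = lat k + lat l" "lat (k - l) = lat k - lat l"
  "lat k $ i = real_of_int (k $ i)" "lat k \<bullet> axis i 1 = real_of_int (k $ i)"
  by (simp_all add: lat_def vec_eq_iff inner_axis)

lemma lat_eq_0_iff [simp]: "lat k = 0 \<longleftrightarrow> k = 0"
  by (simp add: lat_def vec_eq_iff)

lemma abs_cas_le: "\<bar>cas k x\<bar> \<le> 2"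
  unfolding cas_def using abs_cos_le_one[of "lat k \<bullet> x"] abs_sin_le_one[of "lat k \<bullet> x"] by linarith

lemma cas_0 [simp]: "cas 0 x = 1"
  by (simp add: cas_def)

text \<open>The product of two Hartley functions is the cosine of the difference plus the sine of
  the sum of the phases; cosine and sine are then the even and odd parts of \<open>cas\<close> in
  the frequency.\<close>

lemma cas_mult: "cas k x * cas l x = (cas (k - l) x + cas (l - k) x) / 2 + (cas (k + l) x - cas (- k - l) x) / 2"
  unfolding cas_def lat_simps inner_diff_left inner_add_left inner_minus_left
  by (simp add: cos_add sin_add cos_diff sin_diff field_simps)

lemma cos_sin_eq_cas:
  "cos (lat k \<bullet> x) = (cas k x + cas (- k) x) / 2" "sin (lat k \<bullet> x) = (cas k x - cas (- k) x) / 2"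
  by (simp_all add: cas_def)

lemma cas_has_derivative:
  "(cas k has_derivative (\<lambda>v. (lat k \<bullet> v) * cas (- k) x)) (at x within S)"
  unfolding cas_def
  by (auto intro!: derivative_eq_intros simp: algebra_simps)

lemma continuous_cas [continuous_intros]: "continuous_on S (cas k)"
  unfolding cas_def by (intro continuous_intros)

lemma periodic_cas: "periodic (cas k)"
proof -
  have "cas k (x + (2 * pi) *\<^sub>R axis i 1) = cas k x" for x i
  proof -
    have "lat k \<bullet> (x + (2 * pi) *\<^sub>R axis i 1) = lat k \<bullet> x + 2 * pi * real_of_int (k $ i)"
      by (simp add: inner_add_right)
    then show ?thesis
      unfolding cas_def by (simp only: cos_add sin_add sin_int_2pin cos_int_2pin)
  qed
  then show ?thesis
    by (simp add: periodic_def)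
qed

lemma trig_poly_cas: "trig_poly (\<lambda>x. cas k x *\<^sub>R c)"
  unfolding trig_poly_def by (rule exI[of _ "{k}"], rule exI[of _ "\<lambda>_. c"]) auto

lemma trig_poly_0: "trig_poly (\<lambda>x. 0)"
  unfolding trig_poly_def by (rule exI[of _ "{}"]) auto

lemma trig_poly_add:
  assumes "trig_poly f" "trig_poly g"
  shows "trig_poly (\<lambda>x. f x + g x)"
proof -
  obtain A c B d where *: "finite A" "f = (\<lambda>x. \<Sum>k\<in>A. cas k x *\<^sub>R c k)"
      "finite B" "g = (\<lambda>x. \<Sum>k\<in>B. cas k x *\<^sub>R d k)"
    using assms unfolding trig_poly_def by blast
  have "f x + g x = (\<Sum>k\<in>A \<union> B. cas k x *\<^sub>R ((if k \<in> A then c k else 0) + (if k \<in> B then d k else 0)))" for x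
  proof -
    have "f x = (\<Sum>k\<in>A \<union> B. cas k x *\<^sub>R (if k \<in> A then c k else 0))"
      using * by (auto intro!: sum.mono_neutral_cong_left)
    moreover have "g x = (\<Sum>k\<in>A \<union> B. cas k x *\<^sub>R (if k \<in> B then d k else 0))"
      using * by (auto intro!: sum.mono_neutral_cong_left)
    ultimately show ?thesis
      by (simp add: scaleR_add_right sum.distrib)
  qed
  then show ?thesis
    unfolding trig_poly_def using * by (intro exI[of _ "A \<union> B"] exI conjI) (auto simp: fun_eq_iff)
qed

lemma trig_poly_sum: "(\<And>i. i \<in> I \<Longrightarrow> trig_poly (f i)) \<Longrightarrow> trig_poly (\<lambda>x. \<Sum>i\<in>I. f i x)"
  by (induction I rule: infinite_finite_induct) (auto intro: trig_poly_0 trig_poly_add)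

lemma trig_poly_linear:
  assumes "trig_poly f" "linear h"
  shows "trig_poly (\<lambda>x. h (f x))"
proof -
  obtain A c where *: "finite A" "f = (\<lambda>x. \<Sum>k\<in>A. cas k x *\<^sub>R c k)"
    using assms unfolding trig_poly_def by blast
  show ?thesis
    unfolding trig_poly_def using * assms(2)
    by (intro exI[of _ A] exI[of _ "\<lambda>k. h (c k)"]) (auto simp: linear_sum linear_cmul)
qed

lemma trig_poly_mult:
  fixes f g :: "real ^ 'n \<Rightarrow> real"
  assumes "trig_poly f" "trig_poly g"
  shows "trig_poly (\<lambda>x. f x * g x)"
proof -
  obtain A c B d where *: "finite A" "f = (\<lambda>x. \<Sum>k\<in>A. cas k x *\<^sub>R c k)"
      "finite B" "g = (\<lambda>x. \<Sum>k\<in>B. cas k x *\<^sub>R d k)"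
    using assms unfolding trig_poly_def by blast
  have "f x * g x = (\<Sum>k\<in>A. \<Sum>l\<in>B. ((cas (k - l) x *\<^sub>R (c k * d l / 2) + cas (l - k) x *\<^sub>R (c k * d l / 2))
      + (cas (k + l) x *\<^sub>R (c k * d l / 2) + cas (- k - l) x *\<^sub>R (- (c k * d l / 2)))))" for x
  proof -
    have "f x * g x = (\<Sum>k\<in>A. \<Sum>l\<in>B. (cas k x * cas l x) * (c k * d l))"
      by (simp add: * sum_product mult_ac)
    then show ?thesis
      unfolding cas_mult by (simp add: algebra_simps add_divide_distrib diff_divide_distrib)
  qed
  then have "(\<lambda>x. f x * g x) = (\<lambda>x. \<Sum>k\<in>A. \<Sum>l\<in>B. ((cas (k - l) x *\<^sub>R (c k * d l / 2) + cas (l - k) x *\<^sub>R (c k * d l / 2))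
      + (cas (k + l) x *\<^sub>R (c k * d l / 2) + cas (- k - l) x *\<^sub>R (- (c k * d l / 2)))))"
    by (rule ext)
  moreover have "trig_poly \<dots>"
    by (intro trig_poly_sum trig_poly_add trig_poly_cas)
  ultimately show ?thesis by simp
qed

lemma trig_poly_scaleR_const:
  assumes "trig_poly (f :: real ^ 'n \<Rightarrow> real)" shows "trig_poly (\<lambda>x. f x *\<^sub>R (c::'b::real_normed_vector))"
  by (rule trig_poly_linear[OF assms]) (simp add: linear_iff scaleR_add_left)

lemma trig_poly_const: "trig_poly (\<lambda>x. c)"
  using trig_poly_cas[of 0 c] by simp

lemma trig_poly_has_derivative:
  assumes "f = (\<lambda>x. \<Sum>k\<in>A. cas k x *\<^sub>R c k)"
  shows "(f has_derivative (\<lambda>v. \<Sum>k\<in>A. ((lat k \<bullet> v) * cas (- k) x) *\<^sub>R c k)) (at x)"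
  unfolding assms by (intro has_derivative_sum has_derivative_scaleR_left cas_has_derivative)

lemma trig_poly_derivative:
  fixes f :: "real ^ 'n \<Rightarrow> 'b::real_normed_vector"
  assumes "trig_poly f"
  shows "f differentiable (at x)" "trig_poly (\<lambda>x. frechet_derivative f (at x) v)"
proof -
  obtain A c where *: "finite A" "f = (\<lambda>x. \<Sum>k\<in>A. cas k x *\<^sub>R c k)"
    using assms unfolding trig_poly_def by blast
  note d = trig_poly_has_derivative[OF *(2)]
  show "f differentiable (at x)"
    using d differentiable_def by blast
  have "(\<lambda>x. frechet_derivative f (at x) v) = (\<lambda>x. \<Sum>k\<in>A. cas (- k) x *\<^sub>R ((lat k \<bullet> v) *\<^sub>R c k))"
    by (simp add: frechet_derivative_at[OF d, symmetric] mult.commute)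
  then show "trig_poly (\<lambda>x. frechet_derivative f (at x) v)"
    by (simp only:) (intro trig_poly_sum trig_poly_cas)
qed

lemma trig_poly_smooth: "trig_poly f \<Longrightarrow> smooth f"
  by (rule smooth_coinduct[of f "Collect trig_poly"]) (auto intro: trig_poly_derivative)

lemma trig_poly_periodic: "trig_poly f \<Longrightarrow> periodic f"
  by (auto simp: trig_poly_def periodic_def periodic_cas[unfolded periodic_def, rule_format])

lemma trig_poly_continuous: "trig_poly f \<Longrightarrow> continuous_on S f"
  unfolding trig_poly_def by (elim exE conjE, hypsubst) (intro continuous_intros)

lemma pderivs_Nil [simp]: "pderivs [] f = f"
  by (simp add: pderivs_def iter_deriv_def)

lemma pderivs_Cons: "pderivs (i # is) f = (\<lambda>x. frechet_derivative (pderivs is f) (at x) (axis i 1))"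
  by (simp add: pderivs_def iter_deriv_def)

lemma frechet_cas_scaleR:
  "frechet_derivative (\<lambda>x. r * cas k x) (at x) v = r * ((lat k \<bullet> v) * cas (- k) x)"
  by (subst frechet_derivative_at[symmetric]) (auto intro!: has_derivative_mult_right cas_has_derivative)

text \<open>Absolute value aside, this is the Fourier symbol of the derivative along the
  list.\<close>

definition freq :: "'n list \<Rightarrow> int ^ 'n \<Rightarrow> real" where
  "freq is k = prod_list (map (\<lambda>i. real_of_int (k $ i)) is)"

text \<open>Each differentiation contributes one component of \<open>k\<close> and a reflection, and
  every second reflection a minus sign. The sign \<open>s\<close> stays unspecified because later
  estimates use only the norm of the multiplier; the exact signs for orders \<open>[i]\<close> and
  \<open>[i, i]\<close> follow separately.\<close>

lemma pderivs_cas: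
  "\<exists>s. \<bar>s\<bar> = (1::real) \<and>
     pderivs is (cas k) = (\<lambda>x. s * freq is k * cas (if even (length is) then k else - k) x)"
proof (induction "is")
  case (Cons i "is")
  then obtain s :: real where s: "\<bar>s\<bar> = 1"
    "pderivs is (cas k) = (\<lambda>x. s * freq is k * cas (if even (length is) then k else - k) x)" by blast
  show ?case
    unfolding pderivs_Cons s(2) frechet_cas_scaleR
    by (rule exI[of _ "if even (length is) then s else - s"])
       (use s(1) in \<open>auto simp: freq_def fun_eq_iff\<close>)
qed (auto simp: freq_def intro!: exI[of _ 1])

lemma pderivs_cas_1: "pderivs [i] (cas k) = (\<lambda>x. real_of_int (k $ i) * cas (- k) x)"
  unfolding pderivs_Cons pderivs_Nil using frechet_cas_scaleR[of 1 k] by auto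

lemma pderivs_cas_2: "pderivs [i, i] (cas k) = (\<lambda>x. - (real_of_int (k $ i))\<^sup>2 * cas k x)"
  unfolding pderivs_Cons[of i "[i]"] pderivs_cas_1 frechet_cas_scaleR by (simp add: power2_eq_square mult.assoc)

lemma pderivs_scaleR_const:
  assumes "smooth f"
  shows "pderivs is (\<lambda>x. f x *\<^sub>R e) = (\<lambda>x. pderivs is f x *\<^sub>R e)"
proof (induction "is")
  case (Cons i "is")
  have d: "pderivs is f differentiable (at x)" for x
    using assms unfolding smooth_def pderivs_def by blast
  have h: "((\<lambda>x. pderivs is f x *\<^sub>R e) has_derivative (\<lambda>v. frechet_derivative (pderivs is f) (at x) v *\<^sub>R e)) (at x)" for x
    using d frechet_derivative_works has_derivative_scaleR_left by blast
  show ?case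
    unfolding pderivs_Cons Cons by (simp add: frechet_derivative_at[OF h, symmetric])
qed simp

section \<open>Integration over the period cell and orthogonality\<close>

lemma space_torus [simp]: "space (torus :: (real ^ 'n) measure) = cbox 0 (\<chi> i. 2 * pi)"
  by (simp add: torus_def)

lemma sets_lebesgue_torus [simp]: "cbox 0 (\<chi> i. 2 * pi) \<in> sets lebesgue"
  by simp

interpretation torus: finite_measure "torus :: (real ^ 'n) measure"
  by standard (simp add: torus_def emeasure_restrict_space emeasure_lborel_cbox_eq)

lemma continuous_measurable_torus [measurable (raw)]:
  "continuous_on UNIV f \<Longrightarrow> f \<in> borel_measurable torus"
  unfolding torus_def
  by (rule continuous_imp_measurable_on_sets_lebesgue) (auto intro: continuous_on_subset)

lemma bounded_integrable_torus:
  fixes f :: "real ^ 'n \<Rightarrow> 'b::euclidean_space"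
  assumes "f \<in> borel_measurable torus" "\<And>x. x \<in> space torus \<Longrightarrow> norm (f x) \<le> B"
  shows "integrable torus f"
  by (rule torus.integrable_const_bound[of _ B]) (use assms in auto)

lemma continuous_integrable_torus:
  fixes f :: "real ^ 'n \<Rightarrow> 'b::euclidean_space"
  assumes "continuous_on UNIV f"
  shows "integrable torus f"
proof -
  have "compact (f ` cbox 0 (\<chi> i. 2 * pi))"
    by (rule compact_continuous_image) (auto intro: continuous_on_subset[OF assms])
  then obtain B where "\<And>x. x \<in> cbox 0 (\<chi> i. 2 * pi) \<Longrightarrow> norm (f x) \<le> B"
    using compact_imp_bounded bounded_iff by (metis imageI)
  then show ?thesis
    by (intro bounded_integrable_torus[of _ B]) (auto intro: continuous_measurable_torus assms)
qed

lemma integral_cis_interval: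
  fixes m :: int
  shows "integrable lborel (\<lambda>y. indicator {0..2 * pi} y *\<^sub>R cis (real_of_int m * y))"
    and "(\<integral>y. indicator {0..2 * pi} y *\<^sub>R cis (real_of_int m * y) \<partial>lborel)
      = (if m = 0 then complex_of_real (2 * pi) else 0)"
proof -
  have cont: "continuous_on S (\<lambda>y. cis (real_of_int m * y))" for S
    by (auto simp: cis_conv_exp intro!: continuous_intros)
  show "integrable lborel (\<lambda>y. indicator {0..2 * pi} y *\<^sub>R cis (real_of_int m * y))"
    using borel_integrable_compact[of "{0..2 * pi}" "\<lambda>y. cis (real_of_int m * y)"] cont by simp
  show "(\<integral>y. indicator {0..2 * pi} y *\<^sub>R cis (real_of_int m * y) \<partial>lborel)
      = (if m = 0 then complex_of_real (2 * pi) else 0)"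
  proof (cases "m = 0")
    case False
    have "((\<lambda>y. cis (real_of_int m * y) / (\<i> * of_int m)) has_vector_derivative cis (real_of_int m * x))
        (at x within {0..2 * pi})" for x
      unfolding cis_conv_exp using False
      by (auto intro!: derivative_eq_intros has_vector_derivative_real_field simp: field_simps)
    then have "(\<integral>y. indicator {0..2 * pi} y *\<^sub>R cis (real_of_int m * y) \<partial>lborel)
        = cis (real_of_int m * (2 * pi)) / (\<i> * of_int m) - cis (real_of_int m * 0) / (\<i> * of_int m)"
      using cont by (intro integral_FTC_Icc) auto
    moreover have "cis (real_of_int m * (2 * pi)) = 1"
      by (simp add: complex_eq_iff cos_int_2pin sin_int_2pin mult.commute[of "real_of_int m"])
    ultimately show ?thesis
      using False by simp
  qed (simp add: scaleR_conv_of_real)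
qed

text \<open>By \<open>lborel_eq\<close>, Lebesgue measure is the image of a product measure indexed
  by \<open>Basis\<close>. Both the indicator of the cell and the exponential factor over the basis,
  so the integral is a product of one-dimensional integrals, one of which vanishes unless
  \<open>m = 0\<close>.\<close>

lemma integral_cis_torus:
  fixes m :: "int ^ 'n"
  shows "(\<integral>x. cis (lat m \<bullet> x) \<partial>torus) = (if m = 0 then complex_of_real ((2 * pi) ^ CARD('n)) else 0)"
proof -
  interpret product_sigma_finite "\<lambda>_::real ^ 'n. lborel :: real measure"
    by unfold_locales
  let ?Q = "cbox 0 (\<chi> i. 2 * pi) :: (real ^ 'n) set"
  let ?g = "\<lambda>b::real ^ 'n. \<lambda>y. indicator {0..2 * pi} y *\<^sub>R cis ((lat m \<bullet> b) * y)"
  have cont: "continuous_on UNIV (\<lambda>x::real ^ 'n. cis (lat m \<bullet> x))"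
    by (auto simp: cis_conv_exp intro!: continuous_intros)
  have meas: "(\<lambda>x::real ^ 'n. indicator ?Q x *\<^sub>R cis (lat m \<bullet> x)) \<in> borel_measurable borel"
    using borel_measurable_continuous_onI[OF cont] by (intro borel_measurable_scaleR borel_measurable_indicator) auto
  have "(\<integral>x. cis (lat m \<bullet> x) \<partial>torus) = (\<integral>x. indicator ?Q x *\<^sub>R cis (lat m \<bullet> x) \<partial>lebesgue)"
    unfolding torus_def by (rule integral_restrict_space) simp
  also have "\<dots> = (\<integral>x. indicator ?Q x *\<^sub>R cis (lat m \<bullet> x) \<partial>lborel)"
    using meas by (intro integral_completion) simp
  also have "\<dots> = (\<integral>p. indicator ?Q (\<Sum>b\<in>Basis. p b *\<^sub>R b) *\<^sub>R cis (lat m \<bullet> (\<Sum>b\<in>Basis. p b *\<^sub>R b))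
      \<partial>(\<Pi>\<^sub>M b\<in>Basis. lborel))"
    by (subst lborel_eq, rule integral_distr) (use meas in auto)
  also have "\<dots> = (\<integral>p. (\<Prod>b\<in>Basis. ?g b (p b)) \<partial>(\<Pi>\<^sub>M b\<in>Basis. lborel))"
  proof (rule Bochner_Integration.integral_cong[OF refl])
    fix p :: "real ^ 'n \<Rightarrow> real"
    have Q: "(\<Sum>b\<in>Basis. p b *\<^sub>R b) \<in> ?Q \<longleftrightarrow> (\<forall>b\<in>(Basis :: (real ^ 'n) set). p b \<in> {0..2 * pi})"
    proof -
      have "(\<chi> i. 2 * pi) \<bullet> b = 2 * pi" if "b \<in> Basis" for b :: "real ^ 'n"
        using that by (auto simp: Basis_vec_def inner_axis)
      then show ?thesis
        by (auto simp: mem_box)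
    qed
    have "indicator ?Q (\<Sum>b\<in>Basis. p b *\<^sub>R b) = (\<Prod>b\<in>(Basis :: (real ^ 'n) set). indicator {0..2 * pi} (p b) :: real)"
      by (auto simp: indicator_def Q intro!: prod.neutral[symmetric])
    moreover have "cis (lat m \<bullet> (\<Sum>b\<in>Basis. p b *\<^sub>R b)) = (\<Prod>b\<in>Basis. cis ((lat m \<bullet> b) * p b))"
      by (simp add: cis_conv_exp inner_sum_right exp_sum sum_distrib_left mult_ac)
    ultimately show "indicator ?Q (\<Sum>b\<in>Basis. p b *\<^sub>R b) *\<^sub>R cis (lat m \<bullet> (\<Sum>b\<in>Basis. p b *\<^sub>R b))
        = (\<Prod>b\<in>Basis. ?g b (p b))"
      by (simp add: scaleR_conv_of_real prod.distrib)
  qed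
  also have "\<dots> = (\<Prod>b\<in>Basis. \<integral>y. ?g b y \<partial>lborel)"
  proof (rule product_integral_prod)
    fix b :: "real ^ 'n" assume "b \<in> Basis"
    then obtain i where "b = axis i 1" by (auto simp: Basis_vec_def)
    then show "integrable lborel (?g b)"
      using integral_cis_interval(1)[of "m $ i"] by simp
  qed simp
  also have "\<dots> = (\<Prod>b\<in>Basis. if lat m \<bullet> b = 0 then complex_of_real (2 * pi) else 0)"
  proof (rule prod.cong[OF refl])
    fix b :: "real ^ 'n" assume "b \<in> Basis"
    then obtain i where "b = axis i 1" by (auto simp: Basis_vec_def)
    then show "(\<integral>y. ?g b y \<partial>lborel) = (if lat m \<bullet> b = 0 then complex_of_real (2 * pi) else 0)"
      using integral_cis_interval(2)[of "m $ i"] by simp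
  qed
  also have "\<dots> = (if m = 0 then complex_of_real ((2 * pi) ^ CARD('n)) else 0)"
  proof (cases "m = 0")
    case False
    then obtain b where "b \<in> Basis" "lat m \<bullet> b \<noteq> 0"
      by (metis euclidean_all_zero_iff lat_eq_0_iff)
    then show ?thesis
      using False by (simp add: prod_zero_iff) blast
  qed simp
  finally show ?thesis .
qed

lemma integral_cas: "(\<integral>x. cas (m :: int ^ 'n) x \<partial>torus) = (if m = 0 then (2 * pi) ^ CARD('n) else 0)"
proof -
  have i: "integrable torus (\<lambda>x. cos (lat m \<bullet> x))" "integrable torus (\<lambda>x. sin (lat m \<bullet> x))"
    "integrable torus (\<lambda>x. cis (lat m \<bullet> x))"
    by (auto intro!: continuous_integrable_torus continuous_intros simp: cis_conv_exp)
  have "(\<integral>x. cas m x \<partial>torus) = (\<integral>x. cos (lat m \<bullet> x) \<partial>torus) + (\<integral>x. sin (lat m \<bullet> x) \<partial>torus)"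
    unfolding cas_def by (rule Bochner_Integration.integral_add[OF i(1,2)])
  also have "\<dots> = Re (\<integral>x. cis (lat m \<bullet> x) \<partial>torus) + Im (\<integral>x. cis (lat m \<bullet> x) \<partial>torus)"
    using i(3) by (simp flip: integral_Re integral_Im)
  finally show ?thesis
    by (simp add: integral_cis_torus)
qed

lemma integrable_cas [simp]: "integrable torus (cas k)"
  by (intro continuous_integrable_torus continuous_intros)

lemma cas_orthogonal:
  "(\<integral>x. cas (k :: int ^ 'n) x * cas l x \<partial>torus) = (if k = l then (2 * pi) ^ CARD('n) else 0)"
proof -
  \<comment> \<open>The sine part of the product formula has mean zero: the mean of
    \<open>cas m\<close> is unchanged when \<open>m\<close> is replaced by
    \<open>- m\<close>.\<close>
  have eq: "(\<integral>x. cas (k + l) x \<partial>torus) = (\<integral>x. cas (- k - l) x \<partial>torus)"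
    unfolding integral_cas by (metis add.inverse_inverse minus_add_distrib diff_conv_add_uminus neg_equal_0_iff_equal)
  have "(\<integral>x. cas k x * cas l x \<partial>torus) = ((\<integral>x. cas (k - l) x \<partial>torus) + (\<integral>x. cas (l - k) x \<partial>torus)) / 2
      + ((\<integral>x. cas (k + l) x \<partial>torus) - (\<integral>x. cas (- k - l) x \<partial>torus)) / 2"
    by (simp add: cas_mult)
  also have "\<dots> = ((\<integral>x. cas (k - l) x \<partial>torus) + (\<integral>x. cas (l - k) x \<partial>torus)) / 2"
    unfolding eq by simp
  finally show ?thesis
    by (auto simp: integral_cas)
qed

section \<open>Hartley coefficients\<close>

text \<open>The coefficient carries no normalisation, so Parseval's identity has the factor
  \<open>(2 * pi) ^ CARD('n)\<close> on the side of the function, and this factor reappears in all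
  comparisons of norms.\<close>

definition hc :: "int ^ 'n \<Rightarrow> (real ^ 'n \<Rightarrow> 'b::euclidean_space) \<Rightarrow> 'b" where
  "hc k f = (\<integral>x. cas k x *\<^sub>R f x \<partial>torus)"

text \<open>Membership in L2 of one period cell, separated from the periodicity that
  \<open>torus_L 2\<close> also demands, so that products such as the advection term can be handled
  on the cell alone.\<close>

definition sq_integrable :: "(real ^ 'n \<Rightarrow> 'b::euclidean_space) \<Rightarrow> bool" where
  "sq_integrable f \<longleftrightarrow> f \<in> borel_measurable torus \<and> integrable torus (\<lambda>x. (norm (f x))\<^sup>2)"

lemma integrable_bounded_scaleR:
  fixes f :: "real ^ 'n \<Rightarrow> 'b::euclidean_space"
  assumes "integrable torus f" "g \<in> borel_measurable torus" "AE x in torus. \<bar>g x\<bar> \<le> B"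
  shows "integrable torus (\<lambda>x. g x *\<^sub>R f x)"
proof (rule Bochner_Integration.integrable_bound)
  show "integrable torus (\<lambda>x. B *\<^sub>R f x)" using assms by simp
  show "AE x in torus. norm (g x *\<^sub>R f x) \<le> norm (B *\<^sub>R f x)"
    using assms(3) by eventually_elim (auto intro!: mult_right_mono)
qed (use assms in auto)

lemma integrable_cas_scaleR [simp]:
  fixes f :: "real ^ 'n \<Rightarrow> 'b::euclidean_space"
  assumes "integrable torus f"
  shows "integrable torus (\<lambda>x. cas k x *\<^sub>R f x)"
  by (rule integrable_bounded_scaleR[OF assms continuous_measurable_torus[OF continuous_cas], of _ 2])
    (simp add: abs_cas_le)

lemma sq_integrable_imp_integrable:
  assumes "sq_integrable f" shows "integrable torus f"
proof (rule Bochner_Integration.integrable_bound)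
  show "integrable torus (\<lambda>x. (norm (f x))\<^sup>2 + 1)"
    using assms by (simp add: sq_integrable_def)
  have "norm (f x) \<le> (norm (f x))\<^sup>2 + 1" for x
    using sum_squares_bound[of "norm (f x)" 1] by (smt (verit) norm_ge_zero zero_le_power2 power_one mult_1_right)
  then show "AE x in torus. norm (f x) \<le> norm ((norm (f x))\<^sup>2 + 1)"
    by (auto intro!: AE_I2 simp: abs_of_nonneg)
qed (use assms in \<open>simp add: sq_integrable_def\<close>)

lemma sq_integrable_inner:
  assumes "sq_integrable f" "sq_integrable g"
  shows "integrable torus (\<lambda>x. f x \<bullet> g x)"
proof (rule Bochner_Integration.integrable_bound)
  show "integrable torus (\<lambda>x. (norm (f x))\<^sup>2 + (norm (g x))\<^sup>2)"
    using assms by (simp add: sq_integrable_def)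
  have "\<bar>f x \<bullet> g x\<bar> \<le> (norm (f x))\<^sup>2 + (norm (g x))\<^sup>2" for x
  proof -
    have "\<bar>f x \<bullet> g x\<bar> \<le> norm (f x) * norm (g x)"
      by (rule Cauchy_Schwarz_ineq2)
    also have "\<dots> \<le> (norm (f x))\<^sup>2 + (norm (g x))\<^sup>2"
      using sum_squares_bound[of "norm (f x)" "norm (g x)"] by (simp add: mult.assoc) (smt (verit) mult_nonneg_nonneg norm_ge_zero)
    finally show ?thesis .
  qed
  then show "AE x in torus. norm (f x \<bullet> g x) \<le> norm ((norm (f x))\<^sup>2 + (norm (g x))\<^sup>2)"
    by (auto intro!: AE_I2 simp: abs_of_nonneg)
qed (use assms in \<open>auto simp: sq_integrable_def\<close>)

lemma sq_integrable_add:
  assumes "sq_integrable f" "sq_integrable g"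
  shows "sq_integrable (\<lambda>x. f x + g x)"
proof -
  have "integrable torus (\<lambda>x. (norm (f x))\<^sup>2 + (norm (g x))\<^sup>2 + 2 * (f x \<bullet> g x))"
    using assms sq_integrable_inner[OF assms] by (simp add: sq_integrable_def)
  moreover have "(norm (f x))\<^sup>2 + (norm (g x))\<^sup>2 + 2 * (f x \<bullet> g x) = (norm (f x + g x))\<^sup>2" for x
    by (simp add: power2_norm_eq_inner inner_add_left inner_add_right inner_commute)
  moreover have "(\<lambda>x. f x + g x) \<in> borel_measurable torus"
    using assms by (intro borel_measurable_add) (auto simp: sq_integrable_def)
  ultimately show ?thesis
    by (simp add: sq_integrable_def)
qed

lemma sq_integrable_scaleR: "sq_integrable f \<Longrightarrow> sq_integrable (\<lambda>x. c *\<^sub>R f x)"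
  unfolding sq_integrable_def
  by (intro conjI borel_measurable_scaleR borel_measurable_const) (simp_all add: power_mult_distrib)

lemma sq_integrable_diff:
  assumes "sq_integrable f" "sq_integrable g" shows "sq_integrable (\<lambda>x. f x - g x)"
  using sq_integrable_add[OF assms(1) sq_integrable_scaleR[OF assms(2), of "-1"]] by simp

lemma continuous_sq_integrable:
  "continuous_on UNIV f \<Longrightarrow> sq_integrable f"
  unfolding sq_integrable_def
  by (intro conjI continuous_measurable_torus continuous_integrable_torus continuous_intros)

lemma hc_trig_sum:
  fixes c :: "int ^ 'n \<Rightarrow> 'b::euclidean_space"
  assumes "finite A"
  shows "hc l (\<lambda>x. \<Sum>k\<in>A. cas k x *\<^sub>R c k) = (if l \<in> A then (2 * pi) ^ CARD('n) *\<^sub>R c l else 0)"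
proof -
  have i: "integrable torus (\<lambda>x. cas l x * cas k x)" for k :: "int ^ 'n"
    by (intro continuous_integrable_torus continuous_intros)
  have "hc l (\<lambda>x. \<Sum>k\<in>A. cas k x *\<^sub>R c k) = (\<integral>x. (\<Sum>k\<in>A. (cas l x * cas k x) *\<^sub>R c k) \<partial>torus)"
    by (simp add: hc_def scaleR_sum_right)
  also have "\<dots> = (\<Sum>k\<in>A. (if l = k then (2 * pi) ^ CARD('n) else 0) *\<^sub>R c k)"
    using i by (simp add: cas_orthogonal)
  also have "\<dots> = (\<Sum>k\<in>A. (if l = k then (2 * pi) ^ CARD('n) *\<^sub>R c k else 0))"
    by (intro sum.cong) auto
  finally show ?thesis
    using assms by simp
qed

lemma integral_inner_trig_sum:
  fixes f :: "real ^ 'n \<Rightarrow> 'b::euclidean_space"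
  assumes "integrable torus f"
  shows "(\<integral>x. f x \<bullet> (\<Sum>k\<in>A. cas k x *\<^sub>R c k) \<partial>torus) = (\<Sum>k\<in>A. hc k f \<bullet> c k)"
proof -
  have "(\<integral>x. f x \<bullet> (\<Sum>k\<in>A. cas k x *\<^sub>R c k) \<partial>torus) = (\<integral>x. (\<Sum>k\<in>A. (cas k x *\<^sub>R f x) \<bullet> c k) \<partial>torus)"
    by (simp add: inner_sum_right)
  also have "\<dots> = (\<Sum>k\<in>A. (\<integral>x. (cas k x *\<^sub>R f x) \<bullet> c k \<partial>torus))"
    using assms by (intro Bochner_Integration.integral_sum integrable_inner_left impI integrable_cas_scaleR)
  also have "\<dots> = (\<Sum>k\<in>A. hc k f \<bullet> c k)"
    unfolding hc_def
    by (intro sum.cong refl integral_inner_left) (use assms in simp)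
  finally show ?thesis .
qed

text \<open>Expanding the square and using orthogonality makes the error a quadratic polynomial in
  the coefficients \<open>c\<close>. Its value at the minimum gives Bessel's inequality, and a lower
  bound for it gives \<open>best_approximation\<close>.\<close>

lemma norm_diff_trig_sum:
  fixes f :: "real ^ 'n \<Rightarrow> 'b::euclidean_space"
  assumes "sq_integrable f" "finite A"
  shows "(\<integral>x. (norm (f x - (\<Sum>k\<in>A. cas k x *\<^sub>R c k)))\<^sup>2 \<partial>torus)
    = (\<integral>x. (norm (f x))\<^sup>2 \<partial>torus) - 2 * (\<Sum>k\<in>A. hc k f \<bullet> c k)
      + (2 * pi) ^ CARD('n) * (\<Sum>k\<in>A. (norm (c k))\<^sup>2)"
proof -
  let ?p = "\<lambda>x. \<Sum>k\<in>A. cas k x *\<^sub>R c k"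
  have cont: "continuous_on UNIV ?p"
    by (intro continuous_intros)
  then have p: "sq_integrable ?p" by (rule continuous_sq_integrable)
  have "(\<integral>x. (norm (f x - ?p x))\<^sup>2 \<partial>torus)
      = (\<integral>x. (norm (f x))\<^sup>2 - 2 * (f x \<bullet> ?p x) + ?p x \<bullet> ?p x \<partial>torus)"
    by (simp add: power2_norm_eq_inner inner_diff_left inner_diff_right inner_commute algebra_simps)
  also have "\<dots> = (\<integral>x. (norm (f x))\<^sup>2 \<partial>torus) - 2 * (\<integral>x. f x \<bullet> ?p x \<partial>torus) + (\<integral>x. ?p x \<bullet> ?p x \<partial>torus)"
    using assms(1) sq_integrable_inner[OF assms(1) p] sq_integrable_inner[OF p p]
    by (simp add: sq_integrable_def)
  also have "(\<integral>x. ?p x \<bullet> ?p x \<partial>torus) = (\<Sum>k\<in>A. hc k ?p \<bullet> c k)"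
    by (rule integral_inner_trig_sum) (rule continuous_integrable_torus[OF cont])
  also have "\<dots> = (2 * pi) ^ CARD('n) * (\<Sum>k\<in>A. (norm (c k))\<^sup>2)"
    using assms(2) by (simp add: hc_trig_sum power2_norm_eq_inner sum_distrib_left)
  also have "(\<integral>x. f x \<bullet> ?p x \<partial>torus) = (\<Sum>k\<in>A. hc k f \<bullet> c k)"
    by (rule integral_inner_trig_sum) (rule sq_integrable_imp_integrable[OF assms(1)])
  finally show ?thesis .
qed

text \<open>The coefficients \<open>hc k f\<close> divided by the volume minimise the quadratic
  error, and the error is nonnegative.\<close>

lemma bessel:
  fixes f :: "real ^ 'n \<Rightarrow> 'b::euclidean_space"
  assumes "sq_integrable f" "finite A"
  shows "(\<Sum>k\<in>A. (norm (hc k f))\<^sup>2) \<le> (2 * pi) ^ CARD('n) * (\<integral>x. (norm (f x))\<^sup>2 \<partial>torus)"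
proof -
  define V :: real where "V = (2 * pi) ^ CARD('n)"
  have V: "V > 0" by (simp add: V_def)
  have "0 \<le> (\<integral>x. (norm (f x - (\<Sum>k\<in>A. cas k x *\<^sub>R ((1 / V) *\<^sub>R hc k f))))\<^sup>2 \<partial>torus)"
    by (rule integral_nonneg_AE) simp
  also have "\<dots> = (\<integral>x. (norm (f x))\<^sup>2 \<partial>torus) - 2 * (\<Sum>k\<in>A. hc k f \<bullet> ((1 / V) *\<^sub>R hc k f))
      + V * (\<Sum>k\<in>A. (norm ((1 / V) *\<^sub>R hc k f))\<^sup>2)"
    unfolding V_def by (rule norm_diff_trig_sum[OF assms])
  also have "\<dots> = (\<integral>x. (norm (f x))\<^sup>2 \<partial>torus) - 1 / V * (\<Sum>k\<in>A. (norm (hc k f))\<^sup>2)"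
    using V by (simp add: power_divide dot_square_norm sum_divide_distrib[symmetric] power2_eq_square[of V] field_simps)
  finally show ?thesis
    unfolding V_def[symmetric] using V by (simp add: field_simps)
qed

text \<open>Completing the square at each frequency: no choice of \<open>c\<close> on
  \<open>A\<close> beats the orthogonal projection. Together with density of trigonometric
  polynomials this yields Parseval's inequality in the hard direction without constructing the
  Fourier series.\<close>

lemma best_approximation:
  fixes f :: "real ^ 'n \<Rightarrow> 'b::euclidean_space"
  assumes "sq_integrable f" "finite A"
  shows "(\<integral>x. (norm (f x))\<^sup>2 \<partial>torus) \<le> 1 / (2 * pi) ^ CARD('n) * (\<Sum>k\<in>A. (norm (hc k f))\<^sup>2)
    + (\<integral>x. (norm (f x - (\<Sum>k\<in>A. cas k x *\<^sub>R c k)))\<^sup>2 \<partial>torus)"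
proof -
  define V :: real where "V = (2 * pi) ^ CARD('n)"
  have V: "V > 0" by (simp add: V_def)
  have "2 * (h \<bullet> d) \<le> 1 / V * (norm h)\<^sup>2 + V * (norm d)\<^sup>2" for h d :: 'b
  proof -
    have "0 \<le> (norm (h - V *\<^sub>R d))\<^sup>2" by simp
    also have "\<dots> = (norm h)\<^sup>2 - 2 * V * (h \<bullet> d) + V\<^sup>2 * (norm d)\<^sup>2"
      by (simp add: power2_norm_eq_inner inner_diff_left inner_diff_right inner_commute algebra_simps power2_eq_square[of V])
    finally have "V * (2 * (h \<bullet> d)) \<le> V * (1 / V * (norm h)\<^sup>2 + V * (norm d)\<^sup>2)"
      using V by (simp add: algebra_simps power2_eq_square[of V])
    then show ?thesis using V mult_le_cancel_left_pos by blast
  qed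
  then have "(\<Sum>k\<in>A. 2 * (hc k f \<bullet> c k)) \<le> (\<Sum>k\<in>A. 1 / V * (norm (hc k f))\<^sup>2 + V * (norm (c k))\<^sup>2)"
    by (rule sum_mono)
  then have "2 * (\<Sum>k\<in>A. hc k f \<bullet> c k) \<le> 1 / V * (\<Sum>k\<in>A. (norm (hc k f))\<^sup>2) + V * (\<Sum>k\<in>A. (norm (c k))\<^sup>2)"
    by (simp add: sum.distrib sum_distrib_left)
  then show ?thesis
    unfolding norm_diff_trig_sum[OF assms] V_def[symmetric] by linarith
qed

section \<open>Density of trigonometric polynomials and uniqueness of coefficients\<close>

text \<open>The quotient map from the period cell onto the torus, realised as a product of circles.
  All cosines come first and all sines second, so that the target is a Euclidean space on which
  polynomial functions are available.\<close>

definition circle_map :: "real ^ 'n \<Rightarrow> (real ^ 'n) \<times> (real ^ 'n)" where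
  "circle_map x = (\<chi> i. cos (x $ i), \<chi> i. sin (x $ i))"

lemma trig_poly_cos_sin:
  "trig_poly (\<lambda>x :: real ^ 'n. cos (x $ i))" "trig_poly (\<lambda>x :: real ^ 'n. sin (x $ i))"
proof -
  have e: "x $ i = lat (axis i 1) \<bullet> x" for x :: "real ^ 'n"
  proof -
    have "lat (axis i 1) = axis i (1::real)"
      by (simp add: lat_def vec_eq_iff axis_def)
    then show ?thesis by (simp add: inner_axis')
  qed
  have *: "trig_poly (\<lambda>x. (cas k x + c * cas (- k) x) / 2)" for c :: real and k :: "int ^ 'n"
  proof -
    have "(\<lambda>x. (cas k x + c * cas (- k) x) / 2) = (\<lambda>x. cas k x *\<^sub>R (1 / 2) + cas (- k) x *\<^sub>R (c / 2))"
      by (simp add: field_simps)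
    then show ?thesis by (simp only:) (intro trig_poly_add trig_poly_cas)
  qed
  show "trig_poly (\<lambda>x :: real ^ 'n. cos (x $ i))"
    unfolding e cos_sin_eq_cas using *[of "axis i 1" 1] by simp
  show "trig_poly (\<lambda>x :: real ^ 'n. sin (x $ i))"
    unfolding e cos_sin_eq_cas using *[of "axis i 1" "-1"] by simp
qed

text \<open>The coordinates of \<open>circle_map\<close> are trigonometric polynomials and these
  form an algebra. A linear base function is expanded along the axes of both factors.\<close>

lemma trig_poly_real_polynomial:
  assumes "real_polynomial_function g"
  shows "trig_poly (\<lambda>x :: real ^ 'n. g (circle_map x))"
  using assms
proof induction
  case (linear f)
  have e: "circle_map x = (\<Sum>i\<in>UNIV. cos (x $ i) *\<^sub>R (axis i 1, 0)) + (\<Sum>i\<in>UNIV. sin (x $ i) *\<^sub>R (0, axis i 1))"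
    for x :: "real ^ 'n"
    by (simp add: circle_map_def prod_eq_iff fst_sum snd_sum vec_eq_iff axis_def if_distrib[where f="(*) _"] cong: if_cong)
  have l: "linear f" using linear bounded_linear.linear by blast
  have "f (circle_map x) = (\<Sum>i\<in>UNIV. cos (x $ i) *\<^sub>R f (axis i 1, 0)) + (\<Sum>i\<in>UNIV. sin (x $ i) *\<^sub>R f (0, axis i 1))"
    for x :: "real ^ 'n"
    unfolding e linear_add[OF l] linear_sum[OF l] linear_cmul[OF l] ..
  then show ?case
    by (simp only:) (intro trig_poly_add trig_poly_sum trig_poly_scaleR_const trig_poly_cos_sin)
qed (auto intro: trig_poly_const trig_poly_add trig_poly_mult)

text \<open>Distinct points with the same image differ by a nonzero multiple of the period in some
  coordinate. Inside the closed cell this coordinate can then only be 0 or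
  \<open>2 * pi\<close>.\<close>

lemma circle_map_eq_imp:
  assumes "circle_map x = circle_map y" "x \<in> cbox 0 (\<chi> i. 2 * pi)" "y \<in> cbox 0 (\<chi> i. 2 * pi)" "x \<noteq> y"
  shows "x \<notin> box 0 (\<chi> i. 2 * pi)"
proof -
  obtain i where i: "x $ i \<noteq> y $ i" using assms(4) by (auto simp: vec_eq_iff)
  have b: "0 \<le> x $ i" "x $ i \<le> 2 * pi" "0 \<le> y $ i" "y $ i \<le> 2 * pi"
    using assms(2,3) by (auto simp: mem_box_cart)
  have "cos (x $ i) = cos (y $ i)" "sin (x $ i) = sin (y $ i)"
    using assms(1) by (auto simp: circle_map_def vec_eq_iff)
  then obtain n :: int where n: "x $ i = y $ i + 2 * pi * n"
    using sin_cos_eq_iff by metis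
  have "x $ i = 0 \<or> x $ i = 2 * pi"
  proof -
    have "n \<noteq> 0" using n i by auto
    then consider "n \<ge> 1" | "n \<le> -1" by linarith
    then show ?thesis
    proof cases
      case 1
      then have "2 * pi * n \<ge> 2 * pi" by simp
      then show ?thesis using n b by linarith
    next
      case 2
      then have "real_of_int n \<le> -1" by linarith
      then have "2 * pi * n \<le> 2 * pi * (-1)" by (intro mult_left_mono) auto
      then show ?thesis using n b by linarith
    qed
  qed
  moreover have "0 < x $ i \<and> x $ i < 2 * pi" if "x \<in> box 0 (\<chi> i. 2 * pi)"
    using that by (simp add: mem_box_cart)
  ultimately show ?thesis by force
qed

text \<open>
  A function vanishing on the boundary of the period cell factors through the product of circles,
  where real polynomials are dense.
\<close>

lemma trig_poly_uniform_approx: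
  fixes w :: "real ^ 'n \<Rightarrow> real"
  assumes cont: "continuous_on UNIV w"
    and zero: "\<And>x. x \<in> cbox 0 (\<chi> i. 2 * pi) \<Longrightarrow> x \<notin> box 0 (\<chi> i. 2 * pi) \<Longrightarrow> w x = 0"
    and "e > 0"
  shows "\<exists>p. trig_poly p \<and> (\<forall>x\<in>cbox 0 (\<chi> i. 2 * pi). \<bar>w x - p x\<bar> < e)"
proof -
  define Q :: "(real ^ 'n) set" where "Q = cbox 0 (\<chi> i. 2 * pi)"
  define W where "W = w \<circ> inv_into Q circle_map"
  have W: "W (circle_map x) = w x" if "x \<in> Q" for x
  proof -
    define y where "y = inv_into Q circle_map (circle_map x)"
    have y: "y \<in> Q" "circle_map y = circle_map x"
      using that unfolding y_def by (auto intro: inv_into_into f_inv_into_f)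
    show ?thesis
    proof (cases "x = y")
      case False
      then have "w x = 0" "w y = 0"
        using circle_map_eq_imp[of x y] circle_map_eq_imp[of y x] y that zero unfolding Q_def by auto
      then show ?thesis by (simp add: W_def y_def)
    qed (simp add: W_def y_def)
  qed
  have cq: "continuous_on Q circle_map"
    unfolding circle_map_def by (intro continuous_intros)
  have cw: "continuous_on Q w" using cont continuous_on_subset by blast
  \<comment> \<open>The factored function \<open>W\<close> is continuous because its graph is the
    image of the compact cell, hence closed, and its values stay in a compact set.\<close>
  have "compact ((\<lambda>x. (circle_map x, w x)) ` Q)"
    unfolding Q_def using cq cw
    by (intro compact_continuous_image continuous_on_Pair) (simp_all add: Q_def)
  moreover have "(\<lambda>y. (y, W y)) ` (circle_map ` Q) = (\<lambda>x. (circle_map x, w x)) ` Q"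
    using W by (auto simp: image_iff)
  ultimately have "closed ((\<lambda>y. (y, W y)) ` (circle_map ` Q))"
    using compact_imp_closed by metis
  moreover have "compact (w ` Q)" "W \<in> circle_map ` Q \<rightarrow> w ` Q"
    using cw W by (auto intro!: compact_continuous_image simp: Q_def)
  ultimately have "continuous_on (circle_map ` Q) W"
    by (intro continuous_from_closed_graph[of "w ` Q"])
  moreover have "compact (circle_map ` Q)"
    using cq by (intro compact_continuous_image) (simp_all add: Q_def)
  ultimately obtain g where g: "real_polynomial_function g" "\<And>y. y \<in> circle_map ` Q \<Longrightarrow> \<bar>W y - g y\<bar> < e"
    using Stone_Weierstrass_real_polynomial_function \<open>e > 0\<close> by metis
  show ?thesis
    using trig_poly_real_polynomial[OF g(1)] g(2) W
    by (intro exI[of _ "\<lambda>x. g (circle_map x)"]) (metis Q_def imageI)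
qed

lemma AE_torus_box: "AE x in (torus :: (real ^ 'n) measure). x \<in> box 0 (\<chi> i. 2 * pi)"
proof -
  have "cbox 0 (\<chi> i. 2 * pi) - box 0 (\<chi> i. 2 * pi) \<in> null_sets (lebesgue :: (real ^ 'n) measure)"
    using negligible_frontier_interval negligible_iff_null_sets by blast
  then have "AE x in (lebesgue :: (real ^ 'n) measure). x \<notin> cbox 0 (\<chi> i. 2 * pi) - box 0 (\<chi> i. 2 * pi)"
    by (rule AE_not_in)
  then have "AE x in (lebesgue :: (real ^ 'n) measure). x \<in> cbox 0 (\<chi> i. 2 * pi) \<longrightarrow> x \<in> box 0 (\<chi> i. 2 * pi)"
    by eventually_elim auto
  then show ?thesis
    unfolding torus_def by (simp add: AE_restrict_space_iff)
qed

text \<open>A Lebesgue measurable function is almost everywhere a limit of continuous ones. These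
  are truncated at height \<open>B\<close> and multiplied by a cutoff that vanishes on the boundary
  of the cell, which makes uniform approximation possible. The uniform error
  \<open>1 / (n + 1)\<close> is at most 1, hence the bound \<open>B + 1\<close>.\<close>

lemma trig_poly_AE_approx:
  fixes g :: "real ^ 'n \<Rightarrow> real"
  assumes meas: "g \<in> borel_measurable torus" and bound: "\<And>x. x \<in> space torus \<Longrightarrow> \<bar>g x\<bar> \<le> B"
  obtains p where "\<And>n::nat. trig_poly (p n)" "\<And>n x. x \<in> space torus \<Longrightarrow> \<bar>p n x\<bar> \<le> B + 1"
    "AE x in torus. (\<lambda>n. p n x) \<longlonglongrightarrow> g x"
proof -
  let ?Q = "cbox 0 (\<chi> i. 2 * pi) :: (real ^ 'n) set" and ?O = "box 0 (\<chi> i. 2 * pi) :: (real ^ 'n) set"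
  have "g \<in> borel_measurable (lebesgue_on ?Q)" using meas by (simp add: torus_def)
  then have "(\<lambda>x. if x \<in> ?Q then g x else 0) \<in> borel_measurable lebesgue"
    by (simp add: borel_measurable_if)
  then have "(\<lambda>x. if x \<in> ?Q then g x else 0) measurable_on UNIV"
    by (intro lebesgue_measurable_imp_measurable_on) auto
  then obtain N h where N: "negligible N" and h: "\<And>n. continuous_on UNIV (h n)"
    "\<And>x. x \<notin> N \<Longrightarrow> (\<lambda>n::nat. h n x) \<longlonglongrightarrow> (if x \<in> ?Q then g x else 0)"
    unfolding measurable_on_def by auto
  have "0 \<in> ?Q" by (auto simp: mem_box_cart)
  then have B: "B \<ge> 0" using bound[of 0] by simp
  \<comment> \<open>At every interior point of the cell this cutoff equals 1 from some
    \<open>n\<close> on, so it does not change the pointwise limit.\<close>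
  define c where "c n x = min 1 (real n * infdist x (- ?O))" for n x
  define w where "w n x = max (- B) (min B (h n x)) * c n x" for n x
  have c: "0 \<le> c n x" "c n x \<le> 1" for n x
    by (auto simp: c_def infdist_nonneg)
  have nonempty: "- ?O \<noteq> {}"
    using bounded_box[of 0 "\<chi> i. 2 * pi"] not_bounded_UNIV by (metis Compl_empty_eq double_complement)
  have wb: "\<bar>w n x\<bar> \<le> B" for n x
  proof -
    have "\<bar>w n x\<bar> = \<bar>max (- B) (min B (h n x))\<bar> * c n x"
      using c by (simp add: w_def abs_mult)
    also have "\<dots> \<le> B * 1"
      using c B by (intro mult_mono) auto
    finally show ?thesis by simp
  qed
  have cw: "continuous_on UNIV (w n)" for n
    unfolding w_def c_def by (intro continuous_intros h continuous_on_infdist)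
  have z: "w n x = 0" if "x \<notin> ?O" for n x
    using that by (simp add: w_def c_def)
  have "\<exists>p. trig_poly p \<and> (\<forall>x\<in>?Q. \<bar>w n x - p x\<bar> < inverse (real (Suc n)))" for n
    by (rule trig_poly_uniform_approx) (auto intro: cw z)
  then obtain p where p: "\<And>n. trig_poly (p n)" "\<And>n x. x \<in> ?Q \<Longrightarrow> \<bar>w n x - p n x\<bar> < inverse (real (Suc n))"
    by metis
  show ?thesis
  proof (rule that[of p])
    show "trig_poly (p n)" for n by (rule p)
    show "\<bar>p n x\<bar> \<le> B + 1" if "x \<in> space torus" for n x
    proof -
      have "inverse (real (Suc n)) \<le> 1" by (simp add: inverse_le_1_iff)
      then show ?thesis
        using p(2)[of x n] wb[of n x] that by (simp del: of_nat_Suc)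
    qed
    have "AE x in lebesgue. x \<notin> N"
      using N negligible_iff_null_sets AE_not_in by blast
    then have "AE x in torus. x \<notin> N"
      unfolding torus_def by (auto simp: AE_restrict_space_iff elim!: eventually_mono)
    moreover note AE_torus_box
    ultimately show "AE x in torus. (\<lambda>n. p n x) \<longlonglongrightarrow> g x"
    proof eventually_elim
      case (elim x)
      then have xQ: "x \<in> ?Q" using box_subset_cbox by blast
      have "infdist x (- ?O) > 0"
        using elim nonempty by (metis ComplD closed_Compl in_closed_iff_infdist_zero infdist_nonneg less_eq_real_def open_box)
      then have "eventually (\<lambda>n. c n x = 1) sequentially"
      proof -
        obtain m where "1 < real m * infdist x (- ?O)"
          using reals_Archimedean3 \<open>infdist x (- ?O) > 0\<close> by blast
        then have "1 \<le> real n * infdist x (- ?O)" if "n \<ge> m" for n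
          using that mult_right_mono[of "real m" "real n" "infdist x (- ?O)"] infdist_nonneg[of x "- ?O"] by simp
        then show ?thesis
          unfolding eventually_sequentially c_def by (intro exI[of _ m]) auto
      qed
      then have c1: "(\<lambda>n. c n x) \<longlonglongrightarrow> 1"
        by (rule tendsto_eventually)
      have "(\<lambda>n. h n x) \<longlonglongrightarrow> g x" using h(2)[of x] elim xQ by simp
      then have "(\<lambda>n. max (- B) (min B (h n x)) * c n x) \<longlonglongrightarrow> max (- B) (min B (g x)) * 1"
        by (intro tendsto_intros c1)
      moreover have "max (- B) (min B (g x)) * 1 = g x"
        using bound[of x] xQ by (simp add: abs_le_iff)
      ultimately have "(\<lambda>n. w n x) \<longlonglongrightarrow> g x" by (simp add: w_def)
      moreover have "(\<lambda>n. w n x - p n x) \<longlonglongrightarrow> 0"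
        by (rule Lim_null_comparison[OF _ LIMSEQ_inverse_real_of_nat])
          (use p(2)[OF xQ] in \<open>auto intro!: always_eventually less_imp_le\<close>)
      ultimately have "(\<lambda>n. w n x - (w n x - p n x)) \<longlonglongrightarrow> g x - 0"
        by (rule tendsto_diff)
      then show ?case by simp
    qed
  qed
qed

lemma hc_inner:
  assumes "integrable torus f"
  shows "hc k (\<lambda>x. f x \<bullet> b) = hc k f \<bullet> b"
  unfolding hc_def
  by (subst integral_inner_left[symmetric]) (use assms in auto)

lemma integral_trig_poly_eq_0:
  fixes F :: "real ^ 'n \<Rightarrow> real"
  assumes "integrable torus F" "\<And>k. hc k F = 0" "trig_poly p"
  shows "(\<integral>x. F x * p x \<partial>torus) = 0"
proof -
  obtain A c where p: "p = (\<lambda>x. \<Sum>k\<in>A. cas k x *\<^sub>R c k)"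
    using assms(3) unfolding trig_poly_def by blast
  show ?thesis
    using integral_inner_trig_sum[OF assms(1), where A=A and c=c] assms(2) by (simp add: p)
qed

text \<open>Trigonometric polynomials converging boundedly to \<open>sgn F\<close> are integrated
  against \<open>F\<close>; dominated convergence shows that the integral of the absolute value
  vanishes. Duality is used because \<open>F\<close> is merely integrable and Parseval's identity is
  not at hand.\<close>

lemma hc_unique_real:
  fixes F :: "real ^ 'n \<Rightarrow> real"
  assumes int: "integrable torus F" and zero: "\<And>k. hc k F = 0"
  shows "AE x in torus. F x = 0"
proof -
  have "(\<lambda>x. sgn (F x)) \<in> borel_measurable torus"
    using int by simp
  then obtain p where p: "\<And>n::nat. trig_poly (p n)"
    "\<And>n x. x \<in> space torus \<Longrightarrow> \<bar>p n x\<bar> \<le> 1 + 1"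
    "AE x in torus. (\<lambda>n. p n x) \<longlonglongrightarrow> sgn (F x)"
    by (rule trig_poly_AE_approx[where B=1]) (auto simp: abs_sgn_eq)
  have m: "p n \<in> borel_measurable torus" for n
    using p(1) trig_poly_continuous continuous_measurable_torus by blast
  have "(\<lambda>n. \<integral>x. F x * p n x \<partial>torus) \<longlonglongrightarrow> (\<integral>x. F x * sgn (F x) \<partial>torus)"
  proof (rule integral_dominated_convergence)
    show "integrable torus (\<lambda>x. 2 * \<bar>F x\<bar>)" using int by simp
    show "AE x in torus. (\<lambda>n. F x * p n x) \<longlonglongrightarrow> F x * sgn (F x)"
      using p(3) by eventually_elim (intro tendsto_intros)
    show "AE x in torus. norm (F x * p n x) \<le> 2 * \<bar>F x\<bar>" for n
    proof (rule AE_I2)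
      fix x :: "real ^ 'n" assume "x \<in> space torus"
      then have "\<bar>F x\<bar> * \<bar>p n x\<bar> \<le> \<bar>F x\<bar> * 2"
        using p(2)[of x n] by (intro mult_left_mono) auto
      then show "norm (F x * p n x) \<le> 2 * \<bar>F x\<bar>" by (simp add: abs_mult mult.commute)
    qed
  qed (use int m in auto)
  then have "(\<integral>x. F x * sgn (F x) \<partial>torus) = 0"
    using integral_trig_poly_eq_0[OF int zero p(1)] by (simp add: LIMSEQ_const_iff)
  then have "(\<integral>x. \<bar>F x\<bar> \<partial>torus) = 0"
    by (simp add: abs_sgn[symmetric] mult.commute)
  then show ?thesis
    using int integral_nonneg_eq_0_iff_AE[of torus "\<lambda>x. \<bar>F x\<bar>"] by simp
qed

lemma hc_unique:
  fixes f g :: "real ^ 'n \<Rightarrow> 'b::euclidean_space"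
  assumes int: "integrable torus f" "integrable torus g" and eq: "\<And>k. hc k f = hc k g"
  shows "AE x in torus. f x = g x"
proof -
  have "AE x in torus. f x \<bullet> b - g x \<bullet> b = 0" if "b \<in> Basis" for b
  proof (rule hc_unique_real)
    show "integrable torus (\<lambda>x. f x \<bullet> b - g x \<bullet> b)" using int by simp
    fix k
    have "hc k (\<lambda>x. f x \<bullet> b - g x \<bullet> b) = hc k (\<lambda>x. f x \<bullet> b) - hc k (\<lambda>x. g x \<bullet> b)"
      unfolding hc_def scaleR_diff_right
      by (intro Bochner_Integration.integral_diff integrable_cas_scaleR integrable_inner_left impI int)
    then show "hc k (\<lambda>x. f x \<bullet> b - g x \<bullet> b) = 0"
      using int eq by (simp add: hc_inner)
  qed
  then have "AE x in torus. \<forall>b\<in>Basis. f x \<bullet> b - g x \<bullet> b = 0"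
    by (intro AE_finite_allI) auto
  then show ?thesis
    by eventually_elim (metis (no_types, lifting) eq_iff_diff_eq_0 euclidean_eqI)
qed

text \<open>Truncation reduces to bounded functions, for which bounded almost everywhere convergence
  gives L2 convergence. Each of the two errors is below \<open>e / 4\<close> because the square of a
  sum costs a factor 2.\<close>

lemma trig_poly_L2_approx_real:
  fixes F :: "real ^ 'n \<Rightarrow> real"
  assumes F: "sq_integrable F" and "e > 0"
  shows "\<exists>p. trig_poly p \<and> (\<integral>x. (F x - p x)\<^sup>2 \<partial>torus) < e"
proof -
  define G where "G M x = max (- real M) (min (real M) (F x))" for M x
  have meas [measurable]: "F \<in> borel_measurable torus" and int: "integrable torus (\<lambda>x. (F x)\<^sup>2)"
    using F by (auto simp: sq_integrable_def)
  have Gm [measurable]: "G M \<in> borel_measurable torus" for M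
    unfolding G_def by measurable
  have Gb: "\<bar>G M x\<bar> \<le> real M" for M x by (auto simp: G_def)
  have FG: "\<bar>F x - G M x\<bar> \<le> \<bar>F x\<bar>" for M x by (auto simp: G_def)
  have "(\<lambda>M. \<integral>x. (F x - G M x)\<^sup>2 \<partial>torus) \<longlonglongrightarrow> (\<integral>x. 0 \<partial>(torus :: (real ^ 'n) measure))"
  proof (rule integral_dominated_convergence[OF _ _ int])
    show "AE x in torus. (\<lambda>M. (F x - G M x)\<^sup>2) \<longlonglongrightarrow> 0"
    proof (rule AE_I2, rule tendsto_eventually)
      fix x
      obtain m where "\<bar>F x\<bar> < real m" using reals_Archimedean2 by blast
      then have "G M x = F x" if "M \<ge> m" for M
      proof -
        have "real m \<le> real M" using that by simp
        then show ?thesis using \<open>\<bar>F x\<bar> < real m\<close> by (auto simp: G_def max_def min_def)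
      qed
      then show "\<forall>\<^sub>F M in sequentially. (F x - G M x)\<^sup>2 = 0"
        unfolding eventually_sequentially by (intro exI[of _ m]) simp
    qed
    show "AE x in torus. norm ((F x - G M x)\<^sup>2) \<le> (F x)\<^sup>2" for M
      using FG[of _ M] by (auto simp: abs_le_square_iff[symmetric])
  qed auto
  then have "eventually (\<lambda>M. (\<integral>x. (F x - G M x)\<^sup>2 \<partial>torus) < e / 4) sequentially"
    using \<open>e > 0\<close> by (intro order_tendstoD(2)) auto
  then obtain M where M: "(\<integral>x. (F x - G M x)\<^sup>2 \<partial>torus) < e / 4"
    by (auto simp: eventually_sequentially)
  obtain p where p: "\<And>n::nat. trig_poly (p n)" "\<And>n x. x \<in> space torus \<Longrightarrow> \<bar>p n x\<bar> \<le> real M + 1"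
    "AE x in torus. (\<lambda>n. p n x) \<longlonglongrightarrow> G M x"
    by (rule trig_poly_AE_approx[OF Gm, of M "real M"]) (use Gb in auto)
  have pm [measurable]: "p n \<in> borel_measurable torus" for n
    using p(1) trig_poly_continuous continuous_measurable_torus by blast
  have Gp: "norm ((G M x - p n x)\<^sup>2) \<le> (2 * real M + 1)\<^sup>2" if "x \<in> space torus" for x n
    using Gb[of M x] p(2)[OF that, of n] by (simp add: abs_le_square_iff[symmetric])
  have "(\<lambda>n. \<integral>x. (G M x - p n x)\<^sup>2 \<partial>torus) \<longlonglongrightarrow> (\<integral>x. 0 \<partial>(torus :: (real ^ 'n) measure))"
  proof (rule integral_dominated_convergence)
    show "integrable torus (\<lambda>x :: real ^ 'n. (2 * real M + 1)\<^sup>2)" by simp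
    show "AE x in torus. (\<lambda>n. (G M x - p n x)\<^sup>2) \<longlonglongrightarrow> 0"
      using p(3)
    proof eventually_elim
      case (elim x)
      then have "(\<lambda>n. (G M x - p n x)\<^sup>2) \<longlonglongrightarrow> (G M x - G M x)\<^sup>2" by (intro tendsto_intros)
      then show ?case by simp
    qed
    show "AE x in torus. norm ((G M x - p n x)\<^sup>2) \<le> (2 * real M + 1)\<^sup>2" for n
      using Gp by (intro AE_I2) auto
  qed auto
  then have "eventually (\<lambda>n. (\<integral>x. (G M x - p n x)\<^sup>2 \<partial>torus) < e / 4) sequentially"
    using \<open>e > 0\<close> by (intro order_tendstoD(2)) auto
  then obtain n where n: "(\<integral>x. (G M x - p n x)\<^sup>2 \<partial>torus) < e / 4"
    by (auto simp: eventually_sequentially)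
  have i1: "integrable torus (\<lambda>x. (F x - G M x)\<^sup>2)"
    by (rule Bochner_Integration.integrable_bound[OF int]) (use FG[of _ M] in \<open>auto simp: abs_le_square_iff[symmetric]\<close>)
  have i2: "integrable torus (\<lambda>x. (G M x - p n x)\<^sup>2)"
    by (rule bounded_integrable_torus[OF _ Gp]) measurable
  have le: "(F x - p n x)\<^sup>2 \<le> 2 * (F x - G M x)\<^sup>2 + 2 * (G M x - p n x)\<^sup>2" for x
    using sum_squares_bound[of "F x - G M x" "G M x - p n x"]
    by (simp add: power2_eq_square algebra_simps)
  have i3: "integrable torus (\<lambda>x. 2 * (F x - G M x)\<^sup>2 + 2 * (G M x - p n x)\<^sup>2)"
    using i1 i2 by simp
  have "(\<integral>x. (F x - p n x)\<^sup>2 \<partial>torus) \<le> (\<integral>x. 2 * (F x - G M x)\<^sup>2 + 2 * (G M x - p n x)\<^sup>2 \<partial>torus)"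
  proof (rule integral_mono[OF _ i3 le])
    show "integrable torus (\<lambda>x. (F x - p n x)\<^sup>2)"
      by (rule Bochner_Integration.integrable_bound[OF i3]) (use le in \<open>auto intro!: AE_I2\<close>)
  qed
  also have "\<dots> < e" using i1 i2 M n by simp
  finally show ?thesis using p(1) by blast
qed

lemma trig_poly_L2_approx:
  fixes f :: "real ^ 'n \<Rightarrow> 'b::euclidean_space"
  assumes f: "sq_integrable f" and "e > 0"
  shows "\<exists>p. trig_poly p \<and> (\<integral>x. (norm (f x - p x))\<^sup>2 \<partial>torus) < e"
proof -
  have [measurable]: "f \<in> borel_measurable torus"
    using f by (simp add: sq_integrable_def)
  have sq: "sq_integrable (\<lambda>x. f x \<bullet> b)" if b: "b \<in> Basis" for b
  proof -
    have "integrable torus (\<lambda>x. (norm (f x \<bullet> b))\<^sup>2)"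
    proof (rule Bochner_Integration.integrable_bound)
      show "integrable torus (\<lambda>x. (norm (f x))\<^sup>2)" using f by (simp add: sq_integrable_def)
      show "AE x in torus. norm ((norm (f x \<bullet> b))\<^sup>2) \<le> norm ((norm (f x))\<^sup>2)"
        using Basis_le_norm[OF b] by (auto simp: abs_le_square_iff[symmetric])
    qed measurable
    then show ?thesis by (simp add: sq_integrable_def)
  qed
  have "e / DIM('b) > 0" using \<open>e > 0\<close> by simp
  then have "\<exists>p. \<forall>b\<in>Basis. trig_poly (p b) \<and> (\<integral>x. (f x \<bullet> b - p b x)\<^sup>2 \<partial>torus) < e / DIM('b)"
    using trig_poly_L2_approx_real[OF sq] by (intro bchoice) blast
  then obtain p where p: "\<And>b. b \<in> Basis \<Longrightarrow> trig_poly (p b)"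
    "\<And>b. b \<in> Basis \<Longrightarrow> (\<integral>x. (f x \<bullet> b - p b x)\<^sup>2 \<partial>torus) < e / DIM('b)"
    by blast
  let ?P = "\<lambda>x. \<Sum>b\<in>Basis. p b x *\<^sub>R b"
  have "(norm (f x - ?P x))\<^sup>2 = (\<Sum>b\<in>Basis. (f x \<bullet> b - p b x)\<^sup>2)" for x
    unfolding norm_eq_sqrt_inner by (subst euclidean_inner)
      (simp add: inner_diff_left power2_eq_square sum_nonneg)
  moreover have "integrable torus (\<lambda>x. (f x \<bullet> b - p b x)\<^sup>2)" if "b \<in> Basis" for b
    using sq_integrable_diff[OF sq[OF that] continuous_sq_integrable[OF trig_poly_continuous[OF p(1)[OF that]]]]
    by (simp add: sq_integrable_def)
  ultimately have "(\<integral>x. (norm (f x - ?P x))\<^sup>2 \<partial>torus) = (\<Sum>b\<in>Basis. \<integral>x. (f x \<bullet> b - p b x)\<^sup>2 \<partial>torus)"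
    by simp
  also have "\<dots> < (\<Sum>b\<in>(Basis::'b set). e / DIM('b))"
    using p(2) by (intro sum_strict_mono) auto
  also have "\<dots> = e" by simp
  finally have "(\<integral>x. (norm (f x - ?P x))\<^sup>2 \<partial>torus) < e" .
  moreover have "trig_poly ?P"
    by (intro trig_poly_sum trig_poly_scaleR_const p)
  ultimately show ?thesis by blast
qed

text \<open>The frequencies of a polynomial close to \<open>f\<close> in L2 form a finite set, and
  on that set \<open>best_approximation\<close> compares the norm with the coefficient sum up to an
  arbitrarily small error.\<close>

lemma parseval_le:
  fixes f :: "real ^ 'n \<Rightarrow> 'b::euclidean_space"
  assumes f: "sq_integrable f" and c: "\<And>A. finite A \<Longrightarrow> (\<Sum>k\<in>A. (norm (hc k f))\<^sup>2) \<le> c"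
  shows "(\<integral>x. (norm (f x))\<^sup>2 \<partial>torus) \<le> c / (2 * pi) ^ CARD('n)"
proof (rule field_le_epsilon)
  fix e :: real assume "e > 0"
  then obtain p where p: "trig_poly p" "(\<integral>x. (norm (f x - p x))\<^sup>2 \<partial>torus) < e"
    using trig_poly_L2_approx[OF f] by blast
  then obtain A d where A: "finite A" "p = (\<lambda>x. \<Sum>k\<in>A. cas k x *\<^sub>R d k)"
    unfolding trig_poly_def by blast
  have "(\<integral>x. (norm (f x))\<^sup>2 \<partial>torus) \<le> 1 / (2 * pi) ^ CARD('n) * (\<Sum>k\<in>A. (norm (hc k f))\<^sup>2) + e"
    using best_approximation[OF f A(1), of d] p(2) A(2) by simp
  also have "\<dots> \<le> c / (2 * pi) ^ CARD('n) + e"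
    using c[OF A(1)] by (simp add: divide_right_mono)
  finally show "(\<integral>x. (norm (f x))\<^sup>2 \<partial>torus) \<le> c / (2 * pi) ^ CARD('n) + e" .
qed

section \<open>Absolutely convergent Hartley series\<close>

text \<open>Numbering the lattice turns sums over frequencies into series over \<open>nat\<close>,
  for which limits of partial sums and the abstract system of modes are formulated.\<close>

definition freq_enum :: "nat \<Rightarrow> int ^ 'n" where
  "freq_enum = from_nat_into UNIV"

lemma bij_freq_enum: "bij (freq_enum :: nat \<Rightarrow> int ^ 'n)"
proof -
  have "inj (\<lambda>m :: int. \<chi> i :: 'n. m)"
    by (auto simp: inj_def vec_eq_iff)
  then have "infinite (UNIV :: (int ^ 'n) set)"
    by (metis finite_imageD finite_subset infinite_UNIV_int top_greatest)
  then show ?thesis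
    unfolding freq_enum_def by (intro bij_betw_from_nat_into) auto
qed

lemma inj_freq_enum: "inj_on freq_enum A"
  using bij_freq_enum bij_is_inj inj_on_subset by blast

text \<open>The enumeration is a parameter because the derivative of a partial sum is a partial sum
  along the reflected enumeration.\<close>

definition partial_sum :: "(nat \<Rightarrow> int ^ 'n) \<Rightarrow> nat \<Rightarrow> (real ^ 'n \<Rightarrow> 'b::euclidean_space) \<Rightarrow> real ^ 'n \<Rightarrow> 'b" where
  "partial_sum e N f x = (\<Sum>n<N. cas (e n) x *\<^sub>R (hc (e n) f /\<^sub>R (2 * pi) ^ CARD('n)))"

lemma trig_poly_partial_sum: "trig_poly (partial_sum e N f)"
  unfolding partial_sum_def by (intro trig_poly_sum trig_poly_cas)

text \<open>The bound 2 for the Hartley functions is absorbed by the normalisation, since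
  \<open>(2 * pi) ^ CARD('n)\<close> is at least 2.\<close>

lemma norm_partial_sum_le:
  fixes e :: "nat \<Rightarrow> int ^ 'n" and f :: "real ^ 'n \<Rightarrow> 'b::euclidean_space"
  assumes "\<And>N. (\<Sum>n<N. norm (hc (e n) f)) \<le> c"
  shows "norm (partial_sum e N f x) \<le> c"
proof -
  have V: "(1::real) \<le> pi ^ CARD('n)"
    using pi_ge_two by (intro one_le_power) linarith
  have "norm (cas k x *\<^sub>R (h /\<^sub>R (2 * pi) ^ CARD('n))) \<le> norm h" for k and h :: 'b
  proof -
    have "(2::real) ^ 1 \<le> 2 ^ CARD('n)" by (rule power_increasing) auto
    then have "2 \<le> (2 * pi) ^ CARD('n)"
      using V mult_mono[of 2 "2 ^ CARD('n)" 1 "pi ^ CARD('n)"] by (simp add: power_mult_distrib)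
    then have "\<bar>cas k x\<bar> \<le> (2 * pi) ^ CARD('n)" using abs_cas_le[of k x] by linarith
    then have "\<bar>cas k x\<bar> * norm h \<le> (2 * pi) ^ CARD('n) * norm h"
      by (rule mult_right_mono) simp
    then show ?thesis by (simp add: field_simps)
  qed
  then have "norm (partial_sum e N f x) \<le> (\<Sum>n<N. norm (hc (e n) f))"
    unfolding partial_sum_def by (intro sum_norm_le) blast
  then show ?thesis using assms order_trans by blast
qed

lemma hc_partial_sum_limit:
  fixes e :: "nat \<Rightarrow> int ^ 'n" and f :: "real ^ 'n \<Rightarrow> 'b::euclidean_space"
  assumes e: "bij e"
  shows "(\<lambda>N. hc k (partial_sum e N f)) \<longlonglongrightarrow> hc k f"
proof -
  obtain m where m: "k = e m"
    using e by (metis bij_pointE)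
  have "hc k (partial_sum e N f) = hc k f" if "N > m" for N
  proof -
    have "partial_sum e N f = (\<lambda>x. \<Sum>l\<in>e ` {..<N}. cas l x *\<^sub>R (hc l f /\<^sub>R (2 * pi) ^ CARD('n)))"
      unfolding partial_sum_def by (simp add: sum.reindex[OF inj_on_subset[OF bij_is_inj[OF e] subset_UNIV]])
    then have "hc k (partial_sum e N f) = (2 * pi) ^ CARD('n) *\<^sub>R (hc k f /\<^sub>R (2 * pi) ^ CARD('n))"
      using that by (simp only: hc_trig_sum finite_imageI finite_lessThan m) auto
    moreover have "(2 * pi) ^ CARD('n) * inverse ((2 * pi) ^ CARD('n)) = 1"
      by (rule right_inverse) simp
    ultimately show ?thesis by (simp only: scaleR_scaleR scaleR_one)
  qed
  then have "eventually (\<lambda>N. hc k (partial_sum e N f) = hc k f) sequentially"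
    unfolding eventually_sequentially by (intro exI[of _ "Suc m"]) simp
  then show ?thesis by (rule tendsto_eventually)
qed

text \<open>Absolute summability gives a bounded pointwise limit \<open>S\<close>. By dominated
  convergence \<open>S\<close> has the same coefficients as \<open>f\<close>, and uniqueness of
  coefficients identifies the two.\<close>

lemma partial_sum_converges:
  fixes e :: "nat \<Rightarrow> int ^ 'n" and f :: "real ^ 'n \<Rightarrow> 'b::euclidean_space"
  assumes e: "bij e" and f: "integrable torus f" and c: "\<And>N. (\<Sum>n<N. norm (hc (e n) f)) \<le> c"
  shows "AE x in torus. (\<lambda>N. partial_sum e N f x) \<longlonglongrightarrow> f x"
proof -
  have sm: "summable (\<lambda>n. norm (hc (e n) f))"
    using c by (intro summableI_nonneg_bounded) auto
  have "summable (\<lambda>n. cas (e n) x *\<^sub>R (hc (e n) f /\<^sub>R (2 * pi) ^ CARD('n)))" for x :: "real ^ 'n"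
  proof (rule summable_comparison_test')
    show "summable (\<lambda>n. 2 / (2 * pi) ^ CARD('n) * norm (hc (e n) f))"
      by (intro summable_mult sm)
    show "norm (cas (e n) x *\<^sub>R (hc (e n) f /\<^sub>R (2 * pi) ^ CARD('n)))
        \<le> 2 / (2 * pi) ^ CARD('n) * norm (hc (e n) f)" for n
    proof -
      have "norm (cas (e n) x *\<^sub>R (hc (e n) f /\<^sub>R (2 * pi) ^ CARD('n)))
          = \<bar>cas (e n) x\<bar> * (norm (hc (e n) f) / (2 * pi) ^ CARD('n))"
        by (simp add: divide_inverse_commute abs_mult)
      also have "\<dots> \<le> 2 * (norm (hc (e n) f) / (2 * pi) ^ CARD('n))"
        by (intro mult_right_mono abs_cas_le) simp
      finally show ?thesis by simp
    qed
  qed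
  then have lim: "(\<lambda>N. partial_sum e N f x) \<longlonglongrightarrow> (\<Sum>n. cas (e n) x *\<^sub>R (hc (e n) f /\<^sub>R (2 * pi) ^ CARD('n)))" for x :: "real ^ 'n"
    unfolding partial_sum_def by (rule summable_LIMSEQ)
  define S where "S x = (\<Sum>n. cas (e n) x *\<^sub>R (hc (e n) f /\<^sub>R (2 * pi) ^ CARD('n)))" for x :: "real ^ 'n"
  note lim = lim[folded S_def]
  have pm [measurable]: "partial_sum e N f \<in> borel_measurable torus" for N
    using trig_poly_partial_sum trig_poly_continuous continuous_measurable_torus by blast
  have Sm [measurable]: "S \<in> borel_measurable torus"
    by (rule borel_measurable_LIMSEQ_metric[of "\<lambda>N. partial_sum e N f"]) (use lim pm in auto)
  have Sb: "norm (S x) \<le> c" for x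
    by (rule LIMSEQ_le_const2[OF tendsto_norm[OF lim]]) (use norm_partial_sum_le[OF c] in auto)
  have Si: "integrable torus S"
    by (rule bounded_integrable_torus[OF Sm Sb])
  have "hc k S = hc k f" for k
  proof -
    have [measurable]: "cas k \<in> borel_measurable torus"
      by (intro continuous_measurable_torus continuous_cas)
    have "(\<lambda>N. hc k (partial_sum e N f)) \<longlonglongrightarrow> hc k S"
      unfolding hc_def
    proof (rule integral_dominated_convergence)
      show "integrable torus (\<lambda>x :: real ^ 'n. 2 * c)" by simp
      show "AE x in torus. (\<lambda>N. cas k x *\<^sub>R partial_sum e N f x) \<longlonglongrightarrow> cas k x *\<^sub>R S x"
        by (intro AE_I2 tendsto_intros lim)
      show "AE x in torus. norm (cas k x *\<^sub>R partial_sum e N f x) \<le> 2 * c" for N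
        unfolding norm_scaleR by (intro AE_I2 mult_mono abs_cas_le norm_partial_sum_le[OF c]) auto
    qed measurable
    then show ?thesis
      using hc_partial_sum_limit[OF e] LIMSEQ_unique by blast
  qed
  then have "AE x in torus. S x = f x"
    by (intro hc_unique Si f)
  then show ?thesis
    by eventually_elim (use lim in metis)
qed

lemma AE_norm_le_of_series:
  fixes e :: "nat \<Rightarrow> int ^ 'n" and f :: "real ^ 'n \<Rightarrow> 'b::euclidean_space"
  assumes e: "bij e" and f: "integrable torus f" and c: "\<And>N. (\<Sum>n<N. norm (hc (e n) f)) \<le> c"
  shows "AE x in torus. norm (f x) \<le> c"
  using partial_sum_converges[OF assms]
  by eventually_elim (auto intro: LIMSEQ_le_const2[OF tendsto_norm] norm_partial_sum_le[OF c])

text \<open>The partial sums of \<open>f\<close> are bounded by \<open>c\<close> and converge almost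
  everywhere, so \<open>norm (g x) * c\<close> dominates the products and the limit may be taken
  under the integral.\<close>

lemma parseval_series:
  fixes e :: "nat \<Rightarrow> int ^ 'n" and f g :: "real ^ 'n \<Rightarrow> 'b::euclidean_space"
  assumes e: "bij e" and f: "integrable torus f" and c: "\<And>N. (\<Sum>n<N. norm (hc (e n) f)) \<le> c"
    and g: "integrable torus g"
  shows "(\<lambda>n. hc (e n) g \<bullet> hc (e n) f) sums ((2 * pi) ^ CARD('n) * (\<integral>x. g x \<bullet> f x \<partial>torus))"
proof -
  define V :: real where "V = (2 * pi) ^ CARD('n)"
  have V: "V > 0" by (simp add: V_def)
  have pm [measurable]: "partial_sum e N f \<in> borel_measurable torus" for N
    using trig_poly_partial_sum trig_poly_continuous continuous_measurable_torus by blast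
  have [measurable]: "f \<in> borel_measurable torus" "g \<in> borel_measurable torus" using f g by auto
  have "(\<lambda>N. \<integral>x. g x \<bullet> partial_sum e N f x \<partial>torus) \<longlonglongrightarrow> (\<integral>x. g x \<bullet> f x \<partial>torus)"
  proof (rule integral_dominated_convergence)
    show "integrable torus (\<lambda>x. norm (g x) * c)" using g by simp
    show "AE x in torus. (\<lambda>N. g x \<bullet> partial_sum e N f x) \<longlonglongrightarrow> g x \<bullet> f x"
      using partial_sum_converges[OF e f c] by eventually_elim (intro tendsto_intros)
    show "AE x in torus. norm (g x \<bullet> partial_sum e N f x) \<le> norm (g x) * c" for N
      using norm_partial_sum_le[OF c]
      by (intro AE_I2) (smt (verit) Cauchy_Schwarz_ineq2 mult_left_mono norm_ge_zero real_norm_def)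
  qed measurable
  moreover have "(\<integral>x. g x \<bullet> partial_sum e N f x \<partial>torus) = (\<Sum>n<N. hc (e n) g \<bullet> hc (e n) f) / V" for N
  proof -
    have "(\<integral>x. g x \<bullet> partial_sum e N f x \<partial>torus)
        = (\<integral>x. g x \<bullet> (\<Sum>l\<in>e ` {..<N}. cas l x *\<^sub>R (hc l f /\<^sub>R V)) \<partial>torus)"
      unfolding partial_sum_def V_def by (simp add: sum.reindex[OF inj_on_subset[OF bij_is_inj[OF e] subset_UNIV]])
    also have "\<dots> = (\<Sum>l\<in>e ` {..<N}. hc l g \<bullet> (hc l f /\<^sub>R V))"
      by (rule integral_inner_trig_sum[OF g])
    also have "\<dots> = (\<Sum>n<N. hc (e n) g \<bullet> hc (e n) f) / V"
      by (simp add: sum.reindex[OF inj_on_subset[OF bij_is_inj[OF e] subset_UNIV]] sum_distrib_left divide_inverse_commute)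
    finally show ?thesis .
  qed
  ultimately have "(\<lambda>N. V * ((\<Sum>n<N. hc (e n) g \<bullet> hc (e n) f) / V)) \<longlonglongrightarrow> V * (\<integral>x. g x \<bullet> f x \<partial>torus)"
    by (intro tendsto_intros) simp
  then show ?thesis
    using V unfolding sums_def V_def by simp
qed

section \<open>Weak derivatives and Sobolev norms on the Fourier side\<close>

lemma enn_powr_2: "enn_powr x 2 = x\<^sup>2"
proof (cases "x = \<infinity>")
  case False
  then obtain r where "x = ennreal r" "r \<ge> 0" by (cases x) auto
  then show ?thesis by (cases "r = 0") (auto simp: enn_powr_def ennreal_power)
qed (simp add: enn_powr_def power2_eq_square)

lemma enn_powr_half_sq: "(enn_powr x (1 / 2))\<^sup>2 = x"
proof (cases "x = \<infinity>")
  case False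
  then obtain r where "x = ennreal r" "r \<ge> 0" by (cases x) auto
  then show ?thesis by (simp add: enn_powr_def ennreal_power powr_half_sqrt)
qed (simp add: enn_powr_def power2_eq_square)

lemma torus_norm_2_sq: "(torus_norm 2 f)\<^sup>2 = (\<integral>\<^sup>+x. ennreal ((norm (f x))\<^sup>2) \<partial>torus)"
  by (simp add: torus_norm_def Lnorm_def enn_powr_2 enn_powr_half_sq ennreal_power)

lemma torus_norm_2_sq_eq:
  assumes "sq_integrable f"
  shows "(torus_norm 2 f)\<^sup>2 = ennreal (\<integral>x. (norm (f x))\<^sup>2 \<partial>torus)"
  unfolding torus_norm_2_sq
  by (rule nn_integral_eq_integral) (use assms in \<open>auto simp: sq_integrable_def\<close>)

lemma torus_L_2_iff: "f \<in> torus_L 2 \<longleftrightarrow> periodic f \<and> sq_integrable f"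
proof -
  have "torus_norm 2 f < \<infinity> \<longleftrightarrow> (torus_norm 2 f)\<^sup>2 < \<infinity>"
    by (cases "torus_norm 2 f") (auto simp: power2_eq_square ennreal_mult_less_top top_unique)
  also have "\<dots> \<longleftrightarrow> (\<integral>\<^sup>+x. ennreal ((norm (f x))\<^sup>2) \<partial>torus) < \<infinity>"
    by (simp add: torus_norm_2_sq)
  finally show ?thesis
    by (auto simp: torus_L_def sq_integrable_def integrable_iff_bounded)
qed

lemma torus_L_1_iff:
  fixes f :: "real ^ 'n \<Rightarrow> 'b::euclidean_space"
  shows "f \<in> torus_L 1 \<longleftrightarrow> periodic f \<and> integrable torus f"
proof -
  have "enn_powr (ennreal (norm (f x))) 1 = ennreal (norm (f x))" for x
    by (simp add: enn_powr_def)
  moreover have "enn_powr I 1 = I" for I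
    by (cases "I = \<infinity>") (auto simp: enn_powr_def less_top)
  ultimately have "torus_norm 1 f = (\<integral>\<^sup>+x. ennreal (norm (f x)) \<partial>torus)"
    by (simp add: torus_norm_def Lnorm_def)
  then show ?thesis
    by (auto simp: torus_L_def integrable_iff_bounded)
qed

text \<open>The Hartley function \<open>cas k\<close> is itself an admissible test function, so a
  weak derivative acts on coefficients as multiplication by the symbol, with a change of frequency
  from \<open>k\<close> to \<open>l\<close>.\<close>

lemma hc_weak_deriv:
  assumes "is_weak_deriv is f g" and p: "pderivs is (cas k) = (\<lambda>x. s * cas l x)"
  shows "hc k g = ((-1) ^ length is * s) *\<^sub>R hc l f"
proof -
  have "trig_poly (cas k)" using trig_poly_cas[of k "1::real"] by simp
  then have "smooth (cas k)" "periodic (cas k)"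
    using trig_poly_smooth periodic_cas by auto
  then have "(\<integral>x. pderivs is (cas k) x *\<^sub>R f x \<partial>torus) = (-1) ^ length is *\<^sub>R hc k g"
    using assms(1) unfolding is_weak_deriv_def hc_def by blast
  moreover have "(\<integral>x. pderivs is (cas k) x *\<^sub>R f x \<partial>torus) = s *\<^sub>R hc l f"
    by (simp add: p hc_def flip: scaleR_scaleR)
  ultimately have "(-1) ^ length is *\<^sub>R ((-1) ^ length is *\<^sub>R hc k g) = (-1) ^ length is *\<^sub>R (s *\<^sub>R hc l f)"
    by simp
  then show ?thesis
    by (simp add: power_mult_distrib[symmetric])
qed

lemma norm_hc_weak_deriv:
  assumes "is_weak_deriv is f g"
  shows "norm (hc k g) = \<bar>freq is k\<bar> * norm (hc (if even (length is) then k else - k) f)"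
proof -
  obtain s :: real where s: "\<bar>s\<bar> = 1"
    "pderivs is (cas k) = (\<lambda>x. s * freq is k * cas (if even (length is) then k else - k) x)"
    using pderivs_cas by blast
  have "hc k g = ((-1) ^ length is * (s * freq is k)) *\<^sub>R hc (if even (length is) then k else - k) f"
    by (rule hc_weak_deriv[OF assms s(2)])
  then show ?thesis using s(1) by (simp add: abs_mult power_abs)
qed

lemma hc_weak_deriv_1: "is_weak_deriv [i] f g \<Longrightarrow> hc k g = - real_of_int (k $ i) *\<^sub>R hc (- k) f"
  using hc_weak_deriv[of "[i]" f g k, OF _ pderivs_cas_1] by simp

lemma hc_weak_deriv_2: "is_weak_deriv [i, i] f g \<Longrightarrow> hc k g = - (real_of_int (k $ i))\<^sup>2 *\<^sub>R hc k f"
  using hc_weak_deriv[of "[i, i]" f g k, OF _ pderivs_cas_2] by simp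

lemma is_weak_deriv_unique:
  assumes "is_weak_deriv is f g" "is_weak_deriv is f h"
  shows "AE x in torus. g x = h x"
proof (rule hc_unique)
  show "integrable torus g" "integrable torus h"
    using assms by (auto simp: is_weak_deriv_def torus_L_1_iff)
  show "hc k g = hc k h" for k
  proof -
    obtain s :: real where s:
      "pderivs is (cas k) = (\<lambda>x. s * freq is k * cas (if even (length is) then k else - k) x)"
      using pderivs_cas by blast
    show ?thesis
      by (simp add: hc_weak_deriv[OF assms(1) s] hc_weak_deriv[OF assms(2) s])
  qed
qed

lemma sq_integrable_cong_AE:
  assumes "sq_integrable f" "AE x in torus. f x = g x" "g \<in> borel_measurable torus"
  shows "sq_integrable g"
proof -
  have "integrable torus (\<lambda>x. (norm (f x))\<^sup>2)" and [measurable]: "f \<in> borel_measurable torus"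
    using assms by (auto simp: sq_integrable_def)
  moreover have [measurable]: "g \<in> borel_measurable torus" by fact
  moreover have "integrable torus (\<lambda>x. (norm (f x))\<^sup>2) \<longleftrightarrow> integrable torus (\<lambda>x. (norm (g x))\<^sup>2)"
    by (rule integrable_cong_AE) (use assms(2) in auto)
  ultimately show ?thesis by (simp add: sq_integrable_def)
qed

text \<open>\<open>weak_deriv\<close> picks an arbitrary weak derivative, not the square integrable
  witness from \<open>sobolev\<close>. The two agree almost everywhere by uniqueness, which
  transfers square integrability.\<close>

lemma sobolev_weak_deriv:
  assumes "f \<in> sobolev m" "length is \<le> m"
  shows "is_weak_deriv is f (weak_deriv is f)" "sq_integrable (weak_deriv is f)"
    "integrable torus (weak_deriv is f)" "weak_deriv is f \<in> borel_measurable torus"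
proof -
  obtain g where g: "is_weak_deriv is f g" "g \<in> torus_L 2"
    using assms by (auto simp: sobolev_def)
  show w: "is_weak_deriv is f (weak_deriv is f)"
    unfolding weak_deriv_def by (rule someI[of _ g]) (rule g(1))
  then show i: "integrable torus (weak_deriv is f)"
    by (auto simp: is_weak_deriv_def torus_L_1_iff)
  then show m: "weak_deriv is f \<in> borel_measurable torus" by simp
  show "sq_integrable (weak_deriv is f)"
    by (rule sq_integrable_cong_AE[OF _ is_weak_deriv_unique[OF g(1) w] m]) (use g(2) torus_L_2_iff in auto)
qed

lemma sobolev_sq_integrable: "f \<in> sobolev m \<Longrightarrow> sq_integrable f"
  by (simp add: sobolev_def torus_L_2_iff)

lemma sobolev_mono: "m \<le> n \<Longrightarrow> sobolev n \<subseteq> sobolev m"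
  by (auto simp: sobolev_def)

lemma finite_index_lists: "finite {is :: 'n::finite list. length is \<le> m}"
  using finite_lists_length_le[of "UNIV :: 'n set" m] by simp

lemma sobolev_norm_sq:
  assumes "f \<in> sobolev m"
  shows "(sobolev_norm m f)\<^sup>2 = ennreal (\<Sum>is | length is \<le> m. \<integral>x. (norm (weak_deriv is f x))\<^sup>2 \<partial>torus)"
proof -
  let ?S = "\<Sum>is | length is \<le> m. \<integral>x. (norm (weak_deriv is f x))\<^sup>2 \<partial>torus"
  have "(\<Sum>is | length is \<le> m. (torus_norm 2 (weak_deriv is f))\<^sup>2)
      = (\<Sum>is | length is \<le> m. ennreal (\<integral>x. (norm (weak_deriv is f x))\<^sup>2 \<partial>torus))"
    by (intro sum.cong refl torus_norm_2_sq_eq sobolev_weak_deriv[OF assms]) simp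
  also have "\<dots> = ennreal ?S"
    by (rule sum_ennreal) simp
  finally show ?thesis
    by (simp add: sobolev_norm_def enn_powr_half_sq)
qed

text \<open>A weight for the Sobolev norm of order \<open>m\<close>. In this form it equals
  \<open>1 + \<mu>\<^sup>2\<close> for \<open>m = 2\<close> and \<open>1 + \<mu> ^ 4\<close> for
  \<open>m = 4\<close>, with \<open>\<mu>\<close> the eigenvalue of the negative Laplacian, which
  are the quantities of the energy estimates.\<close>

definition wt :: "nat \<Rightarrow> int ^ 'n \<Rightarrow> real" where
  "wt m k = 1 + norm (lat k) ^ (2 * m)"

lemma wt_ge_1: "wt m k \<ge> 1" and wt_pos: "wt m k > 0"
proof -
  show "wt m k \<ge> 1" by (simp add: wt_def)
  then show "wt m k > 0" by linarith
qed

lemma wt_uminus [simp]: "wt m (- k) = wt m k"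
  by (simp add: wt_def)

lemma norm_lat_sq: "(norm (lat k))\<^sup>2 = (\<Sum>i\<in>UNIV. (real_of_int (k $ i))\<^sup>2)"
  by (simp add: norm_vec_def L2_set_def sum_nonneg)

lemma abs_freq_le: "\<bar>freq is k\<bar> \<le> norm (lat k) ^ length is"
proof (induction "is")
  case (Cons i "is")
  have "\<bar>real_of_int (k $ i)\<bar> \<le> norm (lat k)"
    using component_le_norm_cart[of "lat k" i] by simp
  then have "\<bar>real_of_int (k $ i)\<bar> * \<bar>freq is k\<bar> \<le> norm (lat k) * norm (lat k) ^ length is"
    using Cons by (intro mult_mono) auto
  then show ?case by (simp add: freq_def abs_mult)
qed (simp add: freq_def)

lemma abs_freq_uminus [simp]: "\<bar>freq is (- k)\<bar> = \<bar>freq is k\<bar>"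
  by (induction "is") (auto simp: freq_def abs_mult)

lemma freq_uminus_sq [simp]: "(freq is (- k))\<^sup>2 = (freq is k)\<^sup>2"
  by (metis abs_freq_uminus power2_abs)

lemma freq_sq_le_wt:
  assumes "length is \<le> m"
  shows "(freq is k)\<^sup>2 \<le> wt m k"
proof -
  let ?r = "norm (lat k)"
  have "(freq is k)\<^sup>2 \<le> (?r ^ length is)\<^sup>2"
    using abs_freq_le[of "is" k] by (simp add: abs_le_square_iff[symmetric])
  also have "\<dots> = ?r ^ (2 * length is)" by (simp add: power_mult[symmetric] mult.commute)
  also have "\<dots> \<le> wt m k"
  proof (cases "?r \<le> 1")
    case True
    then have "?r ^ (2 * length is) \<le> 1" by (intro power_le_one) auto
    then show ?thesis using wt_ge_1[of m k] by linarith
  next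
    case False
    then have "?r ^ (2 * length is) \<le> ?r ^ (2 * m)"
      using assms by (intro power_increasing) auto
    then show ?thesis by (simp add: wt_def)
  qed
  finally show ?thesis .
qed

lemma sum_signed_freq:
  fixes A :: "(int ^ 'n) set"
  shows "(\<Sum>k\<in>A. F (if b then k else - k)) = (\<Sum>k\<in>(\<lambda>k. if b then k else - k) ` A. F k)"
  by (subst sum.reindex) (auto simp: inj_on_def)

text \<open>The squared symbol of every derivative of order at most \<open>m\<close> is below the
  weight, so each term of the norm is controlled by Parseval; the constant counts the index
  lists.\<close>

lemma sobolev_norm_le:
  fixes f :: "real ^ 'n \<Rightarrow> 'b::euclidean_space"
  assumes f: "f \<in> sobolev m"
    and c: "\<And>A. finite A \<Longrightarrow> (\<Sum>k\<in>A. wt m k * (norm (hc k f))\<^sup>2) \<le> c"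
  shows "(sobolev_norm m f)\<^sup>2
    \<le> ennreal (real (card {is :: 'n list. length is \<le> m}) * (c / (2 * pi) ^ CARD('n)))"
proof -
  have "(\<integral>x. (norm (weak_deriv is f x))\<^sup>2 \<partial>torus) \<le> c / (2 * pi) ^ CARD('n)" if "length is \<le> m" for "is"
  proof (rule parseval_le)
    show "sq_integrable (weak_deriv is f)" using sobolev_weak_deriv[OF f that] by blast
    fix A :: "(int ^ 'n) set" assume A: "finite A"
    let ?\<sigma> = "\<lambda>k :: int ^ 'n. if even (length is) then k else - k"
    have "(\<Sum>k\<in>A. (norm (hc k (weak_deriv is f)))\<^sup>2) \<le> (\<Sum>k\<in>A. wt m (?\<sigma> k) * (norm (hc (?\<sigma> k) f))\<^sup>2)"
    proof (rule sum_mono)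
      fix k
      have "(norm (hc k (weak_deriv is f)))\<^sup>2 = (freq is k)\<^sup>2 * (norm (hc (?\<sigma> k) f))\<^sup>2"
        by (simp add: norm_hc_weak_deriv[OF sobolev_weak_deriv(1)[OF f that]] power_mult_distrib)
      also have "\<dots> \<le> wt m k * (norm (hc (?\<sigma> k) f))\<^sup>2"
        by (intro mult_right_mono freq_sq_le_wt that) simp
      finally show "(norm (hc k (weak_deriv is f)))\<^sup>2 \<le> wt m (?\<sigma> k) * (norm (hc (?\<sigma> k) f))\<^sup>2"
        by (cases "even (length is)") simp_all
    qed
    also have "\<dots> = (\<Sum>k\<in>?\<sigma> ` A. wt m k * (norm (hc k f))\<^sup>2)"
      by (rule sum_signed_freq)
    also have "\<dots> \<le> c" using A by (intro c) simp
    finally show "(\<Sum>k\<in>A. (norm (hc k (weak_deriv is f)))\<^sup>2) \<le> c" .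
  qed
  then have "(\<Sum>is | length is \<le> m. \<integral>x. (norm (weak_deriv is f x))\<^sup>2 \<partial>torus)
      \<le> real (card {is :: 'n list. length is \<le> m}) * (c / (2 * pi) ^ CARD('n))"
    by (intro sum_bounded_above) auto
  then show ?thesis
    unfolding sobolev_norm_sq[OF f] by (rule ennreal_leI)
qed

text \<open>If \<open>j\<close> is the component of largest modulus, the squared length of
  \<open>k\<close> is at most \<open>CARD('n)\<close> times the square of that component, so one
  pure derivative already dominates the full power.\<close>

lemma norm_lat_power_le:
  fixes k :: "int ^ 'n"
  shows "norm (lat k) ^ (2 * m) \<le> real CARD('n) ^ m * (\<Sum>i\<in>UNIV. (freq (replicate m i) k)\<^sup>2)"
proof -
  obtain j where j: "\<And>i. \<bar>k $ i\<bar> \<le> \<bar>k $ j\<bar>"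
  proof -
    have "finite (range (\<lambda>i. \<bar>k $ i\<bar>))" "range (\<lambda>i. \<bar>k $ i\<bar>) \<noteq> {}" by auto
    then have "Max (range (\<lambda>i. \<bar>k $ i\<bar>)) \<in> range (\<lambda>i. \<bar>k $ i\<bar>)" by (rule Max_in)
    then obtain j where "Max (range (\<lambda>i. \<bar>k $ i\<bar>)) = \<bar>k $ j\<bar>" by (rule imageE)
    then show ?thesis
      by (intro that[of j]) (metis Max_ge finite_code finite_imageI rangeI)
  qed
  have "(real_of_int (k $ i))\<^sup>2 \<le> (real_of_int (k $ j))\<^sup>2" for i
    using j[of i] by (simp add: abs_le_square_iff[symmetric])
  then have "(norm (lat k))\<^sup>2 \<le> real CARD('n) * (real_of_int (k $ j))\<^sup>2"
    unfolding norm_lat_sq by (intro sum_bounded_above) auto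
  then have "((norm (lat k))\<^sup>2) ^ m \<le> (real CARD('n) * (real_of_int (k $ j))\<^sup>2) ^ m"
    by (rule power_mono) simp
  also have "\<dots> = real CARD('n) ^ m * (freq (replicate m j) k)\<^sup>2"
    by (simp add: freq_def power_mult_distrib power_mult[symmetric] mult.commute prod_list_replicate)
  also have "\<dots> \<le> real CARD('n) ^ m * (\<Sum>i\<in>UNIV. (freq (replicate m i) k)\<^sup>2)"
    by (intro mult_left_mono member_le_sum) auto
  finally show ?thesis by (simp add: power_mult)
qed

text \<open>The empty list and the pure derivatives \<open>replicate m i\<close> alone dominate the
  weight by \<open>norm_lat_power_le\<close>; each of them is estimated by Bessel's
  inequality.\<close>

lemma sobolev_norm_ge:
  fixes f :: "real ^ 'n \<Rightarrow> 'b::euclidean_space"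
  assumes f: "f \<in> sobolev m" and A: "finite A"
  shows "ennreal (\<Sum>k\<in>A. wt m k * (norm (hc k f))\<^sup>2)
    \<le> ennreal ((2 * pi) ^ CARD('n) * (1 + real CARD('n) ^ (m + 1))) * (sobolev_norm m f)\<^sup>2"
proof -
  define V :: real where "V = (2 * pi) ^ CARD('n)"
  have V: "V > 0" by (simp add: V_def)
  let ?I = "\<lambda>is. \<integral>x. (norm (weak_deriv is f x))\<^sup>2 \<partial>torus"
  let ?S = "\<Sum>is | length is \<le> m. ?I is"
  have IS: "?I is \<le> ?S" if "length is \<le> m" for "is"
    using that finite_index_lists by (intro member_le_sum) auto
  have *: "(\<Sum>k\<in>A. (freq is k)\<^sup>2 * (norm (hc k f))\<^sup>2) \<le> V * ?S" if l: "length is \<le> m" for "is"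
  proof -
    let ?\<sigma> = "\<lambda>k :: int ^ 'n. if even (length is) then k else - k"
    have "(freq is k)\<^sup>2 * (norm (hc k f))\<^sup>2 = (norm (hc (?\<sigma> k) (weak_deriv is f)))\<^sup>2" for k
    proof -
      have "\<bar>freq is (?\<sigma> k)\<bar>\<^sup>2 = \<bar>freq is k\<bar>\<^sup>2" by simp
      then show ?thesis
        unfolding norm_hc_weak_deriv[OF sobolev_weak_deriv(1)[OF f l]]
        by (auto simp: power_mult_distrib)
    qed
    then have "(\<Sum>k\<in>A. (freq is k)\<^sup>2 * (norm (hc k f))\<^sup>2) = (\<Sum>k\<in>?\<sigma> ` A. (norm (hc k (weak_deriv is f)))\<^sup>2)"
      by (simp only:) (rule sum_signed_freq[where F="\<lambda>k. (norm (hc k (weak_deriv is f)))\<^sup>2"])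
    also have "\<dots> \<le> V * ?I is"
      unfolding V_def using A by (intro bessel sobolev_weak_deriv(2)[OF f l]) simp
    also have "\<dots> \<le> V * ?S"
      using V IS[OF l] by (intro mult_left_mono) auto
    finally show ?thesis .
  qed
  have "(\<Sum>k\<in>A. wt m k * (norm (hc k f))\<^sup>2)
      \<le> (\<Sum>k\<in>A. (freq [] k)\<^sup>2 * (norm (hc k f))\<^sup>2
          + real CARD('n) ^ m * (\<Sum>i\<in>UNIV. (freq (replicate m i) k)\<^sup>2 * (norm (hc k f))\<^sup>2))"
  proof (rule sum_mono)
    fix k
    have "wt m k * (norm (hc k f))\<^sup>2
        \<le> ((freq [] k)\<^sup>2 + real CARD('n) ^ m * (\<Sum>i\<in>UNIV. (freq (replicate m i) k)\<^sup>2)) * (norm (hc k f))\<^sup>2"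
      using norm_lat_power_le[of k m] by (intro mult_right_mono) (auto simp: wt_def freq_def)
    then show "wt m k * (norm (hc k f))\<^sup>2
        \<le> (freq [] k)\<^sup>2 * (norm (hc k f))\<^sup>2
          + real CARD('n) ^ m * (\<Sum>i\<in>UNIV. (freq (replicate m i) k)\<^sup>2 * (norm (hc k f))\<^sup>2)"
      by (simp add: distrib_right sum_distrib_right mult.assoc)
  qed
  also have "\<dots> = (\<Sum>k\<in>A. (freq [] k)\<^sup>2 * (norm (hc k f))\<^sup>2)
      + real CARD('n) ^ m * (\<Sum>i\<in>UNIV. \<Sum>k\<in>A. (freq (replicate m i) k)\<^sup>2 * (norm (hc k f))\<^sup>2)"
    by (subst sum.swap) (simp add: sum.distrib sum_distrib_left)
  also have "\<dots> \<le> V * ?S + real CARD('n) ^ m * (\<Sum>i\<in>(UNIV::'n set). V * ?S)"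
    by (intro add_mono mult_left_mono sum_mono *) auto
  also have "\<dots> = V * (1 + real CARD('n) ^ (m + 1)) * ?S"
    by (simp add: algebra_simps)
  finally have "ennreal (\<Sum>k\<in>A. wt m k * (norm (hc k f))\<^sup>2) \<le> ennreal (V * (1 + real CARD('n) ^ (m + 1)) * ?S)"
    by (rule ennreal_leI)
  also have "\<dots> = ennreal (V * (1 + real CARD('n) ^ (m + 1))) * (sobolev_norm m f)\<^sup>2"
    unfolding sobolev_norm_sq[OF f] using V by (intro ennreal_mult sum_nonneg) auto
  finally show ?thesis by (simp add: V_def)
qed

lemma sobolev_wt_bounded:
  assumes "f \<in> sobolev m"
  shows "\<exists>c. \<forall>A. finite A \<longrightarrow> (\<Sum>k\<in>A. wt m k * (norm (hc k f))\<^sup>2) \<le> c"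
proof -
  obtain C r where *: "\<And>A. finite A \<Longrightarrow> ennreal (\<Sum>k\<in>A. wt m k * (norm (hc k f))\<^sup>2) \<le> ennreal C * ennreal r"
    using sobolev_norm_ge[OF assms] unfolding sobolev_norm_sq[OF assms] by blast
  have "(\<Sum>k\<in>A. wt m k * (norm (hc k f))\<^sup>2) \<le> enn2real (ennreal C * ennreal r)" if "finite A" for A
  proof -
    have "(\<Sum>k\<in>A. wt m k * (norm (hc k f))\<^sup>2) \<ge> 0"
      by (intro sum_nonneg mult_nonneg_nonneg) (auto intro: less_imp_le wt_pos)
    then show ?thesis
      using enn2real_mono[OF *[OF that]] by (simp add: ennreal_mult_less_top)
  qed
  then show ?thesis by blast
qed

section \<open>The nonlinear term in two dimensions\<close>

lemma sum_inverse_sq_int_bounded: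
  "\<exists>Z. \<forall>B :: int set. finite B \<longrightarrow> (\<Sum>m\<in>B. 1 / (1 + (real_of_int m)\<^sup>2)) \<le> Z"
proof -
  let ?f = "\<lambda>n::nat. 1 / (1 + (real n)\<^sup>2)"
  have s: "summable ?f"
  proof (rule summable_comparison_test_ev)
    show "summable (\<lambda>n. inverse (real n ^ 2))" by (rule inverse_power_summable) simp
    show "\<forall>\<^sub>F n in sequentially. norm (?f n) \<le> inverse (real n ^ 2)"
      using eventually_gt_at_top[of 0] by eventually_elim (simp add: divide_simps not_less)
  qed
  have b: "(\<Sum>m\<in>B. 1 / (1 + (real_of_int m)\<^sup>2)) \<le> suminf ?f"
    if "finite B" "inj_on (\<lambda>m. nat \<bar>m\<bar>) B" for B
  proof -
    have "(\<Sum>m\<in>B. 1 / (1 + (real_of_int m)\<^sup>2)) = (\<Sum>n\<in>(\<lambda>m. nat \<bar>m\<bar>) ` B. ?f n)"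
      by (subst sum.reindex[OF that(2)]) simp
    also have "\<dots> \<le> suminf ?f"
      by (rule sum_le_suminf[OF s]) (use that in auto)
    finally show ?thesis .
  qed
  have "(\<Sum>m\<in>B. 1 / (1 + (real_of_int m)\<^sup>2)) \<le> suminf ?f + suminf ?f" if B: "finite B" for B
  proof -
    have "(\<Sum>m\<in>B. 1 / (1 + (real_of_int m)\<^sup>2))
        = (\<Sum>m\<in>B \<inter> {0..}. 1 / (1 + (real_of_int m)\<^sup>2)) + (\<Sum>m\<in>B - {0..}. 1 / (1 + (real_of_int m)\<^sup>2))"
      using B by (rule sum.Int_Diff)
    also have "\<dots> \<le> suminf ?f + suminf ?f"
      using B by (intro add_mono b) (auto simp: inj_on_def)
    finally show ?thesis .
  qed
  then show ?thesis by blast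
qed

text \<open>This is where dimension two enters: \<open>wt 2 k\<close> is at least half the product
  of the factors \<open>1 + k_i^2\<close>, so the lattice sum is dominated by a product of two
  convergent one-dimensional sums. The summand 1 in the bound makes it strictly positive.\<close>

lemma sum_inverse_wt_bounded:
  "\<exists>Z>0. \<forall>A :: (int ^ 2) set. finite A \<longrightarrow> (\<Sum>k\<in>A. 1 / wt 2 k) \<le> Z"
proof -
  obtain Z where Z: "\<And>B :: int set. finite B \<Longrightarrow> (\<Sum>m\<in>B. 1 / (1 + (real_of_int m)\<^sup>2)) \<le> Z"
    using sum_inverse_sq_int_bounded by blast
  let ?h = "\<lambda>m. 1 / (1 + (real_of_int m)\<^sup>2)"
  have Z0: "Z \<ge> 0" using Z[of "{}"] by simp
  have "(\<Sum>k\<in>A. 1 / wt 2 k) \<le> 2 * Z * Z + 1" if A: "finite A" for A :: "(int ^ 2) set"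
  proof -
    let ?c = "\<lambda>k :: int ^ 2. (k $ 1, k $ 2)"
    have inj: "inj_on ?c A" by (auto simp: inj_on_def vec_eq_iff forall_2)
    have "1 / wt 2 k \<le> 2 * (?h (k $ 1) * ?h (k $ 2))" for k :: "int ^ 2"
    proof -
      define a b where "a = (real_of_int (k $ 1))\<^sup>2" and "b = (real_of_int (k $ 2))\<^sup>2"
      have ab: "a \<ge> 0" "b \<ge> 0" by (auto simp: a_def b_def)
      have "wt 2 k = 1 + (a + b)\<^sup>2"
        using norm_lat_sq[of k] by (simp add: wt_def a_def b_def sum_2 power2_eq_square[of "_ + _"] power4_eq_xxxx power2_eq_square[of "norm _"])
      moreover have "(1 + a) * (1 + b) \<le> 2 * (1 + (a + b)\<^sup>2)"
        using ab zero_le_power2[of "a + b - 1"] mult_nonneg_nonneg[OF ab] zero_le_square[of a] zero_le_square[of b]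
        unfolding power2_eq_square by (simp only: algebra_simps)
      moreover have "(1 + a) * (1 + b) > 0" using ab by (intro mult_pos_pos) auto
      ultimately have "1 / wt 2 k \<le> 2 / ((1 + a) * (1 + b))"
        by (simp add: field_simps)
      then show ?thesis by (simp add: a_def b_def)
    qed
    then have "(\<Sum>k\<in>A. 1 / wt 2 k) \<le> (\<Sum>k\<in>A. 2 * (?h (k $ 1) * ?h (k $ 2)))"
      by (rule sum_mono)
    also have "\<dots> = 2 * (\<Sum>p\<in>?c ` A. ?h (fst p) * ?h (snd p))"
      by (simp add: sum.reindex[OF inj] sum_distrib_left)
    also have "\<dots> \<le> 2 * (\<Sum>p\<in>(fst ` ?c ` A) \<times> (snd ` ?c ` A). ?h (fst p) * ?h (snd p))"
      using A by (intro mult_left_mono sum_mono2) (auto simp: image_iff)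
    also have "\<dots> = 2 * ((\<Sum>m\<in>fst ` ?c ` A. ?h m) * (\<Sum>m\<in>snd ` ?c ` A. ?h m))"
      by (simp add: sum_product sum.cartesian_product case_prod_beta)
    also have "\<dots> \<le> 2 * (Z * Z)"
      using A Z0 by (intro mult_left_mono mult_mono Z sum_nonneg) auto
    finally show ?thesis by simp
  qed
  moreover have "2 * Z * Z + 1 > 0" using Z0 by (simp add: add_nonneg_pos)
  ultimately show ?thesis by blast
qed

definition embed_const :: real where
  "embed_const = (SOME Z. Z > 0 \<and> (\<forall>A :: (int ^ 2) set. finite A \<longrightarrow> (\<Sum>k\<in>A. 1 / wt 2 k) \<le> Z))"

lemma embed_const: "embed_const > 0" "finite A \<Longrightarrow> (\<Sum>k\<in>(A :: (int ^ 2) set). 1 / wt 2 k) \<le> embed_const"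
proof -
  have "embed_const > 0 \<and> (\<forall>A :: (int ^ 2) set. finite A \<longrightarrow> (\<Sum>k\<in>A. 1 / wt 2 k) \<le> embed_const)"
    unfolding embed_const_def by (rule someI_ex) (use sum_inverse_wt_bounded in blast)
  then show "embed_const > 0" "finite A \<Longrightarrow> (\<Sum>k\<in>(A :: (int ^ 2) set). 1 / wt 2 k) \<le> embed_const"
    by auto
qed

text \<open>Cauchy-Schwarz with the factors \<open>1 / sqrt (wt 2 k)\<close> and
  \<open>sqrt (wt 2 k) * a k\<close>. Functions in H^2 thus have absolutely convergent Hartley
  series, which is the embedding into bounded functions.\<close>

lemma sum_le_sqrt_wt:
  fixes A :: "(int ^ 2) set"
  assumes A: "finite A" and c: "(\<Sum>k\<in>A. wt 2 k * (a k)\<^sup>2) \<le> c"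
  shows "(\<Sum>k\<in>A. a k) \<le> sqrt (embed_const * c)"
proof -
  have "(\<Sum>k\<in>A. a k)\<^sup>2 = (\<Sum>k\<in>A. (1 / sqrt (wt 2 k)) * (sqrt (wt 2 k) * a k))\<^sup>2"
    by (intro arg_cong[of _ _ "\<lambda>x. x\<^sup>2"] sum.cong) (simp_all add: less_imp_neq[OF wt_pos, symmetric])
  also have "\<dots> \<le> (\<Sum>k\<in>A. (1 / sqrt (wt 2 k))\<^sup>2) * (\<Sum>k\<in>A. (sqrt (wt 2 k) * a k)\<^sup>2)"
    by (rule Cauchy_Schwarz_ineq_sum)
  also have "\<dots> = (\<Sum>k\<in>A. 1 / wt 2 k) * (\<Sum>k\<in>A. wt 2 k * (a k)\<^sup>2)"
    by (simp add: power_divide power_mult_distrib less_imp_le[OF wt_pos])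
  also have "\<dots> \<le> embed_const * c"
    using embed_const A c by (intro mult_mono sum_nonneg mult_nonneg_nonneg) (auto intro: less_imp_le wt_pos)
  finally show ?thesis by (rule real_le_rsqrt)
qed

lemma partial_sums_le_sqrt_wt:
  fixes e :: "nat \<Rightarrow> int ^ 2" and f :: "real ^ 2 \<Rightarrow> 'b::euclidean_space"
  assumes "bij e" and c: "\<And>A. finite A \<Longrightarrow> (\<Sum>k\<in>A. wt 2 k * (norm (hc k f))\<^sup>2) \<le> c"
  shows "(\<Sum>n<N. norm (hc (e n) f)) \<le> sqrt (embed_const * c)"
proof -
  have "inj_on e {..<N}" using assms(1) bij_is_inj inj_on_subset by blast
  then have "(\<Sum>n<N. norm (hc (e n) f)) = (\<Sum>k\<in>e ` {..<N}. norm (hc k f))"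
    by (simp add: sum.reindex)
  also have "\<dots> \<le> sqrt (embed_const * c)"
    by (intro sum_le_sqrt_wt c) auto
  finally show ?thesis .
qed

lemma AE_norm_le_wt:
  fixes f :: "real ^ 2 \<Rightarrow> 'b::euclidean_space"
  assumes "integrable torus f" and c: "\<And>A. finite A \<Longrightarrow> (\<Sum>k\<in>A. wt 2 k * (norm (hc k f))\<^sup>2) \<le> c"
  shows "AE x in torus. norm (f x) \<le> sqrt (embed_const * c)"
  by (rule AE_norm_le_of_series[OF bij_freq_enum assms(1) partial_sums_le_sqrt_wt[OF bij_freq_enum c]])

text \<open>The supremum of \<open>f\<close> is estimated by the H^2 embedding, with square at most
  \<open>embed_const * c\<close>, and the gradient in L2 by Parseval. The factor 4 combines the
  square of a sum of two terms with the two partial derivatives.\<close>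

lemma advection_estimate:
  fixes f :: "real ^ 2 \<Rightarrow> real ^ 2"
  assumes f: "f \<in> sobolev 2" and c: "\<And>A. finite A \<Longrightarrow> (\<Sum>k\<in>A. wt 2 k * (norm (hc k f))\<^sup>2) \<le> c"
  shows "sq_integrable (advection f)"
    and "finite A \<Longrightarrow> (\<Sum>k\<in>A. (norm (hc k (advection f)))\<^sup>2) \<le> 4 * embed_const * c\<^sup>2"
proof -
  let ?D = "\<lambda>i. weak_deriv [i] f"
  have c0: "c \<ge> 0" using c[of "{}"] by simp
  have D: "is_weak_deriv [i] f (?D i)" "sq_integrable (?D i)" "?D i \<in> borel_measurable torus" for i
    using sobolev_weak_deriv[OF f, of "[i]"] by auto
  have fi: "integrable torus f"
    using sobolev_sq_integrable[OF f] sq_integrable_imp_integrable by blast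
  then have [measurable]: "f \<in> borel_measurable torus" by simp
  note [measurable] = D(3)
  have fm [measurable]: "(\<lambda>x. f x $ i) \<in> borel_measurable torus" for i
  proof -
    have "(\<lambda>x. f x \<bullet> axis i 1) \<in> borel_measurable torus" by measurable
    then show ?thesis by (simp add: inner_axis)
  qed
  have am: "advection f \<in> borel_measurable torus"
    unfolding advection_def by measurable
  let ?K = "embed_const * c"
  have K0: "?K \<ge> 0" using c0 embed_const by simp
  have le: "AE x in torus. (norm (advection f x))\<^sup>2 \<le> 2 * ?K * (\<Sum>i\<in>UNIV. (norm (?D i x))\<^sup>2)"
  proof -
    have "AE x in torus. norm (f x) \<le> sqrt ?K" by (rule AE_norm_le_wt[OF fi c])
    then show ?thesis
    proof eventually_elim
    case (elim x)
    have "norm (advection f x) \<le> (\<Sum>i\<in>UNIV. sqrt ?K * norm (?D i x))"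
      unfolding advection_def
    proof (rule sum_norm_le)
      fix i :: 2
      have "\<bar>f x $ i\<bar> \<le> sqrt ?K" using component_le_norm_cart[of "f x" i] elim by linarith
      then show "norm (f x $ i *\<^sub>R ?D i x) \<le> sqrt ?K * norm (?D i x)"
        by (simp add: mult_right_mono)
    qed
    then have "norm (advection f x) \<le> sqrt ?K * (norm (?D 1 x) + norm (?D 2 x))"
      by (simp add: sum_2 distrib_left)
    then have "(norm (advection f x))\<^sup>2 \<le> (sqrt ?K * (norm (?D 1 x) + norm (?D 2 x)))\<^sup>2"
      by (rule power_mono) simp
    also have "\<dots> = ?K * (norm (?D 1 x) + norm (?D 2 x))\<^sup>2"
      using K0 by (simp add: power_mult_distrib)
    also have "\<dots> \<le> ?K * (2 * ((norm (?D 1 x))\<^sup>2 + (norm (?D 2 x))\<^sup>2))"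
      using K0 sum_squares_bound[of "norm (?D 1 x)" "norm (?D 2 x)"]
      by (intro mult_left_mono) (auto simp: power2_sum)
    finally show ?case by (simp add: sum_2 algebra_simps)
  qed
  qed
  have int: "integrable torus (\<lambda>x. 2 * ?K * (\<Sum>i\<in>UNIV. (norm (?D i x))\<^sup>2))"
    using D(2) by (auto simp: sq_integrable_def)
  have ai: "integrable torus (\<lambda>x. (norm (advection f x))\<^sup>2)"
    by (rule Bochner_Integration.integrable_bound[OF int])
      (use am le in \<open>auto elim: eventually_mono\<close>)
  show sq: "sq_integrable (advection f)"
    using am ai by (simp add: sq_integrable_def)
  have DI: "(\<integral>x. (norm (?D i x))\<^sup>2 \<partial>torus) \<le> c / (2 * pi) ^ CARD(2)" for i
  proof (rule parseval_le[OF D(2)])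
    fix A :: "(int ^ 2) set" assume A: "finite A"
    have "(\<Sum>k\<in>A. (norm (hc k (?D i)))\<^sup>2) \<le> (\<Sum>k\<in>A. wt 2 (- k) * (norm (hc (- k) f))\<^sup>2)"
    proof (rule sum_mono)
      fix k
      have "(norm (hc k (?D i)))\<^sup>2 = (freq [i] k)\<^sup>2 * (norm (hc (- k) f))\<^sup>2"
        by (simp add: norm_hc_weak_deriv[OF D(1)] power_mult_distrib)
      also have "\<dots> \<le> wt 2 k * (norm (hc (- k) f))\<^sup>2"
        by (intro mult_right_mono freq_sq_le_wt) auto
      finally show "(norm (hc k (?D i)))\<^sup>2 \<le> wt 2 (- k) * (norm (hc (- k) f))\<^sup>2" by simp
    qed
    also have "\<dots> = (\<Sum>k\<in>uminus ` A. wt 2 k * (norm (hc k f))\<^sup>2)"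
      by (subst sum.reindex) (auto simp: inj_on_def)
    also have "\<dots> \<le> c" using A by (intro c) simp
    finally show "(\<Sum>k\<in>A. (norm (hc k (?D i)))\<^sup>2) \<le> c" .
  qed
  show "(\<Sum>k\<in>A. (norm (hc k (advection f)))\<^sup>2) \<le> 4 * embed_const * c\<^sup>2" if "finite A"
  proof -
    have "(\<Sum>k\<in>A. (norm (hc k (advection f)))\<^sup>2) \<le> (2 * pi) ^ CARD(2) * (\<integral>x. (norm (advection f x))\<^sup>2 \<partial>torus)"
      by (rule bessel[OF sq that])
    also have "\<dots> \<le> (2 * pi) ^ CARD(2) * (\<integral>x. 2 * ?K * (\<Sum>i\<in>UNIV. (norm (?D i x))\<^sup>2) \<partial>torus)"
      by (intro mult_left_mono integral_mono_AE ai int le) simp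
    also have "(\<integral>x. 2 * ?K * (\<Sum>i\<in>UNIV. (norm (?D i x))\<^sup>2) \<partial>torus) = 2 * ?K * (\<Sum>i\<in>UNIV. \<integral>x. (norm (?D i x))\<^sup>2 \<partial>torus)"
      using D(2) by (simp add: sq_integrable_def)
    also have "(2 * pi) ^ CARD(2) * \<dots> \<le> (2 * pi) ^ CARD(2) * (2 * ?K * (\<Sum>i\<in>(UNIV::2 set). c / (2 * pi) ^ CARD(2)))"
      using K0 by (intro mult_left_mono sum_mono DI) auto
    also have "\<dots> = 4 * embed_const * c\<^sup>2"
      by (simp add: power2_eq_square)
    finally show ?thesis .
  qed
qed

section \<open>Integration by parts in the advection term\<close>

lemma integral_trig_poly_derivative:
  fixes g :: "real ^ 'n \<Rightarrow> real"
  assumes "trig_poly g"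
  shows "(\<integral>x. frechet_derivative g (at x) v \<partial>torus) = 0"
proof -
  obtain A c where *: "finite A" "g = (\<lambda>x. \<Sum>k\<in>A. cas k x *\<^sub>R c k)"
    using assms unfolding trig_poly_def by blast
  have "(\<integral>x. frechet_derivative g (at x) v \<partial>torus) = (\<integral>x. (\<Sum>k\<in>A. cas (- k) x * ((lat k \<bullet> v) * c k)) \<partial>torus)"
    by (simp add: frechet_derivative_at[OF trig_poly_has_derivative[OF *(2)], symmetric] mult_ac)
  also have "\<dots> = (\<Sum>k\<in>A. (\<integral>x. cas (- k) x \<partial>torus) * ((lat k \<bullet> v) * c k))"
    by simp
  also have "\<dots> = 0"
    by (intro sum.neutral) (auto simp: integral_cas)
  finally show ?thesis .
qed

lemma trig_poly_component:
  fixes U :: "real ^ 'n \<Rightarrow> real ^ 'm"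
  assumes "trig_poly U" shows "trig_poly (\<lambda>x. U x $ i)"
  by (rule trig_poly_linear[OF assms]) (simp add: linear_iff)

lemma trig_poly_inner_self:
  fixes U :: "real ^ 'n \<Rightarrow> real ^ 'm"
  assumes "trig_poly U" shows "trig_poly (\<lambda>x. U x \<bullet> U x)"
  unfolding inner_vec_def
  using trig_poly_component[OF assms] by (intro trig_poly_sum) (auto intro: trig_poly_mult)

text \<open>The integrand is the divergence of the field \<open>U x\<close> times
  \<open>U x \<bullet> U x\<close>, and derivatives of trigonometric polynomials have no zero
  mode.\<close>

lemma trig_poly_trilinear:
  fixes U :: "real ^ 'n \<Rightarrow> real ^ 'n"
  assumes U: "trig_poly U" and W: "\<And>i x. W i x = frechet_derivative U (at x) (axis i 1)"
  shows "(\<integral>x. (\<Sum>i\<in>UNIV. 2 * (U x $ i) * (W i x \<bullet> U x) + W i x $ i * (U x \<bullet> U x)) \<partial>torus) = 0"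
proof -
  have t: "trig_poly (\<lambda>x. U x $ i * (U x \<bullet> U x))" for i
    by (intro trig_poly_mult trig_poly_component trig_poly_inner_self U)
  have d: "frechet_derivative (\<lambda>x. U x $ i * (U x \<bullet> U x)) (at x) (axis i 1)
      = 2 * (U x $ i) * (W i x \<bullet> U x) + W i x $ i * (U x \<bullet> U x)" for i x
  proof -
    have "(U has_derivative frechet_derivative U (at x)) (at x)"
      using trig_poly_derivative(1)[OF U] frechet_derivative_works by blast
    then have "((\<lambda>x. U x $ i * (U x \<bullet> U x)) has_derivative (\<lambda>h. U x $ i * (U x \<bullet> frechet_derivative U (at x) h
        + frechet_derivative U (at x) h \<bullet> U x) + frechet_derivative U (at x) h $ i * (U x \<bullet> U x))) (at x)"
      by (intro has_derivative_mult has_derivative_inner bounded_linear.has_derivative[OF bounded_linear_vec_nth])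
    from frechet_derivative_at[OF this, symmetric] show ?thesis
      by (simp add: W inner_commute)
  qed
  have "integrable torus (\<lambda>x. frechet_derivative (\<lambda>x. U x $ i * (U x \<bullet> U x)) (at x) (axis i 1))" for i
    by (intro continuous_integrable_torus trig_poly_continuous trig_poly_derivative(2) t)
  then have "(\<integral>x. (\<Sum>i\<in>UNIV. 2 * (U x $ i) * (W i x \<bullet> U x) + W i x $ i * (U x \<bullet> U x)) \<partial>torus)
      = (\<Sum>i\<in>UNIV. \<integral>x. frechet_derivative (\<lambda>x. U x $ i * (U x \<bullet> U x)) (at x) (axis i 1) \<partial>torus)"
    by (simp add: d)
  also have "\<dots> = 0"
    by (simp add: integral_trig_poly_derivative[OF t])
  finally show ?thesis .
qed

text \<open>Truncation commutes with differentiation provided the reflected enumeration is used for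
  the derivative; no error term appears when the identity for polynomials is passed to the
  limit.\<close>

lemma frechet_partial_sum:
  fixes f :: "real ^ 'n \<Rightarrow> 'b::euclidean_space"
  assumes "is_weak_deriv [i] f g"
  shows "frechet_derivative (partial_sum e N f) (at x) (axis i 1) = partial_sum (\<lambda>n. - e n) N g x"
proof -
  let ?V = "(2 * pi) ^ CARD('n)"
  have "(partial_sum e N f has_derivative (\<lambda>v. \<Sum>n<N. ((lat (e n) \<bullet> v) * cas (- e n) x) *\<^sub>R (hc (e n) f /\<^sub>R ?V))) (at x)"
    unfolding partial_sum_def by (intro has_derivative_sum has_derivative_scaleR_left cas_has_derivative)
  from frechet_derivative_at[OF this, symmetric] show ?thesis
    unfolding partial_sum_def
    by (auto intro!: sum.cong simp: hc_weak_deriv_1[OF assms] mult_ac)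
qed

text \<open>With this comparison the first derivatives of an H^4 function satisfy the H^2 bound, so
  they too have absolutely convergent series.\<close>

lemma wt_2_freq_le_wt_4: "wt 2 k * (freq [i] k)\<^sup>2 \<le> 2 * wt 4 k"
proof -
  define s where "s = (norm (lat k))\<^sup>2"
  have s: "s \<ge> 0" by (simp add: s_def)
  have "\<bar>freq [i] k\<bar>\<^sup>2 \<le> (norm (lat k))\<^sup>2"
    using abs_freq_le[of "[i]" k] by (intro power_mono) auto
  then have "(freq [i] k)\<^sup>2 \<le> s"
    by (simp add: s_def)
  moreover have w: "wt 2 k = 1 + s ^ 2" "wt 4 k = 1 + s ^ 4"
    by (simp_all add: wt_def s_def flip: power_mult)
  ultimately have "wt 2 k * (freq [i] k)\<^sup>2 \<le> (1 + s ^ 2) * s"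
    by (simp add: mult_left_mono)
  also have "\<dots> \<le> 2 * (1 + s ^ 4)"
  proof (cases "s \<le> 1")
    case True
    then have "s ^ 2 \<le> 1" using s by (simp add: power_le_one)
    then have "(1 + s ^ 2) * s \<le> (1 + 1) * 1" using s True by (intro mult_mono) auto
    also have "(1 + 1) * 1 \<le> 2 * (1 + s ^ 4)" using s by simp
    finally show ?thesis .
  next
    case False
    then have "s ^ 1 \<le> s ^ 4" "s ^ 3 \<le> s ^ 4" by (intro power_increasing; simp)+
    then show ?thesis by (simp add: algebra_simps power3_eq_cube power2_eq_square)
  qed
  finally show ?thesis using w by simp
qed

text \<open>The identity holds exactly for the partial sums. Since \<open>f\<close> lies in H^4,
  both \<open>f\<close> and its first derivatives have absolutely convergent series, so the partial
  sums stay bounded by constants \<open>K\<close> and \<open>L\<close> and dominated convergence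
  applies.\<close>

lemma integral_advection_inner:
  fixes f :: "real ^ 2 \<Rightarrow> real ^ 2"
  assumes f: "f \<in> sobolev 4"
  shows "2 * (\<integral>x. advection f x \<bullet> f x \<partial>torus) + (\<integral>x. weak_divergence f x * (f x \<bullet> f x) \<partial>torus) = 0"
    and "integrable torus (\<lambda>x. weak_divergence f x * (f x \<bullet> f x))"
proof -
  let ?D = "\<lambda>i. weak_deriv [i] f"
  have D: "is_weak_deriv [i] f (?D i)" "integrable torus (?D i)" for i
    using sobolev_weak_deriv[OF f, of "[i]"] by auto
  have fi: "integrable torus f"
    using sobolev_sq_integrable[OF f] sq_integrable_imp_integrable by blast
  have f2: "f \<in> sobolev 2" using f sobolev_mono[of 2 4] by auto
  obtain c2 where c2: "\<And>A. finite A \<Longrightarrow> (\<Sum>k\<in>A. wt 2 k * (norm (hc k f))\<^sup>2) \<le> c2"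
    using sobolev_wt_bounded[OF f2] by blast
  obtain c4 where c4: "\<And>A. finite A \<Longrightarrow> (\<Sum>k\<in>A. wt 4 k * (norm (hc k f))\<^sup>2) \<le> c4"
    using sobolev_wt_bounded[OF f] by blast
  have cD: "(\<Sum>k\<in>A. wt 2 k * (norm (hc k (?D i)))\<^sup>2) \<le> 2 * c4" if A: "finite A" for A i
  proof -
    have "(\<Sum>k\<in>A. wt 2 k * (norm (hc k (?D i)))\<^sup>2) \<le> (\<Sum>k\<in>A. 2 * (wt 4 (- k) * (norm (hc (- k) f))\<^sup>2))"
    proof (rule sum_mono)
      fix k
      have "wt 2 k * (norm (hc k (?D i)))\<^sup>2 = (wt 2 k * (freq [i] k)\<^sup>2) * (norm (hc (- k) f))\<^sup>2"
        by (simp add: norm_hc_weak_deriv[OF D(1)] power_mult_distrib)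
      also have "\<dots> \<le> (2 * wt 4 k) * (norm (hc (- k) f))\<^sup>2"
        by (intro mult_right_mono wt_2_freq_le_wt_4) auto
      finally show "wt 2 k * (norm (hc k (?D i)))\<^sup>2 \<le> 2 * (wt 4 (- k) * (norm (hc (- k) f))\<^sup>2)" by simp
    qed
    also have "\<dots> = 2 * (\<Sum>k\<in>uminus ` A. wt 4 k * (norm (hc k f))\<^sup>2)"
      by (subst sum.reindex) (auto simp: inj_on_def sum_distrib_left)
    also have "\<dots> \<le> 2 * c4" using A c4[of "uminus ` A"] by simp
    finally show ?thesis .
  qed
  define e e' where "e = (freq_enum :: nat \<Rightarrow> int ^ 2)" and "e' = (\<lambda>n. - e n)"
  have e: "bij e" unfolding e_def by (rule bij_freq_enum)
  have e': "bij e'"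
  proof -
    have "bij (uminus \<circ> e)" by (rule bij_comp[OF e]) (rule bij_uminus)
    then show ?thesis by (simp add: e'_def comp_def)
  qed
  define K L where "K = sqrt (embed_const * c2)" and "L = sqrt (embed_const * (2 * c4))"
  define U W where "U N = partial_sum e N f" and "W N i = partial_sum e' N (?D i)" for N i
  have KL: "K \<ge> 0" "L \<ge> 0"
  proof -
    have "c2 \<ge> 0" "c4 \<ge> 0" using c2[of "{}"] c4[of "{}"] by auto
    then show "K \<ge> 0" "L \<ge> 0" using embed_const(1) by (auto simp: K_def L_def)
  qed
  have sK: "(\<Sum>n<N. norm (hc (e n) f)) \<le> K" for N
    unfolding K_def by (rule partial_sums_le_sqrt_wt[OF e c2])
  have sL: "(\<Sum>n<N. norm (hc (e' n) (?D i))) \<le> L" for N i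
    unfolding L_def by (rule partial_sums_le_sqrt_wt[OF e' cD])
  have UK: "norm (U N x) \<le> K" for N x unfolding U_def by (rule norm_partial_sum_le[OF sK])
  have WL: "norm (W N i x) \<le> L" for N i x unfolding W_def by (rule norm_partial_sum_le[OF sL])
  have Ulim: "AE x in torus. (\<lambda>N. U N x) \<longlonglongrightarrow> f x"
    unfolding U_def by (rule partial_sum_converges[OF e fi sK])
  have Wlim: "AE x in torus. \<forall>i\<in>UNIV. (\<lambda>N. W N i x) \<longlonglongrightarrow> ?D i x"
    unfolding W_def by (intro AE_finite_allI partial_sum_converges[OF e' D(2) sL]) auto
  \<comment> \<open>The integrand of \<open>trig_poly_trilinear\<close> as a function of the value
    \<open>u\<close> and the partial derivatives \<open>w\<close>. It is continuous in both and
    bounded on the relevant balls, which is all the limit requires.\<close>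
  let ?q = "\<lambda>u w. \<Sum>i\<in>(UNIV :: 2 set). 2 * (u $ i) * (w i \<bullet> u) + w i $ i * (u \<bullet> (u :: real ^ 2))"
  have qb: "norm (?q u w) \<le> 2 * (2 * K * (L * K) + L * (K * K))"
    if "norm u \<le> K" "\<And>i. norm (w i) \<le> L" for u w
  proof -
    have "norm (?q u w) \<le> (\<Sum>i\<in>(UNIV :: 2 set). 2 * K * (L * K) + L * (K * K))"
    proof (rule sum_norm_le)
      fix i :: 2
      have a: "\<bar>u $ i\<bar> \<le> K" "\<bar>w i $ i\<bar> \<le> L"
        using component_le_norm_cart[of u i] component_le_norm_cart[of "w i" i] that order_trans by blast+
      have b: "\<bar>w i \<bullet> u\<bar> \<le> L * K" "\<bar>u \<bullet> u\<bar> \<le> K * K"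
        using Cauchy_Schwarz_ineq2[of "w i" u] Cauchy_Schwarz_ineq2[of u u] that KL
          mult_mono[of "norm (w i)" L "norm u" K] mult_mono[of "norm u" K "norm u" K] by fastforce+
      have "\<bar>2 * (u $ i) * (w i \<bullet> u) + w i $ i * (u \<bullet> u)\<bar> \<le> 2 * \<bar>u $ i\<bar> * \<bar>w i \<bullet> u\<bar> + \<bar>w i $ i\<bar> * \<bar>u \<bullet> u\<bar>"
        by (rule order_trans[OF abs_triangle_ineq]) (simp add: abs_mult)
      also have "\<dots> \<le> 2 * K * (L * K) + L * (K * K)"
        using a b KL by (intro add_mono mult_mono) auto
      finally show "norm (2 * (u $ i) * (w i \<bullet> u) + w i $ i * (u \<bullet> u)) \<le> 2 * K * (L * K) + L * (K * K)"
        by simp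
    qed
    then show ?thesis by simp
  qed
  have [measurable]: "U N \<in> borel_measurable torus" "W N i \<in> borel_measurable torus" for N i
    unfolding U_def W_def by (intro continuous_measurable_torus trig_poly_continuous trig_poly_partial_sum)+
  have [measurable]: "f \<in> borel_measurable torus" "?D i \<in> borel_measurable torus" for i
    using fi D(2) by auto
  have nth [measurable]: "(\<lambda>x. h x $ i) \<in> borel_measurable torus" if [measurable]: "h \<in> borel_measurable torus" for i :: 2 and h :: "real ^ 2 \<Rightarrow> real ^ 2"
  proof -
    have "(\<lambda>x. h x \<bullet> axis i 1) \<in> borel_measurable torus" by measurable
    then show ?thesis by (simp add: inner_axis)
  qed
  have "(\<lambda>N. \<integral>x. ?q (U N x) (\<lambda>i. W N i x) \<partial>torus) \<longlonglongrightarrow> (\<integral>x. ?q (f x) (\<lambda>i. ?D i x) \<partial>torus)"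
  proof (rule integral_dominated_convergence)
    show "integrable torus (\<lambda>x :: real ^ 2. 2 * (2 * K * (L * K) + L * (K * K)))" by simp
    show "AE x in torus. (\<lambda>N. ?q (U N x) (\<lambda>i. W N i x)) \<longlonglongrightarrow> ?q (f x) (\<lambda>i. ?D i x)"
      using Ulim Wlim by eventually_elim (intro tendsto_intros; simp)
    show "AE x in torus. norm (?q (U N x) (\<lambda>i. W N i x)) \<le> 2 * (2 * K * (L * K) + L * (K * K))" for N
      using UK WL by (intro AE_I2 qb)
  qed measurable
  moreover have "(\<integral>x. ?q (U N x) (\<lambda>i. W N i x) \<partial>torus) = 0" for N
    unfolding U_def W_def e'_def
    by (rule trig_poly_trilinear[OF trig_poly_partial_sum]) (simp add: frechet_partial_sum[OF D(1)])
  ultimately have zero: "(\<integral>x. ?q (f x) (\<lambda>i. ?D i x) \<partial>torus) = 0"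
    by (simp add: LIMSEQ_const_iff)
  have fK: "AE x in torus. norm (f x) \<le> K"
    by (rule AE_norm_le_of_series[OF e fi sK])
  have DL: "AE x in torus. \<forall>i\<in>UNIV. norm (?D i x) \<le> L"
    by (intro AE_finite_allI AE_norm_le_of_series[OF e' D(2) sL]) auto
  have eq: "?q (f x) (\<lambda>i. ?D i x) = 2 * (advection f x \<bullet> f x) + weak_divergence f x * (f x \<bullet> f x)" for x
    by (simp add: advection_def weak_divergence_def inner_sum_left sum.distrib sum_distrib_left sum_distrib_right mult.assoc)
  have am: "(\<lambda>x. advection f x \<bullet> f x) \<in> borel_measurable torus" "(\<lambda>x. weak_divergence f x * (f x \<bullet> f x)) \<in> borel_measurable torus"
    unfolding advection_def weak_divergence_def by measurable
  have nf: "\<bar>f x \<bullet> f x\<bar> \<le> K * K" if "norm (f x) \<le> K" for x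
    using Cauchy_Schwarz_ineq2[of "f x" "f x"] mult_mono[OF that that] KL by fastforce
  show i2: "integrable torus (\<lambda>x. weak_divergence f x * (f x \<bullet> f x))"
  proof (rule torus.integrable_const_bound[of _ "(2 * L) * (K * K)"])
    show "AE x in torus. norm (weak_divergence f x * (f x \<bullet> f x)) \<le> (2 * L) * (K * K)"
      using fK DL
    proof eventually_elim
      case (elim x)
      have "\<bar>weak_divergence f x\<bar> \<le> (\<Sum>i\<in>(UNIV :: 2 set). L)"
        unfolding weak_divergence_def
        using elim(2) component_le_norm_cart order_trans by (intro order_trans[OF sum_abs] sum_mono) blast
      then have "\<bar>weak_divergence f x\<bar> * \<bar>f x \<bullet> f x\<bar> \<le> (2 * L) * (K * K)"
        using nf[OF elim(1)] KL by (intro mult_mono) auto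
      then show ?case by (simp add: abs_mult)
    qed
  qed (rule am)
  have i1: "integrable torus (\<lambda>x. advection f x \<bullet> f x)"
    by (intro sq_integrable_inner advection_estimate(1)[OF f2] sobolev_sq_integrable[OF f]) (rule c2)
  show "2 * (\<integral>x. advection f x \<bullet> f x \<partial>torus) + (\<integral>x. weak_divergence f x * (f x \<bullet> f x) \<partial>torus) = 0"
    using zero i1 i2 unfolding eq by simp
qed

text \<open>After integration by parts the pairing is an integral of the divergence against the
  squared modulus of \<open>f\<close>. One factor \<open>norm (f x)\<close> is bounded by the
  embedding, the other two by Young's inequality. Bounds \<open>P\<close>, \<open>E\<close>,
  \<open>d\<close> on finite sums serve as stand-ins for the squared norms of \<open>f\<close> in
  H^2, of \<open>f\<close> in L2, and of the divergence.\<close>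

lemma advection_pairing:
  fixes f :: "real ^ 2 \<Rightarrow> real ^ 2"
  assumes f: "f \<in> sobolev 4"
    and P: "\<And>A. finite A \<Longrightarrow> (\<Sum>k\<in>A. wt 2 k * (norm (hc k f))\<^sup>2) \<le> P"
    and E: "\<And>A. finite A \<Longrightarrow> (\<Sum>k\<in>A. (norm (hc k f))\<^sup>2) \<le> E"
    and d: "\<And>A. finite A \<Longrightarrow> (\<Sum>k\<in>A. (hc k (weak_divergence f))\<^sup>2) \<le> d"
  shows "\<exists>B. (\<lambda>n. hc (freq_enum n) (advection f) \<bullet> hc (freq_enum n) f) sums B
    \<and> 2 * \<bar>B\<bar> \<le> (P + embed_const * E * d) / 2"
proof (cases "E > 0")
  \<comment> \<open>The weight \<open>P / E\<close> used in the other case requires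
    \<open>E > 0\<close>; for \<open>E = 0\<close> all coefficients vanish and so does the
    pairing.\<close>
  case False
  have "hc k f = 0" for k
    using E[of "{k}"] False by (simp add: power2_le_iff_abs_le)
      (metis False linorder_not_less nle_le norm_eq_zero zero_less_norm_iff zero_less_power order_less_le_trans)
  then have "(\<lambda>n. hc (freq_enum n) (advection f) \<bullet> hc (freq_enum n) f) sums 0" by simp
  moreover have "E = 0" "P \<ge> 0" using E[of "{}"] P[of "{}"] False by auto
  ultimately show ?thesis by (intro exI[of _ 0]) auto
next
  case True
  define V :: real where "V = (2 * pi) ^ CARD(2)"
  have V: "V > 0" by (simp add: V_def)
  let ?e = embed_const and ?w = "weak_divergence f"
  have e0: "?e > 0" by (rule embed_const)
  have P0: "P \<ge> 0" using P[of "{}"] by simp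
  have f2: "f \<in> sobolev 2" using f sobolev_mono[of 2 4] by auto
  have fs: "sq_integrable f" by (rule sobolev_sq_integrable[OF f])
  have fi: "integrable torus f" by (rule sq_integrable_imp_integrable[OF fs])
  have gi: "integrable torus (advection f)"
    by (rule sq_integrable_imp_integrable[OF advection_estimate(1)[OF f2 P]])
  have ws: "sq_integrable ?w"
  proof -
    have "sq_integrable (\<lambda>x. weak_deriv [i] f x $ i)" for i
    proof -
      have s: "sq_integrable (weak_deriv [i] f)" using sobolev_weak_deriv(2)[OF f, of "[i]"] by simp
      then have "(\<lambda>x. weak_deriv [i] f x \<bullet> axis i 1) \<in> borel_measurable torus"
        by (intro borel_measurable_inner) (auto simp: sq_integrable_def)
      then have m: "(\<lambda>x. weak_deriv [i] f x $ i) \<in> borel_measurable torus" by (simp add: inner_axis)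
      have "integrable torus (\<lambda>x. (norm (weak_deriv [i] f x $ i))\<^sup>2)"
      proof (rule Bochner_Integration.integrable_bound)
        show "integrable torus (\<lambda>x. (norm (weak_deriv [i] f x))\<^sup>2)" using s by (simp add: sq_integrable_def)
        show "AE x in torus. norm ((norm (weak_deriv [i] f x $ i))\<^sup>2) \<le> norm ((norm (weak_deriv [i] f x))\<^sup>2)"
          by (intro AE_I2) (simp add: abs_le_square_iff[symmetric] component_le_norm_cart)
      qed (use m in simp)
      then show ?thesis using m by (simp add: sq_integrable_def)
    qed
    then have "sq_integrable (\<lambda>x. weak_deriv [1] f x $ 1 + weak_deriv [2] f x $ 2)"
      by (intro sq_integrable_add) auto
    then show ?thesis by (simp add: weak_divergence_def[abs_def] sum_2)
  qed
  have sums: "(\<lambda>n. hc (freq_enum n) (advection f) \<bullet> hc (freq_enum n) f) sums (V * (\<integral>x. advection f x \<bullet> f x \<partial>torus))"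
    unfolding V_def
    by (rule parseval_series[OF bij_freq_enum fi partial_sums_le_sqrt_wt[OF bij_freq_enum P] gi])
  have wf: "integrable torus (\<lambda>x. ?w x * (f x \<bullet> f x))" by (rule integral_advection_inner(2)[OF f])
  have fE: "V * (\<integral>x. (norm (f x))\<^sup>2 \<partial>torus) \<le> E"
    using parseval_le[OF fs E] V by (simp add: V_def field_simps)
  have wd: "V * (\<integral>x. (?w x)\<^sup>2 \<partial>torus) \<le> d"
    using parseval_le[OF ws] d V by (simp add: V_def field_simps)
  have int: "integrable torus (\<lambda>x. P / E * (norm (f x))\<^sup>2 + ?e * E * (?w x)\<^sup>2)"
    using fs ws by (simp add: sq_integrable_def)
  have "AE x in torus. norm (f x) \<le> sqrt (?e * P)" by (rule AE_norm_le_wt[OF fi P])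
  \<comment> \<open>The weights in Young's inequality are chosen so that \<open>E\<close> cancels
    after integrating the first term, leaving \<open>P\<close> alone, while the second becomes
    linear in \<open>E\<close> with the divergence as a coefficient.\<close>
  then have le: "AE x in torus. 2 * \<bar>?w x * (f x \<bullet> f x)\<bar> \<le> P / E * (norm (f x))\<^sup>2 + ?e * E * (?w x)\<^sup>2"
  proof eventually_elim
    case (elim x)
    have "2 * \<bar>?w x * (f x \<bullet> f x)\<bar> = 2 * (\<bar>?w x\<bar> * norm (f x)) * norm (f x)"
      by (simp add: abs_mult dot_square_norm power2_eq_square)
    also have "\<dots> \<le> 2 * (\<bar>?w x\<bar> * norm (f x)) * sqrt (?e * P)"
      by (intro mult_left_mono elim) auto
    also have "\<dots> = 2 * (sqrt (P / E) * norm (f x)) * (sqrt (?e * E) * \<bar>?w x\<bar>)"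
      using True by (simp add: real_sqrt_mult real_sqrt_divide)
    also have "\<dots> \<le> (sqrt (P / E) * norm (f x))\<^sup>2 + (sqrt (?e * E) * \<bar>?w x\<bar>)\<^sup>2"
      by (rule sum_squares_bound)
    also have "\<dots> = P / E * (norm (f x))\<^sup>2 + ?e * E * (?w x)\<^sup>2"
      using True P0 e0 by (simp add: power_mult_distrib)
    finally show ?case .
  qed
  have "2 * \<bar>V * (\<integral>x. advection f x \<bullet> f x \<partial>torus)\<bar> = V * \<bar>\<integral>x. ?w x * (f x \<bullet> f x) \<partial>torus\<bar>"
    using integral_advection_inner(1)[OF f] V by (simp add: abs_mult)
  also have "\<dots> \<le> V * (\<integral>x. \<bar>?w x * (f x \<bullet> f x)\<bar> \<partial>torus)"
    using V integral_abs_bound by (intro mult_left_mono) auto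
  also have "\<dots> \<le> V * (\<integral>x. (P / E * (norm (f x))\<^sup>2 + ?e * E * (?w x)\<^sup>2) / 2 \<partial>torus)"
    using V wf int le by (intro mult_left_mono integral_mono_AE) (auto elim: eventually_mono)
  also have "\<dots> = (P / E * (V * (\<integral>x. (norm (f x))\<^sup>2 \<partial>torus)) + ?e * E * (V * (\<integral>x. (?w x)\<^sup>2 \<partial>torus))) / 2"
    using fs ws by (simp add: sq_integrable_def field_simps)
  also have "\<dots> \<le> (P / E * E + ?e * E * d) / 2"
    using True P0 e0 fE wd by (intro divide_right_mono add_mono mult_left_mono) auto
  also have "\<dots> = (P + ?e * E * d) / 2" using True by simp
  finally show ?thesis using sums by blast
qed

section \<open>Test functions on the line\<close>

text \<open>The power \<open>n\<close> is a parameter because the derivatives of the flat function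
  \<open>exp (- 1 / t)\<close> are combinations of such quotients; the whole family is closed under
  differentiation.\<close>

definition exp_decay :: "nat \<Rightarrow> real \<Rightarrow> real" where
  "exp_decay n t = (if t > 0 then exp (- 1 / t) / t ^ n else 0)"

text \<open>The term of index \<open>n + 1\<close> in the exponential series of \<open>1 / t\<close>
  bounds the exponential from below, which forces decay at 0 against every power.\<close>

lemma exp_decay_le:
  assumes "t > 0" shows "exp_decay n t \<le> fact (Suc n) * t"
proof -
  have "(1 / t) ^ Suc n /\<^sub>R fact (Suc n) \<le> (\<Sum>m. (1 / t) ^ m /\<^sub>R fact m)"
    using sum_le_suminf[of "\<lambda>m. (1 / t) ^ m /\<^sub>R fact m" "{Suc n}"] assms sums_summable[OF exp_converges[of "1 / t"]]
    by simp
  also have "\<dots> = exp (1 / t)"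
    using exp_converges sums_unique by metis
  finally have "(1 / t) ^ Suc n / fact (Suc n) \<le> exp (1 / t)"
    by (simp only: real_scaleR_def divide_inverse mult.commute)
  then have "(1 / t) ^ Suc n \<le> fact (Suc n) * exp (1 / t)"
    by (simp only: pos_divide_le_eq fact_gt_zero mult.commute)
  then have "exp (- 1 / t) * (1 / t) ^ Suc n * t \<le> exp (- 1 / t) * (fact (Suc n) * exp (1 / t)) * t"
    using assms by (intro mult_right_mono mult_left_mono) auto
  also have "\<dots> = fact (Suc n) * t"
    by (simp add: exp_minus field_simps del: fact_Suc)
  finally show ?thesis
    using assms by (simp add: exp_decay_def power_divide field_simps del: fact_Suc)
qed

lemma exp_decay_derivative:
  "(exp_decay n has_real_derivative exp_decay (n + 2) t - real n * exp_decay (n + 1) t) (at t)"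
proof -
  consider "t > 0" | "t < 0" | "t = 0" by linarith
  then show ?thesis
  proof cases
    case 1
    have "((\<lambda>t. exp (- 1 / t) / t ^ n) has_real_derivative exp_decay (n + 2) t - real n * exp_decay (n + 1) t) (at t)"
    proof (cases n)
      case 0
      then show ?thesis
        using 1 by (auto intro!: derivative_eq_intros simp: exp_decay_def power2_eq_square)
    next
      case (Suc m)
      have "((\<lambda>t. t ^ Suc m) has_real_derivative real (Suc m) * t ^ m) (at t)"
        using DERIV_pow[of "Suc m" t UNIV] by simp
      then have "((\<lambda>t. inverse (t ^ Suc m)) has_real_derivative
          - (inverse (t ^ Suc m) * (real (Suc m) * t ^ m) * inverse (t ^ Suc m))) (at t)"
        using 1 by (intro DERIV_inverse') auto
      moreover have "((\<lambda>t. exp (- 1 / t)) has_real_derivative exp (- 1 / t) * (1 / t\<^sup>2)) (at t)"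
        using 1 by (auto intro!: derivative_eq_intros simp: power2_eq_square field_simps)
      ultimately have d: "((\<lambda>t. exp (- 1 / t) * inverse (t ^ Suc m)) has_real_derivative
          exp (- 1 / t) * (1 / t\<^sup>2) * inverse (t ^ Suc m)
            + - (inverse (t ^ Suc m) * (real (Suc m) * t ^ m) * inverse (t ^ Suc m)) * exp (- 1 / t)) (at t)"
        by (intro DERIV_mult)
      show ?thesis
        using d unfolding divide_inverse[of "exp _"] Suc
        by (rule DERIV_cong) (use 1 in \<open>simp add: exp_decay_def field_simps power2_eq_square\<close>)
    qed
    then show ?thesis
      by (rule has_field_derivative_transform_within_open[of _ _ _ "{0<..}"]) (use 1 in \<open>auto simp: exp_decay_def\<close>)
  next
    case 2
    have "((\<lambda>t. 0) has_real_derivative exp_decay (n + 2) t - real n * exp_decay (n + 1) t) (at t)"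
      using 2 by (simp add: exp_decay_def)
    then show ?thesis
      by (rule has_field_derivative_transform_within_open[of _ _ _ "{..<0}"]) (use 2 in \<open>auto simp: exp_decay_def\<close>)
  next
    case 3
    \<comment> \<open>For positive \<open>h\<close> the difference quotient at 0 is
      \<open>exp_decay (Suc n) h\<close>, which the previous bound sends to 0; for negative
      \<open>h\<close> it vanishes.\<close>
    have "(\<lambda>h. (exp_decay n (0 + h) - exp_decay n 0) / h) \<midarrow>0\<rightarrow> 0"
    proof (rule Lim_null_comparison)
      show "\<forall>\<^sub>F h in at 0. norm ((exp_decay n (0 + h) - exp_decay n 0) / h) \<le> fact (Suc (Suc n)) * \<bar>h\<bar>"
      proof (intro always_eventually allI)
        fix h :: real
        show "norm ((exp_decay n (0 + h) - exp_decay n 0) / h) \<le> fact (Suc (Suc n)) * \<bar>h\<bar>"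
        proof (cases "h > 0")
          case True
          have "exp_decay n h / h = exp_decay (Suc n) h" "exp_decay (Suc n) h \<ge> 0"
            using True by (auto simp: exp_decay_def)
          then show ?thesis
            using exp_decay_le[OF True, of "Suc n"] True by (simp add: exp_decay_def[of _ 0] del: fact_Suc)
        next
          case False
          then have "norm ((exp_decay n (0 + h) - exp_decay n 0) / h) = 0" by (simp add: exp_decay_def)
          also have "\<dots> \<le> fact (Suc (Suc n)) * \<bar>h\<bar>" by (intro mult_nonneg_nonneg) auto
          finally show ?thesis .
        qed
      qed
      show "((\<lambda>h. fact (Suc (Suc n)) * \<bar>h\<bar>) \<longlongrightarrow> 0) (at (0::real))"
        by (intro tendsto_eq_intros) auto
    qed
    then show ?thesis
      using 3 by (simp add: DERIV_def exp_decay_def)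
  qed
qed

text \<open>A chain of successive derivatives, used as a certificate of smoothness on the line. A
  derivative in direction \<open>v\<close> only adds a factor \<open>v\<close>, so scalar multiples
  of the chain form a class closed under differentiation.\<close>

definition deriv_seq :: "(nat \<Rightarrow> real \<Rightarrow> real) \<Rightarrow> bool" where
  "deriv_seq F \<longleftrightarrow> (\<forall>n t. (F n has_real_derivative F (Suc n) t) (at t))"

lemma deriv_seq_smooth:
  assumes "deriv_seq F" shows "smooth (F 0)"
proof (rule smooth_coinduct)
  let ?C = "{\<lambda>x. c * F n x |c n. True}"
  show "F 0 \<in> ?C" by (intro CollectI exI[of _ "1 :: real"] exI[of _ "0 :: nat"]) auto
  fix g assume "g \<in> ?C"
  then obtain c n where g: "g = (\<lambda>x. c * F n x)" by auto
  have d: "(g has_derivative (\<lambda>v. c * F (Suc n) x * v)) (at x)" for x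
    using assms DERIV_cmult[of "F n" "F (Suc n) x" x UNIV c] unfolding g deriv_seq_def has_field_derivative_def by simp
  show "g differentiable (at x)" for x
    using d differentiable_def by blast
  show "(\<lambda>x. frechet_derivative g (at x) v) \<in> ?C" for v
    by (auto simp: frechet_derivative_at[OF d, symmetric] intro!: exI[of _ "c * v"] exI[of _ "Suc n"])
qed

text \<open>The linear span of the products \<open>exp_decay m t * exp_decay n (1 - t)\<close>. The
  derivative of such a product is a combination of four others, so the span is closed under
  differentiation.\<close>

inductive_set bump_class :: "(real \<Rightarrow> real) set" where
  base: "(\<lambda>t. exp_decay m t * exp_decay n (1 - t)) \<in> bump_class"
| add: "f \<in> bump_class \<Longrightarrow> g \<in> bump_class \<Longrightarrow> (\<lambda>t. f t + g t) \<in> bump_class"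
| scale: "f \<in> bump_class \<Longrightarrow> (\<lambda>t. c * f t) \<in> bump_class"

lemma bump_class_derivative:
  "f \<in> bump_class \<Longrightarrow> \<exists>g\<in>bump_class. \<forall>t. (f has_real_derivative g t) (at t)"
proof (induction rule: bump_class.induct)
  case (base m n)
  let ?b = "\<lambda>m n t. exp_decay m t * exp_decay n (1 - t)"
  let ?g = "\<lambda>t. (?b (m + 2) n t + - real m * ?b (m + 1) n t) + ((- 1) * ?b m (n + 2) t + real n * ?b m (n + 1) t)"
  have "?g \<in> bump_class" by (intro bump_class.intros)
  moreover have "((\<lambda>t. ?b m n t) has_real_derivative ?g t) (at t)" for t
  proof -
    have "((\<lambda>t. exp_decay n (1 - t)) has_real_derivative
        (exp_decay (n + 2) (1 - t) - real n * exp_decay (n + 1) (1 - t)) * (0 - 1)) (at t)"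
      by (rule DERIV_chain2[OF exp_decay_derivative]) (intro derivative_intros)
    from DERIV_mult[OF exp_decay_derivative this] show ?thesis
      by (rule DERIV_cong) (simp add: algebra_simps)
  qed
  ultimately show ?case by (intro bexI[of _ ?g] allI)
next
  case (add f g)
  then obtain f' g' where "f' \<in> bump_class" "g' \<in> bump_class"
    "\<And>t. (f has_real_derivative f' t) (at t)" "\<And>t. (g has_real_derivative g' t) (at t)" by blast
  then show ?case
    by (intro bexI[of _ "\<lambda>t. f' t + g' t"] allI DERIV_add bump_class.add) auto
next
  case (scale f c)
  then obtain f' where "f' \<in> bump_class" "\<And>t. (f has_real_derivative f' t) (at t)" by blast
  then show ?case
    by (intro bexI[of _ "\<lambda>t. c * f' t"] allI DERIV_cmult bump_class.scale) auto
qed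

definition bump :: "real \<Rightarrow> real" where
  "bump t = exp_decay 0 t * exp_decay 0 (1 - t)"

lemma bump_deriv_seq: "\<exists>F. F 0 = bump \<and> deriv_seq F"
proof -
  obtain D where D: "\<And>f. f \<in> bump_class \<Longrightarrow> D f \<in> bump_class"
    "\<And>f t. f \<in> bump_class \<Longrightarrow> (f has_real_derivative D f t) (at t)"
    using bump_class_derivative by metis
  have "(D ^^ n) bump \<in> bump_class" for n
    by (induction n) (auto simp: bump_def[abs_def] D intro: bump_class.base)
  then show ?thesis
    using D(2) by (intro exI[of _ "\<lambda>n. (D ^^ n) bump"]) (auto simp: deriv_seq_def)
qed

lemma bump_nonneg: "bump t \<ge> 0"
  by (simp add: bump_def exp_decay_def)

lemma bump_pos: "0 < t \<Longrightarrow> t < 1 \<Longrightarrow> bump t > 0"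
  by (simp add: bump_def exp_decay_def)

lemma bump_zero: "t \<le> 0 \<or> 1 \<le> t \<Longrightarrow> bump t = 0"
  by (auto simp: bump_def exp_decay_def)

lemma continuous_bump: "continuous_on S bump"
proof -
  obtain F where F: "F 0 = bump" "deriv_seq F" using bump_deriv_seq by blast
  then have "(bump has_real_derivative F 1 t) (at t)" for t
    unfolding deriv_seq_def using One_nat_def by metis
  then show ?thesis
    using DERIV_continuous continuous_at_imp_continuous_on by blast
qed

lemma integral_bump_pos: "integral {0..1} bump > 0"
proof -
  have "integral {0..1} bump \<noteq> 0"
  proof
    assume "integral {0..1} bump = 0"
    then have "bump (1 / 2) = 0"
      using integral_eq_0_iff[of 0 1 bump] continuous_bump bump_nonneg by auto
    then show False using bump_pos[of "1 / 2"] by simp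
  qed
  moreover have "integral {0..1} bump \<ge> 0"
    by (intro integral_nonneg integrable_continuous_real continuous_bump) (simp add: bump_nonneg)
  ultimately show ?thesis by linarith
qed

section \<open>Mollifiers and smooth cutoffs in time\<close>

text \<open>The mass lies in the unit interval to the right of 0. Mollification at a point
  \<open>p\<close> with width \<open>e\<close> therefore only looks at times between
  \<open>p\<close> and \<open>p + e\<close>.\<close>

definition mollifier :: "real \<Rightarrow> real" where
  "mollifier t = bump t / integral {0..1} bump"

text \<open>The lower limit lies strictly to the left of the support of the mollifier, so that 0 is
  interior to the interval on which the fundamental theorem is applied.\<close>

definition smooth_step :: "real \<Rightarrow> real" where
  "smooth_step t = integral {- 1..t} mollifier"

lemma mollifier_nonneg: "mollifier t \<ge> 0"
  using bump_nonneg integral_bump_pos by (simp add: mollifier_def less_imp_le)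

lemma mollifier_zero: "t \<le> 0 \<or> 1 \<le> t \<Longrightarrow> mollifier t = 0"
  by (simp add: mollifier_def bump_zero)

lemma continuous_mollifier: "continuous_on S mollifier"
  unfolding mollifier_def using integral_bump_pos by (intro continuous_intros continuous_bump) auto

lemma mollifier_integrable: "mollifier integrable_on {a..b}"
  by (intro integrable_continuous_real continuous_mollifier)

lemma smooth_step_le_0: "t \<le> 0 \<Longrightarrow> smooth_step t = 0"
  unfolding smooth_step_def by (subst Henstock_Kurzweil_Integration.integral_cong[of _ _ "\<lambda>_. 0"]) (auto simp: mollifier_zero)

lemma smooth_step_ge_1:
  assumes "1 \<le> t" shows "smooth_step t = 1"
proof -
  have "integral {- 1..t} mollifier = integral {- 1..0} mollifier + (integral {0..1} mollifier + integral {1..t} mollifier)"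
    using assms mollifier_integrable by (simp add: Henstock_Kurzweil_Integration.integral_combine)
  also have "integral {- 1..0} mollifier = integral {- 1..0} (\<lambda>_ :: real. 0)"
    by (rule Henstock_Kurzweil_Integration.integral_cong) (simp add: mollifier_zero)
  also have "integral {1..t} mollifier = integral {1..t} (\<lambda>_ :: real. 0)"
    by (rule Henstock_Kurzweil_Integration.integral_cong) (simp add: mollifier_zero)
  also have "integral {0..1} mollifier = 1"
    unfolding mollifier_def using integral_bump_pos by simp
  finally show ?thesis by (simp add: smooth_step_def)
qed

lemma smooth_step_derivative: "(smooth_step has_real_derivative mollifier t) (at t)"
proof (cases "t < 0")
  case True
  have "((\<lambda>t. 0) has_real_derivative mollifier t) (at t)"
    using True by (simp add: mollifier_zero)
  then show ?thesis
    by (rule has_field_derivative_transform_within_open[of _ _ _ "{..<0}"]) (use True in \<open>auto simp: smooth_step_le_0\<close>)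
next
  case False
  have "(smooth_step has_real_derivative mollifier t) (at t within {- 1..t + 1})"
    unfolding smooth_step_def using False
    by (intro integral_has_real_derivative continuous_mollifier) auto
  then show ?thesis
    using False at_within_interior[of t "{- 1..t + 1}"] by simp
qed

lemma smooth_step_bounds: "0 \<le> smooth_step t" "smooth_step t \<le> 1"
proof -
  have m: "smooth_step a \<le> smooth_step b" if "a \<le> b" for a b
    using that smooth_step_derivative mollifier_nonneg
    by (intro DERIV_nonneg_imp_nondecreasing[OF that]) blast
  show "0 \<le> smooth_step t"
    using m[of "min 0 t" t] smooth_step_le_0[of "min 0 t"] by simp
  show "smooth_step t \<le> 1"
    using m[of t "max 1 t"] smooth_step_ge_1[of "max 1 t"] by simp
qed

lemma smooth_step_deriv_seq: "\<exists>F. F 0 = smooth_step \<and> F 1 = mollifier \<and> deriv_seq F"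
proof -
  obtain G where G: "G 0 = bump" "deriv_seq G" using bump_deriv_seq by blast
  define F where "F n = (case n of 0 \<Rightarrow> smooth_step | Suc m \<Rightarrow> (\<lambda>t. G m t / integral {0..1} bump))" for n
  have "(F n has_real_derivative F (Suc n) t) (at t)" for n t
  proof (cases n)
    case 0
    then show ?thesis using smooth_step_derivative[of t] G(1) by (simp add: F_def mollifier_def)
  next
    case (Suc m)
    then show ?thesis
      using G(2) by (auto simp: F_def deriv_seq_def intro: DERIV_cdivide)
  qed
  then show ?thesis
    using G(1) by (intro exI[of _ F]) (auto simp: F_def deriv_seq_def mollifier_def)
qed

text \<open>The rise happens between \<open>r\<close> and \<open>r + e\<close>, the fall between
  \<open>s\<close> and \<open>s + e\<close>. As \<open>e\<close> tends to 0 the pointwise limit is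
  therefore the indicator of the interval open at \<open>r\<close> and closed at
  \<open>s\<close>.\<close>

definition plateau :: "real \<Rightarrow> real \<Rightarrow> real \<Rightarrow> real \<Rightarrow> real" where
  "plateau e r s t = smooth_step ((t - r) / e) - smooth_step ((t - s) / e)"

lemma plateau_smooth: "e > 0 \<Longrightarrow> smooth (plateau e r s)"
proof -
  assume e: "e > 0"
  obtain F where F: "F 0 = smooth_step" "deriv_seq F" using smooth_step_deriv_seq by blast
  define G where "G n t = (F n ((t - r) / e) - F n ((t - s) / e)) / e ^ n" for n t
  have d: "((\<lambda>t. F n ((t - p) / e)) has_real_derivative F (Suc n) ((t - p) / e) * (1 / e)) (at t)" for n t p
    by (rule DERIV_chain2[of "F n"])
      (use F(2) e in \<open>auto simp: deriv_seq_def intro!: derivative_eq_intros\<close>)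
  have "deriv_seq G"
    unfolding deriv_seq_def
  proof (intro allI)
    fix n t
    have "(G n has_real_derivative (F (Suc n) ((t - r) / e) * (1 / e) - F (Suc n) ((t - s) / e) * (1 / e)) / e ^ n) (at t)"
      unfolding G_def by (intro DERIV_cdivide DERIV_diff d)
    then show "(G n has_real_derivative G (Suc n) t) (at t)"
      by (rule DERIV_cong) (simp add: G_def diff_divide_distrib mult.commute)
  qed
  moreover have "G 0 = plateau e r s"
    by (auto simp: G_def plateau_def F)
  ultimately show ?thesis using deriv_seq_smooth by metis
qed

lemma plateau_derivative:
  assumes "e > 0"
  shows "(plateau e r s has_real_derivative (mollifier ((t - r) / e) - mollifier ((t - s) / e)) / e) (at t)"
proof -
  have d: "((\<lambda>t. smooth_step ((t - p) / e)) has_real_derivative mollifier ((t - p) / e) * (1 / e)) (at t)" for p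
    by (rule DERIV_chain2[of smooth_step, OF smooth_step_derivative]) (use assms in \<open>auto intro!: derivative_eq_intros\<close>)
  show ?thesis
    unfolding plateau_def by (rule DERIV_cong[OF DERIV_diff[OF d d]]) (simp add: diff_divide_distrib)
qed

lemma abs_plateau_le: "\<bar>plateau e r s t\<bar> \<le> 1"
  using smooth_step_bounds[of "(t - r) / e"] smooth_step_bounds[of "(t - s) / e"] by (simp add: plateau_def abs_le_iff)

lemma plateau_zero:
  assumes "e > 0" "r \<le> s" "t \<le> r \<or> s + e \<le> t" shows "plateau e r s t = 0"
  using assms(3)
proof
  assume "t \<le> r"
  then show ?thesis
    using assms(1,2) by (simp add: plateau_def smooth_step_le_0 divide_nonpos_pos)
next
  assume "s + e \<le> t"
  then have "1 \<le> (t - r) / e" "1 \<le> (t - s) / e"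
    using assms(1,2) by (auto simp: field_simps)
  then show ?thesis by (simp add: plateau_def smooth_step_ge_1)
qed

lemma plateau_tendsto:
  assumes e: "\<And>n. e n > 0" "e \<longlonglongrightarrow> 0" and "r \<le> s"
  shows "(\<lambda>n. plateau (e n) r s t) \<longlonglongrightarrow> indicator {r<..s} t"
proof -
  have step: "(\<lambda>n. smooth_step ((t - p) / e n)) \<longlonglongrightarrow> indicator {p<..} t" for p
  proof (cases "t \<le> p")
    case True
    then show ?thesis using e(1) by (simp add: smooth_step_le_0 divide_nonpos_pos)
  next
    case False
    then have "\<forall>\<^sub>F n in sequentially. e n < t - p"
      using e(2) by (intro order_tendstoD(2)) auto
    then have "\<forall>\<^sub>F n in sequentially. smooth_step ((t - p) / e n) = 1"
      by eventually_elim (use e(1) in \<open>auto intro!: smooth_step_ge_1 simp: field_simps less_imp_le\<close>)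
    then show ?thesis using False by (simp add: tendsto_eventually)
  qed
  have "(indicator {r<..s} t :: real) = indicator {r<..} t - indicator {s<..} t"
    using assms(3) by (auto simp: indicator_def)
  then show ?thesis
    unfolding plateau_def using tendsto_diff[OF step step] by metis
qed

lemma mollifier_integral:
  assumes "e > 0" "c \<le> p" "p + e \<le> d"
  shows "(\<integral>t. mollifier ((t - p) / e) / e \<partial>lebesgue_on {c..d}) = 1"
proof -
  have c: "continuous_on S (\<lambda>t. mollifier ((t - p) / e) / e)" for S
    using assms(1) by (intro continuous_intros continuous_on_compose2[OF continuous_mollifier[of UNIV]]) auto
  have "((\<lambda>t. smooth_step ((t - p) / e)) has_real_derivative mollifier ((t - p) / e) * (1 / e)) (at t)" for t
    by (rule DERIV_chain2[of smooth_step, OF smooth_step_derivative]) (use assms in \<open>auto intro!: derivative_eq_intros\<close>)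
  then have "((\<lambda>t. mollifier ((t - p) / e) / e) has_integral smooth_step ((d - p) / e) - smooth_step ((c - p) / e)) {c..d}"
    using assms by (intro fundamental_theorem_of_calculus)
      (auto simp: has_real_derivative_iff_has_vector_derivative[symmetric] intro: has_field_derivative_at_within)
  moreover have "smooth_step ((d - p) / e) = 1" "smooth_step ((c - p) / e) = 0"
    using assms by (auto intro!: smooth_step_ge_1 smooth_step_le_0 simp: field_simps divide_nonpos_pos)
  ultimately have "integral {c..d} (\<lambda>t. mollifier ((t - p) / e) / e) = 1"
    by (metis diff_zero integral_unique)
  then show ?thesis
    by (subst lebesgue_integral_eq_integral) (auto intro!: continuous_imp_integrable_real c)
qed

text \<open>The kernel is nonnegative, has integral 1 and lives on \<open>p\<close> to
  \<open>p + e n\<close>, where \<open>\<alpha>\<close> differs little from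
  \<open>\<alpha> p\<close> once \<open>e n\<close> is below the modulus of continuity.\<close>

lemma mollifier_tendsto:
  assumes cont: "continuous_on {c..d} \<alpha>" and "c \<le> p" "p < d"
    and e: "\<And>n. e n > 0" "e \<longlonglongrightarrow> 0" "\<And>n. p + e n \<le> d"
  shows "(\<lambda>n. \<integral>t. \<alpha> t * (mollifier ((t - p) / e n) / e n) \<partial>lebesgue_on {c..d}) \<longlonglongrightarrow> \<alpha> p"
proof (rule LIMSEQ_I)
  fix \<epsilon> :: real assume \<epsilon>: "\<epsilon> > 0"
  have "p \<in> {c..d}" using assms by auto
  then obtain \<delta> where \<delta>: "\<delta> > 0" "\<And>t. t \<in> {c..d} \<Longrightarrow> \<bar>t - p\<bar> < \<delta> \<Longrightarrow> \<bar>\<alpha> t - \<alpha> p\<bar> < \<epsilon> / 2"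
    using cont \<epsilon> unfolding continuous_on_iff dist_real_def by (metis half_gt_zero)
  obtain N where N: "\<And>n. n \<ge> N \<Longrightarrow> e n < \<delta>"
    using order_tendstoD(2)[OF e(2) \<delta>(1)] by (auto simp: eventually_sequentially)
  have "\<bar>(\<integral>t. \<alpha> t * (mollifier ((t - p) / e n) / e n) \<partial>lebesgue_on {c..d}) - \<alpha> p\<bar> < \<epsilon>" if "n \<ge> N" for n
  proof -
    let ?m = "\<lambda>t. mollifier ((t - p) / e n) / e n"
    have mc: "continuous_on {c..d} ?m"
      using e(1)[of n] by (intro continuous_intros continuous_on_compose2[OF continuous_mollifier[of UNIV]]) auto
    have m0: "?m t \<ge> 0" for t using mollifier_nonneg e(1)[of n] by (simp add: less_imp_le)
    have mz: "?m t = 0" if "t \<le> p \<or> p + e n \<le> t" for t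
      using that e(1)[of n] by (auto simp: mollifier_zero field_simps divide_nonpos_pos)
    have i: "integrable (lebesgue_on {c..d}) ?m" "integrable (lebesgue_on {c..d}) (\<lambda>t. \<alpha> t * ?m t)"
      "integrable (lebesgue_on {c..d}) (\<lambda>t. (\<alpha> t - \<alpha> p) * ?m t)"
      by (intro continuous_imp_integrable_real continuous_on_mult continuous_on_diff continuous_on_const mc cont)+
    have one: "(\<integral>t. ?m t \<partial>lebesgue_on {c..d}) = 1"
      using mollifier_integral assms by blast
    have "(\<integral>t. \<alpha> t * ?m t \<partial>lebesgue_on {c..d}) - \<alpha> p
        = (\<integral>t. \<alpha> t * ?m t \<partial>lebesgue_on {c..d}) - (\<integral>t. \<alpha> p * ?m t \<partial>lebesgue_on {c..d})"
      using one by (subst Bochner_Integration.integral_mult_right_zero) simp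
    also have "\<dots> = (\<integral>t. (\<alpha> t - \<alpha> p) * ?m t \<partial>lebesgue_on {c..d})"
      unfolding left_diff_distrib
      by (rule Bochner_Integration.integral_diff[OF i(2) integrable_mult_right[OF i(1)], symmetric])
    also have "\<bar>\<dots>\<bar> \<le> (\<integral>t. \<bar>(\<alpha> t - \<alpha> p) * ?m t\<bar> \<partial>lebesgue_on {c..d})"
      by (rule integral_abs_bound)
    also have "\<dots> \<le> (\<integral>t. \<epsilon> / 2 * ?m t \<partial>lebesgue_on {c..d})"
    proof (rule integral_mono)
      fix t assume "t \<in> space (lebesgue_on {c..d})"
      then have t: "t \<in> {c..d}" by simp
      show "\<bar>(\<alpha> t - \<alpha> p) * ?m t\<bar> \<le> \<epsilon> / 2 * ?m t"
      proof (cases "t \<le> p \<or> p + e n \<le> t")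
        case False
        then have "\<bar>\<alpha> t - \<alpha> p\<bar> < \<epsilon> / 2"
          using N[OF that] by (intro \<delta>(2)[OF t]) auto
        then show ?thesis
          unfolding abs_mult abs_of_nonneg[OF m0] by (intro mult_right_mono m0) simp
      next
        case True
        show ?thesis unfolding mz[OF True] by simp
      qed
    qed (intro Bochner_Integration.integrable_abs integrable_mult_right i)+
    also have "\<dots> = \<epsilon> / 2" using one by (subst Bochner_Integration.integral_mult_right_zero) simp
    also have "\<dots> < \<epsilon>" using \<epsilon> by simp
    finally show ?thesis .
  qed
  then show "\<exists>N. \<forall>n\<ge>N. norm ((\<integral>t. \<alpha> t * (mollifier ((t - p) / e n) / e n) \<partial>lebesgue_on {c..d}) - \<alpha> p) < \<epsilon>"
    by auto
qed

section \<open>From weak time derivatives to increments\<close>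

lemma integral_lebesgue_on_zero_outside:
  fixes f :: "real \<Rightarrow> real"
  assumes "A \<subseteq> B" "A \<in> sets lebesgue" "B \<in> sets lebesgue" "\<And>t. t \<in> B \<Longrightarrow> t \<notin> A \<Longrightarrow> f t = 0"
  shows "(\<integral>t. f t \<partial>lebesgue_on B) = (\<integral>t. f t \<partial>lebesgue_on A)"
proof -
  have "(\<lambda>t. indicator B t *\<^sub>R f t) = (\<lambda>t. indicator A t *\<^sub>R f t)"
  proof
    fix t show "indicator B t *\<^sub>R f t = indicator A t *\<^sub>R f t"
      using assms(1,4) by (cases "t \<in> A"; cases "t \<in> B") auto
  qed
  then show ?thesis
    using assms by (simp add: integral_restrict_space del: real_scaleR_def)
qed

lemma integrable_lebesgue_on_subset:
  fixes f :: "real \<Rightarrow> 'b::euclidean_space"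
  assumes "integrable (lebesgue_on B) f" "A \<subseteq> B" "A \<in> sets lebesgue" "B \<in> sets lebesgue"
  shows "integrable (lebesgue_on A) f"
proof -
  have "integrable lebesgue (\<lambda>t. indicator A t *\<^sub>R (indicator B t *\<^sub>R f t))"
    by (rule integrable_mult_indicator) (use assms in \<open>auto simp: integrable_restrict_space\<close>)
  also have "(\<lambda>t. indicator A t *\<^sub>R (indicator B t *\<^sub>R f t)) = (\<lambda>t. indicator A t *\<^sub>R f t)"
    using assms(2) by (auto simp: indicator_def fun_eq_iff)
  finally show ?thesis using assms by (simp add: integrable_restrict_space)
qed

lemma AE_lebesgue_on_subset:
  assumes "AE t in lebesgue_on B. P t" "A \<subseteq> B" "A \<in> sets lebesgue" "B \<in> sets lebesgue"
  shows "AE t in lebesgue_on A. P t"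
  using assms by (auto simp: AE_restrict_space_iff elim!: eventually_mono)

text \<open>
  The lemma of du Bois-Reymond: test the weak derivative with smooth approximations of the
  indicator of the interval from \<open>r\<close> to \<open>s\<close>.
\<close>

lemma weak_time_deriv_increment:
  assumes w: "has_weak_time_deriv a b f g" and cont: "continuous_on {a<..<b} \<alpha>"
    and ae: "AE t in lebesgue_on {a<..<b}. f t = \<alpha> t" and rs: "a < r" "r \<le> s" "s < b"
  shows "\<alpha> s - \<alpha> r = (\<integral>t. g t \<partial>lebesgue_on {r..s})"
proof -
  \<comment> \<open>Margins on both sides are necessary because integrability is available only on
    closed subintervals of the open interval.\<close>
  obtain c where c: "a < c" "c < r" using dense rs(1) by blast
  obtain d where d: "s < d" "d < b" using dense rs(3) by blast
  \<comment> \<open>This width keeps the falling part of the plateau, which ends at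
    \<open>s + e n\<close>, to the left of \<open>d\<close>.\<close>
  define e where "e n = (d - s) / real (Suc n)" for n
  have e0: "e n > 0" for n using d by (simp add: e_def)
  have ed: "s + e n \<le> d" for n
  proof -
    have "(d - s) / real (Suc n) \<le> (d - s) / 1" using d by (intro divide_left_mono) auto
    then show ?thesis by (simp add: e_def)
  qed
  have elim: "e \<longlonglongrightarrow> 0"
    unfolding e_def by (rule LIMSEQ_Suc[OF lim_const_over_n])
  have sub: "{c..d} \<subseteq> {a<..<b}" using c d by auto
  have cc: "continuous_on {c..d} \<alpha>" using cont sub continuous_on_subset by blast
  let ?p = "\<lambda>n. plateau (e n) r s"
  let ?m = "\<lambda>n p t. mollifier ((t - p) / e n) / e n"
  have pz: "?p n t = 0" if "t \<notin> {c..d}" for n t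
    using that plateau_zero[OF e0 rs(2), of t] c ed[of n] by fastforce
  have dp: "deriv (?p n) t = ?m n r t - ?m n s t" for n t
    using DERIV_imp_deriv[OF plateau_derivative[OF e0]] by (simp add: diff_divide_distrib)
  have dz: "deriv (?p n) t = 0" if "t \<notin> {c..d}" for n t
  proof -
    have "?m n q t = 0" if "q = r \<or> q = s" for q
      using that \<open>t \<notin> {c..d}\<close> c rs ed[of n] e0[of n] d
      by (auto simp: field_simps intro!: mollifier_zero)
    then have "?m n r t = 0" "?m n s t = 0" by blast+
    then show ?thesis by (simp only: dp diff_self)
  qed
  have gi: "integrable (lebesgue_on {c..d}) g"
    using w c(1) d(2) by (auto simp: has_weak_time_deriv_def)
  have weak: "(\<integral>t. f t * deriv (?p n) t \<partial>lebesgue_on {a<..<b}) = - (\<integral>t. g t * ?p n t \<partial>lebesgue_on {a<..<b})" for n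
  proof -
    have "{t. ?p n t \<noteq> 0} \<subseteq> {r..s + e n}"
      using plateau_zero[OF e0 rs(2)] by (auto simp: not_less) (metis less_eq_real_def linorder_not_less)+
    then have "closure {t. ?p n t \<noteq> 0} \<subseteq> {r..s + e n}"
      by (rule closure_minimal) simp
    also have "\<dots> \<subseteq> {a<..<b}" using ed[of n] d rs by auto
    finally show ?thesis
      using w plateau_smooth[OF e0] unfolding has_weak_time_deriv_def by blast
  qed
  \<comment> \<open>The derivative of the plateau is a mollifier at \<open>r\<close> minus a
    mollifier at \<open>s\<close>, so continuity of \<open>\<alpha>\<close> turns the tested left
    side into a difference of values.\<close>
  have "(\<lambda>n. (\<integral>t. \<alpha> t * ?m n r t \<partial>lebesgue_on {c..d}) - (\<integral>t. \<alpha> t * ?m n s t \<partial>lebesgue_on {c..d})) \<longlonglongrightarrow> \<alpha> r - \<alpha> s"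
  proof (intro tendsto_diff mollifier_tendsto cc e0 elim)
    show "r + e n \<le> d" for n using ed[of n] rs(2) by linarith
  qed (use c d rs ed in auto)
  moreover have "(\<integral>t. \<alpha> t * ?m n r t \<partial>lebesgue_on {c..d}) - (\<integral>t. \<alpha> t * ?m n s t \<partial>lebesgue_on {c..d})
      = - (\<integral>t. g t * ?p n t \<partial>lebesgue_on {c..d})" for n
  proof -
    have mc: "continuous_on {c..d} (?m n p)" for p
      using e0[of n] by (intro continuous_intros continuous_on_compose2[OF continuous_mollifier[of UNIV]]) auto
    have i: "integrable (lebesgue_on {c..d}) (\<lambda>t. \<alpha> t * ?m n p t)" for p
      by (intro continuous_imp_integrable_real continuous_on_mult mc cc)
    have "(\<integral>t. \<alpha> t * ?m n r t \<partial>lebesgue_on {c..d}) - (\<integral>t. \<alpha> t * ?m n s t \<partial>lebesgue_on {c..d})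
        = (\<integral>t. \<alpha> t * deriv (?p n) t \<partial>lebesgue_on {c..d})"
      unfolding dp right_diff_distrib by (rule Bochner_Integration.integral_diff[OF i i, symmetric])
    also have "\<dots> = (\<integral>t. f t * deriv (?p n) t \<partial>lebesgue_on {c..d})"
    proof (rule integral_cong_AE)
      show "AE t in lebesgue_on {c..d}. \<alpha> t * deriv (?p n) t = f t * deriv (?p n) t"
        using AE_lebesgue_on_subset[OF ae sub] by (auto elim: eventually_mono)
      have "integrable (lebesgue_on {c..d}) (\<lambda>t. \<alpha> t * deriv (?p n) t)"
        unfolding dp right_diff_distrib by (intro Bochner_Integration.integrable_diff i)
      then show "(\<lambda>t. \<alpha> t * deriv (?p n) t) \<in> borel_measurable (lebesgue_on {c..d})" by simp
      have "integrable (lebesgue_on {c..d}) f"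
        using w c(1) d(2) by (auto simp: has_weak_time_deriv_def)
      moreover have "deriv (?p n) \<in> borel_measurable (lebesgue_on {c..d})"
        unfolding dp[abs_def] by (intro continuous_imp_measurable_on_sets_lebesgue continuous_on_diff mc) auto
      ultimately show "(\<lambda>t. f t * deriv (?p n) t) \<in> borel_measurable (lebesgue_on {c..d})" by simp
    qed
    also have "\<dots> = (\<integral>t. f t * deriv (?p n) t \<partial>lebesgue_on {a<..<b})"
      by (rule integral_lebesgue_on_zero_outside[symmetric]) (use sub dz in auto)
    also have "\<dots> = - (\<integral>t. g t * ?p n t \<partial>lebesgue_on {a<..<b})" by (rule weak)
    also have "(\<integral>t. g t * ?p n t \<partial>lebesgue_on {a<..<b}) = (\<integral>t. g t * ?p n t \<partial>lebesgue_on {c..d})"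
      by (rule integral_lebesgue_on_zero_outside) (use sub pz in auto)
    finally show ?thesis .
  qed
  ultimately have 1: "(\<lambda>n. - (\<integral>t. g t * ?p n t \<partial>lebesgue_on {c..d})) \<longlonglongrightarrow> \<alpha> r - \<alpha> s" by simp
  have pm: "?p n \<in> borel_measurable (lebesgue_on {c..d})" for n
    by (intro continuous_imp_measurable_on_sets_lebesgue continuous_at_imp_continuous_on)
      (auto intro: DERIV_isCont[OF plateau_derivative[OF e0]])
  have "(\<lambda>n. \<integral>t. g t * ?p n t \<partial>lebesgue_on {c..d}) \<longlonglongrightarrow> (\<integral>t. g t * indicator {r<..s} t \<partial>lebesgue_on {c..d})"
  proof (rule integral_dominated_convergence)
    show "integrable (lebesgue_on {c..d}) (\<lambda>t. \<bar>g t\<bar>)" using gi by simp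
    show "AE t in lebesgue_on {c..d}. (\<lambda>n. g t * ?p n t) \<longlonglongrightarrow> g t * indicator {r<..s} t"
      by (intro AE_I2 tendsto_mult tendsto_const plateau_tendsto e0 elim rs)
    show "AE t in lebesgue_on {c..d}. norm (g t * ?p n t) \<le> \<bar>g t\<bar>" for n
      using abs_plateau_le by (intro AE_I2) (simp add: abs_mult mult_left_le)
    have "{r<..s} \<subseteq> {c..d}" using c d by auto
    then have "indicator {r<..s} \<in> borel_measurable (lebesgue_on {c..d})"
      by (intro borel_measurable_indicator) (simp add: sets_restrict_space_iff)
    then show "(\<lambda>t. g t * indicator {r<..s} t) \<in> borel_measurable (lebesgue_on {c..d})"
      using gi by (intro borel_measurable_times) auto
    show "(\<lambda>t. g t * ?p n t) \<in> borel_measurable (lebesgue_on {c..d})" for n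
      using gi pm by (intro borel_measurable_times) auto
  qed
  moreover have "(\<integral>t. g t * indicator {r<..s} t \<partial>lebesgue_on {c..d}) = (\<integral>t. g t \<partial>lebesgue_on {r..s})"
  proof -
    have "(\<integral>t. g t * indicator {r<..s} t \<partial>lebesgue_on {c..d}) = (\<integral>t. g t * indicator {r<..s} t \<partial>lebesgue_on {r<..s})"
      by (rule integral_lebesgue_on_zero_outside) (use c d in \<open>auto simp: indicator_def\<close>)
    also have "\<dots> = (\<integral>t. g t \<partial>lebesgue_on {r<..s})"
      by (rule Bochner_Integration.integral_cong) auto
    also have "\<dots> = (\<integral>t. g t \<partial>lebesgue_on {r..s})"
    proof -
      have "AE t in lebesgue. t \<noteq> r"
        using AE_not_in[of "{r}" lebesgue] by (simp add: negligible_iff_null_sets[symmetric])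
      then have ae: "AE t in lebesgue. indicator {r<..s} t *\<^sub>R g t = indicator {r..s} t *\<^sub>R g t"
        by eventually_elim (auto simp: indicator_def)
      have m: "(\<lambda>t. indicator {r..s} t *\<^sub>R g t) \<in> borel_measurable lebesgue"
      proof -
        have "{r..s} \<subseteq> {c..d}" using c d by auto
        then have "g \<in> borel_measurable (lebesgue_on {r..s})"
          using measurable_restrict_mono[OF borel_measurable_integrable[OF gi]] by blast
        then show ?thesis
          by (simp add: borel_measurable_restrict_space_iff)
      qed
      then have "(\<lambda>t. indicator {r<..s} t *\<^sub>R g t) \<in> borel_measurable lebesgue"
        by (rule borel_measurable_AE) (use ae in \<open>auto elim: eventually_mono\<close>)
      then show ?thesis
        using ae m by (simp add: integral_restrict_space) (rule integral_cong_AE; auto)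
    qed
    finally show ?thesis .
  qed
  ultimately have "(\<lambda>n. - (\<integral>t. g t * ?p n t \<partial>lebesgue_on {c..d})) \<longlonglongrightarrow> - (\<integral>t. g t \<partial>lebesgue_on {r..s})"
    using tendsto_minus by metis
  then have "\<alpha> r - \<alpha> s = - (\<integral>t. g t \<partial>lebesgue_on {r..s})"
    using 1 LIMSEQ_unique by blast
  then show ?thesis by simp
qed

section \<open>Energy inequalities for a system of dissipative modes\<close>

text \<open>The square of the integral of \<open>g\<close> is a double integral over a square. The
  diagonal splits it into two triangles, and Fubini turns each of them into the integral of
  \<open>(\<alpha> t - \<alpha> r) * g t\<close>. No pointwise derivative of \<open>\<alpha>\<close>
  is involved.\<close>

lemma square_increment_real:
  fixes \<alpha> g :: "real \<Rightarrow> real"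
  assumes g: "integrable (lebesgue_on {r..s}) g" and rs: "r \<le> s"
    and inc: "\<And>t. r \<le> t \<Longrightarrow> t \<le> s \<Longrightarrow> \<alpha> t = \<alpha> r + (\<integral>\<tau>. g \<tau> \<partial>lebesgue_on {r..t})"
  shows "(\<alpha> s)\<^sup>2 - (\<alpha> r)\<^sup>2 = 2 * (\<integral>t. \<alpha> t * g t \<partial>lebesgue_on {r..s})"
    and "integrable (lebesgue_on {r..s}) (\<lambda>t. \<alpha> t * g t)"
proof -
  define M where "M = lebesgue_on {r..s}"
  interpret M: finite_measure M
    unfolding M_def by standard (simp add: emeasure_restrict_space emeasure_lborel_Icc_eq)
  interpret P: pair_sigma_finite M M ..
  have [measurable]: "g \<in> borel_measurable M" and gi: "integrable M g"
    using g by (auto simp: M_def)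
  have [measurable]: "(\<lambda>x. x) \<in> borel_measurable M"
    unfolding M_def by (intro continuous_imp_measurable_on_sets_lebesgue continuous_on_id) simp
  define h where "h = (\<lambda>(\<tau>, t). indicator {..t} \<tau> * (g \<tau> * g t))"
  define h' where "h' = (\<lambda>(\<tau>, t). indicator {t<..} \<tau> * (g \<tau> * g t))"
  have ind: "indicator {..t} \<tau> = (if \<tau> \<le> t then 1 else (0::real))" "indicator {t<..} \<tau> = (if t < \<tau> then 1 else (0::real))" for t \<tau> :: real
    by (auto simp: indicator_def)
  have hm [measurable]: "h \<in> borel_measurable (M \<Otimes>\<^sub>M M)" "h' \<in> borel_measurable (M \<Otimes>\<^sub>M M)"
    unfolding h_def h'_def ind by measurable
  have gg: "integrable (M \<Otimes>\<^sub>M M) (\<lambda>(\<tau>, t). g \<tau> * g t)"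
  proof (rule P.Fubini_integrable)
    show "AE x in M. integrable M (\<lambda>y. case (x, y) of (\<tau>, t) \<Rightarrow> g \<tau> * g t)" using gi by simp
    show "integrable M (\<lambda>x. \<integral>y. norm (case (x, y) of (\<tau>, t) \<Rightarrow> g \<tau> * g t) \<partial>M)"
      using gi by (simp add: abs_mult)
  qed measurable
  have hi: "integrable (M \<Otimes>\<^sub>M M) h" "integrable (M \<Otimes>\<^sub>M M) h'"
    by (rule Bochner_Integration.integrable_bound[OF gg]; auto simp: h_def h'_def indicator_def)+
  have inner: "(\<integral>\<tau>. indicator {..t} \<tau> * (g \<tau> * g t) \<partial>M) = (\<alpha> t - \<alpha> r) * g t" if "t \<in> {r..s}" for t
  proof -
    have "(\<integral>\<tau>. indicator {..t} \<tau> * (g \<tau> * g t) \<partial>M) = (\<integral>\<tau>. (indicator {..t} \<tau> * g \<tau>) * g t \<partial>M)"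
      by (simp add: mult.assoc)
    also have "\<dots> = (\<integral>\<tau>. indicator {..t} \<tau> * g \<tau> \<partial>M) * g t" by simp
    also have "(\<integral>\<tau>. indicator {..t} \<tau> * g \<tau> \<partial>M) = (\<integral>\<tau>. indicator {..t} \<tau> * g \<tau> \<partial>lebesgue_on {r..t})"
      unfolding M_def by (rule integral_lebesgue_on_zero_outside) (use that in auto)
    also have "\<dots> = (\<integral>\<tau>. g \<tau> \<partial>lebesgue_on {r..t})"
      by (rule Bochner_Integration.integral_cong) auto
    finally show ?thesis using inc[of t] that by simp
  qed
  \<comment> \<open>The triangle \<open>t < \<tau>\<close> is open along the diagonal while the
    formula for the other one is closed; the single point \<open>t = \<tau>\<close> is a null
    set.\<close>
  have inner': "(\<integral>t. indicator {t<..} \<tau> * (g \<tau> * g t) \<partial>M) = (\<alpha> \<tau> - \<alpha> r) * g \<tau>" if \<tau>: "\<tau> \<in> {r..s}" for \<tau>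
  proof -
    have "AE t in lebesgue. t \<noteq> \<tau>"
      using AE_not_in[of "{\<tau>}" lebesgue] by (simp add: negligible_iff_null_sets[symmetric])
    then have "AE t in M. t \<noteq> \<tau>"
      unfolding M_def by (auto simp: AE_restrict_space_iff elim: eventually_mono)
    then have "AE t in M. indicator {t<..} \<tau> * (g \<tau> * g t) = indicator {..\<tau>} t * (g t * g \<tau>)"
      by eventually_elim (auto simp: indicator_def)
    then have "(\<integral>t. indicator {t<..} \<tau> * (g \<tau> * g t) \<partial>M) = (\<integral>t. indicator {..\<tau>} t * (g t * g \<tau>) \<partial>M)"
      unfolding ind by (rule integral_cong_AE[rotated 2]) measurable
    then show ?thesis using inner[OF \<tau>] by simp
  qed
  have sp: "space M = {r..s}" by (simp add: M_def)
  have I: "(\<integral>z. h z \<partial>(M \<Otimes>\<^sub>M M)) = (\<integral>t. (\<alpha> t - \<alpha> r) * g t \<partial>M)"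
  proof -
    have "(\<integral>z. h z \<partial>(M \<Otimes>\<^sub>M M)) = (\<integral>t. \<integral>\<tau>. h (\<tau>, t) \<partial>M \<partial>M)"
      using P.integral_snd[of "\<lambda>\<tau> t. h (\<tau>, t)"] hi(1) by (simp add: split_beta')
    also have "\<dots> = (\<integral>t. (\<alpha> t - \<alpha> r) * g t \<partial>M)"
      by (rule Bochner_Integration.integral_cong) (auto simp: h_def inner sp)
    finally show ?thesis .
  qed
  have I': "(\<integral>z. h' z \<partial>(M \<Otimes>\<^sub>M M)) = (\<integral>t. (\<alpha> t - \<alpha> r) * g t \<partial>M)"
  proof -
    have "(\<integral>z. h' z \<partial>(M \<Otimes>\<^sub>M M)) = (\<integral>\<tau>. \<integral>t. h' (\<tau>, t) \<partial>M \<partial>M)"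
      using P.integral_fst'[OF hi(2)] by simp
    also have "\<dots> = (\<integral>t. (\<alpha> t - \<alpha> r) * g t \<partial>M)"
      by (rule Bochner_Integration.integral_cong) (auto simp: h'_def inner' sp)
    finally show ?thesis .
  qed
  have "(\<integral>z. h z + h' z \<partial>(M \<Otimes>\<^sub>M M)) = (\<integral>z. (case z of (\<tau>, t) \<Rightarrow> g \<tau> * g t) \<partial>(M \<Otimes>\<^sub>M M))"
    by (rule Bochner_Integration.integral_cong) (auto simp: h_def h'_def indicator_def)
  also have "\<dots> = (\<integral>\<tau>. \<integral>t. g \<tau> * g t \<partial>M \<partial>M)"
    using P.integral_fst'[OF gg] by simp
  also have "\<dots> = (\<integral>t. g t \<partial>M)\<^sup>2"
    by (simp add: power2_eq_square)
  finally have sum: "2 * (\<integral>t. (\<alpha> t - \<alpha> r) * g t \<partial>M) = (\<integral>t. g t \<partial>M)\<^sup>2"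
    using hi I I' by simp
  have di: "integrable M (\<lambda>t. (\<alpha> t - \<alpha> r) * g t)"
  proof -
    have "integrable M (\<lambda>t. \<integral>\<tau>. h (\<tau>, t) \<partial>M)"
      using P.integrable_snd[of "\<lambda>\<tau> t. h (\<tau>, t)"] hi(1) by (simp add: split_beta')
    then show ?thesis
      by (rule Bochner_Integration.integrable_cong[THEN iffD1, rotated -1]) (auto simp: h_def inner sp)
  qed
  then have "integrable M (\<lambda>t. (\<alpha> t - \<alpha> r) * g t + \<alpha> r * g t)" using gi by simp
  then show ai: "integrable (lebesgue_on {r..s}) (\<lambda>t. \<alpha> t * g t)"
    by (simp add: M_def algebra_simps)
  have "(\<integral>t. (\<alpha> t - \<alpha> r) * g t \<partial>M) = (\<integral>t. \<alpha> t * g t \<partial>M) - \<alpha> r * (\<integral>t. g t \<partial>M)"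
    unfolding left_diff_distrib using ai gi by (simp add: M_def)
  moreover have "\<alpha> s = \<alpha> r + (\<integral>t. g t \<partial>M)" using inc[of s] rs by (simp add: M_def)
  ultimately show "(\<alpha> s)\<^sup>2 - (\<alpha> r)\<^sup>2 = 2 * (\<integral>t. \<alpha> t * g t \<partial>lebesgue_on {r..s})"
    using sum by (simp add: M_def power2_eq_square algebra_simps)
qed

lemma square_increment:
  fixes a g :: "real \<Rightarrow> 'b::euclidean_space"
  assumes g: "integrable (lebesgue_on {r..s}) g" and rs: "r \<le> s"
    and inc: "\<And>t. r \<le> t \<Longrightarrow> t \<le> s \<Longrightarrow> a t = a r + (\<integral>\<tau>. g \<tau> \<partial>lebesgue_on {r..t})"
  shows "(norm (a s))\<^sup>2 - (norm (a r))\<^sup>2 = 2 * (\<integral>t. a t \<bullet> g t \<partial>lebesgue_on {r..s})"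
    and "integrable (lebesgue_on {r..s}) (\<lambda>t. a t \<bullet> g t)"
proof -
  have comp: "(a s \<bullet> b)\<^sup>2 - (a r \<bullet> b)\<^sup>2 = 2 * (\<integral>t. (a t \<bullet> b) * (g t \<bullet> b) \<partial>lebesgue_on {r..s})"
    and int: "integrable (lebesgue_on {r..s}) (\<lambda>t. (a t \<bullet> b) * (g t \<bullet> b))" for b
  proof -
    have gb: "integrable (lebesgue_on {r..s}) (\<lambda>t. g t \<bullet> b)" using g by simp
    have incb: "a t \<bullet> b = a r \<bullet> b + (\<integral>\<tau>. g \<tau> \<bullet> b \<partial>lebesgue_on {r..t})" if "r \<le> t" "t \<le> s" for t
    proof -
      have "integrable (lebesgue_on {r..t}) g"
        by (rule integrable_lebesgue_on_subset[OF g]) (use that in auto)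
      then show ?thesis using inc[OF that] by (simp add: inner_add_left)
    qed
    show "(a s \<bullet> b)\<^sup>2 - (a r \<bullet> b)\<^sup>2 = 2 * (\<integral>t. (a t \<bullet> b) * (g t \<bullet> b) \<partial>lebesgue_on {r..s})"
      by (rule square_increment_real(1)[where \<alpha> = "\<lambda>t. a t \<bullet> b", OF gb rs incb])
    show "integrable (lebesgue_on {r..s}) (\<lambda>t. (a t \<bullet> b) * (g t \<bullet> b))"
      by (rule square_increment_real(2)[where \<alpha> = "\<lambda>t. a t \<bullet> b", OF gb rs incb])
  qed
  have e: "a t \<bullet> g t = (\<Sum>b\<in>Basis. (a t \<bullet> b) * (g t \<bullet> b))" for t
    by (rule euclidean_inner)
  show "integrable (lebesgue_on {r..s}) (\<lambda>t. a t \<bullet> g t)"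
    unfolding e using int by simp
  have n: "(norm x)\<^sup>2 = (\<Sum>b\<in>Basis. (x \<bullet> b)\<^sup>2)" for x :: 'b
    unfolding power2_norm_eq_inner by (subst euclidean_inner) (simp add: power2_eq_square)
  have "(norm (a s))\<^sup>2 - (norm (a r))\<^sup>2 = (\<Sum>b\<in>Basis. (a s \<bullet> b)\<^sup>2 - (a r \<bullet> b)\<^sup>2)"
    unfolding n by (simp add: sum_subtractf)
  also have "\<dots> = 2 * (\<integral>t. a t \<bullet> g t \<partial>lebesgue_on {r..s})"
    unfolding e comp using int by (simp add: sum_distrib_left)
  finally show "(norm (a s))\<^sup>2 - (norm (a r))\<^sup>2 = 2 * (\<integral>t. a t \<bullet> g t \<partial>lebesgue_on {r..s})" .
qed

lemma integral_lebesgue_on_combine: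
  fixes K :: "real \<Rightarrow> real"
  assumes "integrable (lebesgue_on {p..s}) K" "p \<le> r" "r \<le> s"
  shows "(\<integral>t. K t \<partial>lebesgue_on {p..s}) = (\<integral>t. K t \<partial>lebesgue_on {p..r}) + (\<integral>t. K t \<partial>lebesgue_on {r..s})"
proof -
  have "integrable (lebesgue_on {p..r}) K" "integrable (lebesgue_on {r..s}) K"
    by (rule integrable_lebesgue_on_subset[OF assms(1)]; use assms in auto)+
  moreover have "K integrable_on {p..s}"
    by (rule integrable_on_lebesgue_on[OF assms(1)]) simp
  ultimately show ?thesis
    using assms by (simp add: lebesgue_integral_eq_integral Henstock_Kurzweil_Integration.integral_combine)
qed

section \<open>Gronwall's lemma near the final time\<close>

text \<open>At a suitable \<open>r\<close> the bounded primitive of \<open>K\<close> comes within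
  \<open>1 / 2\<close> of its supremum over the whole interval, so later increments cannot exceed
  \<open>1 / 2\<close>.\<close>

lemma small_tail:
  fixes K :: "real \<Rightarrow> real"
  assumes int: "\<And>s. p \<le> s \<Longrightarrow> s < T \<Longrightarrow> integrable (lebesgue_on {p..s}) K" and "p < T"
    and bound: "\<And>s. p \<le> s \<Longrightarrow> s < T \<Longrightarrow> (\<integral>t. K t \<partial>lebesgue_on {p..s}) \<le> c"
  shows "\<exists>r. p \<le> r \<and> r < T \<and> (\<forall>s. r \<le> s \<and> s < T \<longrightarrow> (\<integral>t. K t \<partial>lebesgue_on {r..s}) \<le> 1 / 2)"
proof -
  let ?\<Phi> = "\<lambda>s. \<integral>t. K t \<partial>lebesgue_on {p..s}"
  have bdd: "bdd_above (?\<Phi> ` {p..<T})" using bound by (intro bdd_aboveI[of _ c]) auto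
  have ne: "?\<Phi> ` {p..<T} \<noteq> {}" using \<open>p < T\<close> by auto
  have "Sup (?\<Phi> ` {p..<T}) - 1 / 2 < Sup (?\<Phi> ` {p..<T})" by simp
  then obtain r where r: "r \<in> {p..<T}" "Sup (?\<Phi> ` {p..<T}) - 1 / 2 < ?\<Phi> r"
    using less_cSup_iff[OF ne bdd] by auto
  have "(\<integral>t. K t \<partial>lebesgue_on {r..s}) \<le> 1 / 2" if "r \<le> s" "s < T" for s
  proof -
    have "?\<Phi> s = ?\<Phi> r + (\<integral>t. K t \<partial>lebesgue_on {r..s})"
      using r that int[of s] by (intro integral_lebesgue_on_combine) auto
    moreover have "?\<Phi> s \<le> Sup (?\<Phi> ` {p..<T})"
      using r that by (intro cSup_upper bdd) auto
    ultimately show ?thesis using r(2) by linarith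
  qed
  then show ?thesis using r by auto
qed

text \<open>
  Since \<open>K\<close> has integral at most one half, no exponential is needed: the supremum of \<open>\<phi>\<close> absorbs
  the integral term.
\<close>

lemma gronwall_small:
  fixes \<phi> K :: "real \<Rightarrow> real"
  assumes K0: "\<And>t. r \<le> t \<Longrightarrow> t < T \<Longrightarrow> K t \<ge> 0"
    and Kint: "\<And>s. r \<le> s \<Longrightarrow> s < T \<Longrightarrow> integrable (lebesgue_on {r..s}) K"
    and K: "\<And>s. r \<le> s \<Longrightarrow> s < T \<Longrightarrow> (\<integral>t. K t \<partial>lebesgue_on {r..s}) \<le> 1 / 2"
    and \<phi>0: "\<And>t. r \<le> t \<Longrightarrow> t < T \<Longrightarrow> \<phi> t \<ge> 0"
    and \<phi>b: "\<And>s. r \<le> s \<Longrightarrow> s < T \<Longrightarrow> \<exists>M. \<forall>t. r \<le> t \<and> t \<le> s \<longrightarrow> \<phi> t \<le> M"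
    and int: "\<And>s. r \<le> s \<Longrightarrow> s < T \<Longrightarrow> integrable (lebesgue_on {r..s}) (\<lambda>t. K t * \<phi> t)"
    and ineq: "\<And>s. r \<le> s \<Longrightarrow> s < T \<Longrightarrow> \<phi> s \<le> A + (\<integral>t. K t * \<phi> t \<partial>lebesgue_on {r..s})"
    and s: "r \<le> s" "s < T"
  shows "\<phi> s \<le> 2 * A" "(\<integral>t. K t * \<phi> t \<partial>lebesgue_on {r..s}) \<le> A"
proof -
  define S where "S = Sup (\<phi> ` {r..s})"
  obtain M where M: "\<And>t. r \<le> t \<Longrightarrow> t \<le> s \<Longrightarrow> \<phi> t \<le> M" using \<phi>b[OF s] by blast
  have bdd: "bdd_above (\<phi> ` {r..s})" using M by (intro bdd_aboveI[of _ M]) auto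
  have S: "\<phi> t \<le> S" if "r \<le> t" "t \<le> s" for t
    unfolding S_def using that bdd by (intro cSup_upper) auto
  have S0: "S \<ge> 0" using S[of r] \<phi>0[of r] s by auto
  have le: "(\<integral>t. K t * \<phi> t \<partial>lebesgue_on {r..t}) \<le> S / 2" if t: "r \<le> t" "t \<le> s" for t
  proof -
    have "(\<integral>t. K t * \<phi> t \<partial>lebesgue_on {r..t}) \<le> (\<integral>t. K t * S \<partial>lebesgue_on {r..t})"
      using t s K0 S by (intro integral_mono int integrable_mult_left Kint mult_left_mono) auto
    also have "\<dots> = (\<integral>t. K t \<partial>lebesgue_on {r..t}) * S" by simp
    also have "\<dots> \<le> 1 / 2 * S" using t s S0 by (intro mult_right_mono K) auto
    finally show ?thesis by simp
  qed
  have "S \<le> A + S / 2"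
    unfolding S_def
  proof (rule cSup_least)
    show "\<phi> ` {r..s} \<noteq> {}" using s by auto
    fix y assume "y \<in> \<phi> ` {r..s}"
    then obtain t where t: "y = \<phi> t" "r \<le> t" "t \<le> s" by auto
    then show "y \<le> A + Sup (\<phi> ` {r..s}) / 2"
      using ineq[of t] le[of t] s by (simp add: S_def)
  qed
  then show "\<phi> s \<le> 2 * A" "(\<integral>t. K t * \<phi> t \<partial>lebesgue_on {r..s}) \<le> A"
    using S[of s] le[of s] s by auto
qed

text \<open>
  In the application, \<open>a\<close> and \<open>F\<close> are the Hartley coefficients of \<open>u\<close> and of \<open>(u \<cdot> \<nabla>) u\<close>, \<open>\<mu>\<close> lists the
  eigenvalues of the negative Laplacian, and \<open>d\<close> is the squared \<open>L\<^sup>2\<close> norm of the divergence of \<open>u\<close>.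
\<close>

locale dissipative_modes =
  fixes a F :: "nat \<Rightarrow> real \<Rightarrow> 'b::euclidean_space" and \<mu> :: "nat \<Rightarrow> real"
    and d :: "real \<Rightarrow> real" and lam C T0 T :: real
  assumes T: "T0 < T" and C: "C \<ge> 0" and \<mu>: "\<And>n. \<mu> n \<ge> 0" and lam: "lam > 0"
    and cont: "\<And>n. continuous_on {T0<..<T} (a n)"
    and F_int: "\<And>n r s. T0 < r \<Longrightarrow> r \<le> s \<Longrightarrow> s < T \<Longrightarrow> integrable (lebesgue_on {r..s}) (F n)"
    and mode: "\<And>n r s. T0 < r \<Longrightarrow> r \<le> s \<Longrightarrow> s < T \<Longrightarrow>
      a n s - a n r = (\<integral>t. (lam * \<mu> n - (\<mu> n)\<^sup>2) *\<^sub>R a n t - F n t \<partial>lebesgue_on {r..s})"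
    and local_bound: "\<And>T'. T' < T \<Longrightarrow>
      \<exists>M. \<forall>t N. T0 < t \<and> t < T' \<longrightarrow> (\<Sum>n<N. (1 + (\<mu> n)\<^sup>2) * (norm (a n t))\<^sup>2) \<le> M"
    and F_bound: "AE t in lebesgue_on {T0<..<T}. \<forall>c.
      (\<forall>N. (\<Sum>n<N. (1 + (\<mu> n)\<^sup>2) * (norm (a n t))\<^sup>2) \<le> c) \<longrightarrow> (\<forall>N. (\<Sum>n<N. (norm (F n t))\<^sup>2) \<le> C * c\<^sup>2)"
    and F_pairing: "AE t in lebesgue_on {T0<..<T}. \<forall>E P.
      (\<forall>N. (\<Sum>n<N. (norm (a n t))\<^sup>2) \<le> E) \<longrightarrow> (\<forall>N. (\<Sum>n<N. (1 + (\<mu> n)\<^sup>2) * (norm (a n t))\<^sup>2) \<le> P) \<longrightarrow>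
      (\<exists>B. (\<lambda>n. F n t \<bullet> a n t) sums B \<and> 2 * \<bar>B\<bar> \<le> (P + C * E * d t) / 2)"
    and d: "integrable (lebesgue_on {T0<..<T}) d" "\<And>t. d t \<ge> 0"
begin

text \<open>Up to a volume factor, \<open>E\<close> and \<open>D\<close> are the squared L2 norms of
  \<open>u\<close> and of its Laplacian. The corresponding quantity for the bilaplacian occurs only
  as a finite sum \<open>ZN\<close>: the local bound controls the weight
  \<open>1 + (\<mu> n)\<^sup>2\<close> alone, so the full series may diverge at individual
  times.\<close>

abbreviation "E t \<equiv> \<Sum>n. (norm (a n t))\<^sup>2"
abbreviation "D t \<equiv> \<Sum>n. (\<mu> n)\<^sup>2 * (norm (a n t))\<^sup>2"
abbreviation "EN N t \<equiv> \<Sum>n<N. (norm (a n t))\<^sup>2"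
abbreviation "DN N t \<equiv> \<Sum>n<N. (\<mu> n)\<^sup>2 * (norm (a n t))\<^sup>2"
abbreviation "ZN N t \<equiv> \<Sum>n<N. (\<mu> n)^4 * (norm (a n t))\<^sup>2"

lemma ED_bound:
  assumes "s < T"
  shows "\<exists>M\<ge>0. \<forall>t. T0 < t \<and> t \<le> s \<longrightarrow> (\<forall>N. EN N t + DN N t \<le> M)"
proof -
  obtain s' where s': "s < s'" "s' < T" using dense assms by blast
  obtain M where M: "\<And>t N. T0 < t \<Longrightarrow> t < s' \<Longrightarrow> (\<Sum>n<N. (1 + (\<mu> n)\<^sup>2) * (norm (a n t))\<^sup>2) \<le> M"
    using local_bound[OF s'(2)] by blast
  have "EN N t + DN N t \<le> max 0 M" if "T0 < t" "t \<le> s" for t N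
    using M[of t N] that s' by (simp add: distrib_right sum.distrib)
  then show ?thesis by (intro exI[of _ "max 0 M"]) auto
qed

lemma nonneg: "0 \<le> EN N t" "0 \<le> DN N t" "0 \<le> ZN N t"
  using \<mu> by (auto intro!: sum_nonneg)

lemma summable_ED:
  assumes "T0 < t" "t < T"
  shows "summable (\<lambda>n. (norm (a n t))\<^sup>2)" "summable (\<lambda>n. (\<mu> n)\<^sup>2 * (norm (a n t))\<^sup>2)"
proof -
  obtain M where M: "\<And>N. EN N t + DN N t \<le> M" using ED_bound[OF assms(2)] assms(1) by blast
  have "EN N t \<le> M" "DN N t \<le> M" for N
    using M[of N] nonneg(1)[where N=N and t=t] nonneg(2)[where N=N and t=t] by auto
  then show "summable (\<lambda>n. (norm (a n t))\<^sup>2)" "summable (\<lambda>n. (\<mu> n)\<^sup>2 * (norm (a n t))\<^sup>2)"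
    by (auto intro!: summableI_nonneg_bounded[where x=M])
qed

lemma ED_tendsto:
  assumes "T0 < t" "t < T"
  shows "(\<lambda>N. EN N t) \<longlonglongrightarrow> E t" "(\<lambda>N. DN N t) \<longlonglongrightarrow> D t"
  using summable_ED[OF assms] by (auto intro: summable_LIMSEQ)

lemma ED_le:
  assumes "T0 < t" "t < T"
  shows "EN N t \<le> E t" "DN N t \<le> D t" "0 \<le> E t" "0 \<le> D t"
  using summable_ED[OF assms] by (auto intro!: sum_le_suminf suminf_nonneg)

lemma ED_le_M:
  assumes "s < T"
  shows "\<exists>M\<ge>0. \<forall>t. T0 < t \<and> t \<le> s \<longrightarrow> E t \<le> M \<and> D t \<le> M"
proof -
  obtain M where M: "M \<ge> 0" "\<And>t N. T0 < t \<Longrightarrow> t \<le> s \<Longrightarrow> EN N t + DN N t \<le> M"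
    using ED_bound[OF assms] by blast
  have "E t \<le> M \<and> D t \<le> M" if t: "T0 < t" "t \<le> s" for t
  proof -
    have "EN N t \<le> M" "DN N t \<le> M" for N
      using M(2)[OF t, of N] nonneg(1)[where N=N and t=t] nonneg(2)[where N=N and t=t] by auto
    then show ?thesis
      using ED_tendsto[of t] t assms by (auto intro: LIMSEQ_le_const2)
  qed
  then show ?thesis using M(1) by blast
qed

lemma a_measurable:
  assumes "T0 < r" "s < T" shows "a n \<in> borel_measurable (lebesgue_on {r..s})"
proof (rule continuous_imp_measurable_on_sets_lebesgue)
  show "continuous_on {r..s} (a n)" using assms by (intro continuous_on_subset[OF cont]) auto
qed simp

lemma finite_measure_Icc: "finite_measure (lebesgue_on {r..s::real})"
  by standard (simp add: emeasure_restrict_space emeasure_lborel_Icc_eq)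

lemma bounded_integrable:
  fixes f :: "real \<Rightarrow> real"
  assumes "f \<in> borel_measurable (lebesgue_on {r..s})" "\<And>t. r \<le> t \<Longrightarrow> t \<le> s \<Longrightarrow> \<bar>f t\<bar> \<le> M"
  shows "integrable (lebesgue_on {r..s}) f"
  by (rule finite_measure.integrable_const_bound[OF finite_measure_Icc, where B=M]) (use assms in auto)

lemma ED_integrable:
  assumes "T0 < r" "s < T"
  shows "integrable (lebesgue_on {r..s}) E" "integrable (lebesgue_on {r..s}) D"
    "integrable (lebesgue_on {r..s}) (\<lambda>t. (D t)\<^sup>2)" "integrable (lebesgue_on {r..s}) (\<lambda>t. (E t + D t)\<^sup>2)"
    "integrable (lebesgue_on {r..s}) (EN N)" "integrable (lebesgue_on {r..s}) (DN N)"
    "integrable (lebesgue_on {r..s}) (ZN N)" "integrable (lebesgue_on {r..s}) (\<lambda>t. (norm (a n t))\<^sup>2)"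
    "E \<in> borel_measurable (lebesgue_on {r..s})" "D \<in> borel_measurable (lebesgue_on {r..s})"
proof -
  note [measurable] = a_measurable[OF assms]
  show m [measurable]: "E \<in> borel_measurable (lebesgue_on {r..s})" "D \<in> borel_measurable (lebesgue_on {r..s})"
    by measurable
  obtain M where M: "M \<ge> 0" "\<And>t. T0 < t \<Longrightarrow> t \<le> s \<Longrightarrow> E t \<le> M \<and> D t \<le> M"
    using ED_le_M[OF assms(2)] by blast
  have b: "0 \<le> E t" "E t \<le> M" "0 \<le> D t" "D t \<le> M" if "r \<le> t" "t \<le> s" for t
    using M(2)[of t] ED_le(3,4)[of t] that assms by auto
  show "integrable (lebesgue_on {r..s}) E" "integrable (lebesgue_on {r..s}) D"
    using b by (auto intro!: bounded_integrable[of _ _ _ M])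
  show "integrable (lebesgue_on {r..s}) (\<lambda>t. (D t)\<^sup>2)"
    using b by (intro bounded_integrable[of _ _ _ "M\<^sup>2"]) (auto intro!: power_mono)
  show "integrable (lebesgue_on {r..s}) (\<lambda>t. (E t + D t)\<^sup>2)"
  proof (rule bounded_integrable)
    show "\<bar>(E t + D t)\<^sup>2\<bar> \<le> (M + M)\<^sup>2" if "r \<le> t" "t \<le> s" for t
      unfolding abs_power2 using b[OF that] by (intro power_mono add_mono) auto
  qed measurable
  show n: "integrable (lebesgue_on {r..s}) (\<lambda>t. (norm (a n t))\<^sup>2)" for n
    by (intro continuous_imp_integrable_real continuous_intros continuous_on_subset[OF cont]) (use assms in auto)
  show "integrable (lebesgue_on {r..s}) (EN N)" "integrable (lebesgue_on {r..s}) (DN N)"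
    "integrable (lebesgue_on {r..s}) (ZN N)"
    using n by auto
qed

text \<open>\<open>square_increment\<close> applied to one mode: the linear part of its derivative
  contributes a multiple of the squared norm, the nonlinear part the pairing with
  \<open>F n\<close>.\<close>

lemma mode_energy:
  assumes rs: "T0 < r" "r \<le> s" "s < T"
  shows "(norm (a n s))\<^sup>2 + 2 * ((\<mu> n)\<^sup>2 - lam * \<mu> n) * (\<integral>t. (norm (a n t))\<^sup>2 \<partial>lebesgue_on {r..s})
      = (norm (a n r))\<^sup>2 - 2 * (\<integral>t. F n t \<bullet> a n t \<partial>lebesgue_on {r..s})"
    and "integrable (lebesgue_on {r..s}) (\<lambda>t. F n t \<bullet> a n t)"
proof -
  let ?g = "\<lambda>t. (lam * \<mu> n - (\<mu> n)\<^sup>2) *\<^sub>R a n t - F n t"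
  have ai: "integrable (lebesgue_on {r..s}) (a n)"
    by (intro continuous_imp_integrable_real continuous_on_subset[OF cont]) (use rs in auto)
  have g: "integrable (lebesgue_on {r..s}) ?g"
    using ai F_int[OF rs] by simp
  have inc: "a n t = a n r + (\<integral>\<tau>. ?g \<tau> \<partial>lebesgue_on {r..t})" if "r \<le> t" "t \<le> s" for t
    using mode[of r t n] that rs by (simp add: algebra_simps)
  have sq: "(norm (a n s))\<^sup>2 - (norm (a n r))\<^sup>2 = 2 * (\<integral>t. a n t \<bullet> ?g t \<partial>lebesgue_on {r..s})"
    and i: "integrable (lebesgue_on {r..s}) (\<lambda>t. a n t \<bullet> ?g t)"
    by (rule square_increment[OF g rs(2) inc]; simp)+
  have e: "F n t \<bullet> a n t = (lam * \<mu> n - (\<mu> n)\<^sup>2) * (norm (a n t))\<^sup>2 - a n t \<bullet> ?g t" for t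
    by (simp add: inner_diff_right power2_norm_eq_inner inner_commute)
  have ni: "integrable (lebesgue_on {r..s}) (\<lambda>t. (norm (a n t))\<^sup>2)" using ED_integrable(8) rs by blast
  then show "integrable (lebesgue_on {r..s}) (\<lambda>t. F n t \<bullet> a n t)"
    unfolding e using i by simp
  have "(\<integral>t. F n t \<bullet> a n t \<partial>lebesgue_on {r..s})
      = (lam * \<mu> n - (\<mu> n)\<^sup>2) * (\<integral>t. (norm (a n t))\<^sup>2 \<partial>lebesgue_on {r..s}) - (\<integral>t. a n t \<bullet> ?g t \<partial>lebesgue_on {r..s})"
    unfolding e using i ni by simp
  then show "(norm (a n s))\<^sup>2 + 2 * ((\<mu> n)\<^sup>2 - lam * \<mu> n) * (\<integral>t. (norm (a n t))\<^sup>2 \<partial>lebesgue_on {r..s})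
      = (norm (a n r))\<^sup>2 - 2 * (\<integral>t. F n t \<bullet> a n t \<partial>lebesgue_on {r..s})"
    using sq by (simp add: algebra_simps)
qed

lemma AE_Icc:
  assumes "AE t in lebesgue_on {T0<..<T}. P t" "T0 < r" "s < T"
  shows "AE t in lebesgue_on {r..s}. P t"
  by (rule AE_lebesgue_on_subset[OF assms(1)]) (use assms in auto)

lemma F_bound_ED:
  assumes "T0 < r" "s < T"
  shows "AE t in lebesgue_on {r..s}. \<forall>N. (\<Sum>n<N. (norm (F n t))\<^sup>2) \<le> C * (E t + D t)\<^sup>2"
proof -
  have "AE t in lebesgue_on {r..s}. t \<in> {r..s}" by (auto intro: AE_I2)
  with AE_Icc[OF F_bound assms] show ?thesis
  proof eventually_elim
    case (elim t)
    have t: "T0 < t" "t < T" using elim(2) assms by auto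
    have "(\<Sum>n<N. (1 + (\<mu> n)\<^sup>2) * (norm (a n t))\<^sup>2) \<le> E t + D t" for N
      using ED_le(1,2)[OF t, of N] by (simp add: distrib_right sum.distrib)
    then show ?case using elim(1) by blast
  qed
qed

lemma F_pairing_ED:
  assumes "T0 < r" "s < T"
  shows "AE t in lebesgue_on {r..s}. (\<lambda>N. \<Sum>n<N. F n t \<bullet> a n t) \<longlonglongrightarrow> (\<Sum>n. F n t \<bullet> a n t)
    \<and> 2 * \<bar>\<Sum>n. F n t \<bullet> a n t\<bar> \<le> (E t + D t + C * E t * d t) / 2"
proof -
  have "AE t in lebesgue_on {r..s}. t \<in> {r..s}" by (auto intro: AE_I2)
  with AE_Icc[OF F_pairing assms] show ?thesis
  proof eventually_elim
    case (elim t)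
    have t: "T0 < t" "t < T" using elim(2) assms by auto
    have "(\<Sum>n<N. (1 + (\<mu> n)\<^sup>2) * (norm (a n t))\<^sup>2) \<le> E t + D t" for N
      using ED_le(1,2)[OF t, of N] by (simp add: distrib_right sum.distrib)
    moreover have "EN N t \<le> E t" for N by (rule ED_le(1)[OF t])
    ultimately obtain B where "(\<lambda>n. F n t \<bullet> a n t) sums B" "2 * \<bar>B\<bar> \<le> (E t + D t + C * E t * d t) / 2"
      using elim(1) by blast
    moreover from this(1) have "B = (\<Sum>n. F n t \<bullet> a n t)" by (rule sums_unique)
    ultimately show ?case by (simp add: sums_def)
  qed
qed

text \<open>The inequality is summed over finitely many modes and then passed to the limit. Of the
  dissipation \<open>2 * D\<close>, one copy of \<open>D\<close> pays for the destabilising linear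
  term and one half for the nonlinear pairing, leaving \<open>D / 2\<close> on the left.\<close>

lemma energy_inequality:
  assumes rs: "T0 < r" "r \<le> s" "s < T"
  shows "E s + (\<integral>t. D t \<partial>lebesgue_on {r..s}) / 2
    \<le> E r + (\<integral>t. (lam\<^sup>2 + 1 / 2 + C / 2 * d t) * E t \<partial>lebesgue_on {r..s})"
    and "integrable (lebesgue_on {r..s}) (\<lambda>t. (lam\<^sup>2 + 1 / 2 + C / 2 * d t) * E t)"
proof -
  let ?M = "lebesgue_on {r..s}"
  let ?I = "\<lambda>f :: real \<Rightarrow> real. \<integral>t. f t \<partial>?M"
  let ?BN = "\<lambda>N t. \<Sum>n<N. F n t \<bullet> a n t"
  let ?B = "\<lambda>t. \<Sum>n. F n t \<bullet> a n t"
  note ints = ED_integrable[OF rs(1) rs(3)]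
  have sT: "T0 < s" "r < T" using rs by auto
  obtain M where M: "M \<ge> 0" "\<And>t. T0 < t \<Longrightarrow> t \<le> s \<Longrightarrow> E t \<le> M \<and> D t \<le> M"
    using ED_le_M[OF rs(3)] by blast
  have ENM: "EN N t \<le> M" "DN N t \<le> M" if "t \<in> {r..s}" for t N
    using M(2)[of t] ED_le(1,2)[of t N] that rs by auto
  have "EN N s + ?I (DN N) \<le> EN N r + lam\<^sup>2 * ?I (EN N) - 2 * ?I (?BN N)" for N
  proof -
    have "(norm (a n s))\<^sup>2 + (\<mu> n)\<^sup>2 * ?I (\<lambda>t. (norm (a n t))\<^sup>2)
        \<le> (norm (a n r))\<^sup>2 + lam\<^sup>2 * ?I (\<lambda>t. (norm (a n t))\<^sup>2) - 2 * ?I (\<lambda>t. F n t \<bullet> a n t)" for n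
    proof -
      \<comment> \<open>Young's inequality gives \<open>2 * (\<mu>\<^sup>2 - lam * \<mu>) \<ge>
        \<mu>\<^sup>2 - lam\<^sup>2\<close>, so the instability costs only a multiple of
        \<open>E\<close>.\<close>
      have "2 * lam * \<mu> n \<le> lam\<^sup>2 + (\<mu> n)\<^sup>2" using sum_squares_bound[of lam "\<mu> n"] by simp
      then have "((\<mu> n)\<^sup>2 - lam\<^sup>2) * ?I (\<lambda>t. (norm (a n t))\<^sup>2)
          \<le> (2 * ((\<mu> n)\<^sup>2 - lam * \<mu> n)) * ?I (\<lambda>t. (norm (a n t))\<^sup>2)"
        by (intro mult_right_mono) auto
      then show ?thesis using mode_energy(1)[OF rs, of n] by (simp add: algebra_simps)
    qed
    then have "(\<Sum>n<N. (norm (a n s))\<^sup>2 + (\<mu> n)\<^sup>2 * ?I (\<lambda>t. (norm (a n t))\<^sup>2))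
        \<le> (\<Sum>n<N. (norm (a n r))\<^sup>2 + lam\<^sup>2 * ?I (\<lambda>t. (norm (a n t))\<^sup>2) - 2 * ?I (\<lambda>t. F n t \<bullet> a n t))"
      by (rule sum_mono)
    then show ?thesis
      using ints(8) mode_energy(2)[OF rs]
      by (simp add: sum.distrib sum_subtractf sum_distrib_left)
  qed
  moreover have "(\<lambda>N. EN N s + ?I (DN N)) \<longlonglongrightarrow> E s + ?I D"
  proof (intro tendsto_add ED_tendsto sT rs integral_dominated_convergence[where w="\<lambda>_. M"])
    show "AE t in ?M. (\<lambda>N. DN N t) \<longlonglongrightarrow> D t"
      using ED_tendsto(2) rs by (intro AE_I2) auto
    show "AE t in ?M. norm (DN N t) \<le> M" for N
      using ENM(2) nonneg(2) by (intro AE_I2) (auto simp: abs_of_nonneg)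
  qed (use ints bounded_integrable[of "\<lambda>_. M" r s "\<bar>M\<bar>"] in auto)
  moreover have B: "(\<lambda>N. ?I (?BN N)) \<longlonglongrightarrow> ?I ?B" "integrable ?M ?B"
  proof -
    \<comment> \<open>\<open>F_pairing\<close> controls only the complete series. The dominating
      constant for its partial sums comes from \<open>F_bound\<close> together with Young's
      inequality.\<close>
    let ?w = "\<lambda>_ :: real. (C * (M + M)\<^sup>2 + M) / 2"
    have wi: "integrable ?M ?w" using bounded_integrable[of ?w r s "\<bar>(C * (M + M)\<^sup>2 + M) / 2\<bar>"] by auto
    have mN: "?BN N \<in> borel_measurable ?M" for N
      using mode_energy(2)[OF rs] by (intro borel_measurable_sum) auto
    have mB: "?B \<in> borel_measurable ?M"
      using mode_energy(2)[OF rs] by (intro borel_measurable_suminf) auto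
    have lim: "AE t in ?M. (\<lambda>N. ?BN N t) \<longlonglongrightarrow> ?B t"
      using F_pairing_ED[OF rs(1,3)] by (auto elim: eventually_mono)
    have "AE t in ?M. t \<in> {r..s}" by (auto intro: AE_I2)
    with F_bound_ED[OF rs(1,3)] have le: "AE t in ?M. \<forall>N. norm (?BN N t) \<le> (C * (M + M)\<^sup>2 + M) / 2"
    proof eventually_elim
      case (elim t)
      show ?case
      proof
        fix N
        have t: "T0 < t" "t < T" using elim(2) rs by auto
        have "norm (?BN N t) \<le> (\<Sum>n<N. ((norm (F n t))\<^sup>2 + (norm (a n t))\<^sup>2) / 2)"
        proof (rule sum_norm_le)
          fix n
          have "\<bar>F n t \<bullet> a n t\<bar> \<le> norm (F n t) * norm (a n t)" by (rule Cauchy_Schwarz_ineq2)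
          then show "norm (F n t \<bullet> a n t) \<le> ((norm (F n t))\<^sup>2 + (norm (a n t))\<^sup>2) / 2"
            using sum_squares_bound[of "norm (F n t)" "norm (a n t)"] by simp
        qed
        also have "\<dots> = ((\<Sum>n<N. (norm (F n t))\<^sup>2) + EN N t) / 2"
          by (simp add: sum.distrib flip: sum_divide_distrib)
        also have "\<dots> \<le> (C * (E t + D t)\<^sup>2 + M) / 2"
          using elim ENM(1)[of t N] by (intro divide_right_mono add_mono) auto
        also have "\<dots> \<le> (C * (M + M)\<^sup>2 + M) / 2"
          using C M(2)[of t] ED_le(3,4)[OF t] elim(2) rs
          by (intro divide_right_mono add_mono mult_left_mono power_mono) auto
        finally show "norm (?BN N t) \<le> (C * (M + M)\<^sup>2 + M) / 2" .
      qed
    qed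
    have le': "AE t in ?M. norm (?BN N t) \<le> (C * (M + M)\<^sup>2 + M) / 2" for N
      using le by (auto elim: eventually_mono)
    show "(\<lambda>N. ?I (?BN N)) \<longlonglongrightarrow> ?I ?B" by (rule integral_dominated_convergence[OF mB mN wi lim le'])
    show "integrable ?M ?B" by (rule integrable_dominated_convergence[OF mB mN wi lim le'])
  qed
  moreover have "(\<lambda>N. ?I (EN N)) \<longlonglongrightarrow> ?I E"
  proof (rule integral_dominated_convergence[where w="\<lambda>_. M"])
    show "AE t in ?M. (\<lambda>N. EN N t) \<longlonglongrightarrow> E t"
      using ED_tendsto(1) rs by (intro AE_I2) auto
    show "AE t in ?M. norm (EN N t) \<le> M" for N
      using ENM(1) nonneg(1) by (intro AE_I2) (auto simp: abs_of_nonneg)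
  qed (use ints bounded_integrable[of "\<lambda>_. M" r s "\<bar>M\<bar>"] in auto)
  then have "(\<lambda>N. EN N r + lam\<^sup>2 * ?I (EN N) - 2 * ?I (?BN N)) \<longlonglongrightarrow> E r + lam\<^sup>2 * ?I E - 2 * ?I ?B"
    by (intro tendsto_intros ED_tendsto rs sT B)
  ultimately have 1: "E s + ?I D \<le> E r + lam\<^sup>2 * ?I E - 2 * ?I ?B"
    by (intro LIMSEQ_le) auto
  have dm: "integrable ?M d"
    by (rule integrable_lebesgue_on_subset[OF d(1)]) (use rs in auto)
  have dE: "integrable ?M (\<lambda>t. d t * E t)"
  proof (rule Bochner_Integration.integrable_bound)
    show "integrable ?M (\<lambda>t. M * d t)" using dm by simp
    show "(\<lambda>t. d t * E t) \<in> borel_measurable ?M" using dm ints(9) by (intro borel_measurable_times) auto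
    show "AE t in ?M. norm (d t * E t) \<le> norm (M * d t)"
    proof (rule AE_I2)
      fix t assume "t \<in> space ?M"
      then have "0 \<le> E t" "E t \<le> M" using M(2)[of t] ED_le(3)[of t] rs by auto
      then show "norm (d t * E t) \<le> norm (M * d t)" using d(2)[of t] M(1)
        by (simp add: abs_mult mult.commute[of M] mult_left_mono)
    qed
  qed
  have e: "(lam\<^sup>2 + 1 / 2 + C / 2 * d t) * E t = (lam\<^sup>2 + 1 / 2) * E t + C / 2 * (d t * E t)" for t
    by (simp add: algebra_simps)
  show "integrable ?M (\<lambda>t. (lam\<^sup>2 + 1 / 2 + C / 2 * d t) * E t)"
    unfolding e using dE ints(1) by simp
  have "- 2 * ?I ?B \<le> ?I (\<lambda>t. (E t + D t + C * (d t * E t)) / 2)"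
  proof -
    have "- 2 * ?I ?B = ?I (\<lambda>t. - 2 * ?B t)" by simp
    also have "\<dots> \<le> ?I (\<lambda>t. (E t + D t + C * (d t * E t)) / 2)"
    proof (rule integral_mono_AE)
      show "AE t in ?M. - 2 * ?B t \<le> (E t + D t + C * (d t * E t)) / 2"
        using F_pairing_ED[OF rs(1,3)]
      proof eventually_elim
        case (elim t)
        have "- 2 * ?B t \<le> 2 * \<bar>?B t\<bar>" using abs_ge_minus_self[of "?B t"] by simp
        also have "\<dots> \<le> (E t + D t + C * E t * d t) / 2" using elim by blast
        also have "C * E t * d t = C * (d t * E t)" by simp
        finally show ?case .
      qed
    qed (use B(2) ints dE in auto)
    finally show ?thesis .
  qed
  also have "\<dots> = (?I E + ?I D + C * ?I (\<lambda>t. d t * E t)) / 2"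
    using ints dE by simp
  finally show "E s + ?I D / 2 \<le> E r + ?I (\<lambda>t. (lam\<^sup>2 + 1 / 2 + C / 2 * d t) * E t)"
    using 1 ints(1) dE unfolding e by (simp add: algebra_simps add_divide_distrib)
qed

text \<open>The equation of a mode is multiplied by \<open>(\<mu> n)\<^sup>2\<close>, which yields
  dissipation \<open>2 * (\<mu> n) ^ 4\<close>. Young's inequality spends one unit of it on the
  nonlinear term and half a unit on the cubic term from \<open>lam\<close>, so half a unit remains.
  The left side stays a finite sum because nothing guarantees convergence of its series
  beforehand.\<close>

lemma higher_energy_inequality:
  assumes rs: "T0 < r" "r \<le> s" "s < T"
  shows "DN N s + (\<integral>t. ZN N t \<partial>lebesgue_on {r..s}) / 2
    \<le> D r + (\<integral>t. 2 * lam\<^sup>2 * D t + C * (E t + D t)\<^sup>2 \<partial>lebesgue_on {r..s})"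
proof -
  let ?M = "lebesgue_on {r..s}"
  let ?I = "\<lambda>f :: real \<Rightarrow> real. \<integral>t. f t \<partial>?M"
  note ints = ED_integrable[OF rs(1) rs(3)]
  have Fm: "F n \<in> borel_measurable ?M" for n by (rule borel_measurable_integrable[OF F_int[OF rs]])
  have Fsq: "integrable ?M (\<lambda>t. (norm (F n t))\<^sup>2)" for n
  proof (rule Bochner_Integration.integrable_bound)
    show "integrable ?M (\<lambda>t. C * (E t + D t)\<^sup>2)" using ints by simp
    show "AE t in ?M. norm ((norm (F n t))\<^sup>2) \<le> norm (C * (E t + D t)\<^sup>2)"
      using F_bound_ED[OF rs(1,3)]
    proof eventually_elim
      case (elim t)
      have "(norm (F n t))\<^sup>2 \<le> (\<Sum>k<Suc n. (norm (F k t))\<^sup>2)" by (intro member_le_sum) auto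
      also have "\<dots> \<le> C * (E t + D t)\<^sup>2" using elim by blast
      finally show ?case by simp
    qed
  qed (use Fm in simp)
  have single: "(\<mu> n)\<^sup>2 * (norm (a n s))\<^sup>2 + (\<mu> n)^4 * ?I (\<lambda>t. (norm (a n t))\<^sup>2) / 2
      \<le> (\<mu> n)\<^sup>2 * (norm (a n r))\<^sup>2 + 2 * lam\<^sup>2 * ((\<mu> n)\<^sup>2 * ?I (\<lambda>t. (norm (a n t))\<^sup>2)) + ?I (\<lambda>t. (norm (F n t))\<^sup>2)" for n
  proof -
    let ?m = "\<mu> n" and ?J = "?I (\<lambda>t. (norm (a n t))\<^sup>2)" and ?K = "?I (\<lambda>t. F n t \<bullet> a n t)"
    have J0: "?J \<ge> 0" by simp
    have "- 2 * ?m\<^sup>2 * ?K = ?I (\<lambda>t. - 2 * ?m\<^sup>2 * (F n t \<bullet> a n t))" by simp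
    also have "\<dots> \<le> ?I (\<lambda>t. ?m^4 * (norm (a n t))\<^sup>2 + (norm (F n t))\<^sup>2)"
    proof (rule integral_mono)
      fix t
      have "\<bar>F n t \<bullet> a n t\<bar> \<le> norm (F n t) * norm (a n t)" by (rule Cauchy_Schwarz_ineq2)
      then have "2 * ?m\<^sup>2 * \<bar>F n t \<bullet> a n t\<bar> \<le> 2 * ?m\<^sup>2 * (norm (F n t) * norm (a n t))"
        by (intro mult_left_mono) auto
      also have "\<dots> = 2 * (?m\<^sup>2 * norm (a n t)) * norm (F n t)" by simp
      also have "\<dots> \<le> (?m\<^sup>2 * norm (a n t))\<^sup>2 + (norm (F n t))\<^sup>2" by (rule sum_squares_bound)
      also have "\<dots> = ?m^4 * (norm (a n t))\<^sup>2 + (norm (F n t))\<^sup>2"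
        by (simp add: power_mult_distrib flip: power_mult)
      finally have "2 * ?m\<^sup>2 * \<bar>F n t \<bullet> a n t\<bar> \<le> ?m^4 * (norm (a n t))\<^sup>2 + (norm (F n t))\<^sup>2" .
      moreover have "- 2 * ?m\<^sup>2 * (F n t \<bullet> a n t) \<le> 2 * ?m\<^sup>2 * \<bar>F n t \<bullet> a n t\<bar>"
        using mult_left_mono[of "- (F n t \<bullet> a n t)" "\<bar>F n t \<bullet> a n t\<bar>" "2 * ?m\<^sup>2"] by simp
      ultimately show "- 2 * ?m\<^sup>2 * (F n t \<bullet> a n t) \<le> ?m^4 * (norm (a n t))\<^sup>2 + (norm (F n t))\<^sup>2"
        by linarith
    qed (use ints(8) Fsq mode_energy(2)[OF rs] in auto)
    also have "\<dots> = ?m^4 * ?J + ?I (\<lambda>t. (norm (F n t))\<^sup>2)"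
      using ints(8) Fsq by simp
    finally have 1: "- 2 * ?m\<^sup>2 * ?K \<le> ?m^4 * ?J + ?I (\<lambda>t. (norm (F n t))\<^sup>2)" .
    have "?m\<^sup>2 * ((norm (a n s))\<^sup>2 + 2 * (?m\<^sup>2 - lam * ?m) * ?J) = ?m\<^sup>2 * ((norm (a n r))\<^sup>2 - 2 * ?K)"
      using mode_energy(1)[OF rs, of n] by simp
    then have 2: "?m\<^sup>2 * (norm (a n s))\<^sup>2 + 2 * ?m^4 * ?J - 2 * lam * ?m^3 * ?J = ?m\<^sup>2 * (norm (a n r))\<^sup>2 - 2 * ?m\<^sup>2 * ?K"
      by (simp add: algebra_simps power2_eq_square power3_eq_cube power4_eq_xxxx)
    \<comment> \<open>Half of the square of \<open>?m - 2 * lam\<close>, multiplied by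
      \<open>?m\<^sup>2\<close>, is nonnegative.\<close>
    have "2 * lam * ?m^3 \<le> ?m^4 / 2 + 2 * lam\<^sup>2 * ?m\<^sup>2"
    proof -
      have "0 \<le> ?m\<^sup>2 * (?m - 2 * lam)\<^sup>2 / 2" by simp
      also have "\<dots> = ?m^4 / 2 + 2 * lam\<^sup>2 * ?m\<^sup>2 - 2 * lam * ?m^3"
        by (simp add: power2_diff algebra_simps power2_eq_square power3_eq_cube power4_eq_xxxx add_divide_distrib diff_divide_distrib)
      finally show ?thesis by simp
    qed
    then have "2 * lam * ?m^3 * ?J \<le> (?m^4 / 2 + 2 * lam\<^sup>2 * ?m\<^sup>2) * ?J"
      by (intro mult_right_mono J0)
    then show ?thesis
      using 1 2 by (simp add: algebra_simps)
  qed
  have "DN N s + ?I (ZN N) / 2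
      = (\<Sum>n<N. (\<mu> n)\<^sup>2 * (norm (a n s))\<^sup>2 + (\<mu> n)^4 * ?I (\<lambda>t. (norm (a n t))\<^sup>2) / 2)"
    using ints(8) by (simp add: sum.distrib sum_divide_distrib)
  also have "\<dots> \<le> (\<Sum>n<N. (\<mu> n)\<^sup>2 * (norm (a n r))\<^sup>2 + 2 * lam\<^sup>2 * ((\<mu> n)\<^sup>2 * ?I (\<lambda>t. (norm (a n t))\<^sup>2)) + ?I (\<lambda>t. (norm (F n t))\<^sup>2))"
    by (intro sum_mono single)
  also have "\<dots> = DN N r + ?I (\<lambda>t. 2 * lam\<^sup>2 * DN N t + (\<Sum>n<N. (norm (F n t))\<^sup>2))"
    using ints(8) Fsq by (simp add: sum.distrib sum_distrib_left)
  also have "\<dots> \<le> D r + ?I (\<lambda>t. 2 * lam\<^sup>2 * D t + C * (E t + D t)\<^sup>2)"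
  proof (rule add_mono)
    show "DN N r \<le> D r" using ED_le(2)[of r N] rs by simp
    have "AE t in ?M. t \<in> {r..s}" by (auto intro: AE_I2)
    with F_bound_ED[OF rs(1,3)] have le: "AE t in ?M. 2 * lam\<^sup>2 * DN N t + (\<Sum>n<N. (norm (F n t))\<^sup>2) \<le> 2 * lam\<^sup>2 * D t + C * (E t + D t)\<^sup>2"
    proof eventually_elim
      case (elim t)
      then have "DN N t \<le> D t" using ED_le(2)[of t N] rs by simp
      then show ?case using elim(1) by (intro add_mono mult_left_mono) auto
    qed
    show "?I (\<lambda>t. 2 * lam\<^sup>2 * DN N t + (\<Sum>n<N. (norm (F n t))\<^sup>2)) \<le> ?I (\<lambda>t. 2 * lam\<^sup>2 * D t + C * (E t + D t)\<^sup>2)"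
      by (rule integral_mono_AE[OF _ _ le]) (use ints Fsq in auto)
  qed
  finally show ?thesis .
qed

text \<open>Two Gronwall arguments in succession. The coefficient of the first involves
  \<open>d\<close> and is integrable up to \<open>T\<close> by hypothesis; it bounds
  \<open>E\<close> and, through the remaining dissipation, the integral of \<open>D\<close>. That
  integral makes the coefficient of the second argument integrable.\<close>

lemma global_bound:
  "\<exists>r c. T0 < r \<and> r < T
    \<and> (\<forall>t N. r \<le> t \<and> t < T \<longrightarrow> (\<Sum>n<N. (1 + (\<mu> n)\<^sup>2) * (norm (a n t))\<^sup>2) \<le> c)
    \<and> (\<forall>s N. r \<le> s \<and> s < T \<longrightarrow> (\<integral>t. (\<Sum>n<N. (1 + (\<mu> n)^4) * (norm (a n t))\<^sup>2) \<partial>lebesgue_on {r..s}) \<le> c)"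
proof -
  obtain p where p: "T0 < p" "p < T" using dense T by blast
  let ?K1 = "\<lambda>t. lam\<^sup>2 + 1 / 2 + C / 2 * d t"
  have K1_0: "?K1 t \<ge> 0" for t using C d(2)[of t] by simp
  have K1_int: "integrable (lebesgue_on {r..s}) ?K1" if "T0 < r" "s < T" for r s
  proof -
    have "integrable (lebesgue_on {r..s}) d"
      by (rule integrable_lebesgue_on_subset[OF d(1)]) (use that in auto)
    then show ?thesis
      using finite_measure.integrable_const[OF finite_measure_Icc]
      by (intro Bochner_Integration.integrable_add integrable_mult_right) auto
  qed
  have K1_bound: "(\<integral>t. ?K1 t \<partial>lebesgue_on {p..s}) \<le> (\<integral>t. ?K1 t \<partial>lebesgue_on {T0<..<T})" if "p \<le> s" "s < T" for s
  proof -
    have i: "integrable (lebesgue_on {T0<..<T}) ?K1"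
    proof -
      have "integrable (lebesgue_on {T0<..<T}) (\<lambda>t. c)" for c :: real
        by (rule integrable_lebesgue_on_subset[of "{T0..T}"])
          (auto intro: finite_measure.integrable_const[OF finite_measure_Icc])
      then show ?thesis using d(1) by simp
    qed
    have "(\<integral>t. ?K1 t \<partial>lebesgue_on {p..s}) = (\<integral>t. indicator {p..s} t * ?K1 t \<partial>lebesgue)"
      by (simp add: integral_restrict_space)
    also have "\<dots> \<le> (\<integral>t. indicator {T0<..<T} t * ?K1 t \<partial>lebesgue)"
    proof (rule integral_mono)
      show "integrable lebesgue (\<lambda>t. indicator {p..s} t * ?K1 t)"
        using K1_int[of p s] p that by (simp add: integrable_restrict_space)
      show "integrable lebesgue (\<lambda>t. indicator {T0<..<T} t * ?K1 t)"
        using i by (simp add: integrable_restrict_space)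
      show "indicator {p..s} t * ?K1 t \<le> indicator {T0<..<T} t * ?K1 t" for t
        by (rule mult_right_mono[OF _ K1_0]) (use p that in \<open>auto simp: indicator_def\<close>)
    qed
    also have "\<dots> = (\<integral>t. ?K1 t \<partial>lebesgue_on {T0<..<T})"
      by (simp add: integral_restrict_space)
    finally show ?thesis .
  qed
  obtain r1 where r1: "p \<le> r1" "r1 < T" "\<And>s. r1 \<le> s \<Longrightarrow> s < T \<Longrightarrow> (\<integral>t. ?K1 t \<partial>lebesgue_on {r1..s}) \<le> 1 / 2"
    using small_tail[OF K1_int p(2) K1_bound] p(1) by auto
  have r1T: "T0 < r1" using p r1 by simp
  define E0 where "E0 = 2 * E r1"
  have D_int_nonneg: "(\<integral>t. D t \<partial>lebesgue_on {r..s}) \<ge> 0" if "T0 < r" "s < T" for r s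
    using that ED_le(4) by (intro integral_nonneg_AE AE_I2) auto
  have g1: "E s \<le> 2 * E r1 \<and> (\<integral>t. ?K1 t * E t \<partial>lebesgue_on {r1..s}) \<le> E r1" if s: "r1 \<le> s" "s < T" for s
  proof -
    have "\<exists>M. \<forall>t. r1 \<le> t \<and> t \<le> s \<longrightarrow> E t \<le> M" if "s < T" for s
      using ED_le_M[OF that] r1T by (meson less_le_trans)
    moreover have "E s \<le> E r1 + (\<integral>t. ?K1 t * E t \<partial>lebesgue_on {r1..s})" if "r1 \<le> s" "s < T" for s
      using energy_inequality(1)[OF r1T that] D_int_nonneg[OF r1T that(2)] by linarith
    ultimately show ?thesis
      using gronwall_small[of r1 T ?K1 E "E r1" s, OF _ _ r1(3) _ _ energy_inequality(2)[OF r1T] _ s]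
        K1_0 K1_int[OF r1T] ED_le(3) r1T by auto
  qed
  have EE0: "E t \<le> E0" if "r1 \<le> t" "t < T" for t using g1[OF that] by (simp add: E0_def)
  have E00: "E0 \<ge> 0" using ED_le(3)[OF r1T r1(2)] by (simp add: E0_def)
  have D_bound: "(\<integral>t. D t \<partial>lebesgue_on {r1..s}) \<le> 2 * E0" if "r1 \<le> s" "s < T" for s
    using energy_inequality(1)[OF r1T that] g1[OF that] ED_le(3)[of s] r1T that by (simp add: E0_def)
  \<comment> \<open>One factor of the quadratic term is kept as a coefficient. Its integral is
    bounded up to \<open>T\<close> because \<open>E\<close> is at most \<open>E0\<close> and the
    integral of \<open>D\<close> at most \<open>2 * E0\<close>.\<close>
  let ?K2 = "\<lambda>t. 2 * lam\<^sup>2 + C * (E t + D t)"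
  have K2_int: "integrable (lebesgue_on {r..s}) ?K2" if "T0 < r" "s < T" for r s
    using ED_integrable(1,2)[OF that] finite_measure.integrable_const[OF finite_measure_Icc]
    by (intro Bochner_Integration.integrable_add integrable_mult_right) auto
  have K2_0: "?K2 t \<ge> 0" if "T0 < t" "t < T" for t using C ED_le(3,4)[OF that] by simp
  have meas: "measure (lebesgue_on {r..s}) {r..s} = s - r" if "r \<le> s" for r s :: real
    using that by (simp add: measure_restrict_space)
  have K2_bound: "(\<integral>t. ?K2 t \<partial>lebesgue_on {r1..s}) \<le> (2 * lam\<^sup>2 + C * E0) * (T - r1) + C * (2 * E0)"
    if s: "r1 \<le> s" "s < T" for s
  proof -
    note i = ED_integrable(1,2)[OF r1T s(2)] and c = finite_measure.integrable_const[OF finite_measure_Icc]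
    have "(\<integral>t. ?K2 t \<partial>lebesgue_on {r1..s}) \<le> (\<integral>t. (2 * lam\<^sup>2 + C * E0) + C * D t \<partial>lebesgue_on {r1..s})"
    proof (rule integral_mono[OF K2_int[OF r1T s(2)]])
      show "integrable (lebesgue_on {r1..s}) (\<lambda>t. (2 * lam\<^sup>2 + C * E0) + C * D t)"
        using i c by (intro Bochner_Integration.integrable_add integrable_mult_right) auto
      fix t assume "t \<in> space (lebesgue_on {r1..s})"
      then have "C * E t \<le> C * E0" using EE0[of t] s C by (intro mult_left_mono) auto
      then show "?K2 t \<le> (2 * lam\<^sup>2 + C * E0) + C * D t" by (simp add: algebra_simps)
    qed
    also have "\<dots> = (2 * lam\<^sup>2 + C * E0) * (s - r1) + C * (\<integral>t. D t \<partial>lebesgue_on {r1..s})"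
      using i c by (subst Bochner_Integration.integral_add) (auto simp: meas s)
    also have "\<dots> \<le> (2 * lam\<^sup>2 + C * E0) * (T - r1) + C * (2 * E0)"
      using s C E00 D_bound[OF s] by (intro add_mono mult_left_mono) auto
    finally show ?thesis .
  qed
  obtain r2 where r2: "r1 \<le> r2" "r2 < T" "\<And>s. r2 \<le> s \<Longrightarrow> s < T \<Longrightarrow> (\<integral>t. ?K2 t \<partial>lebesgue_on {r2..s}) \<le> 1 / 2"
    using small_tail[OF K2_int[OF r1T] r1(2) K2_bound] by auto
  have r2T: "T0 < r2" using r1T r2 by simp
  \<comment> \<open>Adding the bound \<open>E0\<close> makes
    \<open>E t + D t \<le> ?\<phi> t\<close>, so the remaining factor of the square can be replaced
    by \<open>?\<phi>\<close>.\<close>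
  let ?\<phi> = "\<lambda>t. D t + E0"
  have K2\<phi>_int: "integrable (lebesgue_on {r2..s}) (\<lambda>t. ?K2 t * ?\<phi> t)" if sT: "s < T" for s
  proof -
    note i = ED_integrable[OF r2T sT]
    obtain M where M: "M \<ge> 0" "\<And>t. T0 < t \<Longrightarrow> t \<le> s \<Longrightarrow> E t \<le> M \<and> D t \<le> M"
      using ED_le_M[OF sT] by blast
    have meas: "(\<lambda>t. ?K2 t * ?\<phi> t) \<in> borel_measurable (lebesgue_on {r2..s})"
      using i(9,10) by (intro borel_measurable_times borel_measurable_add borel_measurable_const)
    show ?thesis
    proof (rule bounded_integrable[OF meas])
      fix t assume t: "r2 \<le> t" "t \<le> s"
      then have "0 \<le> E t" "E t \<le> M" "0 \<le> D t" "D t \<le> M"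
        using M(2)[of t] ED_le(3,4)[of t] r2T sT by auto
      then have "\<bar>?K2 t\<bar> \<le> 2 * lam\<^sup>2 + C * (M + M)" "\<bar>?\<phi> t\<bar> \<le> M + E0"
        using C E00 by (auto simp: abs_of_nonneg intro!: mult_left_mono)
      then show "\<bar>?K2 t * ?\<phi> t\<bar> \<le> (2 * lam\<^sup>2 + C * (M + M)) * (M + E0)"
        unfolding abs_mult by (intro mult_mono) auto
    qed
  qed
  have en2: "DN N s + (\<integral>t. ZN N t \<partial>lebesgue_on {r2..s}) / 2 \<le> D r2 + (\<integral>t. ?K2 t * ?\<phi> t \<partial>lebesgue_on {r2..s})"
    if s: "r2 \<le> s" "s < T" for s N
  proof -
    note i = ED_integrable[OF r2T s(2)]
    have "(\<integral>t. 2 * lam\<^sup>2 * D t + C * (E t + D t)\<^sup>2 \<partial>lebesgue_on {r2..s}) \<le> (\<integral>t. ?K2 t * ?\<phi> t \<partial>lebesgue_on {r2..s})"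
    proof (rule integral_mono[OF _ K2\<phi>_int[OF s(2)]])
      show "integrable (lebesgue_on {r2..s}) (\<lambda>t. 2 * lam\<^sup>2 * D t + C * (E t + D t)\<^sup>2)"
        using i by (intro Bochner_Integration.integrable_add integrable_mult_right) auto
      fix t assume "t \<in> space (lebesgue_on {r2..s})"
      then have t: "0 \<le> E t" "0 \<le> D t" "E t \<le> E0"
        using ED_le(3,4)[of t] EE0[of t] r2 r2T s by auto
      have "2 * lam\<^sup>2 * D t + C * (E t + D t)\<^sup>2 \<le> 2 * lam\<^sup>2 * (D t + E0) + C * (E t + D t) * (E0 + D t)"
        unfolding power2_eq_square[of "E t + D t"] mult.assoc[of C, symmetric]
        using t C E00 by (intro add_mono mult_left_mono) auto
      then show "2 * lam\<^sup>2 * D t + C * (E t + D t)\<^sup>2 \<le> ?K2 t * ?\<phi> t"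
        by (simp only: distrib_right[of _ _ "?\<phi> t"] add.commute[of E0])
    qed
    then show ?thesis using higher_energy_inequality[OF r2T s, of N] by linarith
  qed
  have ZN_int_nonneg: "(\<integral>t. ZN N t \<partial>lebesgue_on {r2..s}) \<ge> 0" for N s
    using nonneg(3) by (intro integral_nonneg_AE AE_I2)
  have g2: "?\<phi> s \<le> 2 * ?\<phi> r2 \<and> (\<integral>t. ?K2 t * ?\<phi> t \<partial>lebesgue_on {r2..s}) \<le> ?\<phi> r2" if s: "r2 \<le> s" "s < T" for s
  proof -
    have b: "\<exists>M. \<forall>t. r2 \<le> t \<and> t \<le> s \<longrightarrow> ?\<phi> t \<le> M" if "r2 \<le> s" and sT: "s < T" for s
    proof -
      obtain M where "\<And>t. T0 < t \<Longrightarrow> t \<le> s \<Longrightarrow> D t \<le> M" using ED_le_M[OF sT] by blast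
      then have "\<forall>t. r2 \<le> t \<and> t \<le> s \<longrightarrow> ?\<phi> t \<le> M + E0" using r2T by force
      then show ?thesis by blast
    qed
    have ineq: "?\<phi> s \<le> ?\<phi> r2 + (\<integral>t. ?K2 t * ?\<phi> t \<partial>lebesgue_on {r2..s})" if "r2 \<le> s" "s < T" for s
    proof -
      have "DN N s \<le> D r2 + (\<integral>t. ?K2 t * ?\<phi> t \<partial>lebesgue_on {r2..s})" for N
        using en2[OF that, of N] ZN_int_nonneg[of s N] by linarith
      then have "D s \<le> D r2 + (\<integral>t. ?K2 t * ?\<phi> t \<partial>lebesgue_on {r2..s})"
        using ED_tendsto(2)[of s] r2T that by (intro LIMSEQ_le_const2) auto
      then show ?thesis by simp
    qed
    have K20: "?K2 t \<ge> 0" and \<phi>0: "?\<phi> t \<ge> 0" if "r2 \<le> t" "t < T" for t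
      using K2_0[of t] ED_le(4)[of t] E00 r2T that by auto
    show ?thesis
      using gronwall_small[of r2 T ?K2 ?\<phi> "?\<phi> r2" s, OF K20 K2_int[OF r2T] r2(3) \<phi>0 b K2\<phi>_int ineq s] by blast
  qed
  \<comment> \<open>The sum of the two bounds obtained below. All summands are nonnegative, so a
    single constant serves for both claims.\<close>
  define c where "c = E0 * (T - r2) + 2 * (D r2 + ?\<phi> r2) + E0 + 2 * ?\<phi> r2"
  have pos: "D r2 \<ge> 0" "E0 * (T - r2) \<ge> 0" using ED_le(4)[OF r2T r2(2)] E00 r2 by auto
  have "(\<Sum>n<N. (1 + (\<mu> n)\<^sup>2) * (norm (a n t))\<^sup>2) \<le> c" if t: "r2 \<le> t" "t < T" for t N
  proof -
    have "T0 < t" using r2T t by simp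
    then have "EN N t \<le> E0" "DN N t \<le> 2 * ?\<phi> r2"
      using ED_le(1,2)[of t N] EE0[of t] g2[OF t] r2 t E00 by auto
    then show ?thesis
      using pos E00 by (simp add: c_def distrib_right sum.distrib)
  qed
  moreover have "(\<integral>t. (\<Sum>n<N. (1 + (\<mu> n)^4) * (norm (a n t))\<^sup>2) \<partial>lebesgue_on {r2..s}) \<le> c" if s: "r2 \<le> s" "s < T" for s N
  proof -
    note i = ED_integrable[OF r2T s(2)] and k = finite_measure.integrable_const[OF finite_measure_Icc]
    have "(\<integral>t. (\<Sum>n<N. (1 + (\<mu> n)^4) * (norm (a n t))\<^sup>2) \<partial>lebesgue_on {r2..s}) = (\<integral>t. EN N t + ZN N t \<partial>lebesgue_on {r2..s})"
      by (simp add: distrib_right sum.distrib)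
    also have "\<dots> = (\<integral>t. EN N t \<partial>lebesgue_on {r2..s}) + (\<integral>t. ZN N t \<partial>lebesgue_on {r2..s})"
      by (rule Bochner_Integration.integral_add[OF i(5) i(7)])
    also have "(\<integral>t. EN N t \<partial>lebesgue_on {r2..s}) \<le> (\<integral>t. E0 \<partial>lebesgue_on {r2..s})"
    proof (rule integral_mono[OF i(5) k])
      fix t assume "t \<in> space (lebesgue_on {r2..s})"
      then show "EN N t \<le> E0" using ED_le(1)[of t N] EE0[of t] r2 r2T s by fastforce
    qed
    also have "\<dots> = E0 * (s - r2)" by (simp add: meas s)
    also have "\<dots> \<le> E0 * (T - r2)" using E00 s by (intro mult_left_mono) auto
    also have "(\<integral>t. ZN N t \<partial>lebesgue_on {r2..s}) \<le> 2 * (D r2 + ?\<phi> r2)"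
    proof -
      have "z \<le> 2 * (x + y)" if "n + z / 2 \<le> x + w" "w \<le> y" "0 \<le> n" for n z x w y :: real
        using that by simp
      then show ?thesis
        using en2[OF s, of N] conjunct2[OF g2[OF s]] nonneg(2) by blast
    qed
    finally show ?thesis using pos E00 by (simp add: c_def)
  qed
  ultimately show ?thesis
    using r2T r2(2) by (intro exI[of _ r2] exI[of _ c]) auto
qed

end

section \<open>The Besov norm on the Fourier side\<close>

text \<open>The Littlewood-Paley kernels are sums of complex exponentials, so these are used for the
  blocks; \<open>hc_sq_le_fourier\<close> leads back to Hartley coefficients.\<close>

definition wave :: "int ^ 'n \<Rightarrow> real ^ 'n \<Rightarrow> complex" where
  "wave m x = cis (lat m \<bullet> x)"

lemma wave_eq_cas: "wave m x = cas m x *\<^sub>R Complex (1 / 2) (1 / 2) + cas (- m) x *\<^sub>R Complex (1 / 2) (- 1 / 2)"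
proof (rule complex_eqI)
  show "Re (wave m x) = Re (cas m x *\<^sub>R Complex (1 / 2) (1 / 2) + cas (- m) x *\<^sub>R Complex (1 / 2) (- 1 / 2))"
    unfolding wave_def cis.sel cos_sin_eq_cas by simp
  show "Im (wave m x) = Im (cas m x *\<^sub>R Complex (1 / 2) (1 / 2) + cas (- m) x *\<^sub>R Complex (1 / 2) (- 1 / 2))"
    unfolding wave_def cis.sel cos_sin_eq_cas by simp
qed

lemma trig_poly_wave: "trig_poly (\<lambda>x. c * wave m x)"
proof -
  have "trig_poly (\<lambda>x. wave m x)"
    unfolding wave_eq_cas by (intro trig_poly_add trig_poly_cas)
  then show ?thesis
    by (rule trig_poly_linear[where h="\<lambda>z. c * z"]) (simp add: linear_iff distrib_left)
qed

lemma continuous_wave: "continuous_on S (wave m)"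
  using trig_poly_continuous[OF trig_poly_wave[of 1 m]] by simp

lemma norm_wave [simp]: "norm (wave m x) = 1"
  by (simp add: wave_def)

lemma wave_diff: "wave m (x - y) = wave m x * wave (- m) y"
  by (simp add: wave_def inner_diff_right cis_mult)

lemma integral_wave: "(\<integral>x. wave (m :: int ^ 'n) x \<partial>torus) = (if m = 0 then complex_of_real ((2 * pi) ^ CARD('n)) else 0)"
  unfolding wave_def by (rule integral_cis_torus)

lemma integral_norm_wave_sum:
  fixes S :: "(int ^ 'n) set"
  assumes "finite S"
  shows "(\<integral>x. (norm (\<Sum>m\<in>S. \<alpha> m * wave m x))\<^sup>2 \<partial>torus) = (2 * pi) ^ CARD('n) * (\<Sum>m\<in>S. (norm (\<alpha> m))\<^sup>2)"
proof -
  let ?f = "\<lambda>x. \<Sum>m\<in>S. \<alpha> m * wave m x"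
  have e: "complex_of_real ((norm (?f x))\<^sup>2) = (\<Sum>m\<in>S. \<Sum>l\<in>S. (\<alpha> m * cnj (\<alpha> l)) * wave (m - l) x)" for x
  proof -
    have w: "wave m x * cnj (wave l x) = wave (m - l) x" for m l
      by (simp add: wave_def cis_cnj cis_mult inner_diff_left)
    have "complex_of_real ((norm (?f x))\<^sup>2) = ?f x * cnj (?f x)"
      by (rule complex_norm_square)
    also have "\<dots> = (\<Sum>m\<in>S. \<Sum>l\<in>S. (\<alpha> m * cnj (\<alpha> l)) * (wave m x * cnj (wave l x)))"
      by (simp add: sum_product mult_ac)
    finally show ?thesis by (simp only: w)
  qed
  have i: "integrable torus (\<lambda>x. c * wave m x)" for c :: complex and m :: "int ^ 'n"
    by (intro continuous_integrable_torus trig_poly_continuous trig_poly_wave)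
  have "complex_of_real (\<integral>x. (norm (?f x))\<^sup>2 \<partial>torus) = (\<integral>x. complex_of_real ((norm (?f x))\<^sup>2) \<partial>torus)"
    by (rule integral_complex_of_real[symmetric])
  also have "\<dots> = (\<Sum>m\<in>S. \<Sum>l\<in>S. (\<alpha> m * cnj (\<alpha> l)) * (if m = l then complex_of_real ((2 * pi) ^ CARD('n)) else 0))"
    unfolding e using i by (simp add: integral_wave)
  also have "\<dots> = (\<Sum>m\<in>S. (\<alpha> m * cnj (\<alpha> m)) * complex_of_real ((2 * pi) ^ CARD('n)))"
    using assms by (simp add: if_distrib cong: if_cong)
  also have "\<dots> = complex_of_real ((2 * pi) ^ CARD('n) * (\<Sum>m\<in>S. (norm (\<alpha> m))\<^sup>2))"
    by (simp add: complex_norm_square[symmetric] sum_distrib_left mult_ac)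
  finally show ?thesis using of_real_eq_iff by blast
qed

text \<open>The multiplier of the Littlewood-Paley block with index \<open>j\<close>.\<close>

definition shell :: "(real ^ 'n \<Rightarrow> real) \<Rightarrow> int \<Rightarrow> int ^ 'n \<Rightarrow> real" where
  "shell \<phi> j m = \<phi> (2 powi (- j) *\<^sub>R lat m)"

lemma littlewood_paley_support:
  assumes "littlewood_paley \<phi>" "\<phi> \<xi> \<noteq> 0"
  shows "1 / 2 < norm \<xi>" "norm \<xi> < 2"
proof -
  have "\<xi> \<in> closure {\<xi>. \<phi> \<xi> \<noteq> 0}"
    by (rule subsetD[OF closure_subset]) (use assms(2) in simp)
  moreover have "closure {\<xi>. \<phi> \<xi> \<noteq> 0} \<subseteq> {\<xi>. 1 / 2 < norm \<xi> \<and> norm \<xi> < 2}"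
    by (rule conjunct1[OF conjunct2[OF conjunct2[OF assms(1)[unfolded littlewood_paley_def]]]])
  ultimately show "1 / 2 < norm \<xi>" "norm \<xi> < 2" by blast+
qed

lemma shell_0:
  assumes "littlewood_paley \<phi>" shows "shell \<phi> j 0 = 0"
  unfolding shell_def by (rule ccontr) (use littlewood_paley_support(1)[OF assms, of 0] in simp)

lemma finite_lat_ball: "finite {m :: int ^ 'n. norm (lat m) \<le> R}"
proof (rule finite_subset)
  let ?N = "\<lceil>R\<rceil>"
  show "{m :: int ^ 'n. norm (lat m) \<le> R} \<subseteq> {m. \<forall>i. m $ i \<in> {- ?N..?N}}"
  proof clarsimp
    fix m :: "int ^ 'n" and i assume "norm (lat m) \<le> R"
    then have "\<bar>real_of_int (m $ i)\<bar> \<le> R" using component_le_norm_cart[of "lat m" i] by simp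
    then show "- ?N \<le> m $ i \<and> m $ i \<le> ?N" by linarith
  qed
  show "finite {m :: int ^ 'n. \<forall>i. m $ i \<in> {- ?N..?N}}"
  proof (rule finite_subset)
    show "{m :: int ^ 'n. \<forall>i. m $ i \<in> {- ?N..?N}} \<subseteq> vec_lambda ` (UNIV \<rightarrow>\<^sub>E {- ?N..?N})"
    proof
      fix m :: "int ^ 'n" assume "m \<in> {m. \<forall>i. m $ i \<in> {- ?N..?N}}"
      then show "m \<in> vec_lambda ` (UNIV \<rightarrow>\<^sub>E {- ?N..?N})"
        by (intro image_eqI[of _ _ "vec_nth m"]) (auto simp: vec_nth_inverse)
    qed
    show "finite (vec_lambda ` ((UNIV :: 'n set) \<rightarrow>\<^sub>E {- ?N..?N}))"
      by (intro finite_imageI finite_PiE) auto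
  qed
qed

lemma finite_shell:
  fixes \<phi> :: "real ^ 'n \<Rightarrow> real"
  assumes "littlewood_paley \<phi>" shows "finite {m. shell \<phi> j m \<noteq> 0}"
proof (rule finite_subset)
  show "{m. shell \<phi> j m \<noteq> 0} \<subseteq> {m. norm (lat m) \<le> 2 / (2 powi (- j))}"
  proof clarsimp
    fix m assume "shell \<phi> j m \<noteq> 0"
    then have "norm (2 powi (- j) *\<^sub>R lat m) < 2"
      by (intro littlewood_paley_support(2)[OF assms]) (simp add: shell_def)
    then have "2 powi (- j) * norm (lat m) < 2" by simp
    then show "norm (lat m) \<le> 2 / (2 powi (- j))"
      by (subst pos_le_divide_eq) (auto simp: mult.commute)
  qed
qed (rule finite_lat_ball)

lemma lp_kernel_eq:
  assumes "littlewood_paley \<phi>"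
  shows "lp_kernel \<phi> j x = (\<Sum>m | shell \<phi> j m \<noteq> 0. complex_of_real (shell \<phi> j m) * wave m x)"
proof -
  have "lp_kernel \<phi> j x = (\<Sum>\<^sub>\<infinity>m. complex_of_real (shell \<phi> j m) * wave m x)"
    by (simp add: lp_kernel_def shell_def wave_def lat_def cis_conv_exp Let_def)
  also have "\<dots> = (\<Sum>\<^sub>\<infinity>m\<in>{m. shell \<phi> j m \<noteq> 0}. complex_of_real (shell \<phi> j m) * wave m x)"
    by (rule infsum_cong_neutral) auto
  also have "\<dots> = (\<Sum>m | shell \<phi> j m \<noteq> 0. complex_of_real (shell \<phi> j m) * wave m x)"
    by (rule infsum_finite[OF finite_shell[OF assms]])
  finally show ?thesis .
qed

definition fourier :: "int ^ 'n \<Rightarrow> (real ^ 'n \<Rightarrow> real) \<Rightarrow> complex" where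
  "fourier m f = (\<integral>y. f y *\<^sub>R wave (- m) y \<partial>torus)"

lemma integrable_wave_scaleR:
  assumes "integrable torus f" shows "integrable torus (\<lambda>y. f y *\<^sub>R wave m y)"
proof (rule Bochner_Integration.integrable_bound[OF assms])
  show "(\<lambda>y. f y *\<^sub>R wave m y) \<in> borel_measurable torus"
    by (intro borel_measurable_scaleR borel_measurable_integrable[OF assms] continuous_measurable_torus[OF continuous_wave])
qed simp

lemma lp_block_distribution:
  fixes f :: "real ^ 'n \<Rightarrow> real"
  assumes \<phi>: "littlewood_paley \<phi>" and f: "integrable torus f"
  shows "lp_block \<phi> j (distribution f) x
    = (\<Sum>m | shell \<phi> j m \<noteq> 0. (complex_of_real (shell \<phi> j m) * fourier m f) * wave m x)"
proof -
  let ?S = "{m. shell \<phi> j m \<noteq> 0}"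
  let ?c = "\<lambda>m. complex_of_real (shell \<phi> j m) * wave m x"
  have k: "(\<lambda>y. lp_kernel \<phi> j (x - y)) = (\<lambda>y. \<Sum>m\<in>?S. ?c m * wave (- m) y)"
    by (simp add: lp_kernel_eq[OF \<phi>] wave_diff mult.assoc)
  have tp: "trig_poly (\<lambda>y. \<Sum>m\<in>?S. ?c m * wave (- m) y)"
    by (intro trig_poly_sum trig_poly_wave)
  have iw: "integrable torus (\<lambda>y. c * wave m y)" for c :: complex and m :: "int ^ 'n"
    by (intro continuous_integrable_torus trig_poly_continuous trig_poly_wave)
  have "(\<integral>y. (\<Sum>m\<in>?S. ?c m * wave (- m) y) \<partial>torus) = (\<Sum>m\<in>?S. ?c m * (\<integral>y. wave (- m) y \<partial>torus))"
    using iw by simp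
  also have "\<dots> = 0"
    by (intro sum.neutral) (auto simp: integral_wave shell_0[OF \<phi>])
  \<comment> \<open>The kernel has mean zero because no shell contains frequency 0. Membership in
    \<open>D0\<close> matters: elsewhere \<open>distribution\<close> takes its default value
    0.\<close>
  finally have D: "(\<lambda>y. lp_kernel \<phi> j (x - y)) \<in> D0"
    unfolding k D0_def using trig_poly_smooth[OF tp] trig_poly_periodic[OF tp] by simp
  have "lp_block \<phi> j (distribution f) x = (\<integral>y. f y *\<^sub>R (\<Sum>m\<in>?S. ?c m * wave (- m) y) \<partial>torus)"
    using D by (simp add: lp_block_def distribution_def k)
  also have "\<dots> = (\<integral>y. (\<Sum>m\<in>?S. ?c m * (f y *\<^sub>R wave (- m) y)) \<partial>torus)"
    by (simp add: scaleR_sum_right)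
  also have "\<dots> = (\<Sum>m\<in>?S. \<integral>y. ?c m * (f y *\<^sub>R wave (- m) y) \<partial>torus)"
    by (intro Bochner_Integration.integral_sum integrable_mult_right integrable_wave_scaleR f)
  also have "\<dots> = (\<Sum>m\<in>?S. ?c m * fourier m f)"
    unfolding fourier_def by (intro sum.cong refl integral_mult_right_zero)
  finally show ?thesis by (simp add: mult_ac)
qed

lemma torus_norm_lp_block:
  fixes f :: "real ^ 'n \<Rightarrow> real"
  assumes \<phi>: "littlewood_paley \<phi>" and f: "integrable torus f"
  shows "(torus_norm 2 (lp_block \<phi> j (distribution f)))\<^sup>2
    = ennreal ((2 * pi) ^ CARD('n) * (\<Sum>m | shell \<phi> j m \<noteq> 0. (shell \<phi> j m)\<^sup>2 * (norm (fourier m f))\<^sup>2))"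
proof -
  let ?S = "{m. shell \<phi> j m \<noteq> 0}"
  let ?g = "\<lambda>x. \<Sum>m\<in>?S. (complex_of_real (shell \<phi> j m) * fourier m f) * wave m x"
  have "trig_poly ?g" by (intro trig_poly_sum trig_poly_wave)
  then have sq: "sq_integrable ?g"
    using continuous_sq_integrable trig_poly_continuous by blast
  have "lp_block \<phi> j (distribution f) = ?g"
    using lp_block_distribution[OF assms] by blast
  then show ?thesis
    by (simp add: torus_norm_2_sq_eq[OF sq] integral_norm_wave_sum[OF finite_shell[OF \<phi>]]
        norm_mult power_mult_distrib)
qed

lemma besov_norm_sq:
  "(besov_norm \<phi> 0 2 2 F)\<^sup>2 = (\<integral>\<^sup>+j. (torus_norm 2 (lp_block \<phi> j F))\<^sup>2 \<partial>count_space UNIV)"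
  by (simp add: besov_norm_def Lnorm_def enn_powr_2 enn_powr_half_sq)

text \<open>At most three dyadic shells meet at a nonzero frequency.\<close>

lemma shell_ge_third:
  assumes \<phi>: "littlewood_paley \<phi>" and "m \<noteq> 0"
  shows "\<exists>j. shell \<phi> j m \<ge> 1 / 3"
proof (rule ccontr)
  assume neg: "\<nexists>j. shell \<phi> j m \<ge> 1 / 3"
  have "lat m \<noteq> 0" using assms(2) by simp
  then have sum: "((\<lambda>j. shell \<phi> j m) has_sum 1) UNIV"
    using \<phi> unfolding littlewood_paley_def shell_def by blast
  have "\<exists>j. shell \<phi> j m \<noteq> 0"
  proof (rule ccontr)
    assume "\<nexists>j. shell \<phi> j m \<noteq> 0"
    then have "((\<lambda>j :: int. shell \<phi> j m) has_sum 0) UNIV" by (intro has_sum_0) auto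
    then show False using sum has_sum_unique by fastforce
  qed
  then obtain j0 where j0: "shell \<phi> j0 m \<noteq> 0" by blast
  let ?J = "{j0 - 1, j0, j0 + 1}"
  have "shell \<phi> j m = 0" if j: "j \<notin> ?J" for j
  proof (rule ccontr)
    assume nz: "shell \<phi> j m \<noteq> 0"
    let ?n = "norm (lat m)"
    have b: "1 / 2 < 2 powi (- i) * ?n \<and> 2 powi (- i) * ?n < 2" if "shell \<phi> i m \<noteq> 0" for i
      using littlewood_paley_support[OF \<phi>, of "2 powi (- i) *\<^sub>R lat m"] that by (simp add: shell_def)
    \<comment> \<open>On its shell the scaled frequency lies between \<open>1 / 2\<close> and 2,
      while raising the index by 2 or more divides it by at least 4. Such shells are
      disjoint.\<close>
    have far: False if "i + 2 \<le> l" "shell \<phi> i m \<noteq> 0" "shell \<phi> l m \<noteq> 0" for i l :: int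
    proof -
      have "2 powi (2 - l) \<le> (2 :: real) powi (- i)" using that by (intro power_int_increasing) auto
      then have "4 * 2 powi (- l) \<le> (2 :: real) powi (- i)"
        by (simp add: power_int_diff power_int_minus field_simps)
      then have "(4 * 2 powi (- l)) * ?n \<le> 2 powi (- i) * ?n" by (rule mult_right_mono) simp
      then show False using b[OF that(2)] b[OF that(3)] by linarith
    qed
    have "j + 2 \<le> j0 \<or> j0 + 2 \<le> j" using j by auto
    then show False using far nz j0 by blast
  qed
  then have "((\<lambda>j. shell \<phi> j m) has_sum 1) ?J \<longleftrightarrow> ((\<lambda>j. shell \<phi> j m) has_sum 1) UNIV"
    by (intro has_sum_cong_neutral) auto
  with sum have "((\<lambda>j. shell \<phi> j m) has_sum 1) ?J" by blast
  then have "(\<Sum>j\<in>?J. shell \<phi> j m) = 1"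
    using has_sum_finite[of ?J "\<lambda>j. shell \<phi> j m"] has_sum_unique by blast
  \<comment> \<open>If all three possible values were below \<open>1 / 3\<close>, the partition of
    unity could not add up to 1.\<close>
  moreover have "(\<Sum>j\<in>?J. shell \<phi> j m) < (\<Sum>j\<in>?J. 1 / 3)"
    using neg by (intro sum_strict_mono) (auto simp: not_le)
  ultimately show False by simp
qed

text \<open>For a real function the Hartley coefficient is the real part minus the imaginary part of
  the Fourier coefficient, and the square of a difference is at most twice the sum of
  squares.\<close>

lemma hc_sq_le_fourier:
  fixes f :: "real ^ 'n \<Rightarrow> real"
  assumes "integrable torus f"
  shows "(hc m f)\<^sup>2 \<le> 2 * (norm (fourier m f))\<^sup>2"
proof -
  note i = integrable_wave_scaleR[OF assms, of "- m"]
  have "hc m f = (\<integral>x. Re (f x *\<^sub>R wave (- m) x) - Im (f x *\<^sub>R wave (- m) x) \<partial>torus)"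
    by (simp add: hc_def wave_def cas_def algebra_simps)
  also have "\<dots> = Re (fourier m f) - Im (fourier m f)"
    unfolding fourier_def
    by (subst Bochner_Integration.integral_diff[OF integrable_Re[OF i] integrable_Im[OF i]])
      (simp only: integral_Re[OF i] integral_Im[OF i])
  finally have "(hc m f)\<^sup>2 = (Re (fourier m f) - Im (fourier m f))\<^sup>2" by simp
  also have "\<dots> \<le> 2 * ((Re (fourier m f))\<^sup>2 + (Im (fourier m f))\<^sup>2)"
    using zero_le_power2[of "Re (fourier m f) + Im (fourier m f)"] by (simp add: power2_sum power2_diff)
  finally show ?thesis by (simp add: cmod_power2)
qed

text \<open>Each nonzero frequency is charged to one shell in which its multiplier is at least
  \<open>1 / 3\<close>. The constant 18 is 9 for this loss times 2 for the passage from Hartley to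
  Fourier coefficients. Frequency 0 is invisible to the homogeneous norm and is removed by the mean
  value hypothesis.\<close>

lemma besov_norm_ge:
  fixes f :: "real ^ 'n \<Rightarrow> real"
  assumes \<phi>: "littlewood_paley \<phi>" and f: "integrable torus f" and mean: "hc 0 f = 0" and A: "finite A"
  shows "ennreal (\<Sum>m\<in>A. (hc m f)\<^sup>2) \<le> ennreal 18 * (besov_norm \<phi> 0 2 2 (distribution f))\<^sup>2"
proof -
  obtain J where J: "\<And>m. m \<noteq> 0 \<Longrightarrow> shell \<phi> (J m) m \<ge> 1 / 3"
    using shell_ge_third[OF \<phi>] by metis
  let ?V = "(2 * pi) ^ CARD('n)"
  let ?q = "\<lambda>j m. (shell \<phi> j m)\<^sup>2 * (norm (fourier m f))\<^sup>2"
  let ?b = "\<lambda>j. \<Sum>m | shell \<phi> j m \<noteq> 0. ?q j m"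
  have V1: "?V \<ge> 1" using pi_ge_two by (intro one_le_power) linarith
  have b0: "?b j \<ge> 0" for j by (intro sum_nonneg) auto
  let ?A = "A - {0}"
  have "(\<Sum>m\<in>A. (hc m f)\<^sup>2) = (\<Sum>m\<in>?A. (hc m f)\<^sup>2)"
    using A mean by (intro sum.mono_neutral_right) auto
  also have "\<dots> \<le> (\<Sum>m\<in>?A. 18 * ?q (J m) m)"
  proof (rule sum_mono)
    fix m assume "m \<in> ?A"
    then have "(1 / 3)\<^sup>2 \<le> (shell \<phi> (J m) m)\<^sup>2" using J by (intro power_mono) auto
    then have "1 \<le> 9 * (shell \<phi> (J m) m)\<^sup>2" by (simp add: power2_eq_square)
    then have "1 * (norm (fourier m f))\<^sup>2 \<le> (9 * (shell \<phi> (J m) m)\<^sup>2) * (norm (fourier m f))\<^sup>2"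
      by (rule mult_right_mono) simp
    then show "(hc m f)\<^sup>2 \<le> 18 * ?q (J m) m" using hc_sq_le_fourier[OF f, of m] by simp
  qed
  also have "\<dots> = 18 * (\<Sum>m\<in>?A. ?q (J m) m)" by (simp add: sum_distrib_left)
  also have "(\<Sum>m\<in>?A. ?q (J m) m) = (\<Sum>j\<in>J ` ?A. \<Sum>m | m \<in> ?A \<and> J m = j. ?q (J m) m)"
    using A by (intro sum.image_gen) auto
  also have "\<dots> = (\<Sum>j\<in>J ` ?A. \<Sum>m | m \<in> ?A \<and> J m = j. ?q j m)"
    by (intro sum.cong) auto
  also have "\<dots> \<le> (\<Sum>j\<in>J ` ?A. ?b j)"
    using finite_shell[OF \<phi>] J by (intro sum_mono sum_mono2) (fastforce)+
  also have "\<dots> \<le> (\<Sum>j\<in>J ` ?A. ?V * ?b j)"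
  proof (rule sum_mono)
    fix j show "?b j \<le> ?V * ?b j" using mult_right_mono[OF V1 b0[of j]] by (simp only: mult_1)
  qed
  finally have "(\<Sum>m\<in>A. (hc m f)\<^sup>2) \<le> 18 * (\<Sum>j\<in>J ` ?A. ?V * ?b j)" by simp
  then have "ennreal (\<Sum>m\<in>A. (hc m f)\<^sup>2) \<le> ennreal (18 * (\<Sum>j\<in>J ` ?A. ?V * ?b j))"
    by (rule ennreal_leI)
  also have "\<dots> = ennreal 18 * (\<Sum>j\<in>J ` ?A. (torus_norm 2 (lp_block \<phi> j (distribution f)))\<^sup>2)"
  proof -
    have "ennreal (18 * (\<Sum>j\<in>J ` ?A. ?V * ?b j)) = ennreal 18 * ennreal (\<Sum>j\<in>J ` ?A. ?V * ?b j)"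
      by (rule ennreal_mult) (use b0 in \<open>auto intro!: sum_nonneg mult_nonneg_nonneg\<close>)
    also have "ennreal (\<Sum>j\<in>J ` ?A. ?V * ?b j) = (\<Sum>j\<in>J ` ?A. ennreal (?V * ?b j))"
      by (rule sum_ennreal[symmetric]) (use b0 in \<open>auto intro!: mult_nonneg_nonneg\<close>)
    finally show ?thesis unfolding torus_norm_lp_block[OF \<phi> f] .
  qed
  also have "\<dots> \<le> ennreal 18 * (besov_norm \<phi> 0 2 2 (distribution f))\<^sup>2"
  proof (intro mult_left_mono)
    let ?g = "\<lambda>j. (torus_norm 2 (lp_block \<phi> j (distribution f)))\<^sup>2"
    have "(\<Sum>j\<in>J ` ?A. ?g j) = (\<integral>\<^sup>+j. ?g j * indicator (J ` ?A) j \<partial>count_space UNIV)"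
      using A by (subst nn_integral_indicator_finite) auto
    also have "\<dots> \<le> (\<integral>\<^sup>+j. ?g j \<partial>count_space UNIV)"
      by (intro nn_integral_mono) (auto simp: indicator_def)
    finally show "(\<Sum>j\<in>J ` ?A. ?g j) \<le> (besov_norm \<phi> 0 2 2 (distribution f))\<^sup>2"
      by (simp add: besov_norm_sq)
  qed simp
  finally show ?thesis .
qed

section \<open>Exhausting the time interval\<close>

text \<open>The shift by 2 makes already the first end point \<open>T / 2\<close> positive, so every
  interval of the exhaustion is admissible for the hypothesis on the solution.\<close>

definition exhaust :: "real \<Rightarrow> nat \<Rightarrow> real" where
  "exhaust T n = T * (1 - 1 / real (n + 2))"

lemma exhaust_bounds: "T > 0 \<Longrightarrow> 0 < exhaust T n \<and> exhaust T n < T"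
  by (auto simp: exhaust_def field_simps add_pos_nonneg)

lemma exhaust_mono: "T > 0 \<Longrightarrow> m \<le> n \<Longrightarrow> exhaust T m \<le> exhaust T n"
  unfolding exhaust_def by (intro mult_left_mono diff_left_mono divide_left_mono) auto

lemma exhaust_ex:
  assumes "T > 0" "t < T" shows "\<exists>n. t < exhaust T n"
proof -
  have "(\<lambda>n. T * (1 - 1 / real (n + 2))) \<longlonglongrightarrow> T * (1 - 0)"
    by (intro tendsto_intros LIMSEQ_ignore_initial_segment[OF lim_1_over_n])
  then have "eventually (\<lambda>n. t < exhaust T n) sequentially"
    using assms unfolding exhaust_def by (intro order_tendstoD(1)) auto
  then show ?thesis by (auto simp: eventually_sequentially)
qed

lemma AE_exhaust:
  fixes T :: real
  assumes "T > 0" and P: "\<And>T'. 0 < T' \<Longrightarrow> T' < T \<Longrightarrow> AE t in lebesgue_on {0..<T'}. P t"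
  shows "AE t in lebesgue_on {0..T}. P t"
proof -
  have "AE t in lebesgue. \<forall>n. t \<in> {0..<exhaust T n} \<longrightarrow> P t"
    using P exhaust_bounds[OF assms(1)] by (subst AE_all_countable) (auto simp: AE_restrict_space_iff)
  moreover have "AE t in lebesgue. t \<noteq> T"
    using AE_not_in[of "{T}" lebesgue] by (simp add: negligible_iff_null_sets[symmetric])
  ultimately have "AE t in lebesgue. t \<in> {0..T} \<longrightarrow> P t"
  proof eventually_elim
    case (elim t)
    show ?case
    proof
      assume "t \<in> {0..T}"
      then obtain n where "t \<in> {0..<exhaust T n}" using exhaust_ex[OF assms(1), of t] elim(2) by auto
      then show "P t" using elim(1) by blast
    qed
  qed
  then show ?thesis by (simp add: AE_restrict_space_iff)
qed

definition exhaust_index :: "real \<Rightarrow> real \<Rightarrow> nat" where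
  "exhaust_index T t = (LEAST n. t < exhaust T n)"

lemma exhaust_index: "T > 0 \<Longrightarrow> t < T \<Longrightarrow> t < exhaust T (exhaust_index T t)"
  unfolding exhaust_index_def by (rule LeastI_ex) (rule exhaust_ex)

lemma exhaust_index_eq_iff:
  assumes "T > 0" "t < T"
  shows "exhaust_index T t = j \<longleftrightarrow> t < exhaust T j \<and> (\<forall>i<j. \<not> t < exhaust T i)"
proof
  assume "exhaust_index T t = j"
  then show "t < exhaust T j \<and> (\<forall>i<j. \<not> t < exhaust T i)"
    using exhaust_index[OF assms] not_less_Least[of _ "\<lambda>n. t < exhaust T n"]
    unfolding exhaust_index_def by blast
next
  assume "t < exhaust T j \<and> (\<forall>i<j. \<not> t < exhaust T i)"
  then show "exhaust_index T t = j"
    unfolding exhaust_index_def by (intro Least_equality) (metis, metis not_le)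
qed

text \<open>Only strong measurability is inherited from the subintervals; the finite norm on
  \<open>I\<close> is supplied separately, which is why the exponents \<open>p\<close> and
  \<open>q\<close> may differ. The range allowed for \<open>I\<close> covers both the half-open and
  the closed time interval.\<close>

lemma bochner_exhaust:
  fixes u :: "real \<Rightarrow> 'a \<Rightarrow> 'b::real_vector"
  assumes T: "T > 0" and u: "\<And>T'. 0 < T' \<Longrightarrow> T' < T \<Longrightarrow> u \<in> bochner q (lebesgue_on {0..<T'}) X N"
    and I: "{0..<T} \<subseteq> I" "I \<subseteq> {0..T}" "I \<in> sets lebesgue"
    and L: "Lnorm p (lebesgue_on I) (\<lambda>t. N (u t)) < \<infinity>"
  shows "u \<in> bochner p (lebesgue_on I) X N"
proof -
  let ?T = "exhaust T"
  have "\<forall>j. \<exists>s. (\<forall>n. simple_function (lebesgue_on {0..<?T j}) (s n) \<and> s n ` {0..<?T j} \<subseteq> X) \<and>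
        (AE t in lebesgue_on {0..<?T j}. (\<lambda>n. N (\<lambda>x. s n t x - u t x)) \<longlonglongrightarrow> 0)"
    using u exhaust_bounds[OF T] by (auto simp: bochner_def)
  from choice[OF this] obtain s :: "nat \<Rightarrow> nat \<Rightarrow> real \<Rightarrow> 'a \<Rightarrow> 'b" where
    s: "\<forall>j. (\<forall>n. simple_function (lebesgue_on {0..<?T j}) (s j n) \<and> s j n ` {0..<?T j} \<subseteq> X) \<and>
        (AE t in lebesgue_on {0..<?T j}. (\<lambda>n. N (\<lambda>x. s j n t x - u t x)) \<longlonglongrightarrow> 0)" ..
  have simple: "simple_function (lebesgue_on {0..<?T j}) (s j n)" and X: "s j n ` {0..<?T j} \<subseteq> X"
    and lim: "AE t in lebesgue_on {0..<?T j}. (\<lambda>n. N (\<lambda>x. s j n t x - u t x)) \<longlonglongrightarrow> 0" for j n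
    using s by blast+
  have fin: "finite (s j n ` {0..<?T j})" for j n
    using simple[of j n] by (simp add: simple_function_def)
  have pre: "s j n -` {y} \<inter> {0..<?T j} \<in> sets lebesgue" for j n y
    using simple_functionD(2)[OF simple[of j n], of "{y}"] by (simp add: sets_restrict_space_iff)
  have "0 \<in> {0..<?T 0}" using exhaust_bounds[OF T, of 0] by auto
  then obtain x0 where x0: "x0 \<in> X" using X[of 0 0] by blast
  define idx where "idx = exhaust_index T"
  define R where "R j = {t \<in> {0..<T}. idx t = j}" for j
  have R: "R j \<in> sets lebesgue" "R j \<subseteq> {0..<?T j}" "R j \<subseteq> I" for j
  proof -
    have "R j = {0..<?T j} - (\<Union>i<j. {..<?T i})"
    proof (rule set_eqI)
      fix t
      show "t \<in> R j \<longleftrightarrow> t \<in> {0..<?T j} - (\<Union>i<j. {..<?T i})"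
      proof (cases "t < T")
        case True
        then show ?thesis unfolding R_def idx_def by (auto simp: exhaust_index_eq_iff[OF T True])
      next
        case False
        then show ?thesis using exhaust_bounds[OF T, of j] by (auto simp: R_def)
      qed
    qed
    then show "R j \<in> sets lebesgue" "R j \<subseteq> {0..<?T j}" by auto
    show "R j \<subseteq> I" using I(1) by (auto simp: R_def)
  qed
  \<comment> \<open>At stage \<open>n\<close> only the first \<open>n + 1\<close> pieces use their
    own simple function, so the range stays finite; the constant \<open>x0\<close> fills the rest.
    Each fixed \<open>t\<close> is eventually in its own piece.\<close>
  define S where "S n t = (if t \<in> {0..<T} \<and> idx t \<le> n then s (idx t) n t else x0)" for n t
  have SX: "S n t \<in> X" for n t
  proof (cases "t \<in> {0..<T} \<and> idx t \<le> n")
    case True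
    then have "t \<in> {0..<?T (idx t)}" using exhaust_index[OF T, of t] by (auto simp: idx_def)
    then show ?thesis using X True by (force simp: S_def)
  qed (use x0 in \<open>auto simp: S_def\<close>)
  have Ssimple: "simple_function (lebesgue_on I) (S n)" for n
    unfolding simple_function_def
  proof (intro conjI ballI)
    have "S n ` I \<subseteq> insert x0 (\<Union>j\<le>n. s j n ` {0..<?T j})"
    proof
      fix y assume "y \<in> S n ` I"
      then obtain t where t: "t \<in> I" "y = S n t" by blast
      show "y \<in> insert x0 (\<Union>j\<le>n. s j n ` {0..<?T j})"
      proof (cases "t \<in> {0..<T} \<and> idx t \<le> n")
        case True
        then have "t \<in> {0..<?T (idx t)}" using exhaust_index[OF T, of t] by (auto simp: idx_def)
        moreover have "y = s (idx t) n t" using t True by (simp add: S_def)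
        ultimately have "y \<in> s (idx t) n ` {0..<?T (idx t)}" by blast
        then show ?thesis using True by blast
      qed (use t in \<open>auto simp: S_def\<close>)
    qed
    then have "finite (S n ` I)" by (rule finite_subset) (use fin in auto)
    then show "finite (S n ` space (lebesgue_on I))" by simp
    fix y
    define Q where "Q = (\<Union>j\<le>n. R j)"
    have Q: "Q \<in> sets lebesgue" "t \<in> Q \<longleftrightarrow> t \<in> {0..<T} \<and> idx t \<le> n" for t
      using R(1) by (auto simp: Q_def R_def)
    have "S n -` {y} \<inter> I = (\<Union>j\<le>n. R j \<inter> (s j n -` {y} \<inter> {0..<?T j})) \<union> (if x0 = y then I - Q else {})"
    proof (intro set_eqI)
      fix t
      show "t \<in> S n -` {y} \<inter> I \<longleftrightarrow> t \<in> (\<Union>j\<le>n. R j \<inter> (s j n -` {y} \<inter> {0..<?T j})) \<union> (if x0 = y then I - Q else {})"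
      proof (cases "t \<in> Q")
        case True
        then have t: "t \<in> {0..<T}" "idx t \<le> n" using Q(2) by auto
        have tR: "t \<in> R (idx t)" using t by (simp add: R_def)
        then have "t \<in> I" "t \<in> {0..<?T (idx t)}" using R(2,3) by blast+
        moreover note tR
        moreover have "S n t = s (idx t) n t" using t by (simp add: S_def)
        ultimately show ?thesis using True t(2) by (auto simp: R_def)
      next
        case False
        then have "S n t = x0" "t \<notin> R j" if "j \<le> n" for j using Q(2)[of t] that by (auto simp: S_def R_def)
        then show ?thesis using False Q(2)[of t] by (auto simp: S_def)
      qed
    qed
    also have "\<dots> \<in> sets lebesgue"
      using Q(1) I(3) by (intro sets.Un sets.finite_UN sets.Int[OF R(1) pre]) auto
    finally show "S n -` {y} \<inter> space (lebesgue_on I) \<in> sets (lebesgue_on I)"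
      using I(3) by (simp add: sets_restrict_space_iff)
  qed
  have AE1: "AE t in lebesgue_on {0..T}. (\<lambda>n. N (\<lambda>x. S n t x - u t x)) \<longlonglongrightarrow> 0"
  proof -
    have "AE t in lebesgue. \<forall>j. t \<in> {0..<?T j} \<longrightarrow> (\<lambda>n. N (\<lambda>x. s j n t x - u t x)) \<longlonglongrightarrow> 0"
      using lim by (subst AE_all_countable) (auto simp: AE_restrict_space_iff)
    moreover have "AE t in lebesgue. t \<noteq> T"
      using AE_not_in[of "{T}" lebesgue] by (simp add: negligible_iff_null_sets[symmetric])
    ultimately have "AE t in lebesgue. t \<in> {0..T} \<longrightarrow> (\<lambda>n. N (\<lambda>x. S n t x - u t x)) \<longlonglongrightarrow> 0"
    proof eventually_elim
      case (elim t)
      show ?case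
      proof
        assume "t \<in> {0..T}"
        then have t: "t \<in> {0..<T}" using elim(2) by auto
        then have "t \<in> {0..<?T (idx t)}" using exhaust_index[OF T, of t] by (auto simp: idx_def)
        then have "(\<lambda>n. N (\<lambda>x. s (idx t) n t x - u t x)) \<longlonglongrightarrow> 0" using elim(1) by blast
        moreover have "eventually (\<lambda>n. N (\<lambda>x. s (idx t) n t x - u t x) = N (\<lambda>x. S n t x - u t x)) sequentially"
          unfolding eventually_sequentially using t by (intro exI[of _ "idx t"]) (auto simp: S_def)
        ultimately show "(\<lambda>n. N (\<lambda>x. S n t x - u t x)) \<longlonglongrightarrow> 0"
          by (rule Lim_transform_eventually)
      qed
    qed
    then show ?thesis by (simp add: AE_restrict_space_iff)
  qed
  have AE2: "AE t in lebesgue_on {0..T}. u t \<in> X"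
    by (rule AE_exhaust[OF T]) (use u in \<open>auto simp: bochner_def\<close>)
  have "AE t in lebesgue_on I. u t \<in> X" "AE t in lebesgue_on I. (\<lambda>n. N (\<lambda>x. S n t x - u t x)) \<longlonglongrightarrow> 0"
    by (rule AE_lebesgue_on_subset[OF _ I(2,3)]; use AE1 AE2 in simp)+
  then show ?thesis
    unfolding bochner_def using Ssimple SX L by (auto intro!: exI[of _ S])
qed

lemma measurable_exhaust:
  fixes f :: "real \<Rightarrow> ennreal"
  assumes T: "T > 0" and f: "\<And>T'. 0 < T' \<Longrightarrow> T' < T \<Longrightarrow> f \<in> borel_measurable (lebesgue_on {0..<T'})"
    and I: "{0..<T} \<subseteq> I" "I \<subseteq> {0..T}" "I \<in> sets lebesgue"
  shows "f \<in> borel_measurable (lebesgue_on I)"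
proof (rule measurable_piecewise_restrict[where C="insert {T} (range (\<lambda>n. {0..<exhaust T n}))"])
  show "countable (insert {T} (range (\<lambda>n. {0..<exhaust T n})))" by auto
  have sub: "{0..<exhaust T n} \<subseteq> I" for n using I(1) exhaust_bounds[OF T, of n] by auto
  show "\<Omega> \<inter> space (lebesgue_on I) \<in> sets (lebesgue_on I)"
    if "\<Omega> \<in> insert {T} (range (\<lambda>n. {0..<exhaust T n}))" for \<Omega>
    using that I(3) by (auto simp: sets_restrict_space_iff)
  show "space (lebesgue_on I) \<subseteq> \<Union> (insert {T} (range (\<lambda>n. {0..<exhaust T n})))"
  proof
    fix t assume "t \<in> space (lebesgue_on I)"
    then have "t \<in> {0..T}" using I(2) by auto
    then show "t \<in> \<Union> (insert {T} (range (\<lambda>n. {0..<exhaust T n})))"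
      using exhaust_ex[OF T, of t] by (cases "t = T") auto
  qed
  fix \<Omega> assume "\<Omega> \<in> insert {T} (range (\<lambda>n. {0..<exhaust T n}))"
  then consider "\<Omega> = {T}" | n where "\<Omega> = {0..<exhaust T n}" by blast
  then show "f \<in> borel_measurable (restrict_space (lebesgue_on I) \<Omega>)"
  proof cases
    case 1
    have "(\<lambda>t. f T) \<in> borel_measurable (restrict_space (lebesgue_on I) \<Omega>)" by simp
    then show ?thesis
      by (rule measurable_cong[THEN iffD1, rotated]) (use 1 in \<open>auto simp: space_restrict_space\<close>)
  next
    case 2
    have "restrict_space (lebesgue_on I) \<Omega> = lebesgue_on {0..<exhaust T n}"
      using 2 sub[of n] I(3) by (simp add: restrict_restrict_space Int_absorb1)
    then show ?thesis using f exhaust_bounds[OF T, of n] by simp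
  qed
qed

section \<open>Continuity in time and Hartley coefficients\<close>

lemma continuous_AE_eq_imp_eq:
  fixes f g :: "real \<Rightarrow> 'b::euclidean_space"
  assumes f: "continuous_on {0..<T} f" and g: "continuous_on {0..<T} g"
    and ae: "AE t in lebesgue_on {0..<T}. f t = g t" and t: "t \<in> {0..<T}"
  shows "f t = g t"
proof (rule ccontr)
  assume "f t \<noteq> g t"
  then have "norm (f t - g t) > 0" by simp
  moreover have "continuous_on {0..<T} (\<lambda>t. norm (f t - g t))"
    by (intro continuous_intros f g)
  ultimately obtain \<delta> where \<delta>: "\<delta> > 0"
    "\<And>s. s \<in> {0..<T} \<Longrightarrow> dist s t < \<delta> \<Longrightarrow> dist (norm (f s - g s)) (norm (f t - g t)) < norm (f t - g t)"
    using t unfolding continuous_on_iff by meson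
  \<comment> \<open>The interval to the right of \<open>t\<close> has positive measure also for
    \<open>t = 0\<close>.\<close>
  define b where "b = min (t + \<delta>) T"
  have b: "t < b" using \<delta>(1) t by (auto simp: b_def)
  have neq: "f s \<noteq> g s" if "s \<in> {t<..<b}" for s
  proof -
    have "dist (norm (f s - g s)) (norm (f t - g t)) < norm (f t - g t)"
      using that t by (intro \<delta>(2)) (auto simp: b_def dist_real_def)
    then show ?thesis by (auto simp: dist_real_def)
  qed
  have "AE s in lebesgue. s \<in> {0..<T} \<longrightarrow> f s = g s"
    using ae by (simp add: AE_restrict_space_iff)
  then have "AE s in lebesgue. s \<notin> {t<..<b}"
    by eventually_elim (use neq t in \<open>auto simp: b_def\<close>)
  then have "{t<..<b} \<in> null_sets lebesgue"
    by (subst (asm) AE_iff_null_sets[symmetric]) auto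
  then have "emeasure lborel {t<..<b} = 0" by (simp add: null_sets_def)
  then show False using b by (simp add: emeasure_lborel_Ioo)
qed

lemma integrable_lebesgue_on_cong_AE:
  fixes f g :: "real \<Rightarrow> real"
  assumes f: "integrable (lebesgue_on A) f" and ae: "AE t in lebesgue_on A. f t = g t" and A: "A \<in> sets lebesgue"
  shows "integrable (lebesgue_on A) g" "(\<integral>t. f t \<partial>lebesgue_on A) = (\<integral>t. g t \<partial>lebesgue_on A)"
proof -
  have fi: "integrable lebesgue (\<lambda>t. indicator A t * f t)"
    using f A by (simp add: integrable_restrict_space)
  have ae': "AE t in lebesgue. indicator A t * f t = indicator A t * g t"
    using ae A by (auto simp: AE_restrict_space_iff indicator_def elim!: eventually_mono)
  have gm: "(\<lambda>t. indicator A t * g t) \<in> borel_measurable lebesgue"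
    by (rule borel_measurable_AE[OF borel_measurable_integrable[OF fi] ae'])
  have "integrable lebesgue (\<lambda>t. indicator A t * g t)"
    using fi ae' gm integrable_cong_AE[OF borel_measurable_integrable[OF fi] gm ae'] by simp
  then show "integrable (lebesgue_on A) g"
    using A by (simp add: integrable_restrict_space)
  show "(\<integral>t. f t \<partial>lebesgue_on A) = (\<integral>t. g t \<partial>lebesgue_on A)"
    using A integral_cong_AE[OF borel_measurable_integrable[OF fi] gm ae'] by (simp add: integral_restrict_space)
qed

text \<open>A finite set of frequencies is contained in an initial segment of the enumeration. This
  translates between bounds on series and the bounds on all finite sets used for Sobolev
  norms.\<close>

lemma bounded_partial_sums_imp_finite_sums:
  fixes g :: "int ^ 'n \<Rightarrow> real"
  assumes "\<And>N. (\<Sum>n<N. g (freq_enum n)) \<le> c" and g: "\<And>k. g k \<ge> 0" and A: "finite A"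
  shows "(\<Sum>k\<in>A. g k) \<le> c"
proof -
  let ?h = "inv freq_enum :: int ^ 'n \<Rightarrow> nat"
  have h: "freq_enum (?h k) = k" for k :: "int ^ 'n"
    by (rule surj_f_inv_f[OF bij_is_surj[OF bij_freq_enum]])
  have "finite (?h ` A)" using A by simp
  then obtain N where N: "\<And>k. k \<in> A \<Longrightarrow> ?h k < N"
    unfolding finite_nat_iff_bounded by blast
  have "A \<subseteq> freq_enum ` {..<N}"
  proof
    fix k assume "k \<in> A"
    then show "k \<in> freq_enum ` {..<N}" using N h[of k] by (intro image_eqI[of _ _ "?h k"]) auto
  qed
  then have "(\<Sum>k\<in>A. g k) \<le> (\<Sum>k\<in>freq_enum ` {..<N}. g k)"
    using g by (intro sum_mono2) auto
  also have "\<dots> = (\<Sum>n<N. g (freq_enum n))"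
    by (simp add: sum.reindex[OF inj_freq_enum])
  also have "\<dots> \<le> c" by (rule assms(1))
  finally show ?thesis .
qed

lemma hc_diff:
  assumes "integrable torus f" "integrable torus g"
  shows "hc k (\<lambda>x. f x - g x) = hc k f - hc k g"
  unfolding hc_def scaleR_diff_right
  by (intro Bochner_Integration.integral_diff integrable_cas_scaleR assms)

lemma hc_cong_AE:
  fixes f g :: "real ^ 'n \<Rightarrow> 'b::euclidean_space"
  assumes "integrable torus f" "integrable torus g" "AE x in torus. f x = g x"
  shows "hc k f = hc k g"
  unfolding hc_def
proof (rule integral_cong_AE)
  show "AE x in torus. cas k x *\<^sub>R f x = cas k x *\<^sub>R g x" using assms(3) by (auto elim: eventually_mono)
qed (use integrable_cas_scaleR[OF assms(1), of k] integrable_cas_scaleR[OF assms(2), of k] in auto)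

lemma norm_hc_le_torus_norm:
  fixes f :: "real ^ 'n \<Rightarrow> 'b::euclidean_space"
  assumes "sq_integrable f"
  shows "ennreal ((norm (hc k f))\<^sup>2) \<le> ennreal ((2 * pi) ^ CARD('n)) * (torus_norm 2 f)\<^sup>2"
proof -
  have "(norm (hc k f))\<^sup>2 \<le> (2 * pi) ^ CARD('n) * (\<integral>x. (norm (f x))\<^sup>2 \<partial>torus)"
    using bessel[OF assms, of "{k}"] by simp
  then have "ennreal ((norm (hc k f))\<^sup>2) \<le> ennreal ((2 * pi) ^ CARD('n) * (\<integral>x. (norm (f x))\<^sup>2 \<partial>torus))"
    by (rule ennreal_leI)
  also have "\<dots> = ennreal ((2 * pi) ^ CARD('n)) * (torus_norm 2 f)\<^sup>2"
    unfolding torus_norm_2_sq_eq[OF assms] by (rule ennreal_mult) auto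
  finally show ?thesis .
qed

text \<open>Bessel's inequality for a single frequency bounds the difference of coefficients by the
  L2 distance.\<close>

lemma tendsto_hc:
  fixes v :: "'t \<Rightarrow> real ^ 'n \<Rightarrow> 'b::euclidean_space"
  assumes lim: "((\<lambda>r. torus_norm 2 (\<lambda>x. v r x - w x)) \<longlongrightarrow> 0) F"
    and v: "\<forall>\<^sub>F r in F. v r \<in> torus_L 2" and w: "w \<in> torus_L 2"
  shows "((\<lambda>r. hc k (v r)) \<longlongrightarrow> hc k w) F"
proof -
  let ?V = "ennreal ((2 * pi) ^ CARD('n))"
  have ws: "sq_integrable w" using w torus_L_2_iff by blast
  have "((\<lambda>r. ?V * (torus_norm 2 (\<lambda>x. v r x - w x) * torus_norm 2 (\<lambda>x. v r x - w x))) \<longlongrightarrow> ?V * (0 * 0)) F"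
    by (intro ennreal_tendsto_cmult tendsto_mult_ennreal lim) auto
  then have up: "((\<lambda>r. ?V * (torus_norm 2 (\<lambda>x. v r x - w x))\<^sup>2) \<longlongrightarrow> 0) F"
    by (simp add: power2_eq_square)
  have "((\<lambda>r. ennreal ((norm (hc k (v r) - hc k w))\<^sup>2)) \<longlongrightarrow> 0) F"
  proof (rule tendsto_sandwich[OF _ _ tendsto_const up])
    show "\<forall>\<^sub>F r in F. 0 \<le> ennreal ((norm (hc k (v r) - hc k w))\<^sup>2)" by simp
    show "\<forall>\<^sub>F r in F. ennreal ((norm (hc k (v r) - hc k w))\<^sup>2) \<le> ?V * (torus_norm 2 (\<lambda>x. v r x - w x))\<^sup>2"
      using v
    proof eventually_elim
      case (elim r)
      then have vs: "sq_integrable (v r)" using torus_L_2_iff by blast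
      show ?case
        using norm_hc_le_torus_norm[OF sq_integrable_diff[OF vs ws], of k]
        by (simp add: hc_diff sq_integrable_imp_integrable vs ws)
    qed
  qed
  then have "((\<lambda>r. (norm (hc k (v r) - hc k w))\<^sup>2) \<longlongrightarrow> 0) F"
    unfolding ennreal_0[symmetric] by (subst (asm) tendsto_ennreal_iff) auto
  then have "((\<lambda>r. sqrt ((norm (hc k (v r) - hc k w))\<^sup>2)) \<longlongrightarrow> sqrt 0) F"
    by (rule tendsto_real_sqrt)
  then show ?thesis
    by (simp add: tendsto_norm_zero_iff LIM_zero_iff)
qed

lemma torus_norm_cong_AE:
  assumes "AE x in torus. f x = g x"
  shows "torus_norm 2 f = torus_norm 2 g"
proof -
  have "(\<integral>\<^sup>+ x. enn_powr (ennreal (norm (f x))) 2 \<partial>torus) = (\<integral>\<^sup>+ x. enn_powr (ennreal (norm (g x))) 2 \<partial>torus)"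
    by (rule nn_integral_cong_AE) (use assms in \<open>auto elim: eventually_mono\<close>)
  then show ?thesis by (simp add: torus_norm_def Lnorm_def)
qed

section \<open>Solutions on a half-open interval\<close>

lemma integral_lebesgue_on_cong_AE:
  fixes f g :: "real \<Rightarrow> real"
  assumes "AE t in lebesgue_on A. f t = g t" "A \<in> sets lebesgue"
  shows "(\<integral>t. f t \<partial>lebesgue_on A) = (\<integral>t. g t \<partial>lebesgue_on A)"
proof (cases "integrable (lebesgue_on A) f \<or> integrable (lebesgue_on A) g")
  case True
  have "AE t in lebesgue_on A. g t = f t" using assms(1) by (auto elim: eventually_mono)
  then show ?thesis
    using True integrable_lebesgue_on_cong_AE(2)[OF _ _ assms(2)] assms(1) by metis
qed (simp add: not_integrable_integral_eq)

text \<open>The equation determines the tested time derivative almost everywhere. This expression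
  does not depend on the subinterval, in contrast to the witnesses \<open>dtu\<close>.\<close>

definition ks_rhs :: "real \<Rightarrow> (real ^ 'n \<Rightarrow> real ^ 'n) \<Rightarrow> (real ^ 'n \<Rightarrow> real ^ 'n) \<Rightarrow> real" where
  "ks_rhs lam f \<psi> = lam * (\<Sum>i\<in>UNIV. torus_inner (weak_deriv [i] f) (pderivs [i] \<psi>))
     - torus_inner (advection f) \<psi> - torus_inner (weak_laplacian f) (laplacian \<psi>)"

lemma torus_inner_cas:
  fixes f :: "real ^ 'n \<Rightarrow> 'b::euclidean_space"
  assumes "integrable torus f"
  shows "torus_inner f (\<lambda>x. cas k x *\<^sub>R e) = hc k f \<bullet> e"
proof -
  have "torus_inner f (\<lambda>x. cas k x *\<^sub>R e) = (\<integral>x. (cas k x *\<^sub>R f x) \<bullet> e \<partial>torus)"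
    by (simp add: torus_inner_def)
  also have "\<dots> = hc k f \<bullet> e"
    unfolding hc_def by (rule integral_inner_left) (use assms in simp)
  finally show ?thesis .
qed

lemma ks_rhs_cas:
  fixes f :: "real ^ 2 \<Rightarrow> real ^ 2"
  assumes f: "f \<in> sobolev 2"
  shows "ks_rhs lam f (\<lambda>x. cas k x *\<^sub>R e)
    = (lam * (norm (lat k))\<^sup>2 - ((norm (lat k))\<^sup>2)\<^sup>2) * (hc k f \<bullet> e) - hc k (advection f) \<bullet> e"
proof -
  have sm: "smooth (cas k)"
    using trig_poly_smooth[OF trig_poly_cas[of k "1 :: real"]] by simp
  have D1: "is_weak_deriv [i] f (weak_deriv [i] f)" "integrable torus (weak_deriv [i] f)" for i
    using sobolev_weak_deriv[OF f, of "[i]"] by auto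
  have D2: "is_weak_deriv [i, i] f (weak_deriv [i, i] f)" "integrable torus (weak_deriv [i, i] f)" for i
    using sobolev_weak_deriv[OF f, of "[i, i]"] by auto
  have "torus_inner (weak_deriv [i] f) (pderivs [i] (\<lambda>x. cas k x *\<^sub>R e)) = (real_of_int (k $ i))\<^sup>2 * (hc k f \<bullet> e)" for i
  proof -
    have "pderivs [i] (\<lambda>x. cas k x *\<^sub>R e) = (\<lambda>x. cas (- k) x *\<^sub>R (real_of_int (k $ i) *\<^sub>R e))"
      by (simp add: pderivs_scaleR_const[OF sm] pderivs_cas_1 mult.commute)
    then show ?thesis
      by (simp only: torus_inner_cas[OF D1(2)] hc_weak_deriv_1[OF D1(1)]) (simp add: power2_eq_square)
  qed
  then have 1: "(\<Sum>i\<in>UNIV. torus_inner (weak_deriv [i] f) (pderivs [i] (\<lambda>x. cas k x *\<^sub>R e))) = (norm (lat k))\<^sup>2 * (hc k f \<bullet> e)"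
    by (simp add: norm_lat_sq sum_distrib_right)
  have 2: "torus_inner (advection f) (\<lambda>x. cas k x *\<^sub>R e) = hc k (advection f) \<bullet> e"
  proof (rule torus_inner_cas, rule sq_integrable_imp_integrable)
    obtain c where "\<And>A. finite A \<Longrightarrow> (\<Sum>k\<in>A. wt 2 k * (norm (hc k f))\<^sup>2) \<le> c"
      using sobolev_wt_bounded[OF f] by blast
    then show "sq_integrable (advection f)" by (rule advection_estimate(1)[OF f])
  qed
  have l: "laplacian (\<lambda>x. cas k x *\<^sub>R e) = (\<lambda>x. cas k x *\<^sub>R (- (norm (lat k))\<^sup>2 *\<^sub>R e))"
  proof
    fix x
    have "laplacian (\<lambda>x. cas k x *\<^sub>R e) x = (\<Sum>i\<in>UNIV. (- (real_of_int (k $ i))\<^sup>2 * cas k x) *\<^sub>R e)"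
      by (simp add: laplacian_def pderivs_scaleR_const[OF sm] pderivs_cas_2)
    also have "\<dots> = (\<Sum>i\<in>UNIV. - (real_of_int (k $ i))\<^sup>2 * cas k x) *\<^sub>R e"
      by (simp only: scaleR_sum_left)
    also have "(\<Sum>i\<in>UNIV. - (real_of_int (k $ i))\<^sup>2 * cas k x) = cas k x * (- (norm (lat k))\<^sup>2)"
      by (simp add: norm_lat_sq sum_negf sum_distrib_left mult.commute)
    finally show "laplacian (\<lambda>x. cas k x *\<^sub>R e) x = cas k x *\<^sub>R (- (norm (lat k))\<^sup>2 *\<^sub>R e)"
      by simp
  qed
  have wl: "weak_laplacian f = (\<lambda>x. \<Sum>i\<in>UNIV. weak_deriv [i, i] f x)"
    by (simp add: weak_laplacian_def fun_eq_iff)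
  have "hc k (weak_laplacian f) = (\<Sum>i\<in>UNIV. hc k (weak_deriv [i, i] f))"
    unfolding wl hc_def scaleR_sum_right using D2(2) by (intro Bochner_Integration.integral_sum integrable_cas_scaleR)
  also have "\<dots> = - (norm (lat k))\<^sup>2 *\<^sub>R hc k f"
    by (simp add: hc_weak_deriv_2[OF D2(1)] norm_lat_sq scaleR_sum_left sum_negf)
  finally have h: "hc k (weak_laplacian f) = - (norm (lat k))\<^sup>2 *\<^sub>R hc k f" .
  have "integrable torus (weak_laplacian f)"
    unfolding wl using D2(2) by (intro Bochner_Integration.integrable_sum)
  then have 3: "torus_inner (weak_laplacian f) (laplacian (\<lambda>x. cas k x *\<^sub>R e)) = ((norm (lat k))\<^sup>2)\<^sup>2 * (hc k f \<bullet> e)"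
    unfolding l by (subst torus_inner_cas) (simp_all add: h power2_eq_square)
  show ?thesis
    unfolding ks_rhs_def 1 2 3 by (simp add: algebra_simps)
qed

section \<open>Gluing the solutions on subintervals\<close>

locale ks_solution =
  fixes T lam :: real and u\<^sub>0 :: "real ^ 2 \<Rightarrow> real ^ 2" and u :: "real \<Rightarrow> real ^ 2 \<Rightarrow> real ^ 2"
    and \<phi> :: "real ^ 2 \<Rightarrow> real"
  assumes T: "T > 0" and lam: "lam > 0" and \<phi>: "littlewood_paley \<phi>"
    and sol: "solution_on T lam u\<^sub>0 u"
    and besov: "(\<lambda>t. distribution (weak_divergence (u t)))
           \<in> bochner 2 (lebesgue_on {0<..<T}) (besov \<phi> 0 2 2) (besov_norm \<phi> 0 2 2)"
begin

lemma strong: "0 < T' \<Longrightarrow> T' < T \<Longrightarrow> strong_solution T' lam u\<^sub>0 u"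
  using sol by (auto simp: solution_on_def)

lemma AE_sobolev: "AE t in lebesgue_on {0..T}. u t \<in> sobolev 2 \<and> u t \<in> sobolev 4"
proof (rule AE_exhaust[OF T])
  fix T' :: real assume "0 < T'" "T' < T"
  then have "u \<in> bochner_sobolev 2 {0..<T'} 4"
    using strong by (auto simp: strong_solution_def)
  then have "AE t in lebesgue_on {0..<T'}. u t \<in> sobolev 4" by (simp add: bochner_def)
  then show "AE t in lebesgue_on {0..<T'}. u t \<in> sobolev 2 \<and> u t \<in> sobolev 4"
    using sobolev_mono[of 2 4] by (auto elim!: eventually_mono)
qed

lemma between: "s < T \<Longrightarrow> \<exists>T'. 0 < T' \<and> s < T' \<and> T' < T"
  using dense[of "max s 0" T] T by auto

text \<open>A test function in time has compact support in the open interval, hence support in a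
  shorter interval on which the strong solution provides the equation. There its witness
  \<open>dtu\<close> agrees almost everywhere with \<open>ks_rhs\<close>.\<close>

lemma weak_equation:
  assumes \<psi>: "smooth \<psi>" "periodic \<psi>"
  shows "has_weak_time_deriv 0 T (\<lambda>t. torus_inner (u t) \<psi>) (\<lambda>t. ks_rhs lam (u t) \<psi>)"
proof -
  let ?f = "\<lambda>t. torus_inner (u t) \<psi>" and ?g = "\<lambda>t. ks_rhs lam (u t) \<psi>"
  have loc: "\<exists>dtu. has_weak_time_deriv 0 T' ?f dtu \<and> (AE t in lebesgue_on {0<..<T'}. dtu t = ?g t)"
    if T': "0 < T'" "T' < T" for T'
  proof -
    obtain dtu where d: "has_weak_time_deriv 0 T' ?f dtu"
      "AE t in lebesgue_on {0<..<T'}. dtu t + torus_inner (advection (u t)) \<psi>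
                + torus_inner (weak_laplacian (u t)) (laplacian \<psi>)
              = lam * (\<Sum>i\<in>UNIV. torus_inner (weak_deriv [i] (u t)) (pderivs [i] \<psi>))"
      using strong[OF T'] \<psi> unfolding strong_solution_def by blast
    have "AE t in lebesgue_on {0<..<T'}. dtu t = ?g t"
      using d(2) by eventually_elim (simp add: ks_rhs_def)
    then show ?thesis using d(1) by blast
  qed
  show ?thesis
    unfolding has_weak_time_deriv_def
  proof (intro conjI allI impI; (elim conjE)?)
    fix c d :: real assume cd: "0 < c" "d < T"
    obtain T' where T': "0 < T'" "d < T'" "T' < T" using between[OF cd(2)] by blast
    obtain dtu where dtu: "has_weak_time_deriv 0 T' ?f dtu" "AE t in lebesgue_on {0<..<T'}. dtu t = ?g t"
      using loc T' by blast
    then show "integrable (lebesgue_on {c..d}) ?f"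
      using cd T' by (auto simp: has_weak_time_deriv_def)
    have "integrable (lebesgue_on {c..d}) dtu"
      using dtu(1) cd T' by (auto simp: has_weak_time_deriv_def)
    then show "integrable (lebesgue_on {c..d}) ?g"
      by (rule integrable_lebesgue_on_cong_AE(1)[OF _ AE_lebesgue_on_subset[OF dtu(2)]]) (use cd T' in auto)
  next
    fix \<eta> :: "real \<Rightarrow> real" assume \<eta>: "smooth \<eta>" "closure {t. \<eta> t \<noteq> 0} \<subseteq> {0<..<T}"
    define K where "K = closure {t. \<eta> t \<noteq> 0}"
    have KT: "K \<subseteq> {0<..<T}" and Kc: "closed K" using \<eta>(2) by (simp_all add: K_def)
    have "compact K"
      using KT Kc bounded_subset[of "{0<..<T}" K] by (simp add: compact_eq_bounded_closed)
    have "\<exists>s<T. \<forall>t\<in>K. t \<le> s"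
    proof (cases "K = {}")
      case False
      then show ?thesis using compact_attains_sup[OF \<open>compact K\<close>] KT by force
    qed (use T in auto)
    then obtain s where s: "s < T" "\<And>t. t \<in> K \<Longrightarrow> t \<le> s" by blast
    obtain T' where T': "0 < T'" "s < T'" "T' < T" using between[OF s(1)] by blast
    obtain dtu where dtu: "has_weak_time_deriv 0 T' ?f dtu" "AE t in lebesgue_on {0<..<T'}. dtu t = ?g t"
      using loc T' by blast
    have K: "K \<subseteq> {0<..<T'}" using KT s T' by force
    have \<eta>z: "\<eta> t = 0" if "t \<notin> K" for t
      using that closure_subset[of "{t. \<eta> t \<noteq> 0}"] unfolding K_def by auto
    have dz: "deriv \<eta> t = 0" if "t \<notin> K" for t
    proof (rule DERIV_imp_deriv)
      show "(\<eta> has_real_derivative 0) (at t)"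
        by (rule has_field_derivative_transform_within_open[of "\<lambda>_. 0" _ _ "- K"]) (use that \<eta>z Kc in auto)
    qed
    have z: "deriv \<eta> t = 0" "\<eta> t = 0" if "t \<notin> {0<..<T'}" for t
      using that K dz \<eta>z by blast+
    have "(\<integral>t. ?f t * deriv \<eta> t \<partial>lebesgue_on {0<..<T}) = (\<integral>t. ?f t * deriv \<eta> t \<partial>lebesgue_on {0<..<T'})"
      by (rule integral_lebesgue_on_zero_outside) (use T' z in auto)
    also have "\<dots> = - (\<integral>t. dtu t * \<eta> t \<partial>lebesgue_on {0<..<T'})"
      using dtu(1) \<eta>(1) K unfolding has_weak_time_deriv_def K_def by blast
    also have "(\<integral>t. dtu t * \<eta> t \<partial>lebesgue_on {0<..<T'}) = (\<integral>t. ?g t * \<eta> t \<partial>lebesgue_on {0<..<T'})"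
      by (rule integral_lebesgue_on_cong_AE) (use dtu(2) in \<open>auto elim: eventually_mono\<close>)
    also have "\<dots> = (\<integral>t. ?g t * \<eta> t \<partial>lebesgue_on {0<..<T})"
      by (rule integral_lebesgue_on_zero_outside[symmetric]) (use T' z in auto)
    finally show "(\<integral>t. ?f t * deriv \<eta> t \<partial>lebesgue_on {0<..<T}) = - (\<integral>t. ?g t * \<eta> t \<partial>lebesgue_on {0<..<T})" .
  qed
qed

lemma continuous_hc:
  fixes v :: "real \<Rightarrow> real ^ 2 \<Rightarrow> real ^ 2"
  assumes v: "\<forall>t\<in>{0..<T'}. v t \<in> torus_L 2 \<and> ((\<lambda>r. torus_norm 2 (\<lambda>x. v r x - v t x)) \<longlongrightarrow> 0) (at t within {0..<T'})"
  shows "continuous_on {0..<T'} (\<lambda>t. hc k (v t))"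
  unfolding continuous_on_def
proof
  fix t assume t: "t \<in> {0..<T'}"
  show "((\<lambda>t. hc k (v t)) \<longlongrightarrow> hc k (v t)) (at t within {0..<T'})"
  proof (rule tendsto_hc)
    have "\<forall>\<^sub>F r in at t within {0..<T'}. r \<in> {0..<T'}" by (simp add: eventually_at_filter)
    then show "\<forall>\<^sub>F r in at t within {0..<T'}. v r \<in> torus_L 2"
      by eventually_elim (use v in blast)
  qed (use v t in auto)
qed

text \<open>Each subinterval has its own continuous representative. Two of them have coefficients
  that are continuous in time and agree at almost all common times, hence at all common times, and
  uniqueness of coefficients identifies them in space. The glued function takes the first
  representative available at each time and is locally equal to one of them up to null sets of
  space.\<close>

lemma initial_value_T: "initial_value T u u\<^sub>0"
proof -
  let ?T = "exhaust T"
  have "\<forall>j. \<exists>v. (\<forall>t\<in>{0..<?T j}. v t \<in> torus_L 2 \<and>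
        ((\<lambda>r. torus_norm 2 (\<lambda>x. v r x - v t x)) \<longlongrightarrow> 0) (at t within {0..<?T j})) \<and>
     (AE t in lebesgue_on {0..<?T j}. AE x in torus. v t x = u t x) \<and>
     (AE x in torus. v 0 x = u\<^sub>0 x)"
    using strong exhaust_bounds[OF T] unfolding strong_solution_def initial_value_def by blast
  from choice[OF this] obtain v where v: "\<forall>j. (\<forall>t\<in>{0..<?T j}. v j t \<in> torus_L 2 \<and>
        ((\<lambda>r. torus_norm 2 (\<lambda>x. v j r x - v j t x)) \<longlongrightarrow> 0) (at t within {0..<?T j})) \<and>
     (AE t in lebesgue_on {0..<?T j}. AE x in torus. v j t x = u t x) \<and>
     (AE x in torus. v j 0 x = u\<^sub>0 x)" ..
  have vL: "v j t \<in> torus_L 2" if "t \<in> {0..<?T j}" for j t using v that by blast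
  have vi: "integrable torus (v j t)" if "t \<in> {0..<?T j}" for j t
    using vL[OF that] torus_L_2_iff sq_integrable_imp_integrable by blast
  have same: "AE x in torus. v i t x = v j t x" if ij: "i \<le> j" and t: "t \<in> {0..<?T i}" for i j t
  proof (rule hc_unique)
    have sub: "{0..<?T i} \<subseteq> {0..<?T j}" using exhaust_mono[OF T ij] by auto
    show "integrable torus (v i t)" "integrable torus (v j t)" using vi t sub by auto
    fix k
    show "hc k (v i t) = hc k (v j t)"
    proof (rule continuous_AE_eq_imp_eq[OF _ _ _ t])
      show "continuous_on {0..<?T i} (\<lambda>t. hc k (v i t))" by (rule continuous_hc) (use v in blast)
      have "continuous_on {0..<?T j} (\<lambda>t. hc k (v j t))" by (rule continuous_hc) (use v in blast)
      then show "continuous_on {0..<?T i} (\<lambda>t. hc k (v j t))" by (rule continuous_on_subset[OF _ sub])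
      have a: "AE t in lebesgue_on {0..<?T i}. AE x in torus. v i t x = u t x" using v by blast
      have b: "AE t in lebesgue_on {0..<?T i}. AE x in torus. v j t x = u t x"
        by (rule AE_lebesgue_on_subset[OF _ sub]) (use v in auto)
      have "AE t in lebesgue_on {0..<?T i}. t \<in> {0..<?T i}" by (auto intro: AE_I2)
      with a b show "AE t in lebesgue_on {0..<?T i}. hc k (v i t) = hc k (v j t)"
      proof eventually_elim
        case (elim t)
        have "AE x in torus. v i t x = v j t x" using elim(1,2) by eventually_elim simp
        then show ?case using vi elim(3) sub by (intro hc_cong_AE) auto
      qed
    qed
  qed
  define w where "w t = v (exhaust_index T t) t" for t
  have wj: "AE x in torus. w t x = v j t x" if "t \<in> {0..<?T j}" for j t
  proof -
    have tT: "t < T" using that exhaust_bounds[OF T, of j] by auto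
    have "exhaust_index T t \<le> j" unfolding exhaust_index_def by (rule Least_le) (use that in simp)
    moreover have "t \<in> {0..<?T (exhaust_index T t)}" using exhaust_index[OF T tT] that by auto
    ultimately show ?thesis unfolding w_def by (rule same)
  qed
  have wL: "w t \<in> torus_L 2" if "t \<in> {0..<T}" for t
    unfolding w_def by (rule vL) (use that exhaust_index[OF T, of t] in auto)
  have wlim: "((\<lambda>r. torus_norm 2 (\<lambda>x. w r x - w t x)) \<longlongrightarrow> 0) (at t within {0..<T})" if t: "t \<in> {0..<T}" for t
  proof -
    obtain j where j: "t < ?T j" using exhaust_ex[OF T, of t] t by auto
    have tj: "t \<in> {0..<?T j}" using t j by auto
    have "at t within {0..<T} = at t within {0..<?T j}"
      by (rule at_within_nhd[of t "{..<?T j}"]) (use j exhaust_bounds[OF T, of j] in auto)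
    moreover have "((\<lambda>r. torus_norm 2 (\<lambda>x. w r x - w t x)) \<longlongrightarrow> 0) (at t within {0..<?T j})"
    proof (rule Lim_transform_eventually)
      show "((\<lambda>r. torus_norm 2 (\<lambda>x. v j r x - v j t x)) \<longlongrightarrow> 0) (at t within {0..<?T j})"
        using v tj by blast
      have "\<forall>\<^sub>F r in at t within {0..<?T j}. r \<in> {0..<?T j}" by (simp add: eventually_at_filter)
      then show "\<forall>\<^sub>F r in at t within {0..<?T j}. torus_norm 2 (\<lambda>x. v j r x - v j t x) = torus_norm 2 (\<lambda>x. w r x - w t x)"
      proof eventually_elim
        case (elim r)
        show ?case
        proof (rule torus_norm_cong_AE)
          show "AE x in torus. v j r x - v j t x = w r x - w t x"
            using wj[OF elim] wj[OF tj] by eventually_elim simp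
        qed
      qed
    qed
    ultimately show ?thesis by simp
  qed
  have "AE t in lebesgue_on {0..T}. AE x in torus. w t x = u t x"
  proof (rule AE_exhaust[OF T])
    fix T' assume T': "0 < T'" "T' < T"
    obtain j where j: "T' < ?T j" using exhaust_ex[OF T T'(2)] by blast
    have "AE t in lebesgue_on {0..<T'}. AE x in torus. v j t x = u t x"
      by (rule AE_lebesgue_on_subset[where B="{0..<?T j}"]) (use v j in auto)
    moreover have "AE t in lebesgue_on {0..<T'}. t \<in> {0..<T'}" by (auto intro: AE_I2)
    ultimately show "AE t in lebesgue_on {0..<T'}. AE x in torus. w t x = u t x"
    proof eventually_elim
      case (elim t)
      have "AE x in torus. w t x = v j t x" by (rule wj) (use elim(2) j in auto)
      with elim(1) show ?case by eventually_elim simp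
    qed
  qed
  then have wu: "AE t in lebesgue_on {0..<T}. AE x in torus. w t x = u t x"
    by (rule AE_lebesgue_on_subset) auto
  have "AE x in torus. v (exhaust_index T 0) 0 x = u\<^sub>0 x" using v by blast
  then have "AE x in torus. w 0 x = u\<^sub>0 x" by (simp add: w_def)
  then show ?thesis
    unfolding initial_value_def using wL wlim wu by blast
qed

end

section \<open>Bounds up to the final time\<close>

text \<open>The formula serves twice: at \<open>k = 0\<close> it shows that the mean vanishes, and
  it expresses the divergence through coefficients of the field that are continuous in time.\<close>

lemma hc_weak_divergence:
  fixes f :: "real ^ 'n \<Rightarrow> real ^ 'n"
  assumes f: "f \<in> sobolev 2"
  shows "integrable torus (weak_divergence f)"
    and "hc k (weak_divergence f) = - (\<Sum>i\<in>UNIV. real_of_int (k $ i) * hc (- k) f $ i)"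
proof -
  have D: "is_weak_deriv [i] f (weak_deriv [i] f)" "integrable torus (weak_deriv [i] f)" for i
    using sobolev_weak_deriv[OF f, of "[i]"] by auto
  have e: "weak_divergence f = (\<lambda>x. \<Sum>i\<in>UNIV. weak_deriv [i] f x \<bullet> axis i 1)"
    by (simp add: weak_divergence_def fun_eq_iff inner_axis)
  have i: "integrable torus (\<lambda>x. weak_deriv [i] f x \<bullet> axis i 1)" for i using D(2) by simp
  then show "integrable torus (weak_divergence f)" unfolding e by simp
  have "hc k (weak_divergence f) = (\<Sum>i\<in>UNIV. hc k (\<lambda>x. weak_deriv [i] f x \<bullet> axis i 1))"
    unfolding e hc_def scaleR_sum_right by (intro Bochner_Integration.integral_sum integrable_cas_scaleR i)
  also have "\<dots> = (\<Sum>i\<in>UNIV. - (real_of_int (k $ i) * hc (- k) f $ i))"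
    by (simp only: hc_inner[OF D(2)] hc_weak_deriv_1[OF D(1)]) (simp add: inner_axis)
  finally show "hc k (weak_divergence f) = - (\<Sum>i\<in>UNIV. real_of_int (k $ i) * hc (- k) f $ i)"
    by (simp add: sum_negf)
qed

lemma wt_eq: "wt 2 k = 1 + ((norm (lat k))\<^sup>2)\<^sup>2" "wt 4 k = 1 + ((norm (lat k))\<^sup>2) ^ 4"
  by (simp_all add: wt_def flip: power_mult)

lemma Lnorm_2_finite_iff: "Lnorm 2 M f < \<infinity> \<longleftrightarrow> (\<integral>\<^sup>+x. (f x)\<^sup>2 \<partial>M) < \<infinity>"
proof -
  have "Lnorm 2 M f = enn_powr (\<integral>\<^sup>+x. (f x)\<^sup>2 \<partial>M) (1 / 2)"
    by (simp add: Lnorm_def enn_powr_2)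
  then show ?thesis by (auto simp: enn_powr_def less_top)
qed

lemma bochner_Lnorm_finite: "u \<in> bochner p M X N \<Longrightarrow> Lnorm p M (\<lambda>t. N (u t)) < \<infinity>"
  unfolding bochner_def by (elim CollectE conjE)

text \<open>The constant is moved to the side of \<open>g\<close>, whose measurability is known. In
  the applications \<open>f\<close> is a squared norm as a function of time.\<close>

lemma nn_integral_finite_of_le:
  fixes f g :: "'a \<Rightarrow> ennreal"
  assumes g: "g \<in> borel_measurable M" and le: "AE x in M. g x \<le> ennreal C * f x" and C: "C > 0"
    and f: "(\<integral>\<^sup>+x. f x \<partial>M) < \<infinity>"
  shows "(\<integral>\<^sup>+x. g x \<partial>M) < \<infinity>"
proof -
  have "ennreal (1 / C) * (\<integral>\<^sup>+x. g x \<partial>M) = (\<integral>\<^sup>+x. ennreal (1 / C) * g x \<partial>M)"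
    by (rule nn_integral_cmult[symmetric, OF g])
  also have "\<dots> \<le> (\<integral>\<^sup>+x. f x \<partial>M)"
  proof (rule nn_integral_mono_AE)
    show "AE x in M. ennreal (1 / C) * g x \<le> f x"
      using le
    proof eventually_elim
      case (elim x)
      then have "ennreal (1 / C) * g x \<le> ennreal (1 / C) * (ennreal C * f x)"
        by (rule mult_left_mono) simp
      also have "\<dots> = f x"
        unfolding mult.assoc[symmetric] using C by (subst ennreal_mult[symmetric]) auto
      finally show ?case .
    qed
  qed
  finally have "ennreal (1 / C) * (\<integral>\<^sup>+x. g x \<partial>M) < \<infinity>" using f by (rule order.strict_trans1)
  then show ?thesis using C by (auto simp: ennreal_mult_less_top)
qed

lemma nn_integral_exhaust_le:
  fixes h :: "real \<Rightarrow> ennreal"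
  assumes T: "T > 0" and h: "h \<in> borel_measurable (lebesgue_on {r..<T})"
    and le: "\<And>s. r \<le> s \<Longrightarrow> s < T \<Longrightarrow> (\<integral>\<^sup>+t. h t \<partial>lebesgue_on {r..s}) \<le> c"
  shows "(\<integral>\<^sup>+t. h t \<partial>lebesgue_on {r..<T}) \<le> c"
proof -
  let ?g = "\<lambda>j t. h t * indicator {r..exhaust T j} t"
  have "(\<integral>\<^sup>+t. h t \<partial>lebesgue_on {r..<T}) = (\<integral>\<^sup>+t. h t * indicator {r..<T} t \<partial>lebesgue)"
    by (simp add: nn_integral_restrict_space)
  also have "\<dots> \<le> (\<integral>\<^sup>+t. (SUP j. ?g j t) \<partial>lebesgue)"
  proof (rule nn_integral_mono)
    fix t
    show "h t * indicator {r..<T} t \<le> (SUP j. ?g j t)"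
    proof (cases "t \<in> {r..<T}")
      case True
      then obtain j where "t < exhaust T j" using exhaust_ex[OF T, of t] by auto
      then have "h t * indicator {r..<T} t = ?g j t" using True by simp
      also have "\<dots> \<le> (SUP j. ?g j t)" by (rule SUP_upper) simp
      finally show ?thesis .
    qed simp
  qed
  also have "\<dots> = (SUP j. \<integral>\<^sup>+t. ?g j t \<partial>lebesgue)"
  proof (rule nn_integral_monotone_convergence_SUP)
    show "incseq ?g"
      using exhaust_mono[OF T] by (auto simp: incseq_def le_fun_def indicator_def intro: order_trans)
    show "?g j \<in> borel_measurable lebesgue" for j
    proof -
      have "h \<in> borel_measurable (lebesgue_on {r..exhaust T j})"
        by (rule measurable_restrict_mono[OF h]) (use exhaust_bounds[OF T, of j] in auto)
      then show ?thesis by (simp add: borel_measurable_restrict_space_iff_ennreal)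
    qed
  qed
  also have "\<dots> \<le> c"
  proof (rule SUP_least)
    fix j
    show "(\<integral>\<^sup>+t. ?g j t \<partial>lebesgue) \<le> c"
    proof (cases "r \<le> exhaust T j")
      case True
      have "(\<integral>\<^sup>+t. ?g j t \<partial>lebesgue) = (\<integral>\<^sup>+t. h t \<partial>lebesgue_on {r..exhaust T j})"
        by (simp add: nn_integral_restrict_space)
      then show ?thesis using le[OF True] exhaust_bounds[OF T, of j] by simp
    qed simp
  qed
  finally show ?thesis .
qed

text \<open>Bounds on squared Sobolev norms become bounds on the norms without extracting square
  roots in \<open>ennreal\<close>.\<close>

lemma ennreal_le_1_plus_sq: "x \<le> 1 + x\<^sup>2" for x :: ennreal
proof (cases "x \<le> 1")
  case True
  then show ?thesis by (rule order_trans) simp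
next
  case False
  then have "x * 1 \<le> x * x" by (intro mult_left_mono) auto
  also have "\<dots> \<le> 1 + x\<^sup>2" by (simp add: power2_eq_square)
  finally show ?thesis by simp
qed

context ks_solution
begin

text \<open>Continuity in time belongs to the representative \<open>v\<close>, spatial regularity to
  \<open>u\<close> at almost every time. The coefficients are the meeting point of the two.\<close>

lemma coefficients:
  obtains v where
    "\<And>k. continuous_on {0..<T} (\<lambda>t. hc k (v t))"
    "AE t in lebesgue_on {0..T}. u t \<in> sobolev 2 \<and> u t \<in> sobolev 4 \<and> (\<forall>k. hc k (v t) = hc k (u t))"
proof -
  obtain v where v: "\<forall>t\<in>{0..<T}. v t \<in> torus_L 2 \<and>
        ((\<lambda>r. torus_norm 2 (\<lambda>x. v r x - v t x)) \<longlongrightarrow> 0) (at t within {0..<T})"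
    "AE t in lebesgue_on {0..<T}. AE x in torus. v t x = u t x"
    using initial_value_T unfolding initial_value_def by blast
  have "AE t in lebesgue_on {0..T}. t \<noteq> T"
  proof -
    have "AE t in lebesgue. t \<noteq> T"
      using AE_not_in[of "{T}" lebesgue] by (simp add: negligible_iff_null_sets[symmetric])
    then show ?thesis by (auto simp: AE_restrict_space_iff elim: eventually_mono)
  qed
  moreover have "AE t in lebesgue_on {0..T}. AE x in torus. v t x = u t x"
    by (rule AE_exhaust[OF T], rule AE_lebesgue_on_subset[OF v(2)]) auto
  moreover have "AE t in lebesgue_on {0..T}. t \<in> {0..T}" by (auto intro: AE_I2)
  ultimately have "AE t in lebesgue_on {0..T}. u t \<in> sobolev 2 \<and> u t \<in> sobolev 4 \<and> (\<forall>k. hc k (v t) = hc k (u t))"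
    using AE_sobolev
  proof eventually_elim
    case (elim t)
    then have "v t \<in> torus_L 2" using v(1) by auto
    then have "integrable torus (v t)" using torus_L_2_iff sq_integrable_imp_integrable by blast
    moreover have "integrable torus (u t)"
      using elim(4) sobolev_sq_integrable sq_integrable_imp_integrable by blast
    ultimately show ?case using elim(2,4) hc_cong_AE by blast
  qed
  moreover have "continuous_on {0..<T} (\<lambda>t. hc k (v t))" for k
    by (rule continuous_hc[OF v(1)])
  ultimately show ?thesis using that by blast
qed

text \<open>The coefficients of \<open>v\<close> are shown to form a system of dissipative modes, to
  which \<open>global_bound\<close> applies.\<close>

lemma global_coefficient_bounds:
  assumes cont: "\<And>k. continuous_on {0..<T} (\<lambda>t. hc k (v t))"
    and good: "AE t in lebesgue_on {0..T}. u t \<in> sobolev 2 \<and> u t \<in> sobolev 4 \<and> (\<forall>k. hc k (v t) = hc k (u t))"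
  shows "\<exists>r c. 0 < r \<and> r < T
    \<and> (\<forall>t N. r \<le> t \<and> t < T \<longrightarrow> (\<Sum>n<N. wt 2 (freq_enum n :: int ^ 2) * (norm (hc (freq_enum n) (v t)))\<^sup>2) \<le> c)
    \<and> (\<forall>s N. r \<le> s \<and> s < T \<longrightarrow>
        (\<integral>t. (\<Sum>n<N. wt 4 (freq_enum n :: int ^ 2) * (norm (hc (freq_enum n) (v t)))\<^sup>2) \<partial>lebesgue_on {r..s}) \<le> c)"
proof -
  define a where "a n t = hc (freq_enum n) (v t)" for n t
  define F where "F n t = hc (freq_enum n) (advection (u t))" for n t
  define \<mu> where "\<mu> n = (norm (lat (freq_enum n :: int ^ 2)))\<^sup>2" for n
  \<comment> \<open>Coefficients of the divergence, written through \<open>v\<close> so that they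
    are continuous, and hence measurable, in time.\<close>
  define \<delta> where "\<delta> n t = - (\<Sum>i\<in>UNIV. real_of_int (freq_enum n $ i) * hc (- freq_enum n) (v t) $ i)" for n t
  \<comment> \<open>\<open>enn2real\<close> returns 0 where the series is infinite; this concerns
    only a null set of times, because the integral of the series is finite.\<close>
  define d where "d t = enn2real (\<Sum>n. ennreal ((\<delta> n t)\<^sup>2))" for t
  define C where "C = 4 * embed_const"
  have C0: "C \<ge> 0" "embed_const \<ge> 0" "embed_const \<le> C" using embed_const(1) by (auto simp: C_def)
  have w2: "wt 2 (freq_enum n :: int ^ 2) = 1 + (\<mu> n)\<^sup>2" and w4: "wt 4 (freq_enum n :: int ^ 2) = 1 + (\<mu> n) ^ 4" for n
    by (simp_all add: wt_eq \<mu>_def)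
  have goodo: "AE t in lebesgue_on {0<..<T}. u t \<in> sobolev 2 \<and> u t \<in> sobolev 4 \<and> (\<forall>k. hc k (v t) = hc k (u t))"
    by (rule AE_lebesgue_on_subset[OF good]) auto
  have conta: "continuous_on {0..<T} (a n)" for n unfolding a_def by (rule cont)
  have conta': "continuous_on {0<..<T} (a n)" for n by (rule continuous_on_subset[OF conta]) auto
  \<comment> \<open>The equation is tested with \<open>cas k\<close> times a constant vector
    \<open>b\<close>, which gives a scalar identity for each component; the vector-valued statements
    are assembled from them.\<close>
  have comp: "integrable (lebesgue_on {r..s}) (\<lambda>t. F n t \<bullet> b)
      \<and> (a n s - a n r) \<bullet> b = (\<integral>t. ((lam * \<mu> n - (\<mu> n)\<^sup>2) *\<^sub>R a n t - F n t) \<bullet> b \<partial>lebesgue_on {r..s})"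
    if rs: "0 < r" "r \<le> s" "s < T" for n r s b
  proof -
    let ?\<psi> = "\<lambda>x. cas (freq_enum n) x *\<^sub>R b"
    let ?G = "\<lambda>t. ((lam * \<mu> n - (\<mu> n)\<^sup>2) *\<^sub>R a n t - F n t) \<bullet> b"
    have w: "has_weak_time_deriv 0 T (\<lambda>t. torus_inner (u t) ?\<psi>) (\<lambda>t. ks_rhs lam (u t) ?\<psi>)"
      by (rule weak_equation[OF trig_poly_smooth[OF trig_poly_cas] trig_poly_periodic[OF trig_poly_cas]])
    have "AE t in lebesgue_on {0<..<T}. torus_inner (u t) ?\<psi> = a n t \<bullet> b"
      using goodo
    proof eventually_elim
      case (elim t)
      then have "integrable torus (u t)" using sobolev_sq_integrable sq_integrable_imp_integrable by blast
      then show ?case using elim by (simp add: torus_inner_cas a_def)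
    qed
    moreover have "continuous_on {0<..<T} (\<lambda>t. a n t \<bullet> b)"
      by (intro continuous_intros conta')
    ultimately have inc: "a n s \<bullet> b - a n r \<bullet> b = (\<integral>t. ks_rhs lam (u t) ?\<psi> \<partial>lebesgue_on {r..s})"
      by (intro weak_time_deriv_increment[OF w _ _ rs])
    have sub: "{r..s} \<subseteq> {0<..<T}" using rs by auto
    have ri: "integrable (lebesgue_on {r..s}) (\<lambda>t. ks_rhs lam (u t) ?\<psi>)"
      using w rs by (auto simp: has_weak_time_deriv_def)
    have "AE t in lebesgue_on {0<..<T}. ks_rhs lam (u t) ?\<psi> = ?G t"
      using goodo
    proof eventually_elim
      case (elim t)
      then show ?case
        by (simp add: ks_rhs_cas a_def F_def \<mu>_def inner_diff_left)
    qed
    then have ae: "AE t in lebesgue_on {r..s}. ks_rhs lam (u t) ?\<psi> = ?G t"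
      by (rule AE_lebesgue_on_subset[OF _ sub]) auto
    have Gi: "integrable (lebesgue_on {r..s}) ?G"
      and Ge: "(\<integral>t. ks_rhs lam (u t) ?\<psi> \<partial>lebesgue_on {r..s}) = (\<integral>t. ?G t \<partial>lebesgue_on {r..s})"
      by (rule integrable_lebesgue_on_cong_AE[OF ri ae]; simp)+
    have "integrable (lebesgue_on {r..s}) (\<lambda>t. a n t \<bullet> b)"
      by (intro continuous_imp_integrable_real continuous_intros continuous_on_subset[OF conta' sub])
    then have "integrable (lebesgue_on {r..s}) (\<lambda>t. (lam * \<mu> n - (\<mu> n)\<^sup>2) * (a n t \<bullet> b) - ?G t)"
      using Gi by (intro Bochner_Integration.integrable_diff integrable_mult_right)
    then have "integrable (lebesgue_on {r..s}) (\<lambda>t. F n t \<bullet> b)"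
      by (simp add: inner_diff_left)
    then show ?thesis using inc Ge by (simp add: inner_diff_left)
  qed
  have Fint: "integrable (lebesgue_on {r..s}) (F n)" if rs: "0 < r" "r \<le> s" "s < T" for n r s
  proof -
    have "integrable (lebesgue_on {r..s}) (\<lambda>t. \<Sum>b\<in>Basis. (F n t \<bullet> b) *\<^sub>R b)"
      using comp[OF rs] by (intro Bochner_Integration.integrable_sum integrable_scaleR_left) auto
    then show ?thesis by (simp add: euclidean_representation)
  qed
  have mode: "a n s - a n r = (\<integral>t. (lam * \<mu> n - (\<mu> n)\<^sup>2) *\<^sub>R a n t - F n t \<partial>lebesgue_on {r..s})"
    if rs: "0 < r" "r \<le> s" "s < T" for n r s
  proof (rule euclidean_eqI)
    fix b :: "real ^ 2"
    have "integrable (lebesgue_on {r..s}) (a n)"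
      by (intro continuous_imp_integrable_real continuous_on_subset[OF conta']) (use rs in auto)
    then have "integrable (lebesgue_on {r..s}) (\<lambda>t. (lam * \<mu> n - (\<mu> n)\<^sup>2) *\<^sub>R a n t - F n t)"
      using Fint[OF rs] by simp
    then show "(a n s - a n r) \<bullet> b = (\<integral>t. (lam * \<mu> n - (\<mu> n)\<^sup>2) *\<^sub>R a n t - F n t \<partial>lebesgue_on {r..s}) \<bullet> b"
      using conjunct2[OF comp[OF rs, of n b]] by (subst integral_inner_left[symmetric]) auto
  qed
  have local: "\<exists>M. \<forall>t N. 0 < t \<and> t < T' \<longrightarrow> (\<Sum>n<N. (1 + (\<mu> n)\<^sup>2) * (norm (a n t))\<^sup>2) \<le> M" if T': "T' < T" for T'
  proof (cases "T' > 0")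
    case True
    let ?L = "lebesgue_on {0..<T'}"
    define S where "S = esssup ?L (\<lambda>t. sobolev_norm 2 (u t))"
    have "Lnorm \<infinity> ?L (\<lambda>t. sobolev_norm 2 (u t)) < \<infinity>"
      using strong[OF True T'] by (simp add: strong_solution_def bochner_def)
    then have S: "S < \<infinity>" by (simp add: S_def Lnorm_def)
    have aeS: "AE t in ?L. sobolev_norm 2 (u t) \<le> S"
      unfolding S_def by (rule esssup_AE)
    let ?c = "ennreal ((2 * pi) ^ CARD(2) * (1 + real CARD(2) ^ (2 + 1)))"
    define M where "M = enn2real (?c * S\<^sup>2)"
    have cM: "?c * S\<^sup>2 = ennreal M"
      unfolding M_def using S by (subst ennreal_enn2real) (auto simp: ennreal_mult_less_top power2_eq_square)
    have "(\<Sum>n<N. (1 + (\<mu> n)\<^sup>2) * (norm (a n t))\<^sup>2) \<le> M" if t: "0 < t" "t < T'" for t N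
    proof -
      let ?f = "\<lambda>t. \<Sum>n<N. (1 + (\<mu> n)\<^sup>2) * (norm (a n t))\<^sup>2"
      have "AE t in ?L. u t \<in> sobolev 2 \<and> u t \<in> sobolev 4 \<and> (\<forall>k. hc k (v t) = hc k (u t))"
        by (rule AE_lebesgue_on_subset[OF good]) (use T' in auto)
      \<comment> \<open>The inequality is phrased as an equation between continuous functions of
        time, so that it extends from almost every time to every time.\<close>
      with aeS have "AE t in ?L. max (?f t) M = M"
      proof eventually_elim
        case (elim t)
        have "?f t = (\<Sum>k\<in>freq_enum ` {..<N}. wt 2 k * (norm (hc k (u t)))\<^sup>2)"
          using elim(2) by (simp add: sum.reindex[OF inj_freq_enum] w2 a_def)
        also have "ennreal \<dots> \<le> ?c * (sobolev_norm 2 (u t))\<^sup>2"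
          by (rule sobolev_norm_ge) (use elim(2) in auto)
        also have "\<dots> \<le> ?c * S\<^sup>2"
          by (intro mult_left_mono power_mono elim(1)) auto
        finally have "ennreal (?f t) \<le> ennreal M" using cM by simp
        then have "?f t \<le> M" by (subst (asm) ennreal_le_iff) (auto simp: M_def)
        then show ?case by simp
      qed
      then have "max (?f t) M = M"
      proof (rule continuous_AE_eq_imp_eq[rotated 2])
        have "continuous_on {0..<T'} (a n)" for n
          by (rule continuous_on_subset[OF conta]) (use T' in auto)
        then show "continuous_on {0..<T'} (\<lambda>t. max (?f t) M)" by (intro continuous_intros)
      qed (use t in auto)
      then show ?thesis by (simp add: max_def split: if_splits)
    qed
    then show ?thesis by blast
  qed (auto intro: exI[of _ 0])
  have fin2: "(\<Sum>k\<in>A. wt 2 k * (norm (hc k (u t)))\<^sup>2) \<le> c"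
    if "\<And>N. (\<Sum>n<N. (1 + (\<mu> n)\<^sup>2) * (norm (a n t))\<^sup>2) \<le> c" "\<forall>k. hc k (v t) = hc k (u t)" "finite A" for A c t
  proof (rule bounded_partial_sums_imp_finite_sums[OF _ _ that(3)])
    show "(\<Sum>n<N. wt 2 (freq_enum n :: int ^ 2) * (norm (hc (freq_enum n) (u t)))\<^sup>2) \<le> c" for N
      using that(1)[of N] that(2) by (simp add: w2 a_def)
  qed (auto intro: mult_nonneg_nonneg less_imp_le[OF wt_pos])
  have Fb: "AE t in lebesgue_on {0<..<T}. \<forall>c.
      (\<forall>N. (\<Sum>n<N. (1 + (\<mu> n)\<^sup>2) * (norm (a n t))\<^sup>2) \<le> c) \<longrightarrow> (\<forall>N. (\<Sum>n<N. (norm (F n t))\<^sup>2) \<le> C * c\<^sup>2)"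
    using goodo
  proof eventually_elim
    case (elim t)
    show ?case
    proof (intro allI impI)
      fix c N assume c: "\<forall>N. (\<Sum>n<N. (1 + (\<mu> n)\<^sup>2) * (norm (a n t))\<^sup>2) \<le> c"
      have "(\<Sum>n<N. (norm (F n t))\<^sup>2) = (\<Sum>k\<in>freq_enum ` {..<N}. (norm (hc k (advection (u t))))\<^sup>2)"
        by (simp add: sum.reindex[OF inj_freq_enum] F_def)
      also have "\<dots> \<le> 4 * embed_const * c\<^sup>2"
        by (rule advection_estimate(2)[OF _ fin2]) (use elim c in auto)
      finally show "(\<Sum>n<N. (norm (F n t))\<^sup>2) \<le> C * c\<^sup>2" by (simp add: C_def)
    qed
  qed
  have \<delta>: "\<delta> n t = hc (freq_enum n) (weak_divergence (u t))" if "u t \<in> sobolev 2" "\<forall>k. hc k (v t) = hc k (u t)" for n t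
    using that by (simp add: \<delta>_def hc_weak_divergence(2))
  have \<delta>m: "\<delta> n \<in> borel_measurable (lebesgue_on {0<..<T})" for n
  proof (rule continuous_imp_measurable_on_sets_lebesgue)
    have "continuous_on {0<..<T} (\<lambda>t. hc k (v t))" for k by (rule continuous_on_subset[OF cont]) auto
    then show "continuous_on {0<..<T} (\<delta> n)"
      unfolding \<delta>_def by (intro continuous_intros)
  qed simp
  let ?d = "\<lambda>t. \<Sum>n. ennreal ((\<delta> n t)\<^sup>2)"
  have dm: "?d \<in> borel_measurable (lebesgue_on {0<..<T})"
    using \<delta>m by measurable
  have dle: "AE t in lebesgue_on {0<..<T}. ?d t \<le> ennreal 18 * (besov_norm \<phi> 0 2 2 (distribution (weak_divergence (u t))))\<^sup>2"
    using goodo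
  proof eventually_elim
    case (elim t)
    then have f: "u t \<in> sobolev 2" by blast
    show ?case
    proof (rule suminf_le_const)
      fix N
      have "(\<Sum>n<N. ennreal ((\<delta> n t)\<^sup>2)) = ennreal (\<Sum>n<N. (\<delta> n t)\<^sup>2)"
        by (rule sum_ennreal) simp
      also have "(\<Sum>n<N. (\<delta> n t)\<^sup>2) = (\<Sum>k\<in>freq_enum ` {..<N}. (hc k (weak_divergence (u t)))\<^sup>2)"
        using \<delta>[OF f] elim by (simp add: sum.reindex[OF inj_freq_enum])
      also have "ennreal \<dots> \<le> ennreal 18 * (besov_norm \<phi> 0 2 2 (distribution (weak_divergence (u t))))\<^sup>2"
        by (rule besov_norm_ge[OF \<phi> hc_weak_divergence(1)[OF f]]) (simp_all add: hc_weak_divergence(2)[OF f])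
      finally show "(\<Sum>n<N. ennreal ((\<delta> n t)\<^sup>2)) \<le> ennreal 18 * (besov_norm \<phi> 0 2 2 (distribution (weak_divergence (u t))))\<^sup>2" .
    qed simp
  qed
  have "(\<integral>\<^sup>+t. (besov_norm \<phi> 0 2 2 (distribution (weak_divergence (u t))))\<^sup>2 \<partial>lebesgue_on {0<..<T}) < \<infinity>"
    by (rule iffD1[OF Lnorm_2_finite_iff bochner_Lnorm_finite[OF besov]])
  then have "(\<integral>\<^sup>+t. ?d t \<partial>lebesgue_on {0<..<T}) < \<infinity>"
    by (rule nn_integral_finite_of_le[OF dm dle, rotated]) simp
  then have dfin: "(\<integral>\<^sup>+t. ?d t \<partial>lebesgue_on {0<..<T}) \<noteq> \<infinity>"
    by (rule less_imp_neq)
  have dtop: "AE t in lebesgue_on {0<..<T}. ?d t \<noteq> \<infinity>"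
    by (rule nn_integral_PInf_AE[OF dm dfin])
  have dint: "integrable (lebesgue_on {0<..<T}) d"
  proof (rule integrableI_nonneg)
    show "d \<in> borel_measurable (lebesgue_on {0<..<T})" unfolding d_def using dm by measurable
    have "(\<integral>\<^sup>+t. ennreal (d t) \<partial>lebesgue_on {0<..<T}) \<le> (\<integral>\<^sup>+t. ?d t \<partial>lebesgue_on {0<..<T})"
      unfolding d_def by (intro nn_integral_mono) (simp only: ennreal_enn2real_if split: if_split, simp)
    then show "(\<integral>\<^sup>+t. ennreal (d t) \<partial>lebesgue_on {0<..<T}) < \<infinity>"
      by (rule le_less_trans) (use dfin in \<open>simp add: less_top\<close>)
  qed (simp add: d_def)
  have Fp: "AE t in lebesgue_on {0<..<T}. \<forall>E P.
      (\<forall>N. (\<Sum>n<N. (norm (a n t))\<^sup>2) \<le> E) \<longrightarrow> (\<forall>N. (\<Sum>n<N. (1 + (\<mu> n)\<^sup>2) * (norm (a n t))\<^sup>2) \<le> P) \<longrightarrow>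
      (\<exists>B. (\<lambda>n. F n t \<bullet> a n t) sums B \<and> 2 * \<bar>B\<bar> \<le> (P + C * E * d t) / 2)"
    using goodo dtop
  proof eventually_elim
    case (elim t)
    show ?case
    proof (intro allI impI)
      fix E P assume E: "\<forall>N. (\<Sum>n<N. (norm (a n t))\<^sup>2) \<le> E"
        and P: "\<forall>N. (\<Sum>n<N. (1 + (\<mu> n)\<^sup>2) * (norm (a n t))\<^sup>2) \<le> P"
      have f: "u t \<in> sobolev 4" "u t \<in> sobolev 2" and eq: "\<forall>k. hc k (v t) = hc k (u t)" using elim(1) by auto
      have dd: "ennreal (d t) = ?d t" unfolding d_def using elim(2) by (simp add: less_top)
      have \<delta>d: "(\<Sum>n<N. (\<delta> n t)\<^sup>2) \<le> d t" for N
      proof -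
        have "ennreal (\<Sum>n<N. (\<delta> n t)\<^sup>2) = (\<Sum>n<N. ennreal ((\<delta> n t)\<^sup>2))"
          by (rule sum_ennreal[symmetric]) simp
        also have "\<dots> \<le> ?d t" by (rule sum_le_suminf) auto
        finally have "ennreal (\<Sum>n<N. (\<delta> n t)\<^sup>2) \<le> ennreal (d t)" using dd by simp
        then show ?thesis by (subst (asm) ennreal_le_iff) (auto simp: d_def)
      qed
      have dsum: "(\<Sum>k\<in>A. (hc k (weak_divergence (u t)))\<^sup>2) \<le> d t" if "finite A" for A
        by (rule bounded_partial_sums_imp_finite_sums[OF _ _ that]) (use \<delta>d \<delta>[OF f(2) eq] in auto)
      have Esum: "(\<Sum>k\<in>A. (norm (hc k (u t)))\<^sup>2) \<le> E" if "finite A" for A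
        by (rule bounded_partial_sums_imp_finite_sums[OF _ _ that]) (use E eq in \<open>auto simp: a_def\<close>)
      have "\<exists>B. (\<lambda>n. hc (freq_enum n) (advection (u t)) \<bullet> hc (freq_enum n) (u t)) sums B
          \<and> 2 * \<bar>B\<bar> \<le> (P + embed_const * E * d t) / 2"
      proof (rule advection_pairing[OF f(1)])
        show "(\<Sum>k\<in>A. wt 2 k * (norm (hc k (u t)))\<^sup>2) \<le> P" if "finite A" for A
          by (rule fin2[OF spec[OF P] eq that])
      qed (fact Esum, fact dsum)
      then obtain B where B: "(\<lambda>n. F n t \<bullet> a n t) sums B" "2 * \<bar>B\<bar> \<le> (P + embed_const * E * d t) / 2"
        using eq by (auto simp: F_def a_def)
      have "E \<ge> 0" "d t \<ge> 0" using spec[OF E, of 0] by (auto simp: d_def)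
      then have "embed_const * E * d t \<le> C * E * d t" using C0 by (intro mult_right_mono) auto
      then have "(P + embed_const * E * d t) / 2 \<le> (P + C * E * d t) / 2" by simp
      then show "\<exists>B. (\<lambda>n. F n t \<bullet> a n t) sums B \<and> 2 * \<bar>B\<bar> \<le> (P + C * E * d t) / 2"
        using B order_trans by blast
    qed
  qed
  have \<mu>0: "\<mu> n \<ge> 0" for n by (simp add: \<mu>_def)
  have d0: "d t \<ge> 0" for t by (simp add: d_def)
  interpret dissipative_modes a F \<mu> d lam C 0 T
    by standard (fact T C0(1) \<mu>0 lam conta' Fint mode local Fb Fp dint d0)+
  show ?thesis
    unfolding w2 w4 by (rule global_bound[unfolded a_def])
qed

text \<open>Before \<open>r'\<close> the norms are controlled by the strong solution on a shorter
  interval, from \<open>r\<close> on by the coefficient bounds. The set \<open>I\<close> is kept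
  general because both the half-open and the closed interval occur in the conclusion.\<close>

lemma regularity:
  assumes I: "{0..<T} \<subseteq> I" "I \<subseteq> {0..T}" "I \<in> sets lebesgue"
  shows "u \<in> bochner_sobolev \<infinity> I 2" "u \<in> bochner_sobolev 2 I 4"
proof -
  obtain v where cont: "\<And>k. continuous_on {0..<T} (\<lambda>t. hc k (v t))"
    and good: "AE t in lebesgue_on {0..T}. u t \<in> sobolev 2 \<and> u t \<in> sobolev 4 \<and> (\<forall>k. hc k (v t) = hc k (u t))"
    using coefficients by blast
  obtain r c where r: "0 < r" "r < T"
    and c2: "\<And>t N. r \<le> t \<Longrightarrow> t < T \<Longrightarrow> (\<Sum>n<N. wt 2 (freq_enum n :: int ^ 2) * (norm (hc (freq_enum n) (v t)))\<^sup>2) \<le> c"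
    and c4: "\<And>s N. r \<le> s \<Longrightarrow> s < T \<Longrightarrow>
        (\<integral>t. (\<Sum>n<N. wt 4 (freq_enum n :: int ^ 2) * (norm (hc (freq_enum n) (v t)))\<^sup>2) \<partial>lebesgue_on {r..s}) \<le> c"
    using global_coefficient_bounds[OF cont good] by blast
  \<comment> \<open>The two regimes overlap between \<open>r\<close> and \<open>r'\<close>, so
    together they cover all times before \<open>T\<close>.\<close>
  obtain r' where r': "r < r'" "r' < T" using dense r(2) by blast
  have st: "strong_solution r' lam u\<^sub>0 u" using strong r r' by auto
  have wt0: "wt m k * (norm (hc k f))\<^sup>2 \<ge> 0" for m and k :: "int ^ 2" and f :: "real ^ 2 \<Rightarrow> real ^ 2"
    by (intro mult_nonneg_nonneg less_imp_le[OF wt_pos]) simp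
  have goodL: "AE t in lebesgue. t \<in> {0..T} \<longrightarrow> u t \<in> sobolev 2 \<and> u t \<in> sobolev 4 \<and> (\<forall>k. hc k (v t) = hc k (u t))"
    by (rule iffD1[OF AE_restrict_space_iff good]) simp
  have neT: "AE t in lebesgue. t \<noteq> T"
    using AE_not_in[of "{T}" lebesgue] by (simp add: negligible_iff_null_sets[symmetric])
  show "u \<in> bochner_sobolev \<infinity> I 2"
  proof (rule bochner_exhaust[OF T _ I])
    show "u \<in> bochner_sobolev \<infinity> {0..<T'} 2" if "0 < T'" "T' < T" for T'
      using strong[OF that] by (simp add: strong_solution_def)
    let ?s = "\<lambda>t. sobolev_norm 2 (u t)"
    have fin: "esssup (lebesgue_on {0..<T'}) ?s < \<infinity>" if "0 < T'" "T' < T" for T'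
      using strong[OF that] by (simp add: strong_solution_def bochner_def Lnorm_def)
    \<comment> \<open>A function that is not measurable has infinite essential supremum by
      convention, so the finite bound on each subinterval already contains measurability.\<close>
    have meas: "?s \<in> borel_measurable (lebesgue_on I)"
    proof (rule measurable_exhaust[OF T _ I])
      show "?s \<in> borel_measurable (lebesgue_on {0..<T'})" if "0 < T'" "T' < T" for T'
        using fin[OF that] esssup_non_measurable[of ?s "lebesgue_on {0..<T'}"] by (metis order_less_irrefl infinity_ennreal_def)
    qed
    define S where "S = esssup (lebesgue_on {0..<r'}) ?s"
    have S: "S < \<infinity>" unfolding S_def using fin r r' by simp
    have "AE t in lebesgue_on {0..<r'}. ?s t \<le> S" unfolding S_def by (rule esssup_AE)
    then have ae1: "AE t in lebesgue. t \<in> {0..<r'} \<longrightarrow> ?s t \<le> S" by (simp add: AE_restrict_space_iff)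
    let ?K = "ennreal (real (card {is :: 2 list. length is \<le> 2}) * (c / (2 * pi) ^ CARD(2)))"
    have "AE t in lebesgue. t \<in> I \<longrightarrow> ?s t \<le> max S (1 + ?K)"
      using ae1 goodL neT
    proof eventually_elim
      case (elim t)
      show ?case
      proof
        assume "t \<in> I"
        then have t: "t \<in> {0..T}" "t < T" using I(2) elim(3) by auto
        show "?s t \<le> max S (1 + ?K)"
        proof (cases "t < r'")
          case True
          then have "?s t \<le> S" using elim(1) t by auto
          then show ?thesis by (simp add: le_max_iff_disj)
        next
          case False
          have f: "u t \<in> sobolev 2" "\<forall>k. hc k (v t) = hc k (u t)" using elim(2) t by auto
          have "(?s t)\<^sup>2 \<le> ?K"
          proof (rule sobolev_norm_le[OF f(1)])
            show "(\<Sum>k\<in>A. wt 2 k * (norm (hc k (u t)))\<^sup>2) \<le> c" if "finite A" for A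
              by (rule bounded_partial_sums_imp_finite_sums[OF _ wt0 that])
                (use c2[of t] t False r' f(2) in auto)
          qed
          then have "1 + (?s t)\<^sup>2 \<le> 1 + ?K" by (rule add_left_mono)
          then have "?s t \<le> 1 + ?K" using ennreal_le_1_plus_sq order_trans by blast
          then show ?thesis by (simp add: le_max_iff_disj)
        qed
      qed
    qed
    then have "AE t in lebesgue_on I. ?s t \<le> max S (1 + ?K)"
      using I(3) by (simp add: AE_restrict_space_iff)
    then have "esssup (lebesgue_on I) ?s \<le> max S (1 + ?K)"
      by (rule esssup_I[OF meas])
    also have "\<dots> < \<infinity>" using S by (simp add: less_top)
    finally show "Lnorm \<infinity> (lebesgue_on I) ?s < \<infinity>" by (simp add: Lnorm_def)
  qed
  show "u \<in> bochner_sobolev 2 I 4"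
  proof (rule bochner_exhaust[OF T _ I])
    show "u \<in> bochner_sobolev 2 {0..<T'} 4" if "0 < T'" "T' < T" for T'
      using strong[OF that] by (simp add: strong_solution_def)
    let ?s = "\<lambda>t. (sobolev_norm 4 (u t))\<^sup>2"
    let ?w = "\<lambda>n t. wt 4 (freq_enum n :: int ^ 2) * (norm (hc (freq_enum n) (v t)))\<^sup>2"
    \<comment> \<open>A series of functions continuous in time that is comparable with the squared
      H^4 norm at almost every time. It is measurable by construction, so all integrals in time are
      carried out with it.\<close>
    define W where "W t = (\<Sum>n. ennreal (?w n t))" for t
    have w0: "?w n t \<ge> 0" for n t by (rule wt0)
    have wm: "?w n \<in> borel_measurable (lebesgue_on {p..<q})" if "0 \<le> p" "q \<le> T" for n p q
    proof (rule continuous_imp_measurable_on_sets_lebesgue)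
      have "continuous_on {p..<q} (\<lambda>t. hc k (v t))" for k
        by (rule continuous_on_subset[OF cont]) (use that in auto)
      then show "continuous_on {p..<q} (?w n)" by (intro continuous_intros)
    qed simp
    have Wm: "W \<in> borel_measurable (lebesgue_on {p..<q})" if "0 \<le> p" "q \<le> T" for p q
      using wm[OF that] unfolding W_def by measurable
    let ?K = "real (card {is :: 2 list. length is \<le> 4}) / (2 * pi) ^ CARD(2)"
    let ?C = "(2 * pi) ^ CARD(2) * (1 + real CARD(2) ^ (4 + 1))"
    have C0: "?C > 0" by (intro mult_pos_pos add_pos_nonneg) auto
    have K0: "?K \<ge> 0" by simp
    have upper: "?s t \<le> ennreal ?K * W t" and lower: "W t \<le> ennreal ?C * ?s t"
      if f: "u t \<in> sobolev 4" "\<forall>k. hc k (v t) = hc k (u t)" for t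
    proof -
      have part: "(\<Sum>n<N. ennreal (?w n t)) = ennreal (\<Sum>k\<in>freq_enum ` {..<N}. wt 4 k * (norm (hc k (u t)))\<^sup>2)" for N
        using f(2) wt0 by (simp add: sum.reindex[OF inj_freq_enum] sum_ennreal)
      show low: "W t \<le> ennreal ?C * ?s t"
        unfolding W_def
      proof (rule suminf_le_const)
        show "(\<Sum>n<N. ennreal (?w n t)) \<le> ennreal ?C * ?s t" for N
          unfolding part by (rule sobolev_norm_ge[OF f(1)]) simp
      qed simp
      \<comment> \<open>Finiteness allows \<open>W t\<close> to be used as the real constant in
        \<open>sobolev_norm_le\<close>.\<close>
      have "W t < \<infinity>"
        using low unfolding sobolev_norm_sq[OF f(1)]
        by (rule order.strict_trans1) (simp add: ennreal_mult_less_top)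
      then have We: "ennreal (enn2real (W t)) = W t" by simp
      have "?s t \<le> ennreal (real (card {is :: 2 list. length is \<le> 4}) * (enn2real (W t) / (2 * pi) ^ CARD(2)))"
      proof (rule sobolev_norm_le[OF f(1)])
        show "(\<Sum>k\<in>A. wt 4 k * (norm (hc k (u t)))\<^sup>2) \<le> enn2real (W t)" if "finite A" for A
        proof (rule bounded_partial_sums_imp_finite_sums[OF _ wt0 that])
          fix N
          have "(\<Sum>n<N. ennreal (?w n t)) \<le> W t" unfolding W_def by (rule sum_le_suminf) auto
          then have "ennreal (\<Sum>n<N. ?w n t) \<le> ennreal (enn2real (W t))"
            unfolding We using w0 by (simp add: sum_ennreal)
          then show "(\<Sum>n<N. wt 4 (freq_enum n :: int ^ 2) * (norm (hc (freq_enum n) (u t)))\<^sup>2) \<le> enn2real (W t)"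
            using f(2) by (simp add: ennreal_le_iff)
        qed
      qed
      also have "\<dots> = ennreal (?K * enn2real (W t))" by simp
      also have "\<dots> = ennreal ?K * W t" using K0 We by (subst ennreal_mult) auto
      finally show "?s t \<le> ennreal ?K * W t" .
    qed
    have W1: "(\<integral>\<^sup>+t. W t \<partial>lebesgue_on {0..<r'}) < \<infinity>"
    proof (rule nn_integral_finite_of_le[OF Wm _ C0])
      have "AE t in lebesgue_on {0..<r'}. u t \<in> sobolev 2 \<and> u t \<in> sobolev 4 \<and> (\<forall>k. hc k (v t) = hc k (u t))"
        by (rule AE_lebesgue_on_subset[OF good]) (use r' in auto)
      then show "AE t in lebesgue_on {0..<r'}. W t \<le> ennreal ?C * ?s t"
        by eventually_elim (use lower in blast)
      show "(\<integral>\<^sup>+t. ?s t \<partial>lebesgue_on {0..<r'}) < \<infinity>"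
        using st[unfolded strong_solution_def] by (elim conjE) (simp only: Lnorm_2_finite_iff[symmetric] bochner_Lnorm_finite)
    qed (use r r' in auto)
    have W2: "(\<integral>\<^sup>+t. W t \<partial>lebesgue_on {r..<T}) \<le> ennreal c"
    proof (rule nn_integral_exhaust_le[OF T])
      show "W \<in> borel_measurable (lebesgue_on {r..<T})" by (rule Wm) (use r in auto)
      fix s assume s: "r \<le> s" "s < T"
      have wi: "integrable (lebesgue_on {r..s}) (?w n)" for n
        by (intro continuous_imp_integrable_real continuous_intros continuous_on_subset[OF cont]) (use r s in auto)
      have "(\<integral>\<^sup>+t. W t \<partial>lebesgue_on {r..s}) = (\<Sum>n. \<integral>\<^sup>+t. ennreal (?w n t) \<partial>lebesgue_on {r..s})"
        unfolding W_def
        by (intro nn_integral_suminf measurable_compose[OF borel_measurable_integrable[OF wi] measurable_ennreal])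
      also have "\<dots> \<le> ennreal c"
      proof (rule suminf_le_const)
        fix N
        have "(\<Sum>n<N. \<integral>\<^sup>+t. ennreal (?w n t) \<partial>lebesgue_on {r..s}) = (\<Sum>n<N. ennreal (\<integral>t. ?w n t \<partial>lebesgue_on {r..s}))"
          by (intro sum.cong refl nn_integral_eq_integral wi AE_I2 w0)
        also have "\<dots> = ennreal (\<Sum>n<N. \<integral>t. ?w n t \<partial>lebesgue_on {r..s})"
          using w0 by (intro sum_ennreal integral_nonneg_AE AE_I2) auto
        also have "(\<Sum>n<N. \<integral>t. ?w n t \<partial>lebesgue_on {r..s}) = (\<integral>t. (\<Sum>n<N. ?w n t) \<partial>lebesgue_on {r..s})"
          by (rule Bochner_Integration.integral_sum[symmetric]) (rule wi)
        also have "ennreal \<dots> \<le> ennreal c" by (intro ennreal_leI c4 s)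
        finally show "(\<Sum>n<N. \<integral>\<^sup>+t. ennreal (?w n t) \<partial>lebesgue_on {r..s}) \<le> ennreal c" .
      qed simp
      finally show "(\<integral>\<^sup>+t. W t \<partial>lebesgue_on {r..s}) \<le> ennreal c" .
    qed
    have m1: "(\<lambda>t. W t * indicator {0..<r'} t) \<in> borel_measurable lebesgue"
      and m2: "(\<lambda>t. W t * indicator {r..<T} t) \<in> borel_measurable lebesgue"
      using Wm[of 0 r'] Wm[of r T] r r' by (simp_all add: borel_measurable_restrict_space_iff_ennreal)
    have "(\<integral>\<^sup>+t. ?s t \<partial>lebesgue_on I) = (\<integral>\<^sup>+t. ?s t * indicator I t \<partial>lebesgue)"
      using I(3) by (simp add: nn_integral_restrict_space)
    also have "\<dots> \<le> (\<integral>\<^sup>+t. ennreal ?K * (W t * indicator {0..<r'} t + W t * indicator {r..<T} t) \<partial>lebesgue)"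
    proof (rule nn_integral_mono_AE)
      show "AE t in lebesgue. ?s t * indicator I t \<le> ennreal ?K * (W t * indicator {0..<r'} t + W t * indicator {r..<T} t)"
        using goodL neT
      proof eventually_elim
        case (elim t)
        show ?case
        proof (cases "t \<in> I")
          case True
          then have t: "t \<in> {0..T}" "t < T" using I(2) elim(2) by auto
          then have "?s t \<le> ennreal ?K * W t" using upper elim(1) by blast
          also have "W t \<le> W t * indicator {0..<r'} t + W t * indicator {r..<T} t"
            using t r' by (cases "t < r'") auto
          finally show ?thesis using True by (simp add: mult_left_mono)
        qed simp
      qed
    qed
    also have "\<dots> = ennreal ?K * ((\<integral>\<^sup>+t. W t \<partial>lebesgue_on {0..<r'}) + (\<integral>\<^sup>+t. W t \<partial>lebesgue_on {r..<T}))"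
      using m1 m2 by (simp add: nn_integral_cmult nn_integral_add nn_integral_restrict_space)
    also have "\<dots> < \<infinity>"
      using W1 le_less_trans[OF W2 ennreal_less_top] by (simp add: ennreal_mult_less_top)
    finally show "Lnorm 2 (lebesgue_on I) (\<lambda>t. sobolev_norm 4 (u t)) < \<infinity>"
      by (simp only: Lnorm_2_finite_iff)
  qed
qed

lemma strong_solution_T: "strong_solution T lam u\<^sub>0 u"
  unfolding strong_solution_def
proof (intro conjI allI impI)
  show "u \<in> bochner_sobolev \<infinity> {0..<T} 2" "u \<in> bochner_sobolev 2 {0..<T} 4"
    by (rule regularity; auto)+
  show "initial_value T u u\<^sub>0" by (rule initial_value_T)
  fix \<psi> :: "real ^ 2 \<Rightarrow> real ^ 2" assume "smooth \<psi> \<and> periodic \<psi>"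
  then show "\<exists>dtu. has_weak_time_deriv 0 T (\<lambda>t. torus_inner (u t) \<psi>) dtu \<and>
     (AE t in lebesgue_on {0<..<T}.
        dtu t + torus_inner (advection (u t)) \<psi> + torus_inner (weak_laplacian (u t)) (laplacian \<psi>)
        = lam * (\<Sum>i\<in>UNIV. torus_inner (weak_deriv [i] (u t)) (pderivs [i] \<psi>)))"
    by (intro exI[of _ "\<lambda>t. ks_rhs lam (u t) \<psi>"] conjI weak_equation AE_I2) (auto simp: ks_rhs_def)
qed

end

theorem theorem3p10:
  fixes T lam :: real
    and u\<^sub>0 :: "real ^ 2 \<Rightarrow> real ^ 2"
    and u :: "real \<Rightarrow> real ^ 2 \<Rightarrow> real ^ 2"
    and \<phi> :: "real ^ 2 \<Rightarrow> real"
  assumes "T > 0" and "lam > 0"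
    and "littlewood_paley \<phi>"
    and "u\<^sub>0 \<in> sobolev 2"
    and "solution_on T lam u\<^sub>0 u"
    and "(\<lambda>t. distribution (weak_divergence (u t)))
           \<in> bochner 2 (lebesgue_on {0<..<T}) (besov \<phi> 0 2 2) (besov_norm \<phi> 0 2 2)"
  shows "strong_solution T lam u\<^sub>0 u \<and>
         u \<in> bochner_sobolev \<infinity> {0..T} 2 \<and>
         u \<in> bochner_sobolev 2 {0..T} 4"
proof -
  interpret ks_solution T lam u\<^sub>0 u \<phi>
    by standard (rule assms)+
  show ?thesis
    by (intro conjI strong_solution_T regularity) auto
qed

end
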